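(* Let $f:X\to X$ be a transitive (one-sided) subshift of finite type, let $k\in\mathbb N$, and let $\mathcal M_E$ be the set of ergodic $f$-invariant Borel probability measures. To every $m\in\mathbb N$ and every $\Phi\in LC_k(X,\mathbb R^m)$ one can associate a finite set $\mathcal M(\Phi)\subset\mathcal M_E$ such that: (a) For every $m\in\mathbb N$, $\Phi\in LC_k(X,\mathbb R^m)$ and $\alpha\in S^{m-1}$, the zero-temperature measure $\mu_{\infty,\alpha\cdot\Phi}$ is a convex sum (convex combination) of measures in $\mathcal M(\Phi)$. (b) There exist $\Phi_{\rm univ}\in LC_k(X,\mathbb R^{m_c(k)})$ and an analytic surjection $I:LC_k(X,\mathbb R)\setminus\{\phi\equiv0\}\to S^{m_c(k)-1}$ such that for all $\phi\in LC_k(X,\mathbb R)\setminus\{\phi\equiv0\}$ we have that $\mu_{\infty,\phi}=\mu_{\infty,I(\phi)\cdot\Phi_{\rm univ}}$ is a convex sum of measures in $\mathcal M(\Phi_{\rm univ})$.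
   Context: Let $\mathcal A=\{0,\dots,d-1\}$ and let $A$ be a $d\times d$ matrix with entries in $\{0,1\}$. The one-sided subshift of finite type is $X=X_A=\{x=(x_n)_{n\ge1}\in\mathcal A^{\mathbb N}: A_{x_n,x_{n+1}}=1 \text{ for all } n\}$ with the shift map $f(x)_n=x_{n+1}$; every letter is assumed to occur in some sequence in $X$. Transitive means topologically transitive, i.e. $A$ is irreducible. Cylinders of length $k$ are the sets $\{y\in X:y_1=x_1,\dots,y_k=x_k\}$, $x\in X$, and $m_c(k)$ is their number. $LC_k(X,\mathbb R^m)$ is the space of functions $\Phi:X\to\mathbb R^m$ constant on each cylinder of length $k$; $LC_k(X,\mathbb R)$ is identified with $\mathbb R^{m_c(k)}$ (this gives the meaning of analytic). $S^{m-1}$ is the unit sphere in $\mathbb R^m$, and $\alpha\cdot\Phi=\alpha_1\Phi_1+\dots+\alpha_m\Phi_m$. For locally constant $\phi:X\to\mathbb R$ and $t\ge0$, $\mu_{t\phi}$ is the unique equilibrium state of $t\phi$, i.e. the unique $f$-invariant Borel probability measure maximizing $h_\mu(f)+\int t\phi\,d\mu$ ($h_\mu(f)$ the measure-theoretic entropy). The zero-temperature measure is the weak$^*$ limit $\mu_{\infty,\phi}=\lim_{t\to\infty}\mu_{t\phi}$, known to exist for locally constant $\phi$. *)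

theory Defs
  imports "HOL-Probability.Probability"
begin

section \<open>Subshifts of finite type\<close>

text \<open>
  A one-sided sequence \<open>(x\<^sub>n)\<close>, \<open>n \<ge> 1\<close>, is encoded as a function on \<open>nat\<close> starting at index 0.
  The type \<open>nat \<Rightarrow> nat\<close> carries the product topology of the discrete topology on \<open>nat\<close>, and the
  subshift has the subspace topology and the corresponding Borel sigma-algebra.
\<close>

type_synonym seq = "nat \<Rightarrow> nat"

definition sft :: "nat \<Rightarrow> (nat \<Rightarrow> nat \<Rightarrow> nat) \<Rightarrow> seq set" where
  "sft d A = {x. (\<forall>n. x n < d) \<and> (\<forall>n. A (x n) (x (Suc n)) = 1)}"

definition shift_map :: "seq \<Rightarrow> seq" where
  "shift_map x = (\<lambda>n. x (Suc n))"

definition topologically_transitive :: "'a::topological_space set \<Rightarrow> ('a \<Rightarrow> 'a) \<Rightarrow> bool" where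
  "topologically_transitive X T \<longleftrightarrow>
     (\<forall>U V. openin (top_of_set X) U \<and> openin (top_of_set X) V \<and> U \<noteq> {} \<and> V \<noteq> {} \<longrightarrow>
        (\<exists>n. (T ^^ n) ` U \<inter> V \<noteq> {}))"

definition cylinder :: "seq set \<Rightarrow> nat \<Rightarrow> seq \<Rightarrow> seq set" where
  "cylinder X k x = {y \<in> X. \<forall>i<k. y i = x i}"

definition cylinders :: "seq set \<Rightarrow> nat \<Rightarrow> seq set set" where
  "cylinders X k = cylinder X k ` X"

definition num_cylinders :: "seq set \<Rightarrow> nat \<Rightarrow> nat" where
  "num_cylinders X k = card (cylinders X k)"


section \<open>Invariant measures and entropy\<close>

definition invariant_measures :: "'a::topological_space set \<Rightarrow> ('a \<Rightarrow> 'a) \<Rightarrow> 'a measure set" where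
  "invariant_measures X T =
     {\<mu>. sets \<mu> = sets (restrict_space borel X) \<and> prob_space \<mu> \<and> T \<in> measurable \<mu> \<mu> \<and> distr \<mu> \<mu> T = \<mu>}"

definition ergodic_measures :: "'a::topological_space set \<Rightarrow> ('a \<Rightarrow> 'a) \<Rightarrow> 'a measure set" where
  "ergodic_measures X T =
     {\<mu> \<in> invariant_measures X T.
        \<forall>B\<in>sets \<mu>. T -` B \<inter> space \<mu> = B \<longrightarrow> measure \<mu> B = 0 \<or> measure \<mu> B = 1}"

text \<open>The convention \<open>0 ln 0 = 0\<close> is satisfied automatically, since \<open>0 * y = 0\<close>.\<close>

definition partition_entropy :: "'a measure \<Rightarrow> 'a set set \<Rightarrow> real" where
  "partition_entropy \<mu> P = - (\<Sum>p\<in>P. measure \<mu> p * ln (measure \<mu> p))"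

definition pullback_partition :: "'a measure \<Rightarrow> ('a \<Rightarrow> 'a) \<Rightarrow> 'a set set \<Rightarrow> 'a set set" where
  "pullback_partition \<mu> T P = (\<lambda>p. T -` p \<inter> space \<mu>) ` P - {{}}"

definition iterated_partition :: "'a measure \<Rightarrow> ('a \<Rightarrow> 'a) \<Rightarrow> 'a set set \<Rightarrow> nat \<Rightarrow> 'a set set" where
  "iterated_partition \<mu> T P n =
     common_refinement ((\<lambda>i. pullback_partition \<mu> (T ^^ i) P) ` {..<n})"

definition entropy_of_partition :: "'a measure \<Rightarrow> ('a \<Rightarrow> 'a) \<Rightarrow> 'a set set \<Rightarrow> real" where
  "entropy_of_partition \<mu> T P =
     lim (\<lambda>n. partition_entropy \<mu> (iterated_partition \<mu> T P n) / real n)"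

definition ks_entropy :: "'a measure \<Rightarrow> ('a \<Rightarrow> 'a) \<Rightarrow> ereal" where
  "ks_entropy \<mu> T =
     (SUP P \<in> {P. finite P \<and> partition_on (space \<mu>) P \<and> P \<subseteq> sets \<mu>}.
        ereal (entropy_of_partition \<mu> T P))"


section \<open>Equilibrium states and zero-temperature measures\<close>

definition is_equilibrium_state ::
  "'a::topological_space set \<Rightarrow> ('a \<Rightarrow> 'a) \<Rightarrow> ('a \<Rightarrow> real) \<Rightarrow> 'a measure \<Rightarrow> bool" where
  "is_equilibrium_state X T \<phi> \<mu> \<longleftrightarrow>
     \<mu> \<in> invariant_measures X T \<and>
     (\<forall>\<nu> \<in> invariant_measures X T.
        ks_entropy \<nu> T + ereal (\<integral>x. \<phi> x \<partial>\<nu>) \<le> ks_entropy \<mu> T + ereal (\<integral>x. \<phi> x \<partial>\<mu>))"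

definition equilibrium_state ::
  "'a::topological_space set \<Rightarrow> ('a \<Rightarrow> 'a) \<Rightarrow> ('a \<Rightarrow> real) \<Rightarrow> 'a measure" where
  "equilibrium_state X T \<phi> = (THE \<mu>. is_equilibrium_state X T \<phi> \<mu>)"

definition weak_star_tendsto ::
  "'a::topological_space set \<Rightarrow> ('b \<Rightarrow> 'a measure) \<Rightarrow> 'a measure \<Rightarrow> 'b filter \<Rightarrow> bool" where
  "weak_star_tendsto X \<mu> \<nu> F \<longleftrightarrow>
     (\<forall>g::'a \<Rightarrow> real. continuous_on X g \<longrightarrow> ((\<lambda>t. \<integral>x. g x \<partial>\<mu> t) \<longlongrightarrow> (\<integral>x. g x \<partial>\<nu>)) F)"

definition zero_temperature_measure ::
  "'a::topological_space set \<Rightarrow> ('a \<Rightarrow> 'a) \<Rightarrow> ('a \<Rightarrow> real) \<Rightarrow> 'a measure" where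
  "zero_temperature_measure X T \<phi> =
     (THE \<nu>. sets \<nu> = sets (restrict_space borel X) \<and> prob_space \<nu> \<and>
        weak_star_tendsto X (\<lambda>t::real. equilibrium_state X T (\<lambda>x. t * \<phi> x)) \<nu> at_top)"

definition convex_sum_of :: "'a measure \<Rightarrow> 'a measure set \<Rightarrow> bool" where
  "convex_sum_of \<mu> S \<longleftrightarrow>
     finite S \<and> (\<forall>\<nu>\<in>S. sets \<nu> = sets \<mu>) \<and>
     (\<exists>c::'a measure \<Rightarrow> real. (\<forall>\<nu>\<in>S. 0 \<le> c \<nu>) \<and> (\<Sum>\<nu>\<in>S. c \<nu>) = 1 \<and>
        (\<forall>B\<in>sets \<mu>. measure \<mu> B = (\<Sum>\<nu>\<in>S. c \<nu> * measure \<nu> B)))"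


section \<open>Locally constant functions\<close>

text \<open>
  The dimension \<open>m\<close> is quantified over and one of its values depends on the subshift, so vectors in
  \<open>\<real>\<^sup>m\<close> are functions on \<open>{..<m}\<close>, made unique by extensionality.  Likewise functions on the
  subshift are taken extensional, so that equality is equality on the subshift.
\<close>

definition rvec :: "nat \<Rightarrow> (nat \<Rightarrow> real) set" where
  "rvec m = {..<m} \<rightarrow>\<^sub>E UNIV"

text \<open>The unit sphere in \<open>\<real>\<^sup>m\<close>, that is, the sphere of dimension \<open>m - 1\<close>.\<close>

definition unit_sphere :: "nat \<Rightarrow> (nat \<Rightarrow> real) set" where
  "unit_sphere m = {\<alpha> \<in> rvec m. (\<Sum>i<m. (\<alpha> i)\<^sup>2) = 1}"

definition LC :: "seq set \<Rightarrow> nat \<Rightarrow> 'b set \<Rightarrow> (seq \<Rightarrow> 'b) set" where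
  "LC X k E = {\<Phi> \<in> X \<rightarrow>\<^sub>E E. \<forall>C\<in>cylinders X k. \<forall>x\<in>C. \<forall>y\<in>C. \<Phi> x = \<Phi> y}"

definition LC_nonzero :: "seq set \<Rightarrow> nat \<Rightarrow> (seq \<Rightarrow> real) set" where
  "LC_nonzero X k = LC X k UNIV - {\<lambda>x\<in>X. 0}"

definition dot_fun :: "seq set \<Rightarrow> nat \<Rightarrow> (nat \<Rightarrow> real) \<Rightarrow> (seq \<Rightarrow> nat \<Rightarrow> real) \<Rightarrow> seq \<Rightarrow> real" where
  "dot_fun X m \<alpha> \<Phi> = (\<lambda>x\<in>X. \<Sum>i<m. \<alpha> i * \<Phi> x i)"


section \<open>Real analyticity\<close>

text \<open>
  Real analyticity in finitely many variables indexed by \<open>J\<close>: near \<open>a\<close> the function is the sum of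
  an (unconditionally convergent) power series, the sum ranging over all multi-indices on \<open>J\<close>.
\<close>

definition real_analytic_at :: "'j set \<Rightarrow> (('j \<Rightarrow> real) \<Rightarrow> real) \<Rightarrow> ('j \<Rightarrow> real) \<Rightarrow> bool" where
  "real_analytic_at J F a \<longleftrightarrow>
     (\<exists>r>0. \<exists>c::('j \<Rightarrow> nat) \<Rightarrow> real. \<forall>x\<in>J \<rightarrow>\<^sub>E UNIV. (\<forall>j\<in>J. \<bar>x j - a j\<bar> < r) \<longrightarrow>
        ((\<lambda>\<nu>. c \<nu> * (\<Prod>j\<in>J. (x j - a j) ^ \<nu> j)) has_sum F x) (J \<rightarrow>\<^sub>E UNIV))"

text \<open>
  The identification of the real-valued locally constant functions with a Euclidean space uses one
  coordinate per cylinder; indexing coordinates by the cylinders themselves avoids choosing an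
  enumeration of them.
\<close>

definition LC_of_coords :: "seq set \<Rightarrow> nat \<Rightarrow> (seq set \<Rightarrow> real) \<Rightarrow> seq \<Rightarrow> real" where
  "LC_of_coords X k b = (\<lambda>x\<in>X. b (cylinder X k x))"

text \<open>
  Analyticity of a map from \<open>LC_nonzero X k\<close>, an open subset of that Euclidean space, to \<open>\<real>\<^sup>m\<close>,
  componentwise.  The values of \<open>I\<close> outside \<open>LC_nonzero X k\<close> do not matter, as the radius of
  convergence may be shrunk.
\<close>

definition analytic_on_LC_nonzero ::
  "seq set \<Rightarrow> nat \<Rightarrow> nat \<Rightarrow> ((seq \<Rightarrow> real) \<Rightarrow> nat \<Rightarrow> real) \<Rightarrow> bool" where
  "analytic_on_LC_nonzero X k m I \<longleftrightarrow>
     (\<forall>a \<in> cylinders X k \<rightarrow>\<^sub>E UNIV. LC_of_coords X k a \<in> LC_nonzero X k \<longrightarrow>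
        (\<forall>i<m. real_analytic_at (cylinders X k) (\<lambda>b. I (LC_of_coords X k b) i) a))"

end

theory Submission
  imports Defs "Jordan_Normal_Form.Determinant"
begin

text \<open>
  Write \<open>\<phi> = g (prefix k x)\<close>.  The equilibrium state of \<open>t \<phi>\<close> is the Markov measure built from the
  Perron eigenvalue \<open>c t\<close> and the eigenvectors \<open>l t\<close>, \<open>r t\<close> of the matrix with entries
  \<open>exp (t g w)\<close> on words of length \<open>k\<close>: this is Gibbs' inequality for conditional block entropies.
  All entries being exponential sums, its edge weights satisfy polynomial equations whose
  coefficients are exponential sums.  A bounded continuous function of this kind converges, because it
  could pass through an intermediate value only at finitely many levels; so the equilibrium states
  converge on cylinders to a Markov measure \<open>\<nu>\<close>.  Being stationary, \<open>\<nu>\<close> is a convex combination of its restrictions to the strongly connected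
  components of its support.

  The point is that these components depend on \<open>\<phi>\<close> only through their supports.  On the support the
  logarithm of the transition probability is the limit of \<open>t g w - a t\<close> plus a coboundary depending on
  \<open>t\<close>.  Such a limit is itself a constant plus a coboundary, so each component is the Parry measure of
  the subshift carried by its edges.  There are finitely many sets of edges, hence finitely many such
  measures, and one finite set serves all functions and all dimensions.  Part (b) then only has to
  normalise the coordinates of \<open>\<phi>\<close>, since \<open>\<phi>\<close> and its positive multiples have the same
  zero-temperature measure.
\<close>

section \<open>Nonnegative matrices\<close>

text \<open>Compactness alone would give edge weights that converge along subsequences only. The
  polynomial equations come from linear algebra, without resultants or branches: the right Perron
  vector generates a module with \<open>card V\<close> generators over the exponential sums,
  multiplication by the eigenvalue acts on it through the matrix itself, and Cramer's rule expresses
  the remaining quantities by such multipliers. The \<open>card V + 1\<close> monomials of a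
  quotient of multipliers are then dependent. Denominators must be nonzero for every
  \<open>t\<close>, not just generically, because the intermediate value argument needs continuity.

  The entropy of an equilibrium state is a supremum over all finite measurable partitions, so Gibbs'
  inequality on cylinders must be preceded by a bound by conditional block entropies, found by
  approximating partitions by cylinders. Equality at every order makes the equilibrium state
  unique.\<close>

definition support_graph :: "'v set \<Rightarrow> ('v \<Rightarrow> 'v \<Rightarrow> real) \<Rightarrow> ('v \<times> 'v) set" where
  "support_graph V M = {(a, b). a \<in> V \<and> b \<in> V \<and> M a b > 0}"

definition irreducible_on :: "'v set \<Rightarrow> ('v \<Rightarrow> 'v \<Rightarrow> real) \<Rightarrow> bool" where
  "irreducible_on V M \<longleftrightarrow> (\<forall>v\<in>V. \<forall>w\<in>V. (v, w) \<in> (support_graph V M)\<^sup>*)"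

lemma irreducible_on_transpose:
  assumes "irreducible_on V M"
  shows "irreducible_on V (\<lambda>v w. M w v)"
proof -
  have "support_graph V (\<lambda>v w. M w v) = (support_graph V M)\<inverse>"
    by (auto simp: support_graph_def)
  then show ?thesis
    using assms by (auto simp: irreducible_on_def rtrancl_converse)
qed

text \<open>Minimum principle: where a nonnegative \<open>z\<close> vanishes, the inequality makes
  it vanish at every successor, so zeros spread along paths. The vertex \<open>w0\<close> is exempt
  because \<open>eigenvector_ratio\<close> treats a system whose row at one vertex has been
  replaced.\<close>

lemma superharmonic_zero_propagates:
  fixes M :: "'v \<Rightarrow> 'v \<Rightarrow> real"
  assumes "finite V"
    and M: "\<And>v w. v \<in> V \<Longrightarrow> w \<in> V \<Longrightarrow> M v w \<ge> 0"
    and z: "\<And>v. v \<in> V \<Longrightarrow> z v \<ge> 0"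
    and sup: "\<And>v. v \<in> V \<Longrightarrow> v \<noteq> w0 \<Longrightarrow> (\<Sum>w\<in>V. M v w * z w) \<le> c * z v"
    and path: "(w1, w0) \<in> (support_graph V M)\<^sup>*" and "z w1 = 0"
  shows "z w0 = 0"
  using path \<open>z w1 = 0\<close>
proof (induction rule: converse_rtrancl_induct)
  case base
  then show ?case .
next
  case (step a b)
  then have ab: "a \<in> V" "b \<in> V" "M a b > 0"
    by (auto simp: support_graph_def)
  show ?case
  proof (cases "a = w0")
    case False
    have nn: "\<And>w. w \<in> V \<Longrightarrow> 0 \<le> M a w * z w"
      using ab M z by simp
    have "(\<Sum>w\<in>V. M a w * z w) \<le> 0"
      using sup[OF ab(1) False] step.prems by simp
    then have "(\<Sum>w\<in>V. M a w * z w) = 0"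
      using nn by (simp add: antisym sum_nonneg)
    then have "M a b * z b = 0"
      using sum_nonneg_eq_0_iff[OF \<open>finite V\<close>, of "\<lambda>w. M a w * z w"] nn ab(2) by auto
    then show ?thesis
      using ab step.IH by simp
  qed (use step in simp)
qed

text \<open>Scaling \<open>u\<close> until it touches \<open>v\<close> from above prepares the
  minimum principle: the difference is nonnegative and has a zero at \<open>w1\<close>.\<close>

lemma max_ratio:
  fixes u v :: "'v \<Rightarrow> real"
  assumes "finite V" "V \<noteq> {}" and u: "\<And>w. w \<in> V \<Longrightarrow> u w > 0"
  obtains c w1 where "w1 \<in> V" "v w1 = c * u w1" "\<And>w. w \<in> V \<Longrightarrow> v w \<le> c * u w"
proof -
  have "Max ((\<lambda>w. v w / u w) ` V) \<in> (\<lambda>w. v w / u w) ` V"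
    using assms by (intro Max_in) auto
  then obtain w1 where w1: "w1 \<in> V" "Max ((\<lambda>w. v w / u w) ` V) = v w1 / u w1"
    by auto
  have "v w \<le> v w1 / u w1 * u w" if "w \<in> V" for w
  proof -
    have "v w / u w \<le> v w1 / u w1"
      unfolding w1(2)[symmetric] using that \<open>finite V\<close> by (intro Max_ge) auto
    then show ?thesis
      using u[OF that] by (simp add: pos_divide_le_eq)
  qed
  moreover have "v w1 = v w1 / u w1 * u w1"
    using u[OF w1(1)] by simp
  ultimately show ?thesis
    using that w1(1) by blast
qed

text \<open>The least multiple of \<open>u\<close> above \<open>v\<close> exceeds it by a
  nonnegative eigenvector with a zero, which irreducibility kills. No sign is assumed of
  \<open>v\<close>, so that harmonic functions are covered as well as stationary vectors.\<close>

lemma eigenvector_unique: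
  fixes M :: "'v \<Rightarrow> 'v \<Rightarrow> real"
  assumes "finite V" "V \<noteq> {}"
    and M: "\<And>v w. v \<in> V \<Longrightarrow> w \<in> V \<Longrightarrow> M v w \<ge> 0" and irr: "irreducible_on V M"
    and u: "\<And>w. w \<in> V \<Longrightarrow> u w > 0" "\<And>w. w \<in> V \<Longrightarrow> (\<Sum>x\<in>V. M w x * u x) = c * u w"
    and v: "\<And>w. w \<in> V \<Longrightarrow> (\<Sum>x\<in>V. M w x * v x) = c * v w"
  shows "\<exists>b. \<forall>w\<in>V. v w = b * u w"
proof -
  obtain b w1 where b: "w1 \<in> V" "v w1 = b * u w1" "\<And>w. w \<in> V \<Longrightarrow> v w \<le> b * u w"
    using max_ratio[of V u v] assms by metis
  have "b * u w - v w = 0" if "w \<in> V" for w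
  proof (rule superharmonic_zero_propagates[of V M "\<lambda>w. b * u w - v w" w c w1])
    fix x assume x: "x \<in> V"
    have "(\<Sum>y\<in>V. M x y * (b * u y - v y)) = b * (\<Sum>y\<in>V. M x y * u y) - (\<Sum>y\<in>V. M x y * v y)"
      by (simp add: sum_distrib_left algebra_simps flip: sum_subtractf)
    then show "(\<Sum>y\<in>V. M x y * (b * u y - v y)) \<le> c * (b * u x - v x)"
      using u v x by (simp add: algebra_simps)
  qed (use assms b that in \<open>auto simp: irreducible_on_def\<close>)
  then show ?thesis
    by (intro exI[of _ b]) auto
qed

text \<open>Where a multiple of \<open>u\<close> touches \<open>v\<close> from above, the two
  eigenvalue equations can be compared and order the eigenvalues; then the vectors exchange
  roles.\<close>

lemma positive_eigenvalue_unique: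
  fixes M :: "'v \<Rightarrow> 'v \<Rightarrow> real"
  assumes "finite V" "V \<noteq> {}"
    and M: "\<And>v w. v \<in> V \<Longrightarrow> w \<in> V \<Longrightarrow> M v w \<ge> 0"
    and u: "\<And>w. w \<in> V \<Longrightarrow> u w > 0" "\<And>w. w \<in> V \<Longrightarrow> (\<Sum>x\<in>V. M w x * u x) = c * u w"
    and v: "\<And>w. w \<in> V \<Longrightarrow> v w > 0" "\<And>w. w \<in> V \<Longrightarrow> (\<Sum>x\<in>V. M w x * v x) = c' * v w"
  shows "c = c'"
proof -
  have le: "c' \<le> c"
    if u: "\<And>w. w \<in> V \<Longrightarrow> u w > 0" "\<And>w. w \<in> V \<Longrightarrow> (\<Sum>x\<in>V. M w x * u x) = c * u w"
    and v: "\<And>w. w \<in> V \<Longrightarrow> v w > 0" "\<And>w. w \<in> V \<Longrightarrow> (\<Sum>x\<in>V. M w x * v x) = c' * v w"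
  for u v :: "'v \<Rightarrow> real" and c c'
  proof -
    obtain b w1 where b: "w1 \<in> V" "v w1 = b * u w1" "\<And>w. w \<in> V \<Longrightarrow> v w \<le> b * u w"
      using max_ratio[of V u v] assms(1,2) u(1) by metis
    have "c' * v w1 = (\<Sum>x\<in>V. M w1 x * v x)"
      using v(2) b(1) by simp
    also have "\<dots> \<le> (\<Sum>x\<in>V. M w1 x * (b * u x))"
      using b M by (intro sum_mono mult_left_mono) auto
    also have "\<dots> = b * (\<Sum>x\<in>V. M w1 x * u x)"
      by (simp add: sum_distrib_left algebra_simps)
    also have "\<dots> = c * v w1"
      using u(2) b(1,2) by simp
    finally show ?thesis
      using v(1) b(1) by simp
  qed
  show ?thesis
    using le[OF u v] le[OF v u] by simp
qed

section \<open>Compactness and existence of the Perron eigenvector\<close>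

lemma convergent_subseq_finite:
  fixes x :: "nat \<Rightarrow> 'v \<Rightarrow> real"
  assumes "finite V" and "\<And>n v. v \<in> V \<Longrightarrow> \<bar>x n v\<bar> \<le> B"
  shows "\<exists>\<sigma> y. strict_mono (\<sigma> :: nat \<Rightarrow> nat) \<and> (\<forall>v\<in>V. (\<lambda>n. x (\<sigma> n) v) \<longlonglongrightarrow> y v)"
  using assms
proof (induction V rule: finite_induct)
  case empty
  then show ?case
    by (intro exI[of _ "\<lambda>n. n"]) (auto simp: strict_mono_def)
next
  case (insert a V)
  then obtain \<sigma> y where \<sigma>: "strict_mono (\<sigma> :: nat \<Rightarrow> nat)" "\<And>v. v \<in> V \<Longrightarrow> (\<lambda>n. x (\<sigma> n) v) \<longlonglongrightarrow> y v"
    by blast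
  have "bounded (range (\<lambda>n. x (\<sigma> n) a))"
    using insert.prems by (auto simp: bounded_iff)
  then obtain l \<tau> where \<tau>: "strict_mono (\<tau> :: nat \<Rightarrow> nat)" "((\<lambda>n. x (\<sigma> n) a) \<circ> \<tau>) \<longlonglongrightarrow> l"
    using bounded_imp_convergent_subsequence by blast
  have "(\<lambda>n. x ((\<sigma> \<circ> \<tau>) n) v) \<longlonglongrightarrow> (y(a := l)) v" if "v \<in> insert a V" for v
  proof (cases "v = a")
    case False
    then show ?thesis
      using that LIMSEQ_subseq_LIMSEQ[OF \<sigma>(2) \<tau>(1), of v] by (auto simp: o_def)
  qed (use \<tau> in \<open>simp add: o_def\<close>)
  then show ?case
    using strict_mono_o[OF \<sigma>(1) \<tau>(1)] by blast
qed

text \<open>Collatz-Wielandt argument: \<open>c\<close> is the least \<open>b\<close> for which some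
  normalised nonnegative \<open>u\<close> satisfies \<open>M u \<le> b u\<close>, attained by
  compactness. Among the positive solutions for \<open>c\<close>, one with the largest number of
  strict inequalities turns out to have none.\<close>

theorem perron_eigenvector:
  fixes M :: "'v \<Rightarrow> 'v \<Rightarrow> real"
  assumes fin: "finite V" and ne: "V \<noteq> {}"
    and M: "\<And>v w. v \<in> V \<Longrightarrow> w \<in> V \<Longrightarrow> M v w \<ge> 0" and irr: "irreducible_on V M"
  shows "\<exists>c u. (\<forall>w\<in>V. u w > 0) \<and> (\<forall>w\<in>V. (\<Sum>x\<in>V. M w x * u x) = c * u w)"
proof -
  let ?F = "\<lambda>u w. \<Sum>x\<in>V. M w x * u x"
  define D :: "('v \<Rightarrow> real) set" where "D = {u. (\<forall>w\<in>V. u w \<ge> 0) \<and> sum u V = 1}"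
  define L where "L = {c. \<exists>u\<in>D. \<forall>w\<in>V. ?F u w \<le> c * u w}"
  define c where "c = Inf L"
  have pos: "u w > 0" if u: "u \<in> D" "\<And>w. w \<in> V \<Longrightarrow> ?F u w \<le> b * u w" and w: "w \<in> V" for u w b
  proof (rule ccontr)
    assume "\<not> u w > 0"
    then have "u w = 0"
      using u w by (force simp: D_def)
    then have "u v = 0" if "v \<in> V" for v
      using that u w superharmonic_zero_propagates[of V M u v b w] fin M irr
      by (auto simp: irreducible_on_def D_def)
    then show False
      using u(1) by (simp add: D_def)
  qed
  have L0: "b \<ge> 0" if "b \<in> L" for b
  proof -
    obtain u where u: "u \<in> D" "\<And>w. w \<in> V \<Longrightarrow> ?F u w \<le> b * u w"
      using \<open>b \<in> L\<close> by (auto simp: L_def)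
    obtain w where w: "w \<in> V"
      using ne by blast
    have "0 \<le> ?F u w"
      using u(1) M w by (intro sum_nonneg mult_nonneg_nonneg) (auto simp: D_def)
    then have "0 \<le> b * u w"
      using u w by force
    then show ?thesis
      using pos[OF u w] by (simp add: zero_le_mult_iff)
  qed
  then have bdd: "bdd_below L"
    by (auto simp: bdd_below_def)
  have "L \<noteq> {}"
  proof -
    have cV: "real (card V) > 0"
      using fin ne by (simp add: card_gt_0_iff)
    have "?F (\<lambda>_. 1 / real (card V)) w \<le> (\<Sum>x\<in>V. \<Sum>y\<in>V. M x y) * (1 / real (card V))" if "w \<in> V" for w
    proof -
      have "?F (\<lambda>_. 1 / real (card V)) w = (\<Sum>y\<in>V. M w y) * (1 / real (card V))"
        by (simp add: sum_divide_distrib)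
      also have "(\<Sum>y\<in>V. M w y) \<le> (\<Sum>x\<in>V. \<Sum>y\<in>V. M x y)"
        using that fin M by (intro member_le_sum sum_nonneg) auto
      finally show ?thesis
        using cV by (simp add: divide_right_mono)
    qed
    moreover have "(\<lambda>_. 1 / real (card V)) \<in> D"
      using cV by (simp add: D_def)
    ultimately have "(\<Sum>x\<in>V. \<Sum>y\<in>V. M x y) \<in> L"
      unfolding L_def by (intro CollectI bexI[of _ "\<lambda>_. 1 / real (card V)"]) auto
    then show ?thesis
      by blast
  qed
  have "\<exists>b\<in>L. b < c + 1 / Suc n" for n
    using cInf_lessD[OF \<open>L \<noteq> {}\<close>, of "c + 1 / Suc n"] by (auto simp: c_def)
  then obtain b where b: "\<And>n. b n \<in> L" "\<And>n. b n < c + 1 / Suc n"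
    by metis
  have "\<exists>u. \<forall>n. u n \<in> D \<and> (\<forall>w\<in>V. ?F (u n) w \<le> b n * u n w)"
    using b(1) unfolding L_def by (intro choice) blast
  then obtain u where u: "\<And>n. u n \<in> D" "\<And>n w. w \<in> V \<Longrightarrow> ?F (u n) w \<le> b n * u n w"
    by blast
  have "\<bar>u n w\<bar> \<le> 1" if "w \<in> V" for n w
    using u(1)[of n] member_le_sum[of w V "u n"] fin that by (auto simp: D_def)
  then obtain \<sigma> y where \<sigma>: "strict_mono (\<sigma> :: nat \<Rightarrow> nat)" "\<And>v. v \<in> V \<Longrightarrow> (\<lambda>n. u (\<sigma> n) v) \<longlonglongrightarrow> y v"
    using convergent_subseq_finite[OF fin, of u 1] by blast
  have "b \<longlonglongrightarrow> c"
  proof (rule tendsto_sandwich[of "\<lambda>_. c" _ _ "\<lambda>n. c + 1 / Suc n"])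
    show "\<forall>\<^sub>F n in sequentially. c \<le> b n"
      using cInf_lower[OF b(1) bdd] by (simp add: c_def)
    show "\<forall>\<^sub>F n in sequentially. b n \<le> c + 1 / Suc n"
      by (intro always_eventually allI less_imp_le b(2))
    show "(\<lambda>n. c + 1 / Suc n) \<longlonglongrightarrow> c"
      using tendsto_add[OF tendsto_const[of c] LIMSEQ_inverse_real_of_nat]
      by (simp add: inverse_eq_divide)
  qed simp
  then have bs: "(\<lambda>n. b (\<sigma> n)) \<longlonglongrightarrow> c"
    using LIMSEQ_subseq_LIMSEQ[OF _ \<sigma>(1)] by (auto simp: o_def)
  have yD: "y \<in> D"
  proof -
    have "y w \<ge> 0" if "w \<in> V" for w
      using LIMSEQ_le_const[OF \<sigma>(2)[OF that]] u(1) that by (auto simp: D_def)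
    moreover have "(\<lambda>n. \<Sum>w\<in>V. u (\<sigma> n) w) \<longlonglongrightarrow> sum y V"
      by (intro tendsto_sum \<sigma>(2))
    then have "(\<lambda>n. 1) \<longlonglongrightarrow> sum y V"
      using u(1) by (simp add: D_def)
    ultimately show ?thesis
      by (simp add: D_def LIMSEQ_const_iff)
  qed
  have yc: "?F y w \<le> c * y w" if "w \<in> V" for w
  proof (rule LIMSEQ_le)
    show "(\<lambda>n. ?F (u (\<sigma> n)) w) \<longlonglongrightarrow> ?F y w"
      by (intro tendsto_sum tendsto_mult tendsto_const \<sigma>(2))
    show "(\<lambda>n. b (\<sigma> n) * u (\<sigma> n) w) \<longlonglongrightarrow> c * y w"
      by (intro tendsto_mult bs \<sigma>(2) that)
  qed (use u that in auto)
  \<comment> \<open>\<open>St u\<close> is the set of strict inequalities. It can be enlarged unless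
    it is empty or all of \<open>V\<close>, and the latter contradicts minimality of
    \<open>c\<close>.\<close>
  define G where "G = {u. (\<forall>w\<in>V. u w > 0) \<and> (\<forall>w\<in>V. ?F u w \<le> c * u w)}"
  define St where "St u = {w\<in>V. ?F u w < c * u w}" for u
  have "y \<in> G"
    using pos[OF yD yc] yc by (auto simp: G_def)
  have "\<forall>u. u \<in> G \<longrightarrow> card (St u) < card V + 1"
    using fin by (auto simp: St_def less_Suc_eq_le intro!: card_mono)
  then obtain u where u: "u \<in> G" and umax: "\<And>v. v \<in> G \<Longrightarrow> card (St v) \<le> card (St u)"
    using ex_has_greatest_nat[of "\<lambda>u. u \<in> G" y "\<lambda>u. card (St u)" "card V + 1"] \<open>y \<in> G\<close> by (metis less_imp_le)
  have "St u = {}"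
  proof (rule ccontr)
    assume ne_St: "St u \<noteq> {}"
    show False
    proof (cases "St u = V")
      \<comment> \<open>With strictness everywhere the largest quotient \<open>c'\<close> would be
        an element of \<open>L\<close> below its infimum.\<close>
      case True
      define c' where "c' = Max ((\<lambda>w. ?F u w / u w) ` V)"
      have "c' \<in> (\<lambda>w. ?F u w / u w) ` V"
        unfolding c'_def using fin ne by (intro Max_in) auto
      then obtain w where w: "w \<in> V" "c' = ?F u w / u w"
        by blast
      then have "w \<in> St u" "u w > 0"
        using True u by (auto simp: G_def)
      then have "c' < c"
        using w by (simp add: St_def pos_divide_less_eq)
      have "?F u x \<le> c' * u x" if "x \<in> V" for x
      proof -
        have "?F u x / u x \<le> c'"
          unfolding c'_def using that fin by (intro Max_ge) auto
        then show ?thesis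
          using u that by (auto simp: G_def pos_divide_le_eq)
      qed
      moreover have su: "sum u V > 0"
        using u fin ne by (auto simp: G_def intro!: sum_pos)
      ultimately have "?F (\<lambda>w. u w / sum u V) x \<le> c' * (u x / sum u V)" if "x \<in> V" for x
        using that by (simp add: divide_right_mono flip: sum_divide_distrib)
      moreover have "(\<lambda>w. u w / sum u V) \<in> D"
        using u su by (auto simp: D_def G_def less_imp_le simp flip: sum_divide_distrib)
      ultimately have "c' \<in> L"
        unfolding L_def by (intro CollectI bexI[of _ "\<lambda>w. u w / sum u V"]) auto
      then have "c \<le> c'"
        unfolding c_def using bdd by (rule cInf_lower)
      then show False
        using \<open>c' < c\<close> by simp
    next
      case False
      then obtain v where v: "v \<in> V" "v \<notin> St u"
        by (auto simp: St_def)
      obtain s where s: "s \<in> St u" "s \<in> V"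
        using ne_St by (auto simp: St_def)
      have "(v, s) \<in> (support_graph V M)\<^sup>*"
        using irr v s by (auto simp: irreducible_on_def)
      \<comment> \<open>A path from outside \<open>St u\<close> into it contains an edge that enters
        it; lowering \<open>u\<close> at the end \<open>t\<close> of this edge creates strictness at
        its start \<open>a\<close>.\<close>
      then have "\<exists>a b. (a, b) \<in> support_graph V M \<and> a \<notin> St u \<and> b \<in> St u"
        using v(2) s(1) by (induction rule: rtrancl_induct) blast+
      then obtain a t where at: "a \<in> V" "t \<in> V" "M a t > 0" "a \<notin> St u" "t \<in> St u"
        by (auto simp: support_graph_def)
      then have ut: "u t > 0" "?F u t < c * u t"
        using u by (auto simp: G_def St_def)
      have "c > 0"
      proof (rule ccontr)
        assume "\<not> c > 0"
        then have "c * u t \<le> 0"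
          using ut by (simp add: mult_le_0_iff)
        moreover have "0 \<le> ?F u t"
          using u M at by (intro sum_nonneg mult_nonneg_nonneg) (auto simp: G_def intro: less_imp_le)
        ultimately show False
          using ut by simp
      qed
      \<comment> \<open>Half of each admissible bound: \<open>e < u t\<close> keeps the vector
        positive, and \<open>c * e\<close> below the slack keeps the inequality at \<open>t\<close>
        strict.\<close>
      define e where "e = min (u t / 2) ((c * u t - ?F u t) / (2 * c))"
      have e: "e > 0" "e < u t" "c * e < c * u t - ?F u t"
      proof -
        show "e > 0"
          using ut \<open>c > 0\<close> by (simp add: e_def)
        have "e \<le> u t / 2"
          by (simp add: e_def)
        then show "e < u t"
          using ut by simp
        have "c * e \<le> c * ((c * u t - ?F u t) / (2 * c))"
          using \<open>c > 0\<close> by (intro mult_left_mono) (auto simp: e_def)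
        also have "\<dots> = (c * u t - ?F u t) / 2"
          using \<open>c > 0\<close> by simp
        also have "\<dots> < c * u t - ?F u t"
          using ut by simp
        finally show "c * e < c * u t - ?F u t" .
      qed
      define u' where "u' = u(t := u t - e)"
      have F': "?F u' w = ?F u w - M w t * e" for w
      proof -
        have "?F u' w = (\<Sum>x\<in>V. M w x * u x - (if x = t then M w t * e else 0))"
          by (intro sum.cong) (auto simp: u'_def algebra_simps)
        also have "\<dots> = ?F u w - M w t * e"
          using fin at by (simp add: sum_subtractf)
        finally show ?thesis .
      qed
      have F'le: "?F u' w \<le> ?F u w" if "w \<in> V" for w
        using F' M[OF that at(2)] e by simp
      have t': "?F u' t < c * u' t"
        using F'le[OF at(2)] e by (simp add: u'_def algebra_simps)
      have "u' \<in> G"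
        using u F'le t' e unfolding G_def u'_def by (fastforce intro: order_trans)
      moreover have "St u \<union> {a} \<subseteq> St u'"
      proof
        fix w assume "w \<in> St u \<union> {a}"
        then consider "w = t" | "w \<noteq> t" "w \<in> St u" | "w \<noteq> t" "w = a"
          by blast
        then show "w \<in> St u'"
        proof cases
          case 1
          then show ?thesis
            using t' at by (simp add: St_def)
        next
          case 2
          then show ?thesis
            using F'le[of w] by (auto simp: St_def u'_def)
        next
          case 3
          have "?F u a \<le> c * u a"
            using u at by (auto simp: G_def)
          moreover have "M a t * e > 0"
            using at e by simp
          ultimately have "?F u' a < c * u' a"
            using F'[of a] 3 unfolding u'_def by simp
          then show ?thesis
            using 3 at by (simp add: St_def)
        qed
      qed
      then have "card (insert a (St u)) \<le> card (St u')"
        using fin by (intro card_mono) (auto simp: St_def)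
      then have "card (St u) < card (St u')"
        using at fin by (subst (asm) card_insert_disjoint) (auto simp: St_def)
      ultimately show False
        using umax[of u'] by simp
    qed
  qed
  then have "?F u w = c * u w" if "w \<in> V" for w
    using that u by (fastforce simp: G_def St_def)
  then show ?thesis
    using u by (auto simp: G_def)
qed

section \<open>Exponential sums\<close>

definition exp_sum :: "(real \<Rightarrow> real) \<Rightarrow> bool" where
  "exp_sum f \<longleftrightarrow> (\<exists>S c. finite S \<and> (\<forall>t. f t = (\<Sum>a\<in>S. c a * exp (a * t))))"

lemma exp_sum_exp: "exp_sum (\<lambda>t. c * exp (a * t))"
  unfolding exp_sum_def by (intro exI[of _ "{a}"] exI[of _ "\<lambda>_. c"]) simp

lemma exp_sum_const: "exp_sum (\<lambda>_. c)"
  using exp_sum_exp[of c 0] by simp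

lemma exp_sum_add:
  assumes "exp_sum f" "exp_sum g"
  shows "exp_sum (\<lambda>t. f t + g t)"
proof -
  obtain S c where S: "finite S" "\<And>t. f t = (\<Sum>a\<in>S. c a * exp (a * t))"
    using assms(1) by (auto simp: exp_sum_def)
  obtain T d where T: "finite T" "\<And>t. g t = (\<Sum>a\<in>T. d a * exp (a * t))"
    using assms(2) by (auto simp: exp_sum_def)
  have "f t + g t = (\<Sum>a\<in>S \<union> T. ((if a \<in> S then c a else 0) + (if a \<in> T then d a else 0)) * exp (a * t))" for t
  proof -
    have "f t = (\<Sum>a\<in>S \<union> T. (if a \<in> S then c a else 0) * exp (a * t))"
      unfolding S(2) using S(1) T(1) by (intro sum.mono_neutral_cong_left) auto
    moreover have "g t = (\<Sum>a\<in>S \<union> T. (if a \<in> T then d a else 0) * exp (a * t))"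
      unfolding T(2) using S(1) T(1) by (intro sum.mono_neutral_cong_left) auto
    ultimately show ?thesis
      by (simp add: distrib_right sum.distrib)
  qed
  then show ?thesis
    unfolding exp_sum_def using S(1) T(1)
    by (intro exI[of _ "S \<union> T"] exI[of _ "\<lambda>a. (if a \<in> S then c a else 0) + (if a \<in> T then d a else 0)"]) auto
qed

lemma exp_sum_sum:
  assumes "\<And>i. i \<in> I \<Longrightarrow> exp_sum (f i)"
  shows "exp_sum (\<lambda>t. \<Sum>i\<in>I. f i t)"
  using assms by (induction I rule: infinite_finite_induct) (auto intro: exp_sum_add exp_sum_const)

lemma exp_sum_mult_exp:
  assumes "exp_sum f"
  shows "exp_sum (\<lambda>t. c * exp (b * t) * f t)"
proof -
  obtain S d where S: "finite S" "\<And>t. f t = (\<Sum>a\<in>S. d a * exp (a * t))"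
    using assms by (auto simp: exp_sum_def)
  have "(\<lambda>t. c * exp (b * t) * f t) = (\<lambda>t. \<Sum>a\<in>S. c * d a * exp ((b + a) * t))"
    by (auto simp: S(2) sum_distrib_left exp_add algebra_simps)
  then show ?thesis
    by (simp add: exp_sum_sum exp_sum_exp)
qed

lemma exp_sum_mult:
  assumes "exp_sum f" "exp_sum g"
  shows "exp_sum (\<lambda>t. f t * g t)"
proof -
  obtain S d where S: "finite S" "\<And>t. f t = (\<Sum>a\<in>S. d a * exp (a * t))"
    using assms by (auto simp: exp_sum_def)
  have "(\<lambda>t. f t * g t) = (\<lambda>t. \<Sum>a\<in>S. d a * exp (a * t) * g t)"
    by (auto simp: S(2) sum_distrib_right)
  then show ?thesis
    using assms by (simp add: exp_sum_sum exp_sum_mult_exp)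
qed

lemma exp_sum_uminus: "exp_sum f \<Longrightarrow> exp_sum (\<lambda>t. - f t)"
  using exp_sum_mult[OF exp_sum_const[of "-1"]] by simp

lemma exp_sum_diff: "exp_sum f \<Longrightarrow> exp_sum g \<Longrightarrow> exp_sum (\<lambda>t. f t - g t)"
  using exp_sum_add[OF _ exp_sum_uminus] by simp

lemma continuous_on_exp_sum:
  assumes "exp_sum f"
  shows "continuous_on A f"
proof -
  obtain S d where S: "f = (\<lambda>t. \<Sum>a\<in>S. d a * exp (a * t))"
    using assms by (auto simp: exp_sum_def)
  show ?thesis
    unfolding S by (intro continuous_intros)
qed

text \<open>Once zero coefficients are dropped, the term of largest exponent dominates, and its
  coefficient is the limit.\<close>

lemma exp_sum_dominant:
  assumes "exp_sum f" and "f t0 \<noteq> 0"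
  shows "\<exists>a C. C \<noteq> 0 \<and> ((\<lambda>t. f t * exp (- (a * t))) \<longlongrightarrow> C) at_top"
proof -
  obtain S d where S: "finite S" "\<And>t. f t = (\<Sum>a\<in>S. d a * exp (a * t))"
    using assms by (auto simp: exp_sum_def)
  define R where "R = {a\<in>S. d a \<noteq> 0}"
  have fR: "f t = (\<Sum>a\<in>R. d a * exp (a * t))" for t
    unfolding S(2) R_def using S(1) by (intro sum.mono_neutral_right) auto
  have R: "finite R"
    using S(1) by (simp add: R_def)
  have "R \<noteq> {}"
    using assms(2) fR[of t0] by auto
  define m where "m = Max R"
  have m: "m \<in> R" "\<And>a. a \<in> R \<Longrightarrow> a \<le> m"
    using R \<open>R \<noteq> {}\<close> by (auto simp: m_def)
  have lim: "((\<lambda>t. d a * exp ((a - m) * t)) \<longlongrightarrow> (if a = m then d m else 0)) at_top" if "a \<in> R" for a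
  proof (cases "a = m")
    case False
    then have "a - m < 0"
      using m(2)[OF that] by simp
    then have "filterlim (\<lambda>t. (a - m) * t) at_bot at_top"
      by (intro filterlim_tendsto_neg_mult_at_bot[OF tendsto_const _ filterlim_ident])
    then have "((\<lambda>t. exp ((a - m) * t)) \<longlongrightarrow> 0) at_top"
      by (rule filterlim_compose[OF exp_at_bot])
    then show ?thesis
      using False tendsto_mult_right_zero by auto
  qed simp
  have "((\<lambda>t. \<Sum>a\<in>R. d a * exp ((a - m) * t)) \<longlongrightarrow> (\<Sum>a\<in>R. if a = m then d m else 0)) at_top"
    by (intro tendsto_sum lim)
  moreover have "(\<Sum>a\<in>R. if a = m then d m else 0) = d m"
    using R m by simp
  moreover have "(\<Sum>a\<in>R. d a * exp ((a - m) * t)) = f t * exp (- (m * t))" for t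
    unfolding fR sum_distrib_right
    by (intro sum.cong) (simp_all add: left_diff_distrib exp_diff exp_minus divide_inverse)
  ultimately show ?thesis
    using m(1) by (intro exI[of _ m] exI[of _ "d m"]) (simp add: R_def)
qed

text \<open>Either factor is asymptotic to a nonzero multiple of an exponential and so is nonzero
  for all large \<open>t\<close>: the exponential sums have no zero divisors.\<close>

lemma exp_sum_mult_nonzero:
  assumes "exp_sum f" "exp_sum g" "f s \<noteq> 0" "g s' \<noteq> 0"
  shows "\<exists>t. f t * g t \<noteq> 0"
proof -
  have ev: "\<forall>\<^sub>F t in at_top. h t \<noteq> 0" if h: "exp_sum h" "h s \<noteq> 0" for h s
  proof -
    obtain a C where "C \<noteq> 0" "((\<lambda>t. h t * exp (- (a * t))) \<longlongrightarrow> C) at_top"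
      using exp_sum_dominant[OF h] by blast
    then have "\<forall>\<^sub>F t in at_top. h t * exp (- (a * t)) \<noteq> 0"
      by (intro tendsto_imp_eventually_ne) auto
    then show ?thesis
      by (rule eventually_mono) auto
  qed
  have "\<forall>\<^sub>F t in at_top. f t \<noteq> 0 \<and> g t \<noteq> 0"
    using ev assms by (intro eventually_conj) blast+
  then show ?thesis
    using eventually_happens'[OF trivial_limit_at_top_linorder] by fastforce
qed

text \<open>Fraction-free Gaussian elimination. Cross-multiplying instead of dividing by the pivot
  keeps the coefficients of the relation exponential sums.\<close>

lemma exp_sum_dependent:
  assumes "finite I" "finite J" "card I < card J"
    and "\<And>i j. i \<in> I \<Longrightarrow> j \<in> J \<Longrightarrow> exp_sum (c j i)"
  shows "\<exists>e. (\<forall>j\<in>J. exp_sum (e j)) \<and> (\<exists>j\<in>J. \<exists>t. e j t \<noteq> 0) \<and>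
           (\<forall>i\<in>I. \<forall>t. (\<Sum>j\<in>J. e j t * c j i t) = 0)"
  using assms
proof (induction I arbitrary: J c rule: finite_induct)
  case empty
  then have "J \<noteq> {}"
    by auto
  then show ?case
    by (intro exI[of _ "\<lambda>_ _. 1"]) (auto simp: exp_sum_const)
next
  case (insert k I)
  show ?case
  proof (cases "\<forall>j\<in>J. \<forall>t. c j k t = 0")
    case True
    obtain e where e: "\<forall>j\<in>J. exp_sum (e j)" "\<exists>j\<in>J. \<exists>t. e j t \<noteq> 0"
        "\<forall>i\<in>I. \<forall>t. (\<Sum>j\<in>J. e j t * c j i t) = 0"
      using insert.IH[of J c] insert.prems insert.hyps by auto
    then show ?thesis
      using True by (intro exI[of _ e]) auto
  next
    case False
    then obtain j0 s where j0: "j0 \<in> J" "c j0 k s \<noteq> 0"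
      by blast
    define J' where "J' = J - {j0}"
    \<comment> \<open>Cross-multiplication with the pivot \<open>c j0 k\<close> annihilates
      coordinate \<open>k\<close>.\<close>
    define c' where "c' j i t = c j0 k t * c j i t - c j k t * c j0 i t" for j i t
    have J': "finite J'" "J = insert j0 J'" "j0 \<notin> J'"
      using j0 insert.prems by (auto simp: J'_def)
    have "card I < card J'"
      using insert.prems insert.hyps j0 by (simp add: J'_def)
    moreover have "exp_sum (c' j i)" if "i \<in> I" "j \<in> J'" for i j
      unfolding c'_def using that insert.prems J' by (intro exp_sum_diff exp_sum_mult) auto
    ultimately obtain e where e: "\<forall>j\<in>J'. exp_sum (e j)" "\<exists>j\<in>J'. \<exists>t. e j t \<noteq> 0"
        "\<forall>i\<in>I. \<forall>t. (\<Sum>j\<in>J'. e j t * c' j i t) = 0"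
      using insert.IH[of J' c'] J' by blast
    \<comment> \<open>The relation for \<open>c'\<close> is multiplied by the pivot, and the
      coefficient at \<open>j0\<close> collects what was subtracted. Absence of zero divisors keeps
      the relation nontrivial.\<close>
    define e' where "e' j t = (if j = j0 then - (\<Sum>j\<in>J'. e j t * c j k t) else c j0 k t * e j t)" for j t
    have "exp_sum (e' j)" if "j \<in> J" for j
    proof (cases "j = j0")
      case True
      then show ?thesis
        unfolding e'_def using e(1) insert.prems J'
        by (auto intro!: exp_sum_uminus exp_sum_sum exp_sum_mult)
    next
      case False
      then show ?thesis
        unfolding e'_def using e(1) insert.prems J' that
        by (auto intro!: exp_sum_mult)
    qed
    moreover have "\<exists>j\<in>J. \<exists>t. e' j t \<noteq> 0"
    proof -
      obtain j s' where j: "j \<in> J'" "e j s' \<noteq> 0"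
        using e(2) by blast
      have "\<exists>t. c j0 k t * e j t \<noteq> 0"
        using exp_sum_mult_nonzero[of "c j0 k" "e j" s s'] j e(1) j0 insert.prems by auto
      then show ?thesis
        using j J' by (intro bexI[of _ j]) (auto simp: e'_def)
    qed
    moreover have "(\<Sum>j\<in>J. e' j t * c j i t) = 0" if "i \<in> insert k I" for i t
    proof -
      have "(\<Sum>j\<in>J. e' j t * c j i t) = e' j0 t * c j0 i t + (\<Sum>j\<in>J'. e' j t * c j i t)"
        using J' by simp
      also have "(\<Sum>j\<in>J'. e' j t * c j i t) = (\<Sum>j\<in>J'. c j0 k t * e j t * c j i t)"
        using J' by (intro sum.cong) (auto simp: e'_def)
      also have "e' j0 t * c j0 i t + \<dots> = (\<Sum>j\<in>J'. e j t * c' j i t)"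
        by (simp add: e'_def c'_def sum_distrib_right sum_distrib_left right_diff_distrib sum_subtractf algebra_simps)
      also have "\<dots> = 0"
        using e(3) that by (cases "i = k") (auto simp: c'_def)
      finally show ?thesis .
    qed
    ultimately show ?thesis
      by (intro exI[of _ e']) blast
  qed
qed

text \<open>
  Between two limit points \<open>p\<close> takes every value \<open>y\<close> arbitrarily late, so that \<open>y\<close> is a root of the
  polynomial formed by the leading coefficients; only finitely many \<open>y\<close> are.
\<close>

lemma tendsto_of_exp_sum_relation:
  fixes p :: "real \<Rightarrow> real" and c :: "nat \<Rightarrow> real \<Rightarrow> real"
  assumes cont: "continuous_on UNIV p" and bnd: "\<And>t. 0 \<le> p t" "\<And>t. p t \<le> 1"
    and c: "\<And>j. j \<le> n \<Longrightarrow> exp_sum (c j)" and nz: "\<exists>j\<le>n. \<exists>t. c j t \<noteq> 0"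
    and rel: "\<And>t. (\<Sum>j\<le>n. c j t * p t ^ j) = 0"
  shows "\<exists>L. (p \<longlongrightarrow> L) at_top"
proof -
  define J where "J = {j. j \<le> n \<and> (\<exists>t. c j t \<noteq> 0)}"
  have J: "finite J" "J \<noteq> {}"
    using nz by (auto simp: J_def)
  have "\<exists>a C. C \<noteq> 0 \<and> ((\<lambda>t. c j t * exp (- (a * t))) \<longlongrightarrow> C) at_top" if "j \<in> J" for j
    using that c exp_sum_dominant[of "c j"] by (auto simp: J_def)
  then obtain a C where aC: "\<And>j. j \<in> J \<Longrightarrow> C j \<noteq> 0"
      "\<And>j. j \<in> J \<Longrightarrow> ((\<lambda>t. c j t * exp (- (a j * t))) \<longlongrightarrow> C j) at_top"
    by metis
  \<comment> \<open>\<open>m\<close> is the largest growth rate among the coefficients. Division of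
    the relation by \<open>exp (m * t)\<close> leaves in the limit the polynomial with coefficients
    \<open>g j\<close>, not all zero.\<close>
  define m where "m = Max (a ` J)"
  have m: "m \<in> a ` J" "\<And>j. j \<in> J \<Longrightarrow> a j \<le> m"
    using J by (auto simp: m_def)
  define g where "g j = (if j \<in> J \<and> a j = m then C j else 0)" for j
  have lim: "((\<lambda>t. c j t * exp (- (m * t))) \<longlongrightarrow> g j) at_top" if "j \<le> n" for j
  proof (cases "j \<in> J")
    case False
    then show ?thesis
      using that by (simp add: J_def g_def)
  next
    case True
    show ?thesis
    proof (cases "a j = m")
      case True
      then show ?thesis
        using aC(2)[OF \<open>j \<in> J\<close>] \<open>j \<in> J\<close> by (simp add: g_def)
    next
      case False
      then have "a j - m < 0"
        using m(2)[OF \<open>j \<in> J\<close>] by simp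
      then have "filterlim (\<lambda>t. (a j - m) * t) at_bot at_top"
        by (intro filterlim_tendsto_neg_mult_at_bot[OF tendsto_const _ filterlim_ident])
      then have "((\<lambda>t. exp ((a j - m) * t)) \<longlongrightarrow> 0) at_top"
        by (rule filterlim_compose[OF exp_at_bot])
      then have "((\<lambda>t. c j t * exp (- (a j * t)) * exp ((a j - m) * t)) \<longlongrightarrow> C j * 0) at_top"
        by (intro tendsto_mult aC(2) \<open>j \<in> J\<close>)
      moreover have "c j t * exp (- (a j * t)) * exp ((a j - m) * t) = c j t * exp (- (m * t))" for t
        by (simp add: algebra_simps flip: exp_add)
      ultimately show ?thesis
        using False by (simp add: g_def)
    qed
  qed
  define Z where "Z = {y. (\<Sum>j\<le>n. g j * y ^ j) = 0}"
  obtain j1 where "j1 \<in> J" "a j1 = m"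
    using m(1) by blast
  then have "j1 \<le> n" "g j1 \<noteq> 0"
    using aC(1) by (auto simp: g_def J_def)
  then have "finite Z"
    unfolding Z_def by (subst polyfun_finite_roots) blast
  have root: "y \<in> Z" if fr: "\<exists>\<^sub>F t in at_top. p t = y" for y
  proof (rule ccontr)
    assume "y \<notin> Z"
    have "((\<lambda>t. \<Sum>j\<le>n. c j t * exp (- (m * t)) * y ^ j) \<longlongrightarrow> (\<Sum>j\<le>n. g j * y ^ j)) at_top"
      by (intro tendsto_sum tendsto_mult lim tendsto_const) auto
    then have "\<forall>\<^sub>F t in at_top. (\<Sum>j\<le>n. c j t * exp (- (m * t)) * y ^ j) \<noteq> 0"
      using \<open>y \<notin> Z\<close> by (intro tendsto_imp_eventually_ne) (auto simp: Z_def)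
    moreover have "(\<Sum>j\<le>n. c j t * exp (- (m * t)) * y ^ j) = 0" if "p t = y" for t
    proof -
      have "(\<Sum>j\<le>n. c j t * exp (- (m * t)) * y ^ j) = exp (- (m * t)) * (\<Sum>j\<le>n. c j t * p t ^ j)"
        unfolding that sum_distrib_left by (intro sum.cong) auto
      then show ?thesis
        using rel by simp
    qed
    ultimately have "\<forall>\<^sub>F t in at_top. p t \<noteq> y"
      by (auto elim!: eventually_mono)
    then show False
      using fr by (simp add: frequently_def)
  qed
  \<comment> \<open>A level outside \<open>Z\<close> is avoided from some time on, so connectedness
    of the half-line keeps \<open>p\<close> on one side of it.\<close>
  have dich: "(\<forall>\<^sub>F t in at_top. p t < y) \<or> (\<forall>\<^sub>F t in at_top. p t > y)" if y: "y \<notin> Z" for y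
  proof -
    obtain T where T: "\<And>t. t \<ge> T \<Longrightarrow> p t \<noteq> y"
      using root[of y] y unfolding frequently_def eventually_at_top_linorder by metis
    have conn: "connected (p ` {T..})"
      using cont by (intro connected_continuous_image) (auto intro: continuous_on_subset)
    have "(\<forall>t\<ge>T. p t < y) \<or> (\<forall>t\<ge>T. p t > y)"
    proof (rule ccontr)
      assume "\<not> ?thesis"
      then obtain t1 t2 where "t1 \<ge> T" "t2 \<ge> T" "p t1 \<ge> y" "p t2 \<le> y"
        by (auto simp: not_less)
      then have "y \<in> p ` {T..}"
        using connectedD_interval[OF conn, of "p t2" "p t1" y] by auto
      then show False
        using T by auto
    qed
    then show ?thesis
      unfolding eventually_at_top_linorder by blast
  qed
  \<comment> \<open>The lower limit of \<open>p\<close>, written as the supremum of its eventual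
    strict lower bounds.\<close>
  define L where "L = Sup {y. \<forall>\<^sub>F t in at_top. p t > y}"
  have mem: "-1 \<in> {y. \<forall>\<^sub>F t in at_top. p t > y}"
  proof -
    have "p t > -1" for t
      using bnd(1)[of t] by linarith
    then show ?thesis
      by simp
  qed
  have ub: "y \<le> 1" if y: "\<forall>\<^sub>F t in at_top. p t > y" for y
  proof -
    obtain t where "y < p t"
      using eventually_happens'[OF trivial_limit_at_top_linorder y] by blast
    then show ?thesis
      using bnd(2)[of t] by linarith
  qed
  have "(p \<longlongrightarrow> L) at_top"
  proof (rule order_tendstoI)
    fix y assume "y < L"
    then obtain y' where "y < y'" "\<forall>\<^sub>F t in at_top. p t > y'"
      unfolding L_def using less_cSupD[of "{y. \<forall>\<^sub>F t in at_top. p t > y}" y] mem by blast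
    then show "\<forall>\<^sub>F t in at_top. y < p t"
      by (auto elim!: eventually_mono)
  next
    fix y assume "L < y"
    then have "infinite ({L<..<y} - Z)"
      using \<open>finite Z\<close> infinite_Ioo[of L y] by (simp add: Diff_infinite_finite)
    then obtain y' where y': "L < y'" "y' < y" "y' \<notin> Z"
      by (metis DiffE ex_in_conv finite.emptyI greaterThanLessThan_iff)
    have "\<not> (\<forall>\<^sub>F t in at_top. p t > y')"
    proof
      assume "\<forall>\<^sub>F t in at_top. p t > y'"
      then have "y' \<le> L"
        unfolding L_def using ub by (intro cSup_upper) (auto simp: bdd_above_def)
      then show False
        using y' by simp
    qed
    then have "\<forall>\<^sub>F t in at_top. p t < y'"
      using dich[OF y'(3)] by blast
    then show "\<forall>\<^sub>F t in at_top. p t < y"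
      using y'(2) by (auto elim!: eventually_mono)
  qed
  then show ?thesis ..
qed

section \<open>Modules over the exponential sums and their multipliers\<close>

definition exp_span :: "'v set \<Rightarrow> ('v \<Rightarrow> real \<Rightarrow> real) \<Rightarrow> (real \<Rightarrow> real) set" where
  "exp_span V r = {f. \<exists>c. (\<forall>v\<in>V. exp_sum (c v)) \<and> (\<forall>t. f t = (\<Sum>v\<in>V. c v t * r v t))}"

text \<open>Functions that act on a finitely generated module form a ring, which replaces the
  closure properties of algebraic functions. Continuity is part of the notion because the
  convergence criterion relies on intermediate values.\<close>

definition span_multiplier :: "'v set \<Rightarrow> ('v \<Rightarrow> real \<Rightarrow> real) \<Rightarrow> (real \<Rightarrow> real) \<Rightarrow> bool" where
  "span_multiplier V r g \<longleftrightarrow>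
     continuous_on UNIV g \<and> (\<forall>f\<in>exp_span V r. (\<lambda>t. g t * f t) \<in> exp_span V r)"

lemma exp_span_mult:
  assumes "exp_sum g" "f \<in> exp_span V r"
  shows "(\<lambda>t. g t * f t) \<in> exp_span V r"
proof -
  obtain c where c: "\<forall>v\<in>V. exp_sum (c v)" "\<And>t. f t = (\<Sum>v\<in>V. c v t * r v t)"
    using assms by (auto simp: exp_span_def)
  then show ?thesis
    unfolding exp_span_def using assms(1)
    by (intro CollectI exI[of _ "\<lambda>v t. g t * c v t"])
       (auto simp: sum_distrib_left mult.assoc intro: exp_sum_mult)
qed

lemma exp_span_add:
  assumes "f \<in> exp_span V r" "g \<in> exp_span V r"
  shows "(\<lambda>t. f t + g t) \<in> exp_span V r"
proof -
  obtain c d where "\<forall>v\<in>V. exp_sum (c v)" "\<And>t. f t = (\<Sum>v\<in>V. c v t * r v t)"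
      "\<forall>v\<in>V. exp_sum (d v)" "\<And>t. g t = (\<Sum>v\<in>V. d v t * r v t)"
    using assms by (auto simp: exp_span_def)
  then show ?thesis
    unfolding exp_span_def
    by (intro CollectI exI[of _ "\<lambda>v t. c v t + d v t"])
       (auto simp: distrib_right sum.distrib intro: exp_sum_add)
qed

lemma exp_span_generator:
  assumes "finite V" "v \<in> V"
  shows "r v \<in> exp_span V r"
  unfolding exp_span_def using assms
  by (intro CollectI exI[of _ "\<lambda>w _. if w = v then 1 else 0"]) (auto simp: exp_sum_const if_distrib[of "\<lambda>x. x * _"] cong: if_cong)

lemma span_multiplier_exp_sum: "exp_sum g \<Longrightarrow> span_multiplier V r g"
  by (simp add: span_multiplier_def exp_span_mult continuous_on_exp_sum)

lemma span_multiplier_add: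
  "span_multiplier V r f \<Longrightarrow> span_multiplier V r g \<Longrightarrow> span_multiplier V r (\<lambda>t. f t + g t)"
  by (auto simp: span_multiplier_def distrib_right intro: exp_span_add continuous_intros)

lemma span_multiplier_mult:
  "span_multiplier V r f \<Longrightarrow> span_multiplier V r g \<Longrightarrow> span_multiplier V r (\<lambda>t. f t * g t)"
  by (auto simp: span_multiplier_def mult.assoc intro: continuous_intros)

lemma span_multiplier_const: "span_multiplier V r (\<lambda>_. c)"
  by (intro span_multiplier_exp_sum exp_sum_const)

lemma span_multiplier_power:
  "span_multiplier V r f \<Longrightarrow> span_multiplier V r (\<lambda>t. f t ^ n)"
  by (induction n) (auto intro: span_multiplier_mult span_multiplier_const)

text \<open>The \<open>n + 1\<close> functions \<open>N ^ j * D ^ (n - j) * r v0\<close> lie in a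
  module with \<open>n\<close> generators, so they are dependent over the exponential sums; division
  by \<open>D ^ n * r v0\<close> turns the dependence into a polynomial relation for
  \<open>N / D\<close>.\<close>

lemma tendsto_quotient_of_multipliers:
  assumes fin: "finite V" and v0: "v0 \<in> V" "\<And>t. r v0 t \<noteq> 0"
    and N: "span_multiplier V r N" and D: "span_multiplier V r D" "\<And>t. D t \<noteq> 0"
    and bnd: "\<And>t. 0 \<le> N t / D t" "\<And>t. N t / D t \<le> 1"
  shows "\<exists>L. ((\<lambda>t. N t / D t) \<longlongrightarrow> L) at_top"
proof -
  define n where "n = card V"
  have "(\<lambda>t. N t ^ j * D t ^ (n - j) * r v0 t) \<in> exp_span V r" for j
    using span_multiplier_mult[OF span_multiplier_power[OF N, of j] span_multiplier_power[OF D(1), of "n - j"]]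
      exp_span_generator[OF fin v0(1), of r]
    by (auto simp: span_multiplier_def)
  then have "\<forall>j. \<exists>c. (\<forall>v\<in>V. exp_sum (c v)) \<and>
      (\<forall>t. N t ^ j * D t ^ (n - j) * r v0 t = (\<Sum>v\<in>V. c v t * r v t))"
    by (simp add: exp_span_def)
  then obtain c where c: "\<And>j v. v \<in> V \<Longrightarrow> exp_sum (c j v)"
      "\<And>j t. N t ^ j * D t ^ (n - j) * r v0 t = (\<Sum>v\<in>V. c j v t * r v t)"
    by metis
  obtain e where e: "\<forall>j\<in>{..n}. exp_sum (e j)" "\<exists>j\<in>{..n}. \<exists>t. e j t \<noteq> 0"
      "\<forall>v\<in>V. \<forall>t. (\<Sum>j\<le>n. e j t * c j v t) = 0"
    using exp_sum_dependent[OF fin, of "{..n}" c] c(1) by (auto simp: n_def)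
  have "(\<Sum>j\<le>n. e j t * (N t / D t) ^ j) = 0" for t
  proof -
    have "(\<Sum>j\<le>n. e j t * (N t / D t) ^ j) * (D t ^ n * r v0 t) = (\<Sum>j\<le>n. e j t * (N t ^ j * D t ^ (n - j) * r v0 t))"
      unfolding sum_distrib_right
    proof (intro sum.cong refl)
      fix j assume "j \<in> {..n}"
      then have "D t ^ n = D t ^ j * D t ^ (n - j)"
        by (simp flip: power_add)
      then show "e j t * (N t / D t) ^ j * (D t ^ n * r v0 t) = e j t * (N t ^ j * D t ^ (n - j) * r v0 t)"
        using D(2)[of t] by (simp add: power_divide)
    qed
    also have "\<dots> = (\<Sum>j\<le>n. \<Sum>v\<in>V. e j t * c j v t * r v t)"
      unfolding c(2) by (simp add: sum_distrib_left mult.assoc)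
    also have "\<dots> = (\<Sum>v\<in>V. (\<Sum>j\<le>n. e j t * c j v t) * r v t)"
      by (subst sum.swap) (simp add: sum_distrib_right)
    also have "\<dots> = 0"
      using e(3) by simp
    finally show ?thesis
      using D(2)[of t] v0(2)[of t] by simp
  qed
  moreover have "continuous_on UNIV (\<lambda>t. N t / D t)"
    using N D by (auto simp: span_multiplier_def intro!: continuous_intros)
  ultimately show ?thesis
    using tendsto_of_exp_sum_relation[of "\<lambda>t. N t / D t" n e] bnd e(1,2) by auto
qed

section \<open>Convergence of normalised Perron data\<close>

hide_const (open) Determinants.det Finite_Cartesian_Product.vec

text \<open>Ring operations are all that determinants and cofactors need. The instance in use is the
  ring of multipliers of the span of the right Perron vector.\<close>

locale function_ring =
  fixes Q :: "('t \<Rightarrow> real) \<Rightarrow> bool"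
  assumes const: "Q (\<lambda>_. c)"
    and add: "Q f \<Longrightarrow> Q g \<Longrightarrow> Q (\<lambda>t. f t + g t)"
    and mult: "Q f \<Longrightarrow> Q g \<Longrightarrow> Q (\<lambda>t. f t * g t)"
begin

lemma sum: "(\<And>i. i \<in> I \<Longrightarrow> Q (f i)) \<Longrightarrow> Q (\<lambda>t. \<Sum>i\<in>I. f i t)"
  by (induction I rule: infinite_finite_induct) (auto intro: add const)

lemma prod: "(\<And>i. i \<in> I \<Longrightarrow> Q (f i)) \<Longrightarrow> Q (\<lambda>t. \<Prod>i\<in>I. f i t)"
  by (induction I rule: infinite_finite_induct) (auto intro: mult const)

lemma diff: "Q f \<Longrightarrow> Q g \<Longrightarrow> Q (\<lambda>t. f t - g t)"
  using add[OF _ mult[OF const[of "-1"]], of f g] by simp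

lemma det:
  assumes A: "\<And>t. A t \<in> carrier_mat n n"
    and Q: "\<And>i j. i < n \<Longrightarrow> j < n \<Longrightarrow> Q (\<lambda>t. A t $$ (i, j))"
  shows "Q (\<lambda>t. Determinant.det (A t))"
proof -
  have "Q (\<lambda>t. \<Sum>p | p permutes {0..<n}. signof p * (\<Prod>i = 0..<n. A t $$ (i, p i)))"
    by (intro sum mult const prod Q) (auto simp: permutes_in_image[of _ "{0..<n}", simplified])
  then show ?thesis
    by (simp add: det_def'[OF A])
qed

lemma cofactor:
  assumes A: "\<And>t. A t \<in> carrier_mat n n"
    and Q: "\<And>i j. i < n \<Longrightarrow> j < n \<Longrightarrow> Q (\<lambda>t. A t $$ (i, j))"
    and ij: "i < n" "j < n"
  shows "Q (\<lambda>t. cofactor (A t) i j)"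
proof -
  have "Q (\<lambda>t. Determinant.det (mat_delete (A t) i j))"
  proof (rule det)
    show "mat_delete (A t) i j \<in> carrier_mat (n - 1) (n - 1)" for t
      using A[of t] by (rule mat_delete_carrier)
    show "Q (\<lambda>t. mat_delete (A t) i j $$ (i', j'))" if "i' < n - 1" "j' < n - 1" for i' j'
    proof -
      have "mat_delete (A t) i j $$ (i', j') =
          A t $$ (if i' < i then i' else Suc i', if j' < j then j' else Suc j')" for t
        using A[of t] that by (simp add: mat_delete_def)
      then show ?thesis
        using that by (auto intro!: Q)
    qed
  qed
  then show ?thesis
    unfolding cofactor_def by (intro mult const)
qed

text \<open>
  Replacing the row of \<open>v0\<close> in \<open>c I - M\<close> by a unit vector gives a matrix that is invertible for every
  parameter and maps the eigenvector to a multiple of this unit vector, so that Cramer's rule applies.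
\<close>

lemma eigenvector_ratio:
  fixes M :: "'t \<Rightarrow> 'v \<Rightarrow> 'v \<Rightarrow> real" and u :: "'t \<Rightarrow> 'v \<Rightarrow> real"
  assumes fin: "finite V" and v0: "v0 \<in> V"
    and M: "\<And>t v w. v \<in> V \<Longrightarrow> w \<in> V \<Longrightarrow> M t v w \<ge> 0" and irr: "\<And>t. irreducible_on V (M t)"
    and u: "\<And>t v. v \<in> V \<Longrightarrow> u t v > 0"
    and eig: "\<And>t v. v \<in> V \<Longrightarrow> (\<Sum>w\<in>V. M t v w * u t w) = c t * u t v"
    and QM: "\<And>v w. v \<in> V \<Longrightarrow> w \<in> V \<Longrightarrow> Q (\<lambda>t. M t v w)" and Qc: "Q c"
  shows "\<exists>D N. Q D \<and> (\<forall>v\<in>V. Q (N v)) \<and> (\<forall>t. D t \<noteq> 0 \<and> (\<forall>v\<in>V. D t * u t v = N v t * u t v0))"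
proof -
  define n where "n = card V"
  obtain h where h: "bij_betw h {0..<n} V"
    unfolding n_def using fin ex_bij_betw_nat_finite by blast
  have hV: "h i \<in> V" if "i < n" for i
    using h that by (auto simp: bij_betw_def)
  have hinj: "h i = h j \<longleftrightarrow> i = j" if "i < n" "j < n" for i j
    using h that by (auto simp: bij_betw_def inj_on_def)
  have sumV: "(\<Sum>w\<in>V. f w) = (\<Sum>j = 0..<n. f (h j))" for f :: "'v \<Rightarrow> real"
    using sum.reindex_bij_betw[OF h] by metis
  obtain i0 where i0: "i0 < n" "h i0 = v0"
    using h v0 by (auto simp: bij_betw_def)
  define B where "B t = mat n n (\<lambda>(i, j). if i = i0 then if j = i0 then 1 else 0
      else (if i = j then c t else 0) - M t (h i) (h j))" for t
  have B: "B t \<in> carrier_mat n n" for t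
    by (simp add: B_def)
  have B_mult: "(B t *\<^sub>v vec n (\<lambda>j. y (h j))) $ i =
      (if i = i0 then y v0 else c t * y (h i) - (\<Sum>w\<in>V. M t (h i) w * y w))" if "i < n" for t y i
  proof (cases "i = i0")
    case True
    have "(B t *\<^sub>v vec n (\<lambda>j. y (h j))) $ i = (\<Sum>j = 0..<n. (if j = i0 then 1 else 0) * y (h j))"
      using that True by (simp add: B_def scalar_prod_def)
    also have "\<dots> = y (h i0)"
      using i0 by (simp add: if_distrib[of "\<lambda>x. x * _"] cong: if_cong)
    finally show ?thesis
      using True i0 by simp
  next
    case False
    have "(B t *\<^sub>v vec n (\<lambda>j. y (h j))) $ i = (\<Sum>j = 0..<n. ((if i = j then c t else 0) - M t (h i) (h j)) * y (h j))"
      using that False by (simp add: B_def scalar_prod_def)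
    also have "\<dots> = (\<Sum>j = 0..<n. (if i = j then c t else 0) * y (h j)) - (\<Sum>j = 0..<n. M t (h i) (h j) * y (h j))"
      by (simp add: left_diff_distrib sum_subtractf)
    also have "(\<Sum>j = 0..<n. (if i = j then c t else 0) * y (h j)) = c t * y (h i)"
      using that by (simp add: if_distrib[of "\<lambda>x. x * _"] cong: if_cong)
    finally show ?thesis
      using False by (simp add: sumV)
  qed
  have det: "Determinant.det (B t) \<noteq> 0" for t
  proof
    assume "Determinant.det (B t) = 0"
    then obtain x where x: "x \<in> carrier_vec n" "x \<noteq> 0\<^sub>v n" "B t *\<^sub>v x = 0\<^sub>v n"
      using det_0_iff_vec_prod_zero[OF B[of t]] by blast
    define y where "y v = x $ the_inv_into {0..<n} h v" for v
    have yh: "y (h j) = x $ j" if "j < n" for j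
      using h that by (simp add: y_def bij_betw_def the_inv_into_f_f)
    have xy: "x = vec n (\<lambda>j. y (h j))"
      using x(1) yh by (intro eq_vecI) auto
    have y0: "y v0 = 0"
      using B_mult[OF i0(1), of t y] x(3) i0 xy by simp
    have yeig: "(\<Sum>w\<in>V. M t v w * y w) = c t * y v" if v: "v \<in> V" "v \<noteq> v0" for v
    proof -
      obtain i where i: "i < n" "h i = v"
        using h v(1) by (auto simp: bij_betw_def)
      then show ?thesis
        using B_mult[OF i(1), of t y] x(3) xy i0 v by (auto split: if_splits)
    qed
    \<comment> \<open>To be applied to \<open>y\<close> and \<open>- y\<close>. The multiple
      \<open>b\<close> of \<open>u\<close> touching \<open>y\<close> from above obeys the minimum
      principle away from \<open>v0\<close>, so the difference vanishes at \<open>v0\<close>; there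
      \<open>y\<close> is 0 and \<open>u\<close> is positive, whence \<open>b = 0\<close>.\<close>
    have le: "y v \<le> 0" if y0: "y v0 = 0" and v: "v \<in> V"
      and yeig: "\<And>v. v \<in> V \<Longrightarrow> v \<noteq> v0 \<Longrightarrow> (\<Sum>w\<in>V. M t v w * y w) = c t * y v" for y v
    proof -
      obtain b w1 where b: "w1 \<in> V" "y w1 = b * u t w1" "\<And>w. w \<in> V \<Longrightarrow> y w \<le> b * u t w"
        using max_ratio[of V "u t" y] fin v0 u by (metis empty_iff)
      have "b * u t v0 - y v0 = 0"
      proof (rule superharmonic_zero_propagates[of V "M t" "\<lambda>w. b * u t w - y w" v0 "c t" w1])
        fix x assume x: "x \<in> V" "x \<noteq> v0"
        have "(\<Sum>w\<in>V. M t x w * (b * u t w - y w)) = b * (\<Sum>w\<in>V. M t x w * u t w) - (\<Sum>w\<in>V. M t x w * y w)"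
          by (simp add: sum_distrib_left algebra_simps flip: sum_subtractf)
        then show "(\<Sum>w\<in>V. M t x w * (b * u t w - y w)) \<le> c t * (b * u t x - y x)"
          using eig[OF x(1)] yeig[OF x] by (simp add: algebra_simps)
      qed (use fin M b irr v0 in \<open>auto simp: irreducible_on_def\<close>)
      then have "b = 0"
        using y0 u[OF v0, of t] by simp
      then show ?thesis
        using b(3)[OF v] by simp
    qed
    have "y v = 0" if "v \<in> V" for v
      using le[of y v] le[of "\<lambda>v. - y v" v] y0 yeig that by (auto simp: sum_negf)
    then have "x = 0\<^sub>v n"
      using xy hV by (auto intro!: eq_vecI)
    then show False
      using x(2) by simp
  qed
  \<comment> \<open>Cramer's rule: the adjugate applied to a multiple of the unit vector
    \<open>i0\<close> picks its column \<open>i0\<close>, which consists of the cofactors of row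
    \<open>i0\<close>.\<close>
  have main: "Determinant.det (B t) * u t (h j) = cofactor (B t) i0 j * u t v0" if "j < n" for t j
  proof -
    define x where "x = vec n (\<lambda>j. u t (h j))"
    have Bx: "B t *\<^sub>v x = u t v0 \<cdot>\<^sub>v unit_vec n i0"
      using i0 hV eig carrier_matD[OF B[of t]] B_mult[of _ t "u t"] by (intro eq_vecI) (auto simp: x_def)
    have "adj_mat (B t) *\<^sub>v (B t *\<^sub>v x) = (adj_mat (B t) * B t) *\<^sub>v x"
      by (rule assoc_mult_mat_vec[OF adj_mat(1)[OF B] B, symmetric]) (simp add: x_def)
    also have "\<dots> = Determinant.det (B t) \<cdot>\<^sub>v x"
      unfolding adj_mat(3)[OF B] x_def
      by (rule eq_vecI) (auto simp: scalar_prod_def if_distrib[of "\<lambda>z. z * _"] if_distrib[of "\<lambda>z. _ * z"] cong: if_cong)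
    finally have "(adj_mat (B t) *\<^sub>v (u t v0 \<cdot>\<^sub>v unit_vec n i0)) $ j = Determinant.det (B t) * u t (h j)"
      using that unfolding Bx by (simp add: x_def)
    moreover have "(adj_mat (B t) *\<^sub>v (u t v0 \<cdot>\<^sub>v unit_vec n i0)) $ j = u t v0 * cofactor (B t) i0 j"
    proof -
      have "(adj_mat (B t) *\<^sub>v (u t v0 \<cdot>\<^sub>v unit_vec n i0)) $ j
          = (\<Sum>i = 0..<n. adj_mat (B t) $$ (j, i) * (u t v0 * (if i = i0 then 1 else 0)))"
        using that adj_mat(1)[OF B[of t]] i0 by (auto simp: scalar_prod_def unit_vec_def intro!: sum.cong)
      also have "\<dots> = adj_mat (B t) $$ (j, i0) * u t v0"
        using i0 by (simp add: if_distrib[of "\<lambda>x. _ * x"] cong: if_cong)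
      finally show ?thesis
        using that i0 B[of t] by (simp add: adj_mat_def)
    qed
    ultimately show ?thesis
      by (simp add: mult.commute)
  qed
  have QB: "Q (\<lambda>t. B t $$ (i, j))" if "i < n" "j < n" for i j
  proof -
    have "Q (\<lambda>t. (if i = j then c t else 0) - M t (h i) (h j))"
      by (intro diff QM hV that) (cases "i = j"; simp add: Qc const)
    then show ?thesis
      using that by (cases "i = i0") (auto simp: B_def intro: const)
  qed
  define N where "N v t = cofactor (B t) i0 (the_inv_into {0..<n} h v)" for v t
  have "Q (N v)" if "v \<in> V" for v
  proof -
    have "the_inv_into {0..<n} h v < n"
      using bij_betwE[OF bij_betw_the_inv_into[OF h]] that by auto
    then show ?thesis
      unfolding N_def using cofactor[OF B QB i0(1)] by simp
  qed
  moreover have "Determinant.det (B t) * u t v = N v t * u t v0" if "v \<in> V" for v t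
  proof -
    have "the_inv_into {0..<n} h v < n" "h (the_inv_into {0..<n} h v) = v"
      using bij_betwE[OF bij_betw_the_inv_into[OF h]] f_the_inv_into_f_bij_betw[OF h] that by auto
    then show ?thesis
      using main by (metis N_def)
  qed
  ultimately show ?thesis
    using det function_ring.det[OF function_ring_axioms B QB]
    by (intro exI[of _ "\<lambda>t. Determinant.det (B t)"] exI[of _ N]) auto
qed

end

text \<open>\<open>M_lip\<close> is the multiplicative form of Lipschitz continuity enjoyed by
  entries \<open>exp (t * g)\<close>. It passes unchanged to the Perron eigenvalue and so yields
  continuity of the latter.\<close>

locale perron_family =
  fixes V :: "'v set" and M :: "real \<Rightarrow> 'v \<Rightarrow> 'v \<Rightarrow> real" and K :: real
  assumes fin: "finite V" and ne: "V \<noteq> {}"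
    and M_nonneg: "v \<in> V \<Longrightarrow> w \<in> V \<Longrightarrow> M t v w \<ge> 0"
    and irr: "irreducible_on V (M t)"
    and row: "v \<in> V \<Longrightarrow> \<exists>w\<in>V. M t v w > 0"
    and M_exp_sum: "v \<in> V \<Longrightarrow> w \<in> V \<Longrightarrow> exp_sum (\<lambda>t. M t v w)"
    and M_lip: "v \<in> V \<Longrightarrow> w \<in> V \<Longrightarrow> M s v w \<le> exp (K * \<bar>s - t\<bar>) * M t v w"
begin

definition perron_data :: "(real \<Rightarrow> real) \<Rightarrow> (real \<Rightarrow> 'v \<Rightarrow> real) \<Rightarrow> (real \<Rightarrow> 'v \<Rightarrow> real) \<Rightarrow> bool" where
  "perron_data c l r \<longleftrightarrow> (\<forall>t. c t > 0 \<and> (\<forall>v\<in>V. l t v > 0 \<and> r t v > 0 \<and>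
     (\<Sum>w\<in>V. M t v w * r t w) = c t * r t v \<and> (\<Sum>w\<in>V. l t w * M t w v) = c t * l t v) \<and>
     (\<Sum>v\<in>V. l t v * r t v) = 1)"

text \<open>Left and right eigenvectors come from two applications of the Perron theorem; pairing
  them through the matrix shows that their eigenvalues agree. A positive entry in a row makes the
  eigenvalue positive.\<close>

lemma perron_data_exists: "\<exists>c l r. perron_data c l r"
proof -
  define P where "P t c l r \<longleftrightarrow> c > 0 \<and> (\<forall>v\<in>V. l v > 0 \<and> r v > 0 \<and>
     (\<Sum>w\<in>V. M t v w * r w) = c * r v \<and> (\<Sum>w\<in>V. l w * M t w v) = c * l v) \<and>
     (\<Sum>v\<in>V. l v * r v) = 1" for t c l r
  have "\<exists>c l r. P t c l r" for t
  proof -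
    obtain c r where r: "\<And>v. v \<in> V \<Longrightarrow> r v > 0" "\<And>v. v \<in> V \<Longrightarrow> (\<Sum>w\<in>V. M t v w * r w) = c * r v"
      using perron_eigenvector[OF fin ne M_nonneg irr, of t] by blast
    obtain c' l where l: "\<And>v. v \<in> V \<Longrightarrow> l v > 0" "\<And>v. v \<in> V \<Longrightarrow> (\<Sum>w\<in>V. M t w v * l w) = c' * l v"
      using perron_eigenvector[OF fin ne M_nonneg irreducible_on_transpose[OF irr], of t] by blast
    define s where "s = (\<Sum>v\<in>V. l v * r v)"
    have s: "s > 0"
      unfolding s_def using fin ne l r by (intro sum_pos) auto
    have "c * s = (\<Sum>v\<in>V. \<Sum>w\<in>V. l v * (M t v w * r w))"
      by (simp add: s_def sum_distrib_left r(2) mult.left_commute flip: sum_distrib_left)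
    also have "\<dots> = (\<Sum>w\<in>V. (\<Sum>v\<in>V. M t v w * l v) * r w)"
      by (subst sum.swap) (simp add: sum_distrib_right sum_distrib_left mult_ac)
    also have "\<dots> = c' * s"
      by (simp add: s_def l(2) sum_distrib_left mult.assoc)
    finally have "c' = c"
      using s by simp
    obtain v where v: "v \<in> V"
      using ne by blast
    obtain w where w: "w \<in> V" "M t v w > 0"
      using row[OF v] by blast
    have nonneg: "0 \<le> M t v w * r w" if "w \<in> V" for w
      using M_nonneg[OF v that] r(1)[OF that] by simp
    have "0 < (\<Sum>w\<in>V. M t v w * r w)"
      using v w fin nonneg r(1) by (intro sum_pos2[of _ w]) auto
    then have "c > 0"
      using zero_less_mult_pos2[of c "r v"] r(2)[OF v] r(1)[OF v] by simp
    have "(\<Sum>v\<in>V. l v / s * r v) = s / s"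
      by (subst (2) s_def) (simp add: sum_divide_distrib)
    then have "(\<Sum>v\<in>V. l v / s * r v) = 1"
      using s by simp
    moreover have "(\<Sum>w\<in>V. l w / s * M t w v) = c * (l v / s)" if "v \<in> V" for v
    proof -
      have "(\<Sum>w\<in>V. l w / s * M t w v) = (\<Sum>w\<in>V. M t w v * l w) / s"
        by (simp add: sum_divide_distrib mult.commute)
      then show ?thesis
        using l(2)[OF that] \<open>c' = c\<close> by simp
    qed
    ultimately show ?thesis
      unfolding P_def using \<open>c > 0\<close> l(1) r s
      by (intro exI[of _ c] exI[of _ "\<lambda>v. l v / s"] exI[of _ r]) auto
  qed
  then obtain c l r where "\<And>t. P t (c t) (l t) (r t)"
    by metis
  then have "perron_data c l r"
    by (simp add: perron_data_def P_def)
  then show ?thesis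
    by blast
qed

context
  fixes c l r
  assumes data: "perron_data c l r"
begin

lemma c_pos: "c t > 0"
  and l_pos: "v \<in> V \<Longrightarrow> l t v > 0"
  and r_pos: "v \<in> V \<Longrightarrow> r t v > 0"
  and r_eig: "v \<in> V \<Longrightarrow> (\<Sum>w\<in>V. M t v w * r t w) = c t * r t v"
  and l_eig: "v \<in> V \<Longrightarrow> (\<Sum>w\<in>V. l t w * M t w v) = c t * l t v"
  and lr_sum: "(\<Sum>v\<in>V. l t v * r t v) = 1"
  using data by (auto simp: perron_data_def)

text \<open>The left vector at \<open>t\<close> is paired with the right vector at \<open>s\<close>:
  through \<open>M s\<close> this gives \<open>c s\<close>, and replacing \<open>M s\<close> by
  \<open>M t\<close>, which gives \<open>c t\<close>, costs the Lipschitz factor.\<close>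

lemma c_lip: "c s \<le> exp (K * \<bar>s - t\<bar>) * c t"
proof -
  define q where "q = (\<Sum>v\<in>V. l t v * r s v)"
  have q: "q > 0"
    unfolding q_def using fin ne l_pos r_pos by (intro sum_pos) auto
  have "c s * q = (\<Sum>v\<in>V. l t v * (\<Sum>w\<in>V. M s v w * r s w))"
    by (simp add: q_def sum_distrib_left r_eig mult.left_commute)
  also have "\<dots> \<le> (\<Sum>v\<in>V. l t v * (\<Sum>w\<in>V. exp (K * \<bar>s - t\<bar>) * M t v w * r s w))"
    using l_pos r_pos M_lip by (intro sum_mono mult_left_mono mult_right_mono) (auto intro: less_imp_le)
  also have "\<dots> = exp (K * \<bar>s - t\<bar>) * (\<Sum>v\<in>V. \<Sum>w\<in>V. l t v * M t v w * r s w)"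
    by (simp add: sum_distrib_left mult_ac)
  also have "(\<Sum>v\<in>V. \<Sum>w\<in>V. l t v * M t v w * r s w) = (\<Sum>w\<in>V. (\<Sum>v\<in>V. l t v * M t v w) * r s w)"
    by (subst sum.swap) (simp add: sum_distrib_right)
  also have "\<dots> = c t * q"
    by (simp add: l_eig q_def sum_distrib_left mult.assoc)
  finally show ?thesis
    using q by (simp flip: mult.assoc)
qed

lemma c_continuous: "continuous_on UNIV c"
proof (rule continuous_at_imp_continuous_on, rule ballI)
  fix t :: real
  have "(c \<longlongrightarrow> c t) (at t)"
  proof (rule tendsto_sandwich)
    show "\<forall>\<^sub>F s in at t. exp (- (K * \<bar>s - t\<bar>)) * c t \<le> c s"
    proof (intro always_eventually allI)
      fix s
      have "exp (- (K * \<bar>s - t\<bar>)) * c t \<le> exp (- (K * \<bar>s - t\<bar>)) * (exp (K * \<bar>s - t\<bar>) * c s)"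
        using c_lip[of t s] by (intro mult_left_mono) (auto simp: abs_minus_commute)
      also have "\<dots> = c s"
        by (simp flip: mult.assoc exp_add)
      finally show "exp (- (K * \<bar>s - t\<bar>)) * c t \<le> c s" .
    qed
    show "\<forall>\<^sub>F s in at t. c s \<le> exp (K * \<bar>s - t\<bar>) * c t"
      using c_lip by simp
    have "((\<lambda>s. exp (- (K * \<bar>s - t\<bar>)) * c t) \<longlongrightarrow> exp (- (K * \<bar>t - t\<bar>)) * c t) (at t)"
      by (intro tendsto_intros)
    then show "((\<lambda>s. exp (- (K * \<bar>s - t\<bar>)) * c t) \<longlongrightarrow> c t) (at t)"
      by simp
    have "((\<lambda>s. exp (K * \<bar>s - t\<bar>) * c t) \<longlongrightarrow> exp (K * \<bar>t - t\<bar>) * c t) (at t)"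
      by (intro tendsto_intros)
    then show "((\<lambda>s. exp (K * \<bar>s - t\<bar>) * c t) \<longlongrightarrow> c t) (at t)"
      by simp
  qed
  then show "isCont c t"
    by (simp add: isCont_def)
qed

text \<open>The eigenvalue equation says that multiplication by \<open>c\<close> replaces each
  generator by the combination in its row of \<open>M\<close>.\<close>

lemma c_multiplier: "span_multiplier V (\<lambda>v t. r t v) c"
  unfolding span_multiplier_def
proof (intro conjI ballI c_continuous)
  fix f assume "f \<in> exp_span V (\<lambda>v t. r t v)"
  then obtain d where d: "\<And>v. v \<in> V \<Longrightarrow> exp_sum (d v)" "\<And>t. f t = (\<Sum>v\<in>V. d v t * r t v)"
    by (auto simp: exp_span_def)
  have "c t * f t = (\<Sum>w\<in>V. (\<Sum>v\<in>V. d v t * M t v w) * r t w)" for t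
  proof -
    have "c t * f t = (\<Sum>v\<in>V. d v t * (\<Sum>w\<in>V. M t v w * r t w))"
      by (simp add: d(2) sum_distrib_left r_eig mult.left_commute)
    also have "\<dots> = (\<Sum>v\<in>V. \<Sum>w\<in>V. d v t * M t v w * r t w)"
      by (simp add: sum_distrib_left mult.assoc)
    also have "\<dots> = (\<Sum>w\<in>V. (\<Sum>v\<in>V. d v t * M t v w) * r t w)"
      by (subst sum.swap) (simp add: sum_distrib_right)
    finally show ?thesis .
  qed
  then show "(\<lambda>t. c t * f t) \<in> exp_span V (\<lambda>v t. r t v)"
    unfolding exp_span_def using d(1) M_exp_sum
    by (intro CollectI exI[of _ "\<lambda>w t. \<Sum>v\<in>V. d v t * M t v w"]) (auto intro!: exp_sum_sum exp_sum_mult)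
qed

text \<open>Relative to their entries at \<open>v0\<close> both eigenvectors are quotients of
  multipliers of the same module. This includes the left one, although the module is built from the
  right one, because only \<open>c\<close> and the entries of \<open>M\<close> enter Cramer's
  rule.\<close>

theorem edge_weight_converges:
  assumes v: "v \<in> V" and w: "w \<in> V"
  shows "\<exists>L. ((\<lambda>t. l t v * M t v w * r t w / c t) \<longlongrightarrow> L) at_top"
proof -
  let ?Q = "span_multiplier V (\<lambda>v t. r t v)"
  interpret function_ring ?Q
    by unfold_locales (auto intro: span_multiplier_const span_multiplier_add span_multiplier_mult)
  have QM: "?Q (\<lambda>t. M t v w)" if "v \<in> V" "w \<in> V" for v w
    using that by (intro span_multiplier_exp_sum M_exp_sum)
  obtain v0 where v0: "v0 \<in> V"
    using ne by blast
  have "\<exists>D N. ?Q D \<and> (\<forall>v\<in>V. ?Q (N v)) \<and>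
      (\<forall>t. D t \<noteq> 0 \<and> (\<forall>v\<in>V. D t * r t v = N v t * r t v0))"
    by (rule eigenvector_ratio[OF fin v0, of M r c])
       (use M_nonneg irr r_pos r_eig QM c_multiplier in auto)
  then obtain D N where D: "?Q D" "\<And>v. v \<in> V \<Longrightarrow> ?Q (N v)" "\<And>t. D t \<noteq> 0"
      "\<And>v t. v \<in> V \<Longrightarrow> D t * r t v = N v t * r t v0"
    by metis
  have "\<exists>D N. ?Q D \<and> (\<forall>v\<in>V. ?Q (N v)) \<and>
      (\<forall>t. D t \<noteq> 0 \<and> (\<forall>v\<in>V. D t * l t v = N v t * l t v0))"
    by (rule eigenvector_ratio[OF fin v0, of "\<lambda>t v w. M t w v" l c])
       (use M_nonneg irreducible_on_transpose[OF irr] l_pos l_eig QM c_multiplier in \<open>auto simp: mult.commute\<close>)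
  then obtain D' N' where D': "?Q D'" "\<And>v. v \<in> V \<Longrightarrow> ?Q (N' v)" "\<And>t. D' t \<noteq> 0"
      "\<And>v t. v \<in> V \<Longrightarrow> D' t * l t v = N' v t * l t v0"
    by metis
  \<comment> \<open>The normalisation of \<open>l\<close> against \<open>r\<close> eliminates the
    unknown factor \<open>l t v0 * r t v0\<close>, leaving the quotient
    \<open>num / den\<close>.\<close>
  define den where "den t = c t * (\<Sum>x\<in>V. N' x t * N x t)" for t
  define num where "num t = N' v t * M t v w * N w t" for t
  have Nsum: "(\<Sum>x\<in>V. N' x t * N x t) * (l t v0 * r t v0) = D' t * D t" for t
  proof -
    have "(\<Sum>x\<in>V. N' x t * N x t) * (l t v0 * r t v0) = (\<Sum>x\<in>V. (N' x t * l t v0) * (N x t * r t v0))"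
      by (simp add: sum_distrib_left sum_distrib_right mult_ac)
    also have "\<dots> = (\<Sum>x\<in>V. (D' t * l t x) * (D t * r t x))"
      by (intro sum.cong refl) (simp only: D(4) D'(4))
    also have "\<dots> = D' t * D t * (\<Sum>x\<in>V. l t x * r t x)"
      by (simp add: sum_distrib_left mult_ac)
    finally show ?thesis
      by (simp add: lr_sum)
  qed
  have den: "den t \<noteq> 0" for t
    using Nsum[of t] D(3)[of t] D'(3)[of t] c_pos[of t] by (auto simp: den_def)
  have eq: "l t v * M t v w * r t w / c t = num t / den t" for t
  proof -
    let ?z = "l t v0 * r t v0"
    have z: "?z \<noteq> 0"
      using l_pos[OF v0, of t] r_pos[OF v0, of t] by simp
    have "num t * ?z = (N' v t * l t v0) * M t v w * (N w t * r t v0)"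
      by (simp add: num_def mult_ac)
    also have "\<dots> = D' t * D t * (l t v * M t v w * r t w)"
      by (simp add: D(4)[OF w, symmetric] D'(4)[OF v, symmetric] mult_ac)
    finally have "num t * ?z = D' t * D t * (l t v * M t v w * r t w)" .
    moreover have "den t * ?z = c t * (D' t * D t)"
      using Nsum[of t] by (simp add: den_def mult.assoc)
    moreover have "num t / den t = (num t * ?z) / (den t * ?z)"
      using z by simp
    ultimately show ?thesis
      using D(3)[of t] D'(3)[of t] by simp
  qed
  have bnd: "0 \<le> l t v * M t v w * r t w / c t" "l t v * M t v w * r t w / c t \<le> 1" for t
  proof -
    show "0 \<le> l t v * M t v w * r t w / c t"
      using l_pos[OF v, of t] r_pos[OF w, of t] c_pos[of t] M_nonneg[OF v w, of t] by simp
    have nonneg: "0 \<le> M t v x * r t x" "0 \<le> l t x * r t x" if "x \<in> V" for x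
      using M_nonneg[OF v that, of t] r_pos[OF that, of t] l_pos[OF that, of t] by simp_all
    have "M t v w * r t w \<le> (\<Sum>w\<in>V. M t v w * r t w)"
      using w fin nonneg by (intro member_le_sum) auto
    then have "l t v * (M t v w * r t w) \<le> l t v * (c t * r t v)"
      using r_eig[OF v, of t] l_pos[OF v, of t] by simp
    also have "\<dots> = c t * (l t v * r t v)"
      by simp
    also have "l t v * r t v \<le> (\<Sum>v\<in>V. l t v * r t v)"
      using v fin nonneg by (intro member_le_sum) auto
    finally show "l t v * M t v w * r t w / c t \<le> 1"
      using c_pos[of t] lr_sum[of t] by (simp add: mult.assoc)
  qed
  have "?Q num" "?Q den"
    unfolding num_def den_def using v w by (auto intro!: mult sum D(2) D'(2) QM c_multiplier)
  then show ?thesis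
    using tendsto_quotient_of_multipliers[of V v0 "\<lambda>v t. r t v" num den] fin v0 r_pos[OF v0] den bnd
    unfolding eq by (metis less_irrefl)
qed

end

end

section \<open>Words and cylinders\<close>

hide_const (open) Matrix.vec

section \<open>Prefixes and finite words\<close>

definition prefix :: "nat \<Rightarrow> seq \<Rightarrow> nat list" where
  "prefix n x = map x [0..<n]"

definition words :: "nat \<Rightarrow> nat \<Rightarrow> nat list set" where
  "words d n = {u. length u = n \<and> set u \<subseteq> {..<d}}"

lemma length_prefix [simp]: "length (prefix n x) = n"
  by (simp add: prefix_def)

lemma nth_prefix [simp]: "i < n \<Longrightarrow> prefix n x ! i = x i"
  by (simp add: prefix_def)

lemma prefix_eq_iff: "prefix n x = prefix n y \<longleftrightarrow> (\<forall>i<n. x i = y i)"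
  by (auto simp: prefix_def)

lemma prefix_eq_word_iff: "length u = n \<Longrightarrow> prefix n x = u \<longleftrightarrow> (\<forall>i<n. x i = u ! i)"
  by (auto simp: list_eq_iff_nth_eq)

lemma open_prefix: "open {x :: seq. prefix n x = u}"
proof (cases "length u = n")
  case True
  have "{x :: seq. prefix n x = u} = (\<Inter>i\<in>{..<n}. (\<lambda>x. x i) -` {u ! i})"
    using prefix_eq_word_iff[OF True] by auto
  moreover have "open ((\<lambda>x :: seq. x i) -` {u ! i})" for i
    by (intro open_vimage continuous_on_product_coordinates) (simp add: discrete_topology_class.open_discrete)
  ultimately show ?thesis
    by (auto intro!: open_INT)
next
  case False
  then have "{x :: seq. prefix n x = u} = {}"
    by auto
  then show ?thesis
    by simp
qed

lemma prefix_Suc: "prefix (Suc n) x = prefix n x @ [x n]"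
  by (simp add: prefix_def)

lemma prefix_shift: "prefix (Suc n) x = x 0 # prefix n (shift_map x)"
  by (rule nth_equalityI) (auto simp: prefix_def shift_map_def nth_Cons' simp del: upt_Suc)

lemma shift_pow: "(shift_map ^^ i) x n = x (i + n)"
  by (induction i arbitrary: n) (auto simp: shift_map_def)

lemma prefix_shift_pow: "i + m \<le> n \<Longrightarrow> take m (drop i (prefix n x)) = prefix m ((shift_map ^^ i) x)"
  by (rule nth_equalityI) (auto simp: shift_pow)

lemma take_prefix: "m \<le> n \<Longrightarrow> take m (prefix n x) = prefix m x"
  using prefix_shift_pow[of 0 m n x] by simp

lemma finite_words: "finite (words d n)"
  using finite_lists_length_eq[of "{..<d}" n] by (simp add: words_def conj_commute)

lemma words_0 [simp]: "words d 0 = {[]}"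
  by (auto simp: words_def)

lemma words_length: "u \<in> words d n \<Longrightarrow> length u = n"
  by (simp add: words_def)

lemma words_snoc_iff: "u @ [b] \<in> words d (Suc n) \<longleftrightarrow> u \<in> words d n \<and> b < d"
  by (auto simp: words_def)

lemma words_Cons_iff: "a # u \<in> words d (Suc n) \<longleftrightarrow> a < d \<and> u \<in> words d n"
  by (auto simp: words_def)

lemma sum_words_snoc: "(\<Sum>u\<in>words d (Suc n). f u) = (\<Sum>u\<in>words d n. \<Sum>b<d. f (u @ [b]))"
proof -
  have "bij_betw (\<lambda>(u, b). u @ [b]) (words d n \<times> {..<d}) (words d (Suc n))"
    unfolding bij_betw_def
  proof
    show "(\<lambda>(u, b). u @ [b]) ` (words d n \<times> {..<d}) = words d (Suc n)"
    proof (intro equalityI subsetI)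
      fix u assume u: "u \<in> words d (Suc n)"
      then have "u = butlast u @ [last u]"
        by (cases u rule: rev_cases) (auto simp: words_def)
      then show "u \<in> (\<lambda>(u, b). u @ [b]) ` (words d n \<times> {..<d})"
        using u words_snoc_iff[of "butlast u" "last u" d n]
        by (intro image_eqI[of _ _ "(butlast u, last u)"]) auto
    qed (auto simp: words_snoc_iff)
  qed (auto simp: inj_on_def)
  from sum.reindex_bij_betw[OF this, of f] show ?thesis
    by (simp add: sum.cartesian_product case_prod_unfold)
qed

lemma sum_words_Cons: "(\<Sum>u\<in>words d (Suc n). f u) = (\<Sum>a<d. \<Sum>u\<in>words d n. f (a # u))"
proof -
  have "bij_betw (\<lambda>(a, u). a # u) ({..<d} \<times> words d n) (words d (Suc n))"
    unfolding bij_betw_def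
  proof
    show "(\<lambda>(a, u). a # u) ` ({..<d} \<times> words d n) = words d (Suc n)"
    proof (intro equalityI subsetI)
      fix u assume u: "u \<in> words d (Suc n)"
      then have "u = hd u # tl u"
        by (cases u) (auto simp: words_def)
      then show "u \<in> (\<lambda>(a, u). a # u) ` ({..<d} \<times> words d n)"
        using u words_Cons_iff[of "hd u" "tl u" d n]
        by (intro image_eqI[of _ _ "(hd u, tl u)"]) auto
    qed (auto simp: words_Cons_iff)
  qed (auto simp: inj_on_def)
  from sum.reindex_bij_betw[OF this, of f] show ?thesis
    by (simp add: sum.cartesian_product case_prod_unfold)
qed

text \<open>
  Kolmogorov extension: read off a sequence from independent random maps, the \<open>n\<close>-th of which
  chooses the next letter after each word of length \<open>n\<close>.
\<close>

primrec random_path :: "(nat \<Rightarrow> nat list \<Rightarrow> nat) \<Rightarrow> nat \<Rightarrow> nat list" where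
  "random_path \<omega> 0 = []"
| "random_path \<omega> (Suc n) = random_path \<omega> n @ [\<omega> n (random_path \<omega> n)]"

lemma length_random_path [simp]: "length (random_path \<omega> n) = n"
  by (induction n) auto

lemma random_path_eq_iff:
  "length u = n \<Longrightarrow> random_path \<omega> n = u \<longleftrightarrow> (\<forall>i<n. \<omega> i (take i u) = u ! i)"
proof (induction n arbitrary: u)
  case (Suc n)
  then obtain v b where u: "u = v @ [b]" "length v = n"
    by (metis length_Suc_conv_rev)
  have "(\<forall>i<Suc n. \<omega> i (take i u) = u ! i) \<longleftrightarrow> (\<forall>i<n. \<omega> i (take i v) = v ! i) \<and> \<omega> n v = b"
    using u by (auto simp: less_Suc_eq nth_append)
  then show ?case
    using Suc.IH[OF u(2)] u by auto
qed simp

lemma prefix_random_path: "prefix n (\<lambda>i. \<omega> i (random_path \<omega> i)) = random_path \<omega> n"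
  by (induction n) (auto simp: prefix_Suc, simp add: prefix_def)

lemma kolmogorov_extension:
  fixes W :: "nat list \<Rightarrow> real"
  assumes W_nonneg: "\<And>u. W u \<ge> 0" and W_Nil: "W [] = 1"
    and W_snoc: "\<And>u. W u = (\<Sum>b<d. W (u @ [b]))"
  shows "\<exists>\<mu> :: seq measure. prob_space \<mu> \<and> sets \<mu> = sets borel \<and>
    (\<forall>n. \<forall>u\<in>words d n. measure \<mu> {x. prefix n x = u} = W u)"
proof -
  \<comment> \<open>The law of the next letter after \<open>u\<close>. After a word of weight zero
    any law will do.\<close>
  have "\<exists>p. \<forall>b<d. W u \<noteq> 0 \<longrightarrow> pmf p b = W (u @ [b]) / W u" for u
  proof (cases "W u = 0")
    case False
    let ?f = "\<lambda>b. if b < d then W (u @ [b]) / W u else 0"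
    have nn: "0 \<le> ?f b" for b
      using W_nonneg by simp
    have "(\<integral>\<^sup>+b. ennreal (?f b) \<partial>count_space UNIV) = (\<Sum>b\<in>{..<d}. ennreal (?f b))"
      by (rule nn_integral_count_space') auto
    also have "\<dots> = ennreal (\<Sum>b<d. ?f b)"
      by (rule sum_ennreal) (use W_nonneg in auto)
    also have "(\<Sum>b<d. ?f b) = (\<Sum>b<d. W (u @ [b])) / W u"
      by (simp add: sum_divide_distrib)
    also have "\<dots> = 1"
      using False by (simp flip: W_snoc)
    finally have "(\<integral>\<^sup>+b. ennreal (?f b) \<partial>count_space UNIV) = 1"
      by simp
    then have "pmf (embed_pmf ?f) b = ?f b" for b
      using nn by (intro pmf_embed_pmf)
    then show ?thesis
      by (intro exI[of _ "embed_pmf ?f"]) auto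
  qed auto
  then obtain K where K: "\<And>u b. b < d \<Longrightarrow> W u \<noteq> 0 \<Longrightarrow> pmf (K u) b = W (u @ [b]) / W u"
    by metis
  \<comment> \<open>Coordinate \<open>n\<close> is a random map on the words of length
    \<open>n\<close> with independent values, so the whole space is a product. The value 0 outside
    these words is a mere default.\<close>
  define M where "M n = measure_pmf (Pi_pmf (words d n) 0 K)" for n
  interpret P: product_prob_space M "UNIV :: nat set"
    by (rule product_prob_spaceI) (simp add: M_def measure_pmf.prob_space_axioms)
  have sp: "space (Pi\<^sub>M UNIV M) = UNIV"
    by (simp add: space_PiM M_def PiE_UNIV_domain)
  have M_single: "emeasure (M n) {f. f u = b} = ennreal (pmf (K u) b)" if "u \<in> words d n" for n u b
  proof -
    have "pmf (map_pmf (\<lambda>f. f u) (Pi_pmf (words d n) 0 K)) b = measure_pmf.prob (Pi_pmf (words d n) 0 K) {f. f u = b}"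
      by (simp add: pmf_map vimage_def)
    then show ?thesis
      using that by (simp add: Pi_pmf_component finite_words M_def measure_pmf.emeasure_eq_measure)
  qed
  have W_prod: "(\<Prod>i<n. pmf (K (take i u)) (u ! i)) = W u" if "u \<in> words d n" for n u
    using that
  proof (induction n arbitrary: u)
    case 0
    then show ?case
      by (simp add: W_Nil)
  next
    case (Suc n)
    then obtain v b where u: "u = v @ [b]" "length v = n"
      by (metis length_Suc_conv_rev words_length)
    have v: "v \<in> words d n" "b < d"
      using Suc.prems words_snoc_iff u by auto
    have "(\<Prod>i<Suc n. pmf (K (take i u)) (u ! i)) = (\<Prod>i<n. pmf (K (take i v)) (v ! i)) * pmf (K v) b"
      using u by (simp add: nth_append)
    also have "\<dots> = W v * pmf (K v) b"
      using Suc.IH[OF v(1)] by simp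
    \<comment> \<open>By nonnegativity all extensions of a word of weight zero have weight zero, so
      the arbitrary law chosen there stays invisible.\<close>
    also have "\<dots> = W (v @ [b])"
    proof (cases "W v = 0")
      case True
      then have "(\<Sum>b<d. W (v @ [b])) = 0"
        using W_snoc by metis
      then have "W (v @ [b]) = 0"
        using v(2) W_nonneg by (subst (asm) sum_nonneg_eq_0_iff) auto
      then show ?thesis
        using True by simp
    next
      case False
      then show ?thesis
        using K v(2) by simp
    qed
    finally show ?case
      using u by simp
  qed
  have set_eq: "{\<omega>. random_path \<omega> n = u} = {\<omega>\<in>space (Pi\<^sub>M UNIV M). \<forall>i\<in>{..<n}. \<omega> i \<in> {f. f (take i u) = u ! i}}"
    if "length u = n" for n u
    using random_path_eq_iff[OF that] by (auto simp: sp)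
  have path_sets: "{\<omega>. random_path \<omega> n = u} \<in> sets (Pi\<^sub>M UNIV M)" for n u
  proof (cases "length u = n")
    case True
    have "{\<omega>\<in>space (Pi\<^sub>M UNIV M). \<omega> i \<in> A} \<in> sets (Pi\<^sub>M UNIV M)" for i A
    proof -
      have "(\<lambda>\<omega>. \<omega> i) -` A \<inter> space (Pi\<^sub>M UNIV M) \<in> sets (Pi\<^sub>M UNIV M)"
        by (rule measurable_sets[OF measurable_component_singleton[of i UNIV M]]) (simp_all add: M_def)
      then show ?thesis
        by (simp add: vimage_def Int_def conj_commute)
    qed
    then show ?thesis
      unfolding set_eq[OF True] by (intro sets.sets_Collect_finite_All \<open>\<And>i A. {\<omega>\<in>space (Pi\<^sub>M UNIV M). \<omega> i \<in> A} \<in> sets (Pi\<^sub>M UNIV M)\<close>) auto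
  next
    case False
    then have "{\<omega>. random_path \<omega> n = u} = {}"
      by auto
    then show ?thesis
      by simp
  qed
  define \<xi> where "\<xi> \<omega> = (\<lambda>i. \<omega> i (random_path \<omega> i))" for \<omega> :: "nat \<Rightarrow> nat list \<Rightarrow> nat"
  have path_meas: "(\<lambda>\<omega>. random_path \<omega> n) \<in> measurable (Pi\<^sub>M UNIV M) (count_space UNIV)" for n
    unfolding measurable_count_space_eq2_countable using path_sets by (auto simp: vimage_def sp)
  have coord: "(\<lambda>\<omega>. \<xi> \<omega> i) \<in> measurable (Pi\<^sub>M UNIV M) borel" for i
  proof -
    have "(\<lambda>\<omega>. random_path \<omega> (Suc i) ! i) \<in> measurable (Pi\<^sub>M UNIV M) borel"
      by (rule measurable_compose[OF path_meas]) simp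
    then show ?thesis
      by (simp add: \<xi>_def nth_append)
  qed
  have "(\<lambda>\<omega> i. \<xi> \<omega> i) \<in> measurable (Pi\<^sub>M UNIV M) (Pi\<^sub>M UNIV (\<lambda>_. borel))"
    by (rule measurable_PiM_single') (rule coord, simp add: PiE_UNIV_domain)
  then have meas: "\<xi> \<in> measurable (Pi\<^sub>M UNIV M) borel"
    by (subst (asm) measurable_cong_sets[OF refl sets_PiM_equal_borel]) simp
  have "measure (distr (Pi\<^sub>M UNIV M) borel \<xi>) {x. prefix n x = u} = W u" if u: "u \<in> words d n" for n u
  proof -
    have "{x :: seq. prefix n x = u} \<in> sets borel"
      by (simp add: open_prefix)
    then have "emeasure (distr (Pi\<^sub>M UNIV M) borel \<xi>) {x. prefix n x = u} =
        emeasure (Pi\<^sub>M UNIV M) {\<omega>. random_path \<omega> n = u}"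
      using meas by (subst emeasure_distr) (auto simp: sp \<xi>_def prefix_random_path vimage_def)
    also have "\<dots> = (\<Prod>i\<in>{..<n}. emeasure (M i) {f. f (take i u) = u ! i})"
      unfolding set_eq[OF words_length[OF u]] by (rule P.emeasure_PiM_Collect) (auto simp: M_def)
    also have "\<dots> = (\<Prod>i<n. ennreal (pmf (K (take i u)) (u ! i)))"
      using u by (intro prod.cong refl M_single) (auto simp: words_def dest: in_set_takeD)
    also have "\<dots> = ennreal (W u)"
      using W_prod[OF u] by (simp add: prod_ennreal)
    finally show ?thesis
      using W_nonneg by (simp add: measure_def)
  qed
  then show ?thesis
    using P.prob_space_distr[OF meas] by (intro exI[of _ "distr (Pi\<^sub>M UNIV M) borel \<xi>"]) simp
qed

text \<open>\<open>prefix_closed\<close> is topological closedness in terms of prefixes; over a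
  finite alphabet it gives compactness, used below in the form of Koenig's lemma.\<close>

locale shift_space =
  fixes d :: nat and X :: "seq set"
  assumes letters: "x \<in> X \<Longrightarrow> x n < d"
    and shift_closed: "x \<in> X \<Longrightarrow> shift_map x \<in> X"
    and prefix_closed: "(\<And>n. \<exists>y\<in>X. prefix n y = prefix n x) \<Longrightarrow> x \<in> X"
    and nonempty: "X \<noteq> {}"
begin

abbreviation BX :: "seq measure" where
  "BX \<equiv> restrict_space borel X"

section \<open>Cylinders and the Borel sets of the subshift\<close>

definition cyl :: "nat list \<Rightarrow> seq set" where
  "cyl u = {x \<in> X. prefix (length u) x = u}"

lemma mem_cyl_iff: "x \<in> cyl u \<longleftrightarrow> x \<in> X \<and> prefix (length u) x = u"
  by (simp add: cyl_def)

lemma cyl_subset: "cyl u \<subseteq> X"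
  by (auto simp: cyl_def)

lemma cyl_Nil [simp]: "cyl [] = X"
  by (auto simp: cyl_def prefix_def)

lemma cyl_prefix: "cylinder X n x = cyl (prefix n x)"
  by (auto simp: cylinder_def cyl_def prefix_eq_iff)

lemma shift_pow_closed: "x \<in> X \<Longrightarrow> (shift_map ^^ i) x \<in> X"
  by (induction i) (auto intro: shift_closed)

lemma prefix_words: "x \<in> X \<Longrightarrow> prefix n x \<in> words d n"
  by (auto simp: words_def prefix_def letters)

lemma cyl_empty: "u \<notin> words d (length u) \<Longrightarrow> cyl u = {}"
  by (metis (mono_tags, lifting) cyl_def empty_Collect_eq prefix_words)

lemma cyl_append: "cyl (u @ v) \<subseteq> cyl u"
  using take_prefix[of "length u" "length (u @ v)"] by (auto simp: cyl_def) (metis append_eq_conv_conj)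

lemma cyl_Int:
  assumes "length u \<le> length v"
  shows "cyl u \<inter> cyl v = (if take (length u) v = u then cyl v else {})"
proof -
  have "prefix (length u) x = take (length u) v" if "x \<in> cyl v" for x
    using that take_prefix[OF assms, of x] by (metis mem_cyl_iff)
  then show ?thesis
    by (auto simp: mem_cyl_iff)
qed

lemma cyl_snoc: "cyl u = (\<Union>b\<in>{..<d}. cyl (u @ [b]))"
  by (auto simp: cyl_def prefix_Suc letters)

lemma cyl_Cons: "shift_map -` cyl u \<inter> X = (\<Union>a\<in>{..<d}. cyl (a # u))"
  by (auto simp: cyl_def prefix_shift letters shift_closed)

lemma cyl_disjoint: "length u = length v \<Longrightarrow> u \<noteq> v \<Longrightarrow> cyl u \<inter> cyl v = {}"
  by (auto simp: cyl_def)

lemma space_BX [simp]: "space BX = X"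
  by (simp add: space_restrict_space)

lemma cyl_sets_BX: "cyl u \<in> sets BX"
proof -
  have "cyl u = X \<inter> {x. prefix (length u) x = u}"
    by (auto simp: cyl_def)
  then show ?thesis
    using open_prefix[of "length u" u] by (auto simp: sets_restrict_space)
qed

lemma open_contains_cyl:
  assumes "open S" "x \<in> S"
  shows "\<exists>n. {y :: seq. prefix n y = prefix n x} \<subseteq> S"
proof -
  have "openin (product_topology (\<lambda>_. euclidean) UNIV) S"
    using assms(1) by (simp only: euclidean_product_topology flip: open_openin)
  from product_topology_open_contains_basis[OF this assms(2)]
  obtain V where V: "x \<in> Pi\<^sub>E UNIV V" "finite {i. V i \<noteq> UNIV}" "Pi\<^sub>E UNIV V \<subseteq> S"
    by auto
  define n where "n = Suc (Max (insert 0 {i. V i \<noteq> UNIV}))"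
  have n: "i < n" if "V i \<noteq> UNIV" for i
    using that V(2) by (auto simp: n_def less_Suc_eq_le intro!: Max_ge)
  have "y \<in> S" if "prefix n y = prefix n x" for y
  proof -
    have "y i \<in> V i" for i
    proof (cases "V i = UNIV")
      case False
      then have "y i = x i"
        using that n by (simp add: prefix_eq_iff)
      then show ?thesis
        using V(1) by auto
    qed simp
    then show ?thesis
      using V(3) by auto
  qed
  then show ?thesis
    by blast
qed

lemma sets_BX: "sets BX = sigma_sets X (range cyl)"
proof
  have "range cyl \<subseteq> sets BX"
    using cyl_sets_BX by auto
  then show "sigma_sets X (range cyl) \<subseteq> sets BX"
    using sets.sigma_sets_subset[of "range cyl" BX] by simp
next
  interpret S: sigma_algebra X "sigma_sets X (range cyl)"
    using cyl_subset by (intro sigma_algebra_sigma_sets) auto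
  have "X \<inter> B \<in> sigma_sets X (range cyl)" if "B \<in> sigma_sets UNIV {S :: seq set. open S}" for B
    using that
  proof induction
    case (Basic S)
    then have S: "open S"
      by simp
    \<comment> \<open>A countable union, as there are only countably many words.\<close>
    have "X \<inter> S = (\<Union>u\<in>{u. cyl u \<subseteq> S}. cyl u)"
    proof (intro equalityI subsetI)
      fix x assume x: "x \<in> X \<inter> S"
      obtain n where "{y :: seq. prefix n y = prefix n x} \<subseteq> S"
        using open_contains_cyl[OF S] x by blast
      then have "cyl (prefix n x) \<subseteq> S"
        by (auto simp: cyl_def)
      moreover have "x \<in> cyl (prefix n x)"
        using x by (simp add: cyl_def)
      ultimately show "x \<in> (\<Union>u\<in>{u. cyl u \<subseteq> S}. cyl u)"
        by blast
    qed (use cyl_subset in auto)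
    also have "\<dots> \<in> sigma_sets X (range cyl)"
      by (rule S.countable_UN'') auto
    finally show ?case .
  next
    case Empty
    then show ?case
      by simp
  next
    case (Compl a)
    have "X \<inter> (UNIV - a) = X - X \<inter> a"
      by blast
    then show ?case
      using Compl by auto
  next
    case (Union a)
    have "X \<inter> (\<Union>i. a i) = (\<Union>i. X \<inter> a i)"
      by blast
    moreover have "(\<Union>i. X \<inter> a i) \<in> sigma_sets X (range cyl)"
      using Union by (intro sigma_sets.Union)
    ultimately show ?case
      by simp
  qed
  then show "sets BX \<subseteq> sigma_sets X (range cyl)"
    by (auto simp: sets_restrict_space borel_def)
qed

lemma cyl_Int_stable: "Int_stable (range cyl)"
proof -
  have "cyl [d] = {}"
    by (rule cyl_empty) (simp add: words_def)
  then have "{} \<in> range cyl"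
    by (metis rangeI)
  then have "cyl u \<inter> cyl v \<in> range cyl" if "length u \<le> length v" for u v
    using cyl_Int[OF that] by auto
  then show ?thesis
    unfolding Int_stable_def by (metis Int_commute imageE nat_le_linear)
qed

text \<open>Dynkin's argument for differences of finite measures, to which uniqueness of measures
  does not apply directly. \<open>F\<close> will be the difference of the two sides of an identity
  already known on cylinders.\<close>

lemma set_function_zero:
  fixes F :: "seq set \<Rightarrow> real"
  assumes cyl: "\<And>u. F (cyl u) = 0"
    and compl: "\<And>B. B \<in> sets BX \<Longrightarrow> F (X - B) = F X - F B"
    and union: "\<And>A. range A \<subseteq> sets BX \<Longrightarrow> disjoint_family A \<Longrightarrow> (\<lambda>i :: nat. F (A i)) sums F (\<Union>i. A i)"
    and B: "B \<in> sets BX"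
  shows "F B = 0"
proof -
  have X: "F X = 0"
    using cyl[of "[]"] by simp
  have "range cyl \<subseteq> Pow X" "B \<in> sigma_sets X (range cyl)"
    using B cyl_subset by (auto simp: sets_BX)
  with cyl_Int_stable show ?thesis
  proof (induction rule: sigma_sets_induct_disjoint)
    case (basic A)
    then show ?case
      using cyl by auto
  next
    case empty
    have "F (X - X) = F X - F X"
      using sets.top[of BX] by (intro compl) simp
    then show ?case
      by simp
  next
    case (compl A)
    then show ?case
      using assms(2)[of A] X by (simp add: sets_BX)
  next
    case (union A)
    then show ?case
      using assms(3)[of A] by (simp add: sets_BX sums_iff)
  qed
qed

section \<open>Measures described by their cylinder probabilities\<close>

definition prob_on :: "seq measure \<Rightarrow> bool" where
  "prob_on \<nu> \<longleftrightarrow> sets \<nu> = sets BX \<and> prob_space \<nu>"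

abbreviation Inv :: "seq measure set" where
  "Inv \<equiv> invariant_measures X shift_map"

definition cp :: "seq measure \<Rightarrow> nat list \<Rightarrow> real" where
  "cp \<nu> u = measure \<nu> (cyl u)"

lemma inv_prob_on: "\<nu> \<in> Inv \<Longrightarrow> prob_on \<nu>"
  by (simp add: invariant_measures_def prob_on_def)

lemma prob_on_sets: "prob_on \<nu> \<Longrightarrow> sets \<nu> = sets BX"
  by (simp add: prob_on_def)

lemma prob_on_space: "prob_on \<nu> \<Longrightarrow> space \<nu> = X"
  using sets_eq_imp_space_eq[of \<nu> BX] by (simp add: prob_on_def)

lemma prob_on_prob: "prob_on \<nu> \<Longrightarrow> prob_space \<nu>"
  by (simp add: prob_on_def)

lemma prob_on_finite: "prob_on \<nu> \<Longrightarrow> finite_measure \<nu>"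
  by (simp add: prob_on_def prob_space.finite_measure)

lemma cp_nonneg: "cp \<nu> u \<ge> 0"
  by (simp add: cp_def)

lemma cp_empty: "cyl u = {} \<Longrightarrow> cp \<nu> u = 0"
  by (simp add: cp_def)

lemma cp_Nil: "prob_on \<nu> \<Longrightarrow> cp \<nu> [] = 1"
  using prob_space.prob_space[of \<nu>] by (simp add: cp_def prob_on_prob prob_on_space)

lemma measure_cyl_Union:
  assumes "prob_on \<nu>" "finite I" "\<And>i j. i \<in> I \<Longrightarrow> j \<in> I \<Longrightarrow> i \<noteq> j \<Longrightarrow> f i \<noteq> f j"
    "\<And>i. i \<in> I \<Longrightarrow> length (f i) = n"
  shows "measure \<nu> (\<Union>i\<in>I. cyl (f i)) = (\<Sum>i\<in>I. cp \<nu> (f i))"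
  unfolding cp_def using assms cyl_disjoint cyl_sets_BX
  by (intro finite_measure.finite_measure_finite_Union)
     (auto simp: prob_on_finite prob_on_sets disjoint_family_on_def)

lemma cp_snoc: "prob_on \<nu> \<Longrightarrow> cp \<nu> u = (\<Sum>b<d. cp \<nu> (u @ [b]))"
  using measure_cyl_Union[of \<nu> "{..<d}" "\<lambda>b. u @ [b]" "Suc (length u)"] cyl_snoc[of u]
  by (simp add: cp_def)

lemma cp_Cons:
  assumes "\<nu> \<in> Inv"
  shows "cp \<nu> u = (\<Sum>a<d. cp \<nu> (a # u))"
proof -
  have \<nu>: "prob_on \<nu>" "shift_map \<in> measurable \<nu> \<nu>" "distr \<nu> \<nu> shift_map = \<nu>"
    using assms inv_prob_on by (auto simp: invariant_measures_def)
  have "cp \<nu> u = measure (distr \<nu> \<nu> shift_map) (cyl u)"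
    using \<nu> by (simp add: cp_def)
  also have "\<dots> = measure \<nu> (shift_map -` cyl u \<inter> X)"
    using measure_distr[OF \<nu>(2), of "cyl u"] \<nu>(1) cyl_sets_BX by (simp only: prob_on_space prob_on_sets)
  also have "\<dots> = (\<Sum>a<d. cp \<nu> (a # u))"
    using \<nu> measure_cyl_Union[of \<nu> "{..<d}" "\<lambda>a. a # u" "Suc (length u)"] by (simp add: cyl_Cons)
  finally show ?thesis .
qed

lemma cp_words: "prob_on \<nu> \<Longrightarrow> (\<Sum>v\<in>words d n. cp \<nu> (u @ v)) = cp \<nu> u"
proof (induction n)
  case (Suc n)
  have "(\<Sum>b<d. cp \<nu> (u @ v @ [b])) = cp \<nu> (u @ v)" for v
    using cp_snoc[OF Suc.prems, of "u @ v"] by simp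
  then show ?case
    using Suc by (simp add: sum_words_snoc)
qed simp

lemma cp_sum_words: "prob_on \<nu> \<Longrightarrow> (\<Sum>v\<in>words d n. cp \<nu> v) = 1"
  using cp_words[of \<nu> "[]" n] by (simp add: cp_Nil)

lemma cp_append_le: "prob_on \<nu> \<Longrightarrow> cp \<nu> (u @ v) \<le> cp \<nu> u"
  unfolding cp_def using cyl_append cyl_sets_BX
  by (intro finite_measure.finite_measure_mono) (auto simp: prob_on_finite prob_on_sets)

lemma cp_outside: "u \<notin> words d (length u) \<Longrightarrow> cp \<nu> u = 0"
  by (simp add: cp_empty cyl_empty)

lemma cp_Cons_le:
  assumes "\<nu> \<in> Inv"
  shows "cp \<nu> (a # u) \<le> cp \<nu> u"
proof (cases "a < d")
  case True
  then show ?thesis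
    unfolding cp_Cons[OF assms, of u]
    by (intro member_le_sum) (auto simp: cp_nonneg)
next
  case False
  then show ?thesis
    using cp_outside[of "a # u" \<nu>] by (auto simp: words_def cp_nonneg)
qed

lemma cp_append_le2: "\<nu> \<in> Inv \<Longrightarrow> cp \<nu> (v @ u) \<le> cp \<nu> u"
proof (induction v)
  case (Cons a v)
  then show ?case
    using cp_Cons_le[of \<nu> a "v @ u"] by simp
qed simp

lemma cp_drop_le: "\<nu> \<in> Inv \<Longrightarrow> cp \<nu> u \<le> cp \<nu> (drop i u)"
  using cp_append_le2[of \<nu> "take i u" "drop i u"] by simp

text \<open>Short cylinders are disjoint unions of long ones. The bound \<open>n\<close> is there
  for Markov measures, whose product formula starts at length \<open>k\<close>.\<close>

lemma measure_eqI_cyl: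
  assumes \<mu>: "prob_on \<mu>" and \<nu>: "prob_on \<nu>" and eq: "\<And>u. length u \<ge> n \<Longrightarrow> cp \<mu> u = cp \<nu> u"
  shows "\<mu> = \<nu>"
proof (rule measure_eqI_generator_eq[of "range cyl" X])
  show "emeasure \<mu> A = emeasure \<nu> A" if A: "A \<in> range cyl" for A
  proof -
    obtain u where u: "A = cyl u"
      using A by blast
    have "cp \<mu> u = (\<Sum>v\<in>words d n. cp \<mu> (u @ v))"
      using cp_words[OF \<mu>] by simp
    also have "\<dots> = (\<Sum>v\<in>words d n. cp \<nu> (u @ v))"
      by (intro sum.cong refl eq) (auto simp: words_def)
    finally have "cp \<mu> u = cp \<nu> u"
      using cp_words[OF \<nu>] by simp
    then show ?thesis
      using \<mu> \<nu> by (simp add: u cp_def finite_measure.emeasure_eq_measure prob_on_finite)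
  qed
  show "range cyl \<subseteq> Pow X"
    using cyl_subset by auto
  show "sets \<mu> = sigma_sets X (range cyl)" "sets \<nu> = sigma_sets X (range cyl)"
    using \<mu> \<nu> by (simp_all add: prob_on_sets sets_BX)
  show "range (\<lambda>_. X) \<subseteq> range cyl"
    by (metis cyl_Nil image_subset_iff rangeI)
  show "emeasure \<mu> X \<noteq> \<infinity>"
    using \<mu> by (simp add: finite_measure.emeasure_eq_measure prob_on_finite)
qed (auto intro: cyl_Int_stable)

lemma measurable_prefix:
  assumes "prob_on \<nu>"
  shows "(\<lambda>x. prefix n x) \<in> measurable \<nu> (count_space UNIV)"
  unfolding measurable_count_space_eq2_countable
proof (intro conjI ballI)
  fix u :: "nat list"
  show "(\<lambda>x. prefix n x) -` {u} \<inter> space \<nu> \<in> sets \<nu>"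
  proof (cases "length u = n")
    case True
    then have "(\<lambda>x. prefix n x) -` {u} \<inter> space \<nu> = cyl u"
      using assms by (auto simp: cyl_def prob_on_space)
    then show ?thesis
      using assms cyl_sets_BX by (simp add: prob_on_sets)
  next
    case False
    then have "(\<lambda>x. prefix n x) -` {u} \<inter> space \<nu> = {}"
      by auto
    then show ?thesis
      by simp
  qed
qed simp

lemma shift_measurable:
  assumes "prob_on \<nu>"
  shows "shift_map \<in> measurable \<nu> \<nu>"
proof (rule measurableI)
  fix x assume "x \<in> space \<nu>"
  then show "shift_map x \<in> space \<nu>"
    using assms by (simp add: prob_on_space shift_closed)
next
  have "shift_map \<in> measurable (sigma X (range cyl)) (sigma X (range cyl))"
  proof (rule measurable_measure_of)
    show "shift_map \<in> space (sigma X (range cyl)) \<rightarrow> X"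
      using shift_closed cyl_subset by (auto simp: space_measure_of_conv)
    show "shift_map -` y \<inter> space (sigma X (range cyl)) \<in> sets (sigma X (range cyl))" if y: "y \<in> range cyl" for y
    proof -
      obtain u where u: "y = cyl u"
        using y by blast
      have "(\<Union>a\<in>{..<d}. cyl (a # u)) \<in> sets BX"
        by (intro sets.finite_UN) (auto intro: cyl_sets_BX)
      then show ?thesis
        using cyl_subset u by (simp add: space_measure_of_conv sets_measure_of_conv sets_BX cyl_Cons image_subset_iff)
    qed
  qed (use cyl_subset in auto)
  then show "shift_map -` A \<inter> space \<nu> \<in> sets \<nu>" if "A \<in> sets \<nu>" for A
    using that assms cyl_subset measurable_sets[of shift_map "sigma X (range cyl)" "sigma X (range cyl)" A]
    by (simp add: prob_on_space prob_on_sets sets_BX space_measure_of_conv sets_measure_of_conv image_subset_iff)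
qed

text \<open>Invariance on long cylinders suffices, as a measure is determined by them.\<close>

lemma invI:
  assumes \<nu>: "prob_on \<nu>" and eq: "\<And>u. length u \<ge> n \<Longrightarrow> (\<Sum>a<d. cp \<nu> (a # u)) = cp \<nu> u"
  shows "\<nu> \<in> Inv"
proof -
  have T: "shift_map \<in> measurable \<nu> \<nu>"
    by (rule shift_measurable[OF \<nu>])
  have D: "prob_on (distr \<nu> \<nu> shift_map)"
    using \<nu> T by (auto simp: prob_on_def intro: prob_space.prob_space_distr)
  have "distr \<nu> \<nu> shift_map = \<nu>"
  proof (rule measure_eqI_cyl[OF D \<nu>])
    fix u :: "nat list" assume "length u \<ge> n"
    have "cp (distr \<nu> \<nu> shift_map) u = measure \<nu> (shift_map -` cyl u \<inter> X)"
      using measure_distr[OF T, of "cyl u"] \<nu> cyl_sets_BX by (simp only: cp_def prob_on_space prob_on_sets)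
    also have "\<dots> = (\<Sum>a<d. cp \<nu> (a # u))"
      using \<nu> measure_cyl_Union[of \<nu> "{..<d}" "\<lambda>a. a # u" "Suc (length u)"] by (simp add: cyl_Cons)
    finally show "cp (distr \<nu> \<nu> shift_map) u = cp \<nu> u"
      using eq[OF \<open>length u \<ge> n\<close>] by simp
  qed
  then show ?thesis
    using \<nu> T by (simp add: invariant_measures_def prob_on_def)
qed

lemma integral_prefix:
  fixes f :: "nat list \<Rightarrow> real"
  assumes \<nu>: "prob_on \<nu>"
  shows "(\<integral>x. f (prefix n x) \<partial>\<nu>) = (\<Sum>u\<in>words d n. f u * cp \<nu> u)"
    and "integrable \<nu> (\<lambda>x. f (prefix n x))"
proof -
  have eq: "f (prefix n x) = (\<Sum>u\<in>words d n. f u * indicator (cyl u) x)" if "x \<in> space \<nu>" for x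
  proof -
    have x: "x \<in> X"
      using that \<nu> by (simp add: prob_on_space)
    have "(\<Sum>u\<in>words d n. f u * indicator (cyl u) x) = (\<Sum>u\<in>words d n. if u = prefix n x then f u else 0)"
      using x by (intro sum.cong) (auto simp: cyl_def words_def indicator_def)
    then show ?thesis
      using finite_words prefix_words[OF x] by simp
  qed
  have int: "integrable \<nu> (\<lambda>x. f u * indicator (cyl u) x)" for u
    using \<nu> cyl_sets_BX finite_measure.emeasure_finite[of \<nu>]
    by (intro integrable_mult_right integrable_real_indicator)
       (auto simp: prob_on_sets prob_on_finite less_top[symmetric])
  then show "integrable \<nu> (\<lambda>x. f (prefix n x))"
    by (subst Bochner_Integration.integrable_cong[OF refl eq]) (auto intro!: Bochner_Integration.integrable_sum)
  have "(\<integral>x. f (prefix n x) \<partial>\<nu>) = (\<integral>x. (\<Sum>u\<in>words d n. f u * indicator (cyl u) x) \<partial>\<nu>)"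
    by (rule Bochner_Integration.integral_cong) (simp_all add: eq)
  also have "\<dots> = (\<Sum>u\<in>words d n. \<integral>x. f u * indicator (cyl u) x \<partial>\<nu>)"
    using int by (intro Bochner_Integration.integral_sum) auto
  also have "\<dots> = (\<Sum>u\<in>words d n. f u * cp \<nu> u)"
    using \<nu> cyl_sets_BX
    by (intro sum.cong) (auto simp: cp_def prob_on_sets prob_on_space Int_absorb2 cyl_subset)
  finally show "(\<integral>x. f (prefix n x) \<partial>\<nu>) = (\<Sum>u\<in>words d n. f u * cp \<nu> u)" .
qed

lemma integral_shift_pow:
  fixes f :: "seq \<Rightarrow> real"
  assumes "\<nu> \<in> Inv" and f: "f \<in> borel_measurable \<nu>"
  shows "(\<integral>x. f ((shift_map ^^ i) x) \<partial>\<nu>) = (\<integral>x. f x \<partial>\<nu>)"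
proof (induction i)
  case (Suc i)
  have \<nu>: "shift_map \<in> measurable \<nu> \<nu>" "distr \<nu> \<nu> shift_map = \<nu>"
    using assms(1) by (auto simp: invariant_measures_def)
  have pow: "(shift_map ^^ i) \<in> measurable \<nu> \<nu>" for i
    using \<nu>(1) by (induction i) (auto intro: measurable_comp simp: o_def)
  have "(\<integral>x. f ((shift_map ^^ i) x) \<partial>\<nu>) = (\<integral>x. f ((shift_map ^^ i) x) \<partial>(distr \<nu> \<nu> shift_map))"
    using \<nu>(2) by simp
  also have "\<dots> = (\<integral>x. f ((shift_map ^^ i) (shift_map x)) \<partial>\<nu>)"
    using \<nu>(1) measurable_compose[OF pow f] by (intro integral_distr)
  finally show ?case
    using Suc by (simp add: funpow_swap1)
qed simp

text \<open>
  A weight on words that vanishes on words outside the language of \<open>X\<close> lives on \<open>X\<close> by closedness.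
\<close>

lemma measure_extension:
  fixes W :: "nat list \<Rightarrow> real"
  assumes W_nonneg: "\<And>u. W u \<ge> 0" and W_Nil: "W [] = 1"
    and W_snoc: "\<And>u. W u = (\<Sum>b<d. W (u @ [b]))"
    and W_lang: "\<And>u. cyl u = {} \<Longrightarrow> W u = 0"
  shows "\<exists>\<nu>. prob_on \<nu> \<and> (\<forall>u. cp \<nu> u = W u)"
proof -
  obtain \<mu> :: "seq measure" where \<mu>: "prob_space \<mu>" "sets \<mu> = sets borel"
      "\<And>n u. u \<in> words d n \<Longrightarrow> measure \<mu> {x. prefix n x = u} = W u"
    using kolmogorov_extension[OF W_nonneg W_Nil W_snoc] by blast
  interpret \<mu>: prob_space \<mu>
    by (rule \<mu>(1))
  have sp: "space \<mu> = UNIV"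
    using sets_eq_imp_space_eq[OF \<mu>(2)] by simp
  have pm: "{x. prefix n x = u} \<in> sets \<mu>" for n u
    using \<mu>(2) open_prefix by simp
  define L where "L n = {u\<in>words d n. cyl u \<noteq> {}}" for n
  have finL: "finite (L n)" for n
    using finite_words[of d n] by (simp add: L_def)
  \<comment> \<open>Closedness writes \<open>X\<close> as a countable intersection of finite unions
    of cylinder sets, each of full measure because words outside the language have weight
    zero.\<close>
  have Xeq: "X = (\<Inter>n. \<Union>u\<in>L n. {x. prefix n x = u})"
  proof (intro equalityI subsetI)
    fix x assume "x \<in> X"
    then show "x \<in> (\<Inter>n. \<Union>u\<in>L n. {x. prefix n x = u})"
      using prefix_words[of x] by (auto simp: L_def cyl_def)
  next
    fix x assume x: "x \<in> (\<Inter>n. \<Union>u\<in>L n. {x. prefix n x = u})"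
    have "\<exists>y\<in>X. prefix n y = prefix n x" for n
      using x by (auto simp: L_def cyl_def)
    then show "x \<in> X"
      by (rule prefix_closed)
  qed
  have XS: "X \<in> sets \<mu>"
    unfolding Xeq using pm finL sets.top[of \<mu>] sp by (intro sets.countable_INT'' sets.finite_UN) auto
  have L1: "measure \<mu> (\<Union>u\<in>L n. {x. prefix n x = u}) = 1" for n
  proof -
    have sumW: "(\<Sum>u\<in>words d n. W u) = 1" for n
    proof (induction n)
      case (Suc n)
      then show ?case
        by (simp add: sum_words_snoc flip: W_snoc)
    qed (simp add: W_Nil)
    have "measure \<mu> (\<Union>u\<in>L n. {x. prefix n x = u}) = (\<Sum>u\<in>L n. measure \<mu> {x. prefix n x = u})"
      using pm finL by (intro \<mu>.finite_measure_finite_Union) (auto simp: disjoint_family_on_def)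
    also have "\<dots> = (\<Sum>u\<in>L n. W u)"
      by (intro sum.cong refl \<mu>(3)) (simp add: L_def)
    also have "\<dots> = (\<Sum>u\<in>words d n. W u)"
      using W_lang finite_words by (intro sum.mono_neutral_left) (auto simp: L_def)
    finally show ?thesis
      using sumW by simp
  qed
  have "AE x in \<mu>. \<forall>n. x \<in> (\<Union>u\<in>L n. {x. prefix n x = u})"
    unfolding AE_all_countable using L1 by (intro allI \<mu>.AE_prob_1) simp
  then have AEX: "AE x in \<mu>. x \<in> X"
    by eventually_elim (subst Xeq, simp)
  then have "emeasure \<mu> X = 1"
    using XS \<mu>.emeasure_eq_1_AE by blast
  then have "prob_space (restrict_space \<mu> X)"
    using XS by (intro prob_space_restrict_space)
  moreover have "sets (restrict_space \<mu> X) = sets BX"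
    using \<mu>(2) by (simp add: sets_restrict_space)
  ultimately have "prob_on (restrict_space \<mu> X)"
    by (simp add: prob_on_def)
  moreover have "cp (restrict_space \<mu> X) u = W u" for u
  proof (cases "u \<in> words d (length u)")
    case True
    have "cp (restrict_space \<mu> X) u = measure \<mu> (cyl u)"
      unfolding cp_def using XS sp cyl_subset by (intro measure_restrict_space) auto
    also have "\<dots> = measure \<mu> {x. prefix (length u) x = u}"
    proof (rule measure_eq_AE)
      show "AE x in \<mu>. (x \<in> cyl u) = (x \<in> {x. prefix (length u) x = u})"
        using AEX by eventually_elim (simp add: cyl_def)
      have "cyl u = X \<inter> {x. prefix (length u) x = u}"
        by (auto simp: cyl_def)
      then show "cyl u \<in> sets \<mu>"
        using XS pm by simp
    qed (rule pm)
    finally show ?thesis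
      using \<mu>(3)[OF True] by simp
  next
    case False
    then show ?thesis
      using cyl_empty[OF False] W_lang by (simp add: cp_def)
  qed
  ultimately show ?thesis
    by blast
qed

end

section \<open>Entropy\<close>

text \<open>Division of \<open>n\<close> by a nearly optimal \<open>m\<close> bounds
  \<open>a n / n\<close> by \<open>a m / m\<close> up to a remainder \<open>C / n\<close>.\<close>

lemma fekete:
  fixes a :: "nat \<Rightarrow> real"
  assumes nonneg: "\<And>n. a n \<ge> 0" and sub: "\<And>m n. a (m + n) \<le> a m + a n"
  shows "convergent (\<lambda>n. a n / real n)"
proof -
  define L where "L = Inf ((\<lambda>n. a n / real n) ` {1..})"
  have bdd: "bdd_below ((\<lambda>n. a n / real n) ` {1..})"
    using nonneg by (intro bdd_belowI[of _ 0]) auto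
  have L_le: "L \<le> a n / real n" if "n \<ge> 1" for n
    unfolding L_def using that by (intro cInf_lower bdd) auto
  have mult: "a (q * m) \<le> real q * a m" if "q \<ge> 1" for q m
    using that
  proof (induction q rule: dec_induct)
    case (step q)
    then show ?case
      using sub[of m "q * m"] by (simp add: algebra_simps)
  qed simp
  have "(\<lambda>n. a n / real n) \<longlonglongrightarrow> L"
  proof (rule LIMSEQ_I)
    fix e :: real assume "e > 0"
    then obtain m where m: "m \<ge> 1" "a m / real m < L + e / 2"
      using cInf_lessD[of "(\<lambda>n. a n / real n) ` {1..}" "L + e / 2"] by (auto simp: L_def)
    define C where "C = Max (a ` {..<m})"
    have C: "a r \<le> C" if "r < m" for r
      unfolding C_def using that by (intro Max_ge) auto
    obtain n0 :: nat where n0: "real n0 > 2 * C / e"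
      using reals_Archimedean2 by blast
    have "norm (a n / real n - L) < e" if n: "n \<ge> max n0 m" for n
    proof -
      define q r where "q = n div m" and "r = n mod m"
      have nqr: "n = q * m + r" "r < m" "q \<ge> 1"
        using m n by (auto simp: q_def r_def div_greater_zero_iff Suc_le_eq)
      have npos: "real n > 0"
        using m n by simp
      have "a n \<le> real q * a m + C"
        using sub[of "q * m" r] mult[OF nqr(3), of m] C[OF nqr(2)] nqr(1) by simp
      also have "real q * a m = real (q * m) * (a m / real m)"
        using m by simp
      also have "\<dots> \<le> real n * (a m / real m)"
      proof (rule mult_right_mono)
        have "q * m \<le> n"
          using nqr(1) by linarith
        then show "real (q * m) \<le> real n"
          by (simp only: of_nat_le_iff)
      qed (use nonneg in simp)
      finally have "a n / real n \<le> a m / real m + C / real n"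
        using npos by (simp add: field_simps)
      moreover have "C / real n < e / 2"
      proof -
        have "2 * C / e < real n"
          using n0 n by (simp add: max_def split: if_splits)
        then show ?thesis
          using npos \<open>e > 0\<close> by (simp add: field_simps)
      qed
      ultimately have "a n / real n < L + e"
        using m(2) by argo
      then show ?thesis
        using L_le[of n] m n \<open>e > 0\<close> by (simp add: abs_less_iff)
    qed
    then show "\<exists>no. \<forall>n\<ge>no. norm (a n / real n - L) < e"
      by blast
  qed
  then show ?thesis
    by (rule convergentI)
qed

text \<open>This is \<open>ln x \<le> x - 1\<close> at \<open>x = b / a\<close>. Its equality case
  \<open>x = 1\<close> is the source of the uniqueness of equilibrium states.\<close>

lemma gibbs_term:
  fixes a b :: real
  assumes "a \<ge> 0" "b \<ge> 0" "a > 0 \<Longrightarrow> b > 0"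
  shows "a * ln b - a * ln a \<le> b - a" and "a * ln b - a * ln a = b - a \<Longrightarrow> a = b"
proof -
  show le: "a * ln b - a * ln a \<le> b - a"
  proof (cases "a = 0")
    case False
    then have "a > 0" "b > 0"
      using assms by auto
    then have "a * ln (b / a) \<le> a * (b / a - 1)"
      by (intro mult_left_mono ln_le_minus_one) auto
    then show ?thesis
      using \<open>a > 0\<close> \<open>b > 0\<close> by (simp add: ln_div algebra_simps)
  qed (use assms in simp)
  show "a = b" if eq: "a * ln b - a * ln a = b - a"
  proof (cases "a = 0")
    case True
    then show ?thesis
      using eq by simp
  next
    case False
    then have "a > 0" "b > 0"
      using assms by auto
    then have "a * ln (b / a) = a * (b / a - 1)"
      using eq by (simp add: ln_div algebra_simps)
    then have "ln (b / a) = b / a - 1"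
      using \<open>a > 0\<close> by simp
    then have "b / a = 1"
      using \<open>a > 0\<close> \<open>b > 0\<close> by (intro ln_eq_minus_one) auto
    then show ?thesis
      using \<open>a > 0\<close> by simp
  qed
qed

text \<open>The termwise defects are nonnegative, so equality of the sums makes each of them vanish.
  Total masses need only satisfy \<open>le\<close>, which admits subprobabilities
  \<open>b\<close>.\<close>

lemma gibbs_inequality:
  fixes a b :: "'v \<Rightarrow> real"
  assumes "finite S" and "\<And>v. v \<in> S \<Longrightarrow> a v \<ge> 0" "\<And>v. v \<in> S \<Longrightarrow> b v \<ge> 0"
    and "\<And>v. v \<in> S \<Longrightarrow> a v > 0 \<Longrightarrow> b v > 0" and le: "(\<Sum>v\<in>S. b v) \<le> (\<Sum>v\<in>S. a v)"
  shows "(\<Sum>v\<in>S. a v * ln (b v)) \<le> (\<Sum>v\<in>S. a v * ln (a v))"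
    and "(\<Sum>v\<in>S. a v * ln (b v)) = (\<Sum>v\<in>S. a v * ln (a v)) \<Longrightarrow> v \<in> S \<Longrightarrow> a v = b v"
proof -
  let ?d = "\<lambda>v. b v - a v - (a v * ln (b v) - a v * ln (a v))"
  have nn: "?d v \<ge> 0" if "v \<in> S" for v
    using gibbs_term(1)[of "a v" "b v"] assms that by auto
  have sum: "(\<Sum>v\<in>S. ?d v) = (\<Sum>v\<in>S. b v) - (\<Sum>v\<in>S. a v) - ((\<Sum>v\<in>S. a v * ln (b v)) - (\<Sum>v\<in>S. a v * ln (a v)))"
    by (simp add: sum_subtractf)
  have "(\<Sum>v\<in>S. ?d v) \<ge> 0"
    using nn by (rule sum_nonneg)
  then show "(\<Sum>v\<in>S. a v * ln (b v)) \<le> (\<Sum>v\<in>S. a v * ln (a v))"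
    unfolding sum using le by linarith
  assume eq: "(\<Sum>v\<in>S. a v * ln (b v)) = (\<Sum>v\<in>S. a v * ln (a v))" and v: "v \<in> S"
  have "(\<Sum>v\<in>S. ?d v) = 0"
    using \<open>(\<Sum>v\<in>S. ?d v) \<ge> 0\<close> le unfolding sum eq by linarith
  then have "?d v = 0"
    using sum_nonneg_eq_0_iff[OF \<open>finite S\<close>, of ?d] nn v by blast
  then show "a v = b v"
    using gibbs_term(2)[of "a v" "b v"] assms v by auto
qed

section \<open>Entropy of finite-valued random variables\<close>

context shift_space
begin

text \<open>Partitions are handled as level sets of finite-valued maps: refinement becomes pairing,
  and coarsening or shifting becomes composition.\<close>

definition finite_rv :: "(seq \<Rightarrow> 'v) \<Rightarrow> bool" where
  "finite_rv G \<longleftrightarrow> finite (G ` X) \<and> (\<forall>v. {x \<in> X. G x = v} \<in> sets BX)"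

definition pr :: "seq measure \<Rightarrow> (seq \<Rightarrow> 'v) \<Rightarrow> 'v \<Rightarrow> real" where
  "pr \<nu> G v = measure \<nu> {x \<in> X. G x = v}"

definition rv_entropy :: "seq measure \<Rightarrow> (seq \<Rightarrow> 'v) \<Rightarrow> real" where
  "rv_entropy \<nu> G = - (\<Sum>v\<in>G ` X. pr \<nu> G v * ln (pr \<nu> G v))"

definition fibres :: "(seq \<Rightarrow> 'v) \<Rightarrow> seq set set" where
  "fibres G = (\<lambda>v. {x \<in> X. G x = v}) ` G ` X"

definition block_entropy :: "seq measure \<Rightarrow> nat \<Rightarrow> real" where
  "block_entropy \<nu> n = - (\<Sum>u\<in>words d n. cp \<nu> u * ln (cp \<nu> u))"

lemma finite_rv_comp:
  assumes "finite_rv G"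
  shows "finite_rv (\<lambda>x. h (G x))"
proof -
  have "{x \<in> X. h (G x) = v} = (\<Union>w\<in>{w\<in>G ` X. h w = v}. {x \<in> X. G x = w})" for v
    by auto
  moreover have "(\<Union>w\<in>{w\<in>G ` X. h w = v}. {x \<in> X. G x = w}) \<in> sets BX" for v
    using assms by (intro sets.finite_UN) (auto simp: finite_rv_def)
  moreover have "(\<lambda>x. h (G x)) ` X = h ` G ` X"
    by auto
  ultimately show ?thesis
    using assms by (simp add: finite_rv_def)
qed

lemma finite_rv_Pair:
  assumes "finite_rv F" "finite_rv G"
  shows "finite_rv (\<lambda>x. (F x, G x))"
proof -
  have "(\<lambda>x. (F x, G x)) ` X \<subseteq> F ` X \<times> G ` X"
    by auto
  then have "finite ((\<lambda>x. (F x, G x)) ` X)"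
    using assms by (rule_tac finite_subset) (auto simp: finite_rv_def)
  moreover have "{x \<in> X. (F x, G x) = v} = {x \<in> X. F x = fst v} \<inter> {x \<in> X. G x = snd v}" for v
    by auto
  moreover have "{x \<in> X. F x = v} \<inter> {x \<in> X. G x = w} \<in> sets BX" for v w
    using assms by (intro sets.Int) (auto simp: finite_rv_def)
  ultimately show ?thesis
    by (simp add: finite_rv_def)
qed

lemma finite_rv_restrict:
  fixes n :: nat
  assumes "\<And>i. i < n \<Longrightarrow> finite_rv (F i)"
  shows "finite_rv (\<lambda>x. \<lambda>i\<in>{..<n}. F i x)"
proof -
  have "(\<lambda>x. \<lambda>i\<in>{..<n}. F i x) ` X \<subseteq> (\<Pi>\<^sub>E i\<in>{..<n}. F i ` X)"
    by (intro image_subsetI restrict_PiE) auto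
  then have "finite ((\<lambda>x. \<lambda>i\<in>{..<n}. F i x) ` X)"
    using assms by (rule_tac finite_subset[OF _ finite_PiE]) (auto simp: finite_rv_def)
  moreover have "{x \<in> X. (\<lambda>i\<in>{..<n}. F i x) = v} \<in> sets BX" for v
  proof (cases "v \<in> extensional {..<n}")
    case True
    then have "{x \<in> X. (\<lambda>i\<in>{..<n}. F i x) = v} = {x \<in> X. \<forall>i\<in>{..<n}. x \<in> {x \<in> X. F i x = v i}}"
      by (auto simp: fun_eq_iff restrict_def extensional_def)
    also have "\<dots> \<in> sets BX"
    proof -
      have "{x \<in> space BX. \<forall>i\<in>{..<n}. x \<in> {x \<in> X. F i x = v i}} \<in> sets BX"
      proof (rule sets.sets_Collect_finite_All)
        fix i assume "i \<in> {..<n}"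
        moreover have "{x \<in> space BX. x \<in> {x \<in> X. F i x = v i}} = {x \<in> X. F i x = v i}"
          by auto
        ultimately show "{x \<in> space BX. x \<in> {x \<in> X. F i x = v i}} \<in> sets BX"
          using assms by (auto simp: finite_rv_def)
      qed simp
      then show ?thesis
        by simp
    qed
    finally show ?thesis .
  next
    case False
    then have "{x \<in> X. (\<lambda>i\<in>{..<n}. F i x) = v} = {}"
      by auto
    then show ?thesis
      by (metis sets.empty_sets)
  qed
  ultimately show ?thesis
    by (simp add: finite_rv_def)
qed

lemma shift_pow_measurable: "prob_on \<nu> \<Longrightarrow> (shift_map ^^ i) \<in> measurable \<nu> \<nu>"
proof (induction i)
  case (Suc i)
  then show ?case
    using measurable_comp[OF Suc.IH shift_measurable] by (simp only: funpow.simps(2))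
qed (simp add: id_def)

lemma finite_rv_shift:
  assumes "prob_on \<nu>" "finite_rv G"
  shows "finite_rv (\<lambda>x. G ((shift_map ^^ i) x))"
proof -
  have "(\<lambda>x. G ((shift_map ^^ i) x)) ` X \<subseteq> G ` X"
    using shift_pow_closed by auto
  then have "finite ((\<lambda>x. G ((shift_map ^^ i) x)) ` X)"
    using assms by (rule_tac finite_subset) (auto simp: finite_rv_def)
  moreover have "{x \<in> X. G ((shift_map ^^ i) x) = v} \<in> sets BX" for v
  proof -
    have "(shift_map ^^ i) -` {x \<in> X. G x = v} \<inter> space \<nu> \<in> sets \<nu>"
      using assms by (intro measurable_sets[OF shift_pow_measurable]) (auto simp: finite_rv_def prob_on_sets)
    moreover have "(shift_map ^^ i) -` {x \<in> X. G x = v} \<inter> space \<nu> = {x \<in> X. G ((shift_map ^^ i) x) = v}"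
      using shift_pow_closed assms(1) by (auto simp: prob_on_space)
    ultimately show ?thesis
      using assms(1) by (simp add: prob_on_sets)
  qed
  ultimately show ?thesis
    by (simp add: finite_rv_def)
qed

lemma prefix_fibre: "{x \<in> X. prefix n x = u} = (if length u = n then cyl u else {})"
  by (auto simp: cyl_def)

lemma finite_rv_prefix: "finite_rv (prefix n)"
  unfolding finite_rv_def
proof (intro conjI allI)
  show "finite (prefix n ` X)"
    using prefix_words by (intro finite_subset[OF _ finite_words[of d n]]) auto
  show "{x \<in> X. prefix n x = v} \<in> sets BX" for v
    using cyl_sets_BX by (simp add: prefix_fibre)
qed

lemma integral_finite_rv:
  fixes f :: "'v \<Rightarrow> real"
  assumes \<nu>: "prob_on \<nu>" and G: "finite_rv G"
  shows "(\<integral>x. f (G x) \<partial>\<nu>) = (\<Sum>v\<in>G ` X. f v * pr \<nu> G v)"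
    and "integrable \<nu> (\<lambda>x. f (G x))"
proof -
  let ?A = "\<lambda>v. {x \<in> X. G x = v}"
  have A: "?A v \<in> sets \<nu>" for v
    using \<nu> G by (simp add: finite_rv_def prob_on_sets)
  have eq: "f (G x) = (\<Sum>v\<in>G ` X. f v * indicator (?A v) x)" if "x \<in> space \<nu>" for x
  proof -
    have x: "x \<in> X"
      using that \<nu> by (simp add: prob_on_space)
    have "(\<Sum>v\<in>G ` X. f v * indicator (?A v) x) = (\<Sum>v\<in>G ` X. if v = G x then f v else 0)"
      using x by (intro sum.cong) (auto simp: indicator_def)
    then show ?thesis
      using G x by (simp add: finite_rv_def)
  qed
  have int: "integrable \<nu> (\<lambda>x. f v * indicator (?A v) x)" for v
    using A \<nu> finite_measure.emeasure_finite[of \<nu>]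
    by (intro integrable_mult_right integrable_real_indicator) (auto simp: prob_on_finite less_top[symmetric])
  then show "integrable \<nu> (\<lambda>x. f (G x))"
    by (subst Bochner_Integration.integrable_cong[OF refl eq]) (auto intro!: Bochner_Integration.integrable_sum)
  have "(\<integral>x. f (G x) \<partial>\<nu>) = (\<integral>x. (\<Sum>v\<in>G ` X. f v * indicator (?A v) x) \<partial>\<nu>)"
    by (rule Bochner_Integration.integral_cong) (simp_all add: eq)
  also have "\<dots> = (\<Sum>v\<in>G ` X. \<integral>x. f v * indicator (?A v) x \<partial>\<nu>)"
    using int by (intro Bochner_Integration.integral_sum) auto
  also have "\<dots> = (\<Sum>v\<in>G ` X. f v * pr \<nu> G v)"
  proof (intro sum.cong refl)
    fix v
    have "?A v \<inter> space \<nu> = ?A v"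
      using \<nu> by (auto simp: prob_on_space)
    then show "(\<integral>x. f v * indicator (?A v) x \<partial>\<nu>) = f v * pr \<nu> G v"
      using A by (simp add: pr_def)
  qed
  finally show "(\<integral>x. f (G x) \<partial>\<nu>) = (\<Sum>v\<in>G ` X. f v * pr \<nu> G v)" .
qed

lemma pr_nonneg: "pr \<nu> G v \<ge> 0"
  by (simp add: pr_def)

lemma pr_sum:
  assumes "prob_on \<nu>" "finite_rv G"
  shows "(\<Sum>v\<in>G ` X. pr \<nu> G v) = 1"
  using integral_finite_rv(1)[OF assms, of "\<lambda>_. 1"] prob_space.prob_space[OF prob_on_prob[OF assms(1)]]
  by simp

lemma pr_mono:
  assumes "prob_on \<nu>" "finite_rv H" "\<And>x. x \<in> X \<Longrightarrow> G x = v \<Longrightarrow> H x = w"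
  shows "pr \<nu> G v \<le> pr \<nu> H w"
  unfolding pr_def using assms
  by (intro finite_measure.finite_measure_mono) (auto simp: prob_on_finite prob_on_sets finite_rv_def)

lemma pr_shift:
  assumes "\<nu> \<in> Inv" "finite_rv G"
  shows "pr \<nu> (\<lambda>x. G ((shift_map ^^ i) x)) v = pr \<nu> G v"
proof -
  have \<nu>: "prob_on \<nu>"
    using assms by (simp add: inv_prob_on)
  have *: "pr \<nu> G v = (\<integral>x. (if G x = v then 1 else 0) \<partial>\<nu>)" if "finite_rv G" for G :: "seq \<Rightarrow> 'a"
  proof -
    have "(\<integral>x. (if G x = v then 1 else 0) \<partial>\<nu>) = (\<Sum>w\<in>G ` X. (if w = v then 1 else 0) * pr \<nu> G w)"
      by (rule integral_finite_rv[OF \<nu> that])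
    also have "\<dots> = (if v \<in> G ` X then pr \<nu> G v else 0)"
      using that by (simp add: if_distrib[of "\<lambda>x. x * _"] finite_rv_def cong: if_cong)
    also have "\<dots> = pr \<nu> G v"
    proof (cases "v \<in> G ` X")
      case False
      then have "{x \<in> X. G x = v} = {}"
        by auto
      then show ?thesis
        using False by (simp only: pr_def measure_empty if_False)
    qed simp
    finally show ?thesis
      by simp
  qed
  have "(\<lambda>x. if G x = v then 1 else 0 :: real) \<in> borel_measurable \<nu>"
    using integral_finite_rv(2)[OF \<nu> assms(2), of "\<lambda>w. if w = v then 1 else 0"] by (rule borel_measurable_integrable)
  then show ?thesis
    unfolding *[OF assms(2)] *[OF finite_rv_shift[OF \<nu> assms(2)]] by (rule integral_shift_pow[OF assms(1)])
qed

lemma rv_entropy_integral: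
  "prob_on \<nu> \<Longrightarrow> finite_rv G \<Longrightarrow> rv_entropy \<nu> G = - (\<integral>x. ln (pr \<nu> G (G x)) \<partial>\<nu>)"
  using integral_finite_rv(1)[of \<nu> G "\<lambda>v. ln (pr \<nu> G v)"] by (simp add: rv_entropy_def mult.commute)

lemma rv_entropy_nonneg:
  assumes "prob_on \<nu>"
  shows "rv_entropy \<nu> G \<ge> 0"
proof -
  have "pr \<nu> G v * ln (pr \<nu> G v) \<le> 0" for v
  proof (cases "pr \<nu> G v = 0")
    case False
    then have "0 < pr \<nu> G v" "pr \<nu> G v \<le> 1"
      using pr_nonneg[of \<nu> G v] prob_space.prob_le_1[OF prob_on_prob[OF assms]]
      by (auto simp: pr_def zero_less_measure_iff)
    then show ?thesis
      by (intro mult_nonneg_nonpos) auto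
  qed simp
  then show ?thesis
    by (simp add: rv_entropy_def sum_nonpos)
qed

text \<open>The working tool for upper bounds: exhibit a subprobability model \<open>q\<close> of
  the values and integrate the negative logarithm of its weights.\<close>

lemma rv_entropy_le:
  assumes \<nu>: "prob_on \<nu>" and G: "finite_rv G"
    and q: "\<And>v. v \<in> G ` X \<Longrightarrow> q v \<ge> 0" "(\<Sum>v\<in>G ` X. q v) \<le> 1"
      "\<And>v. v \<in> G ` X \<Longrightarrow> pr \<nu> G v > 0 \<Longrightarrow> q v > 0"
  shows "rv_entropy \<nu> G \<le> - (\<integral>x. ln (q (G x)) \<partial>\<nu>)"
proof -
  have "(\<Sum>v\<in>G ` X. pr \<nu> G v * ln (q v)) \<le> (\<Sum>v\<in>G ` X. pr \<nu> G v * ln (pr \<nu> G v))"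
    by (rule gibbs_inequality(1)) (use pr_sum[OF \<nu> G] q G in \<open>auto simp: finite_rv_def pr_nonneg\<close>)
  then show ?thesis
    using integral_finite_rv(1)[OF \<nu> G, of "\<lambda>v. ln (q v)"] by (simp add: rv_entropy_def mult.commute)
qed

text \<open>A fibre of the coarser map contains one of \<open>G\<close> and is at least as likely;
  the logarithms are averaged against the law of \<open>G\<close>.\<close>

lemma rv_entropy_comp_le:
  assumes \<nu>: "prob_on \<nu>" and G: "finite_rv G"
  shows "rv_entropy \<nu> (\<lambda>x. h (G x)) \<le> rv_entropy \<nu> G"
proof -
  let ?H = "\<lambda>x. h (G x)"
  have H: "finite_rv ?H"
    by (rule finite_rv_comp[OF G])
  have "rv_entropy \<nu> ?H = - (\<Sum>v\<in>G ` X. ln (pr \<nu> ?H (h v)) * pr \<nu> G v)"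
    using rv_entropy_integral[OF \<nu> H] integral_finite_rv(1)[OF \<nu> G, of "\<lambda>v. ln (pr \<nu> ?H (h v))"] by simp
  also have "\<dots> \<le> - (\<Sum>v\<in>G ` X. ln (pr \<nu> G v) * pr \<nu> G v)"
  proof (intro le_imp_neg_le sum_mono)
    fix v
    show "ln (pr \<nu> G v) * pr \<nu> G v \<le> ln (pr \<nu> ?H (h v)) * pr \<nu> G v"
    proof (cases "pr \<nu> G v = 0")
      case False
      then have "0 < pr \<nu> G v"
        using pr_nonneg[of \<nu> G v] by simp
      then show ?thesis
        using pr_mono[OF \<nu> H, of G v "h v"] by (intro mult_right_mono) auto
    qed simp
  qed
  finally show ?thesis
    by (simp add: rv_entropy_def mult.commute)
qed

lemma rv_entropy_prefix: "rv_entropy \<nu> (prefix n) = block_entropy \<nu> n"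
proof -
  have pr: "pr \<nu> (prefix n) u = cp \<nu> u" if "u \<in> words d n" for u
    using words_length[OF that] by (simp add: pr_def cp_def prefix_fibre)
  have "(\<Sum>u\<in>prefix n ` X. pr \<nu> (prefix n) u * ln (pr \<nu> (prefix n) u)) =
      (\<Sum>u\<in>prefix n ` X. cp \<nu> u * ln (cp \<nu> u))"
    by (intro sum.cong) (auto simp: pr prefix_words)
  also have "\<dots> = (\<Sum>u\<in>words d n. cp \<nu> u * ln (cp \<nu> u))"
  proof (intro sum.mono_neutral_left finite_words ballI)
    fix u assume u: "u \<in> words d n - prefix n ` X"
    have "x \<notin> cyl u" for x
      using u words_length[of u d n] by (metis DiffD1 DiffD2 imageI mem_cyl_iff)
    then have "cyl u = {}"
      by blast
    then show "cp \<nu> u * ln (cp \<nu> u) = 0"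
      by (simp add: cp_empty)
  qed (use prefix_words in auto)
  finally show ?thesis
    by (simp add: rv_entropy_def block_entropy_def)
qed

lemma partition_entropy_fibres: "partition_entropy \<nu> (fibres G) = rv_entropy \<nu> G"
proof -
  have "inj_on (\<lambda>v. {x \<in> X. G x = v}) (G ` X)"
    by (auto simp: inj_on_def)
  then show ?thesis
    by (simp add: partition_entropy_def fibres_def rv_entropy_def sum.reindex pr_def)
qed

section \<open>From iterated partitions to itineraries\<close>

definition itinerary :: "(seq \<Rightarrow> 'v) \<Rightarrow> nat \<Rightarrow> seq \<Rightarrow> nat \<Rightarrow> 'v" where
  "itinerary F n x = (\<lambda>i\<in>{..<n}. F ((shift_map ^^ i) x))"

lemma finite_rv_itinerary: "prob_on \<nu> \<Longrightarrow> finite_rv F \<Longrightarrow> finite_rv (itinerary F n)"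
  unfolding itinerary_def by (intro finite_rv_restrict finite_rv_shift)

lemma pullback_fibres:
  assumes "space \<nu> = X"
  shows "pullback_partition \<nu> (shift_map ^^ i) (fibres F) = fibres (\<lambda>x. F ((shift_map ^^ i) x))"
proof (intro equalityI subsetI)
  fix p assume "p \<in> pullback_partition \<nu> (shift_map ^^ i) (fibres F)"
  then obtain v where v: "p = (shift_map ^^ i) -` {x \<in> X. F x = v} \<inter> X" "p \<noteq> {}"
    using assms by (auto simp: pullback_partition_def fibres_def)
  then have "p = {x \<in> X. F ((shift_map ^^ i) x) = v}"
    using shift_pow_closed by auto
  then show "p \<in> fibres (\<lambda>x. F ((shift_map ^^ i) x))"
    using v(2) by (auto simp: fibres_def)
next
  fix p assume "p \<in> fibres (\<lambda>x. F ((shift_map ^^ i) x))"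
  then obtain y where y: "y \<in> X" "p = {x \<in> X. F ((shift_map ^^ i) x) = F ((shift_map ^^ i) y)}"
    by (auto simp: fibres_def)
  then have "p = (shift_map ^^ i) -` {x \<in> X. F x = F ((shift_map ^^ i) y)} \<inter> X"
    using shift_pow_closed by auto
  moreover have "{x \<in> X. F x = F ((shift_map ^^ i) y)} \<in> fibres F"
    using shift_pow_closed[OF y(1)] by (auto simp: fibres_def)
  ultimately show "p \<in> pullback_partition \<nu> (shift_map ^^ i) (fibres F)"
    unfolding pullback_partition_def assms using y by (intro DiffI image_eqI) auto
qed

lemma fibres_memI: "x \<in> X \<Longrightarrow> {y \<in> X. G y = G x} \<in> fibres G"
  by (auto simp: fibres_def)

lemma fibres_memD: "S \<in> fibres G \<Longrightarrow> x \<in> S \<Longrightarrow> S = {y \<in> X. G y = G x}"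
  by (auto simp: fibres_def)

lemma restrict_eq_iff:
  fixes n :: nat
  shows "(\<lambda>i\<in>{..<n}. f i) = (\<lambda>i\<in>{..<n}. g i) \<longleftrightarrow> (\<forall>i\<in>{..<n}. f i = g i)"
  by (auto simp: fun_eq_iff restrict_def)

text \<open>The case \<open>n = 0\<close> is excluded because an empty intersection is the whole
  type and not \<open>X\<close>.\<close>

lemma common_refinement_fibres:
  fixes F :: "nat \<Rightarrow> seq \<Rightarrow> 'v"
  assumes "n \<ge> 1"
  shows "common_refinement ((\<lambda>i. fibres (F i)) ` {..<n}) = fibres (\<lambda>x. \<lambda>i\<in>{..<n}. F i x)"
proof -
  have block: "{y \<in> X. (\<lambda>i\<in>{..<n}. F i y) = (\<lambda>i\<in>{..<n}. F i x)} = (\<Inter>i\<in>{..<n}. {y \<in> X. F i y = F i x})" for x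
  proof -
    have "0 \<in> {..<n}"
      using assms by simp
    then show ?thesis
      unfolding restrict_eq_iff by blast
  qed
  show ?thesis
  proof (intro equalityI subsetI)
    fix S assume "S \<in> common_refinement ((\<lambda>i. fibres (F i)) ` {..<n})"
    then obtain f where f: "f \<in> (\<Pi> P\<in>(\<lambda>i. fibres (F i)) ` {..<n}. P)"
        "S = (\<Inter>i\<in>{..<n}. f (fibres (F i)))" "S \<noteq> {}"
      by (auto simp: common_refinement)
    then obtain x where x: "x \<in> S"
      by blast
    have fi: "f (fibres (F i)) = {y \<in> X. F i y = F i x}" if "i < n" for i
    proof -
      have "f (fibres (F i)) \<in> fibres (F i)"
        using f(1) that by auto
      moreover have "x \<in> f (fibres (F i))"
        using f(2) x that by auto
      ultimately show ?thesis
        by (rule fibres_memD)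
    qed
    then have "S = {y \<in> X. (\<lambda>i\<in>{..<n}. F i y) = (\<lambda>i\<in>{..<n}. F i x)}"
      unfolding block f(2) by auto
    moreover have "x \<in> X"
    proof -
      have "x \<in> f (fibres (F 0))"
        using x f(2) assms by auto
      then show ?thesis
        using fi[of 0] assms by simp
    qed
    ultimately show "S \<in> fibres (\<lambda>x. \<lambda>i\<in>{..<n}. F i x)"
      using fibres_memI[of x "\<lambda>x. \<lambda>i\<in>{..<n}. F i x"] by simp
  next
    fix S assume "S \<in> fibres (\<lambda>x. \<lambda>i\<in>{..<n}. F i x)"
    then obtain x where x: "x \<in> X" "S = {y \<in> X. (\<lambda>i\<in>{..<n}. F i y) = (\<lambda>i\<in>{..<n}. F i x)}"
      by (auto simp: fibres_def)
    define f where "f P = \<Union>{p\<in>P. x \<in> p}" for P :: "seq set set"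
    have fi: "f (fibres (F i)) = {y \<in> X. F i y = F i x}" for i
      using x(1) by (auto simp: f_def fibres_def)
    have "f \<in> (\<Pi> P\<in>(\<lambda>i. fibres (F i)) ` {..<n}. P)"
      using fi fibres_memI[OF x(1)] by auto
    moreover have "S = \<Inter> (f ` (\<lambda>i. fibres (F i)) ` {..<n})"
      unfolding x(2) block by (simp add: image_image fi)
    moreover have "S \<noteq> {}"
      using x by auto
    ultimately show "S \<in> common_refinement ((\<lambda>i. fibres (F i)) ` {..<n})"
      unfolding common_refinement by blast
  qed
qed

lemma partition_entropy_iterated:
  assumes "prob_on \<nu>" "n \<ge> 1"
  shows "partition_entropy \<nu> (iterated_partition \<nu> shift_map (fibres F) n) = rv_entropy \<nu> (itinerary F n)"
  using common_refinement_fibres[OF assms(2), of "\<lambda>i x. F ((shift_map ^^ i) x)"]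
  by (simp add: iterated_partition_def pullback_fibres prob_on_space[OF assms(1)] partition_entropy_fibres itinerary_def[abs_def])

lemma partition_fibres:
  assumes "partition_on X P"
  shows "fibres (\<lambda>x. THE p. p \<in> P \<and> x \<in> p) = P"
    and "\<And>p. p \<in> P \<Longrightarrow> {x \<in> X. (THE p. p \<in> P \<and> x \<in> p) = p} = p"
proof -
  have the: "(THE p. p \<in> P \<and> x \<in> p) = p" if "p \<in> P" "x \<in> p" for x p
    using that assms by (intro the_equality) (auto simp: partition_on_def disjoint_def)
  have ex: "\<exists>p\<in>P. x \<in> p" if "x \<in> X" for x
    using that assms by (auto simp: partition_on_def)
  show fib: "{x \<in> X. (THE p. p \<in> P \<and> x \<in> p) = p} = p" if "p \<in> P" for p
    using the ex assms that by (auto simp: partition_on_def)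
  have "(\<lambda>x. THE p. p \<in> P \<and> x \<in> p) ` X = P"
  proof (intro equalityI subsetI)
    fix p assume p: "p \<in> P"
    then have "p \<noteq> {}" "p \<subseteq> X"
      using assms by (auto simp: partition_on_def)
    then obtain x where "x \<in> p" "x \<in> X"
      by blast
    then show "p \<in> (\<lambda>x. THE p. p \<in> P \<and> x \<in> p) ` X"
      using the[OF p] by force
  qed (use the ex in force)
  then show "fibres (\<lambda>x. THE p. p \<in> P \<and> x \<in> p) = P"
    using fib by (simp add: fibres_def)
qed

lemma AE_pr_pos:
  assumes p: "prob_on \<nu>" and H: "finite_rv H"
  shows "AE x in \<nu>. pr \<nu> H (H x) > 0"
proof -
  have "AE x in \<nu>. \<forall>v\<in>{v\<in>H ` X. pr \<nu> H v = 0}. x \<notin> {x \<in> X. H x = v}"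
  proof (rule AE_finite_allI)
    show "finite {v\<in>H ` X. pr \<nu> H v = 0}"
      using H by (simp add: finite_rv_def)
    fix v assume "v \<in> {v\<in>H ` X. pr \<nu> H v = 0}"
    then have "emeasure \<nu> {x \<in> X. H x = v} = 0"
      using p by (simp add: pr_def finite_measure.emeasure_eq_measure prob_on_finite)
    then have "{x \<in> X. H x = v} \<in> null_sets \<nu>"
      using H p by (auto simp: finite_rv_def prob_on_sets)
    then show "AE x in \<nu>. x \<notin> {x \<in> X. H x = v}"
      by (rule AE_not_in)
  qed
  moreover have "AE x in \<nu>. x \<in> X"
    using p by (auto simp: prob_on_space[symmetric])
  ultimately show ?thesis
    by eventually_elim (use pr_nonneg[of \<nu> H] in \<open>force simp: less_le\<close>)
qed

text \<open>The model makes the first \<open>m\<close> and the last \<open>n\<close> entries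
  independent, each with its own law. Two halves determine the whole, so this is a subprobability,
  and invariance gives the second half the law of an unshifted itinerary.\<close>

lemma rv_entropy_itinerary_subadditive:
  assumes \<nu>: "\<nu> \<in> Inv" and F: "finite_rv F"
  shows "rv_entropy \<nu> (itinerary F (m + n)) \<le> rv_entropy \<nu> (itinerary F m) + rv_entropy \<nu> (itinerary F n)"
proof -
  let ?G = "itinerary F"
  have p: "prob_on \<nu>"
    by (rule inv_prob_on[OF \<nu>])
  have G: "finite_rv (?G n)" for n
    by (rule finite_rv_itinerary[OF p F])
  define L where "L \<phi> = (\<lambda>i\<in>{..<m}. \<phi> i)" for \<phi> :: "nat \<Rightarrow> 'a"
  define R where "R \<phi> = (\<lambda>i\<in>{..<n}. \<phi> (m + i))" for \<phi> :: "nat \<Rightarrow> 'a"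
  have LG: "L (?G (m + n) x) = ?G m x" for x
    by (auto simp: L_def itinerary_def fun_eq_iff)
  have RG: "R (?G (m + n) x) = ?G n ((shift_map ^^ m) x)" for x
    by (auto simp: R_def itinerary_def fun_eq_iff funpow_add funpow_swap1 add.commute[of m] o_def)
  define q where "q \<phi> = pr \<nu> (?G m) (L \<phi>) * pr \<nu> (?G n) (R \<phi>)" for \<phi>
  have "rv_entropy \<nu> (?G (m + n)) \<le> - (\<integral>x. ln (q (?G (m + n) x)) \<partial>\<nu>)"
  proof (rule rv_entropy_le[OF p G])
    show "q v \<ge> 0" for v
      by (simp add: q_def pr_nonneg)
    have inj: "inj_on (\<lambda>\<phi>. (L \<phi>, R \<phi>)) (?G (m + n) ` X)"
    proof (rule inj_onI)
      fix \<phi> \<psi> assume A: "\<phi> \<in> ?G (m + n) ` X" "\<psi> \<in> ?G (m + n) ` X" "(L \<phi>, R \<phi>) = (L \<psi>, R \<psi>)"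
      have "\<phi> i = \<psi> i" for i
      proof -
        consider "i < m" | "m \<le> i" "i < m + n" | "i \<ge> m + n"
          by linarith
        then show ?thesis
        proof cases
          case 1
          then show ?thesis
            using A(3) by (auto simp: L_def fun_eq_iff restrict_def split: if_splits dest: spec[of _ i])
        next
          case 2
          then have "R \<phi> (i - m) = R \<psi> (i - m)" "i - m < n" "m + (i - m) = i"
            using A(3) by auto
          then show ?thesis
            by (simp add: R_def)
        next
          case 3
          then show ?thesis
            using A(1,2) by (auto simp: itinerary_def)
        qed
      qed
      then show "\<phi> = \<psi>"
        by (rule ext)
    qed
    have "(\<Sum>\<phi>\<in>?G (m + n) ` X. q \<phi>) = (\<Sum>(v, w)\<in>(\<lambda>\<phi>. (L \<phi>, R \<phi>)) ` ?G (m + n) ` X. pr \<nu> (?G m) v * pr \<nu> (?G n) w)"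
      by (simp add: sum.reindex[OF inj] q_def)
    also have "\<dots> \<le> (\<Sum>(v, w)\<in>?G m ` X \<times> ?G n ` X. pr \<nu> (?G m) v * pr \<nu> (?G n) w)"
    proof (rule sum_mono2)
      show "finite (?G m ` X \<times> ?G n ` X)"
        using G by (simp add: finite_rv_def)
      show "(\<lambda>\<phi>. (L \<phi>, R \<phi>)) ` ?G (m + n) ` X \<subseteq> ?G m ` X \<times> ?G n ` X"
        using LG RG shift_pow_closed by auto
    qed (auto simp: pr_nonneg)
    also have "\<dots> = (\<Sum>v\<in>?G m ` X. pr \<nu> (?G m) v) * (\<Sum>w\<in>?G n ` X. pr \<nu> (?G n) w)"
      by (simp add: sum_product sum.cartesian_product)
    also have "\<dots> = 1"
      using pr_sum[OF p G] by simp
    finally show "(\<Sum>\<phi>\<in>?G (m + n) ` X. q \<phi>) \<le> 1" .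
  next
    fix \<phi> assume "pr \<nu> (?G (m + n)) \<phi> > 0"
    moreover have "pr \<nu> (?G (m + n)) \<phi> \<le> pr \<nu> (?G m) (L \<phi>)"
      using LG by (intro pr_mono[OF p G]) auto
    moreover have "pr \<nu> (?G (m + n)) \<phi> \<le> pr \<nu> (\<lambda>x. ?G n ((shift_map ^^ m) x)) (R \<phi>)"
      using RG by (intro pr_mono[OF p finite_rv_shift[OF p G]]) auto
    ultimately show "q \<phi> > 0"
      by (simp add: q_def pr_shift[OF \<nu> G])
  qed
  also have "(\<integral>x. ln (q (?G (m + n) x)) \<partial>\<nu>) =
      (\<integral>x. ln (pr \<nu> (?G m) (?G m x)) + ln (pr \<nu> (?G n) (?G n ((shift_map ^^ m) x))) \<partial>\<nu>)"
  proof (rule integral_cong_AE)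
    have "AE x in \<nu>. pr \<nu> (?G n) (?G n ((shift_map ^^ m) x)) > 0"
      using AE_pr_pos[OF p finite_rv_shift[OF p G]] by (simp add: pr_shift[OF \<nu> G])
    with AE_pr_pos[OF p G[of m]] show "AE x in \<nu>. ln (q (?G (m + n) x)) =
        ln (pr \<nu> (?G m) (?G m x)) + ln (pr \<nu> (?G n) (?G n ((shift_map ^^ m) x)))"
      by eventually_elim (simp add: q_def LG RG ln_mult)
    show "(\<lambda>x. ln (q (?G (m + n) x))) \<in> borel_measurable \<nu>"
      using integral_finite_rv(2)[OF p G, of "\<lambda>v. ln (q v)"] by (rule borel_measurable_integrable)
    show "(\<lambda>x. ln (pr \<nu> (?G m) (?G m x)) + ln (pr \<nu> (?G n) (?G n ((shift_map ^^ m) x)))) \<in> borel_measurable \<nu>"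
      using integral_finite_rv(2)[OF p G, of "\<lambda>v. ln (pr \<nu> (?G m) v)"]
        integral_finite_rv(2)[OF p finite_rv_shift[OF p G], of "\<lambda>v. ln (pr \<nu> (?G n) v)"]
      by (intro borel_measurable_add borel_measurable_integrable)
  qed
  also have "\<dots> = (\<integral>x. ln (pr \<nu> (?G m) (?G m x)) \<partial>\<nu>) + (\<integral>x. ln (pr \<nu> (?G n) (?G n ((shift_map ^^ m) x))) \<partial>\<nu>)"
    using integral_finite_rv(2)[OF p G, of "\<lambda>v. ln (pr \<nu> (?G m) v)"]
      integral_finite_rv(2)[OF p finite_rv_shift[OF p G], of "\<lambda>v. ln (pr \<nu> (?G n) v)"]
    by (intro Bochner_Integration.integral_add)
  also have "(\<integral>x. ln (pr \<nu> (?G n) (?G n ((shift_map ^^ m) x))) \<partial>\<nu>) = (\<integral>x. ln (pr \<nu> (?G n) (?G n x)) \<partial>\<nu>)"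
    using integral_finite_rv(2)[OF p G, of "\<lambda>v. ln (pr \<nu> (?G n) v)"]
    by (intro integral_shift_pow[OF \<nu>] borel_measurable_integrable)
  finally show ?thesis
    by (simp add: rv_entropy_integral[OF p G])
qed

text \<open>The definition uses \<open>lim\<close>, which says something only once convergence is
  known; Fekete's lemma supplies it. At \<open>n = 0\<close> both quotients are 0 by the convention
  for division, so the sequences agree everywhere.\<close>

lemma entropy_of_partition_lim:
  assumes \<nu>: "\<nu> \<in> Inv" and F: "finite_rv F"
  shows "(\<lambda>n. rv_entropy \<nu> (itinerary F n) / real n) \<longlonglongrightarrow> entropy_of_partition \<nu> shift_map (fibres F)"
proof -
  have p: "prob_on \<nu>"
    by (rule inv_prob_on[OF \<nu>])
  have "convergent (\<lambda>n. rv_entropy \<nu> (itinerary F n) / real n)"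
    by (intro fekete rv_entropy_nonneg rv_entropy_itinerary_subadditive p \<nu> F)
  then have lim: "(\<lambda>n. rv_entropy \<nu> (itinerary F n) / real n) \<longlonglongrightarrow> lim (\<lambda>n. rv_entropy \<nu> (itinerary F n) / real n)"
    by (simp add: convergent_LIMSEQ_iff)
  have "(\<lambda>n. rv_entropy \<nu> (itinerary F n) / real n) =
      (\<lambda>n. partition_entropy \<nu> (iterated_partition \<nu> shift_map (fibres F) n) / real n)"
  proof
    fix n :: nat
    show "rv_entropy \<nu> (itinerary F n) / real n =
        partition_entropy \<nu> (iterated_partition \<nu> shift_map (fibres F) n) / real n"
      using partition_entropy_iterated[OF p, of n F] by (cases "n = 0") auto
  qed
  then show ?thesis
    using lim by (simp add: entropy_of_partition_def)
qed

end

lemma ln_prod_pos: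
  fixes f :: "'i \<Rightarrow> real"
  assumes "\<And>i. i \<in> I \<Longrightarrow> f i > 0"
  shows "ln (\<Prod>i\<in>I. f i) = (\<Sum>i\<in>I. ln (f i))"
  using assms
proof (induction I rule: infinite_finite_induct)
  case (insert i I)
  then have "(\<Prod>i\<in>I. f i) > 0"
    by (intro prod_pos) auto
  then show ?case
    using insert by (simp add: ln_mult_pos)
qed auto

section \<open>Kolmogorov-Sinai entropy and conditional block entropies\<close>

context shift_space
begin

lemma prefix_set_measurable:
  assumes "prob_on \<nu>"
  shows "{x \<in> X. prefix N x \<in> U} \<in> sets \<nu>"
proof -
  have "(\<lambda>x. prefix N x) -` U \<inter> space \<nu> \<in> sets \<nu>"
    using measurable_prefix[OF assms] by (rule measurable_sets) simp
  moreover have "(\<lambda>x. prefix N x) -` U \<inter> space \<nu> = {x \<in> X. prefix N x \<in> U}"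
    using assms by (auto simp: prob_on_space)
  ultimately show ?thesis
    by simp
qed

definition approx_error :: "seq set \<Rightarrow> nat \<Rightarrow> nat list set \<Rightarrow> seq set" where
  "approx_error B N U = {x \<in> X. (x \<in> B) \<noteq> (prefix N x \<in> U)}"

lemma approx_error_measurable:
  assumes "prob_on \<nu>" "B \<in> sets BX"
  shows "approx_error B N U \<in> sets \<nu>"
proof -
  have "B \<subseteq> X"
    using sets.sets_into_space[OF assms(2)] by simp
  then have "approx_error B N U = (B - {x \<in> X. prefix N x \<in> U}) \<union> ({x \<in> X. prefix N x \<in> U} - B)"
    by (auto simp: approx_error_def)
  then show ?thesis
    using assms prefix_set_measurable[OF assms(1), of N U] by (simp add: prob_on_sets sets.Un sets.Diff)
qed

text \<open>The approximable sets form a sigma-algebra: a countable union is cut to finitely many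
  terms by continuity of the measure, and these are approximated simultaneously.\<close>

lemma cylinder_approximation:
  assumes \<nu>: "prob_on \<nu>" and B: "B \<in> sets BX" and "e > 0"
  shows "\<exists>N U. measure \<nu> (approx_error B N U) < e"
proof -
  interpret \<nu>: prob_space \<nu>
    by (rule prob_on_prob[OF \<nu>])
  have "B \<in> sigma_sets X (range cyl)"
    using B by (simp add: sets_BX)
  then have "\<forall>e>0. \<exists>N U. measure \<nu> (approx_error B N U) < e"
  proof induction
    case (Basic B)
    then obtain u where "B = cyl u"
      by blast
    then have "approx_error B (length u) {u} = {}"
      by (auto simp: approx_error_def cyl_def)
    then show ?case
      by (metis measure_empty)
  next
    case Empty
    have "approx_error {} 0 {} = {}"
      by (auto simp: approx_error_def)
    then show ?case
      by (metis measure_empty)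
  next
    case (Compl B)
    have "approx_error (X - B) N (- U) = approx_error B N U" for N U
      by (auto simp: approx_error_def)
    then show ?case
      using Compl.IH by metis
  next
    case (Union A)
    show ?case
    proof (intro allI impI)
      fix e :: real assume "e > 0"
      let ?B = "\<lambda>n. \<Union>i<n. A i"
      have A: "A i \<in> sets \<nu>" for i
        using Union.hyps \<nu> by (simp add: prob_on_sets sets_BX)
      have "(\<lambda>n. measure \<nu> (?B n)) \<longlonglongrightarrow> measure \<nu> (\<Union>n. ?B n)"
        using A by (intro \<nu>.finite_Lim_measure_incseq) (force simp: incseq_def intro: less_le_trans)+
      moreover have "(\<Union>n. ?B n) = (\<Union>i. A i)"
        by auto
      ultimately have "(\<lambda>n. measure \<nu> (?B n)) \<longlonglongrightarrow> measure \<nu> (\<Union>i. A i)"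
        by simp
      then have "\<forall>\<^sub>F n in sequentially. measure \<nu> (?B n) > measure \<nu> (\<Union>i. A i) - e / 2"
        using \<open>e > 0\<close> by (intro order_tendstoD(1)) auto
      then obtain n where n: "measure \<nu> (?B n) > measure \<nu> (\<Union>i. A i) - e / 2"
        using eventually_happens' sequentially_bot by blast
      \<comment> \<open>The errors of \<open>n\<close> sets must add up to at most
        \<open>e / 2\<close>; the summand 1 covers \<open>n = 0\<close>.\<close>
      have "\<forall>i. \<exists>N U. measure \<nu> (approx_error (A i) N U) < e / (2 * (real n + 1))"
        using Union.IH \<open>e > 0\<close> by simp
      then obtain N U where NU: "\<And>i. measure \<nu> (approx_error (A i) (N i) (U i)) < e / (2 * (real n + 1))"
        by metis
      define M where "M = (\<Sum>i<n. N i)"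
      have M: "N i \<le> M" if "i < n" for i
        unfolding M_def using that by (intro member_le_sum) auto
      define W where "W = {w. \<exists>i<n. take (N i) w \<in> U i}"
      have W: "prefix M x \<in> W \<longleftrightarrow> (\<exists>i<n. prefix (N i) x \<in> U i)" for x
        using take_prefix[OF M] by (auto simp: W_def)
      have err: "approx_error (A i) (N i) (U i) \<in> sets \<nu>" for i
        using \<nu> A by (intro approx_error_measurable) (auto simp: prob_on_sets)
      have "approx_error (\<Union>i. A i) M W \<subseteq> ((\<Union>i. A i) - ?B n) \<union> (\<Union>i<n. approx_error (A i) (N i) (U i))"
        unfolding approx_error_def W by auto
      then have "measure \<nu> (approx_error (\<Union>i. A i) M W) \<le>
          measure \<nu> (((\<Union>i. A i) - ?B n) \<union> (\<Union>i<n. approx_error (A i) (N i) (U i)))"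
        using A err by (intro \<nu>.finite_measure_mono) auto
      also have "\<dots> \<le> measure \<nu> ((\<Union>i. A i) - ?B n) + measure \<nu> (\<Union>i<n. approx_error (A i) (N i) (U i))"
        using A err by (intro measure_Un_le) auto
      also have "measure \<nu> ((\<Union>i. A i) - ?B n) = measure \<nu> (\<Union>i. A i) - measure \<nu> (?B n)"
        using A by (intro \<nu>.finite_measure_Diff) auto
      also have "measure \<nu> (\<Union>i<n. approx_error (A i) (N i) (U i)) \<le> (\<Sum>i<n. measure \<nu> (approx_error (A i) (N i) (U i)))"
        using err by (intro \<nu>.finite_measure_subadditive_finite) auto
      also have "\<dots> \<le> (\<Sum>i<n. e / (2 * (real n + 1)))"
        by (intro sum_mono less_imp_le NU)
      also have "\<dots> \<le> e / 2"
        using \<open>e > 0\<close> by (simp add: field_simps)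
      finally show "\<exists>N U. measure \<nu> (approx_error (\<Union>i. A i) N U) < e"
        using n by (intro exI[of _ M] exI[of _ W]) simp
    qed
  qed
  then show ?thesis
    using \<open>e > 0\<close> by blast
qed

text \<open>Each level set is approximated by cylinders. Off the exceptional sets exactly one value
  accepts the prefix, so the choice made in \<open>g\<close> returns \<open>F x\<close>.\<close>

lemma finite_rv_approximation:
  fixes F :: "seq \<Rightarrow> 'v"
  assumes \<nu>: "prob_on \<nu>" and F: "finite_rv F" and "e > 0"
  shows "\<exists>N g. measure \<nu> {x \<in> X. F x \<noteq> g (prefix N x)} < e"
proof -
  interpret \<nu>: prob_space \<nu>
    by (rule prob_on_prob[OF \<nu>])
  define V where "V = F ` X"
  have V: "finite V"
    using F by (simp add: V_def finite_rv_def)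
  let ?A = "\<lambda>v. {x \<in> X. F x = v}"
  have A: "?A v \<in> sets BX" for v
    using F by (simp add: finite_rv_def)
  have "\<forall>v. \<exists>N U. measure \<nu> (approx_error (?A v) N U) < e / (real (card V) + 1)"
    using cylinder_approximation[OF \<nu> A] \<open>e > 0\<close> by simp
  then obtain N U where NU: "\<And>v. measure \<nu> (approx_error (?A v) (N v) (U v)) < e / (real (card V) + 1)"
    by metis
  define M where "M = (\<Sum>v\<in>V. N v)"
  have M: "N v \<le> M" if "v \<in> V" for v
    unfolding M_def using that V by (intro member_le_sum) auto
  define g where "g w = (SOME v. v \<in> V \<and> take (N v) w \<in> U v)" for w
  have err: "approx_error (?A v) (N v) (U v) \<in> sets \<nu>" for v
    by (rule approx_error_measurable[OF \<nu> A])
  have "{x \<in> X. F x \<noteq> g (prefix M x)} \<subseteq> (\<Union>v\<in>V. approx_error (?A v) (N v) (U v))"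
  proof
    fix x assume x: "x \<in> {x \<in> X. F x \<noteq> g (prefix M x)}"
    show "x \<in> (\<Union>v\<in>V. approx_error (?A v) (N v) (U v))"
    proof (rule ccontr)
      assume "\<not> ?thesis"
      then have eq: "prefix (N v) x \<in> U v \<longleftrightarrow> F x = v" if "v \<in> V" for v
        using x that by (auto simp: approx_error_def)
      have "v \<in> V \<and> take (N v) (prefix M x) \<in> U v \<longleftrightarrow> v = F x" for v
        using eq[of v] M[of v] take_prefix[of "N v" M x] x by (auto simp: V_def)
      then have "g (prefix M x) = F x"
        by (simp add: g_def)
      then show False
        using x by simp
    qed
  qed
  then have "measure \<nu> {x \<in> X. F x \<noteq> g (prefix M x)} \<le> measure \<nu> (\<Union>v\<in>V. approx_error (?A v) (N v) (U v))"
    using err V by (intro \<nu>.finite_measure_mono sets.finite_UN) auto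
  also have "\<dots> \<le> (\<Sum>v\<in>V. measure \<nu> (approx_error (?A v) (N v) (U v)))"
    using err V by (intro \<nu>.finite_measure_subadditive_finite) auto
  also have "\<dots> \<le> (\<Sum>v\<in>V. e / (real (card V) + 1))"
    by (intro sum_mono less_imp_le NU)
  also have "\<dots> < e"
    using \<open>e > 0\<close> by (simp add: field_simps)
  finally show ?thesis
    by blast
qed

text \<open>
  The \<open>j\<close>-step Markov approximation of \<open>\<nu>\<close>, whose entropy is the conditional entropy of order \<open>j\<close>.
\<close>

definition markov_weight :: "seq measure \<Rightarrow> nat \<Rightarrow> nat list \<Rightarrow> real" where
  "markov_weight \<nu> j u = cp \<nu> (take j u) *
     (\<Prod>i<length u - j. cp \<nu> (take (Suc j) (drop i u)) / cp \<nu> (take j (drop i u)))"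

lemma markov_weight_nonneg: "markov_weight \<nu> j u \<ge> 0"
  by (auto simp: markov_weight_def cp_nonneg intro!: mult_nonneg_nonneg prod_nonneg divide_nonneg_nonneg)

text \<open>Only an inequality: after a block of probability zero the quotient is 0 by convention,
  and mass may be lost.\<close>

lemma markov_weight_sum_le:
  assumes "prob_on \<nu>"
  shows "(\<Sum>u\<in>words d (j + n). markov_weight \<nu> j u) \<le> 1"
proof (induction n)
  case 0
  have "(\<Sum>u\<in>words d j. markov_weight \<nu> j u) = (\<Sum>u\<in>words d j. cp \<nu> u)"
    by (intro sum.cong) (auto simp: markov_weight_def words_def)
  then show ?case
    using assms by (simp add: cp_sum_words)
next
  case (Suc n)
  have snoc: "markov_weight \<nu> j (u @ [b]) = markov_weight \<nu> j u * (cp \<nu> (drop n u @ [b]) / cp \<nu> (drop n u))"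
    if "length u = j + n" for u b
  proof -
    have "(\<Prod>i<n. cp \<nu> (take (Suc j) (drop i (u @ [b]))) / cp \<nu> (take j (drop i (u @ [b])))) =
        (\<Prod>i<n. cp \<nu> (take (Suc j) (drop i u)) / cp \<nu> (take j (drop i u)))"
      using that by (intro prod.cong) auto
    then show ?thesis
      using that by (simp add: markov_weight_def Suc_diff_le)
  qed
  have "(\<Sum>u\<in>words d (j + Suc n). markov_weight \<nu> j u) =
      (\<Sum>u\<in>words d (j + n). \<Sum>b<d. markov_weight \<nu> j (u @ [b]))"
    by (simp add: sum_words_snoc)
  also have "\<dots> = (\<Sum>u\<in>words d (j + n). \<Sum>b<d. markov_weight \<nu> j u * (cp \<nu> (drop n u @ [b]) / cp \<nu> (drop n u)))"
    by (intro sum.cong refl snoc words_length)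
  also have "\<dots> = (\<Sum>u\<in>words d (j + n). markov_weight \<nu> j u * ((\<Sum>b<d. cp \<nu> (drop n u @ [b])) / cp \<nu> (drop n u)))"
    by (simp add: sum_distrib_left sum_divide_distrib)
  also have "\<dots> \<le> (\<Sum>u\<in>words d (j + n). markov_weight \<nu> j u)"
  proof (rule sum_mono)
    fix u
    show "markov_weight \<nu> j u * ((\<Sum>b<d. cp \<nu> (drop n u @ [b])) / cp \<nu> (drop n u)) \<le> markov_weight \<nu> j u"
      unfolding cp_snoc[OF assms, symmetric] using markov_weight_nonneg[of \<nu> j u] by simp
  qed
  finally show ?case
    using Suc by simp
qed

lemma cp_subword_le:
  assumes "\<nu> \<in> Inv"
  shows "cp \<nu> u \<le> cp \<nu> (take m (drop i u))"
proof -
  have "cp \<nu> u \<le> cp \<nu> (drop i u)"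
    by (rule cp_drop_le[OF assms])
  also have "\<dots> \<le> cp \<nu> (take m (drop i u))"
    using cp_append_le[OF inv_prob_on[OF assms], of "take m (drop i u)" "drop m (drop i u)"]
    by (simp only: append_take_drop_id)
  finally show ?thesis .
qed

lemma markov_weight_pos:
  assumes "\<nu> \<in> Inv" "cp \<nu> u > 0"
  shows "markov_weight \<nu> j u > 0"
proof -
  have pos: "cp \<nu> (take m (drop i u)) > 0" for m i
    using cp_subword_le[OF assms(1), of u m i] assms(2) by simp
  then show ?thesis
    using pos[of j 0] by (auto simp: markov_weight_def intro!: mult_pos_pos prod_pos divide_pos_pos)
qed

lemma AE_cp_pos:
  assumes "prob_on \<nu>"
  shows "AE x in \<nu>. cp \<nu> (prefix n x) > 0"
  using AE_pr_pos[OF assms finite_rv_prefix[of n]] by (simp add: pr_def prefix_fibre cp_def)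

lemma integral_ln_cp:
  assumes "prob_on \<nu>"
  shows "(\<integral>x. ln (cp \<nu> (prefix n x)) \<partial>\<nu>) = - block_entropy \<nu> n"
  using integral_prefix(1)[OF assms, of "\<lambda>u. ln (cp \<nu> u)" n] by (simp add: block_entropy_def mult.commute)

lemma integrable_prefix_shift:
  fixes f :: "nat list \<Rightarrow> real"
  assumes "prob_on \<nu>"
  shows "integrable \<nu> (\<lambda>x. f (prefix n ((shift_map ^^ i) x)))"
  by (rule integral_finite_rv(2)[OF assms finite_rv_shift[OF assms finite_rv_prefix]])

text \<open>The logarithm of the weight is a sum of shifted terms, so by invariance every step
  contributes the same increment of block entropy.\<close>

lemma integral_markov_weight:
  assumes \<nu>: "\<nu> \<in> Inv"
  shows "(\<integral>x. ln (markov_weight \<nu> j (prefix (j + n) x)) \<partial>\<nu>) =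
    - block_entropy \<nu> j - real n * (block_entropy \<nu> (Suc j) - block_entropy \<nu> j)"
proof -
  have p: "prob_on \<nu>"
    by (rule inv_prob_on[OF \<nu>])
  let ?f = "\<lambda>m i x. ln (cp \<nu> (prefix m ((shift_map ^^ i) x)))"
  have int: "integrable \<nu> (?f m i)" for m i
    by (rule integrable_prefix_shift[OF p])
  have "(\<integral>x. ln (markov_weight \<nu> j (prefix (j + n) x)) \<partial>\<nu>) =
      (\<integral>x. ?f j 0 x + (\<Sum>i<n. ?f (Suc j) i x - ?f j i x) \<partial>\<nu>)"
  proof (rule integral_cong_AE)
    show "(\<lambda>x. ln (markov_weight \<nu> j (prefix (j + n) x))) \<in> borel_measurable \<nu>"
      using integral_prefix(2)[OF p, of "\<lambda>u. ln (markov_weight \<nu> j u)"] by (rule borel_measurable_integrable)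
    show "(\<lambda>x. ?f j 0 x + (\<Sum>i<n. ?f (Suc j) i x - ?f j i x)) \<in> borel_measurable \<nu>"
      using int by (intro borel_measurable_add borel_measurable_sum borel_measurable_diff borel_measurable_integrable)
    show "AE x in \<nu>. ln (markov_weight \<nu> j (prefix (j + n) x)) = ?f j 0 x + (\<Sum>i<n. ?f (Suc j) i x - ?f j i x)"
      using AE_cp_pos[OF p, of "j + n"]
    proof eventually_elim
      case (elim x)
      have pos: "cp \<nu> (prefix m ((shift_map ^^ i) x)) > 0" if "i + m \<le> j + n" for m i
        using cp_subword_le[OF \<nu>, of "prefix (j + n) x" m i] elim prefix_shift_pow[OF that, of x] by simp
      have quot: "cp \<nu> (prefix (Suc j) ((shift_map ^^ i) x)) / cp \<nu> (prefix j ((shift_map ^^ i) x)) > 0"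
        if "i < n" for i
        using pos[of i "Suc j"] pos[of i j] that by simp
      have weight: "markov_weight \<nu> j (prefix (j + n) x) = cp \<nu> (prefix j x) *
          (\<Prod>i<n. cp \<nu> (prefix (Suc j) ((shift_map ^^ i) x)) / cp \<nu> (prefix j ((shift_map ^^ i) x)))"
        by (auto simp: markov_weight_def take_prefix prefix_shift_pow intro!: prod.cong)
      have "ln (markov_weight \<nu> j (prefix (j + n) x)) = ln (cp \<nu> (prefix j x)) +
          ln (\<Prod>i<n. cp \<nu> (prefix (Suc j) ((shift_map ^^ i) x)) / cp \<nu> (prefix j ((shift_map ^^ i) x)))"
        unfolding weight using pos[of 0 j] quot by (intro ln_mult_pos prod_pos) auto
      also have "ln (\<Prod>i<n. cp \<nu> (prefix (Suc j) ((shift_map ^^ i) x)) / cp \<nu> (prefix j ((shift_map ^^ i) x))) =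
          (\<Sum>i<n. ln (cp \<nu> (prefix (Suc j) ((shift_map ^^ i) x)) / cp \<nu> (prefix j ((shift_map ^^ i) x))))"
        by (rule ln_prod_pos) (rule quot, simp)
      also have "\<dots> = (\<Sum>i<n. ?f (Suc j) i x - ?f j i x)"
      proof (intro sum.cong refl)
        fix i assume "i \<in> {..<n}"
        then show "ln (cp \<nu> (prefix (Suc j) ((shift_map ^^ i) x)) / cp \<nu> (prefix j ((shift_map ^^ i) x))) =
            ?f (Suc j) i x - ?f j i x"
          using pos[of i "Suc j"] pos[of i j] by (simp add: ln_div)
      qed
      finally show ?case
        by simp
    qed
  qed
  also have "\<dots> = (\<integral>x. ?f j 0 x \<partial>\<nu>) + (\<integral>x. (\<Sum>i<n. ?f (Suc j) i x - ?f j i x) \<partial>\<nu>)"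
    by (intro Bochner_Integration.integral_add Bochner_Integration.integrable_sum Bochner_Integration.integrable_diff int)
  also have "(\<integral>x. (\<Sum>i<n. ?f (Suc j) i x - ?f j i x) \<partial>\<nu>) = (\<Sum>i<n. (\<integral>x. ?f (Suc j) i x - ?f j i x \<partial>\<nu>))"
    by (intro Bochner_Integration.integral_sum Bochner_Integration.integrable_diff int)
  also have "\<dots> = (\<Sum>i<n. (\<integral>x. ?f (Suc j) i x \<partial>\<nu>) - (\<integral>x. ?f j i x \<partial>\<nu>))"
    by (intro sum.cong refl Bochner_Integration.integral_diff int)
  also have "(\<integral>x. ?f j 0 x \<partial>\<nu>) + \<dots> = - block_entropy \<nu> j - real n * (block_entropy \<nu> (Suc j) - block_entropy \<nu> j)"
  proof -
    have "(\<integral>x. ?f m i x \<partial>\<nu>) = - block_entropy \<nu> m" for m i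
      using integral_shift_pow[OF \<nu>, of "\<lambda>x. ln (cp \<nu> (prefix m x))" i] int[of m 0] integral_ln_cp[OF p]
      by (simp add: borel_measurable_integrable)
    then show ?thesis
      using integral_ln_cp[OF p, of j] by (simp add: algebra_simps)
  qed
  finally show ?thesis .
qed

text \<open>The itinerary is modelled together with a prefix: the prefix by the
  \<open>j\<close>-step Markov approximation, and entry \<open>i\<close> of the itinerary by
  \<open>g\<close> of the block at \<open>i\<close> with probability at least
  \<open>1 - \<theta>\<close>, errors being spread evenly over the \<open>c\<close> values. The cost
  per step is the conditional entropy of order \<open>j\<close> plus a term that is small when
  \<open>g\<close> rarely errs.\<close>

lemma itinerary_entropy_le:
  fixes F :: "seq \<Rightarrow> 'v" and g :: "nat list \<Rightarrow> 'v" and N :: nat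
  assumes \<nu>: "\<nu> \<in> Inv" and F: "finite_rv F" and \<theta>: "0 < \<theta>" "\<theta> < 1"
  defines "c \<equiv> real (card (F ` X))"
  defines "\<eta> \<equiv> measure \<nu> {x \<in> X. F x \<noteq> g (prefix N x)}"
  shows "rv_entropy \<nu> (itinerary F n) \<le> block_entropy \<nu> j +
    real (n + N) * (block_entropy \<nu> (Suc j) - block_entropy \<nu> j) +
    real n * (- ln (1 - \<theta>) + \<eta> * (ln (1 - \<theta>) - ln (\<theta> / c)))"
proof -
  have p: "prob_on \<nu>"
    by (rule inv_prob_on[OF \<nu>])
  interpret \<nu>: prob_space \<nu>
    by (rule prob_on_prob[OF p])
  define V where "V = F ` X"
  have V: "finite V" "V \<noteq> {}"
    using F nonempty by (auto simp: V_def finite_rv_def)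
  have c: "c > 0"
    using V by (simp add: c_def V_def card_gt_0_iff)
  define \<kappa> where "\<kappa> v w = (if v = g w then 1 - \<theta> else \<theta> / c)" for v w
  have \<kappa>_pos: "\<kappa> v w > 0" for v w
    using \<theta> c by (simp add: \<kappa>_def)
  have \<kappa>_sum: "(\<Sum>v\<in>V. \<kappa> v w) \<le> 1" for w
  proof -
    have "(\<Sum>v\<in>V. \<kappa> v w) \<le> (\<Sum>v\<in>V. (if v = g w then 1 - \<theta> else 0) + \<theta> / c)"
      using \<theta> c by (intro sum_mono) (auto simp: \<kappa>_def)
    also have "\<dots> = (if g w \<in> V then 1 - \<theta> else 0) + \<theta>"
      using V c by (simp add: sum.distrib c_def V_def)
    also have "\<dots> \<le> 1"
      using \<theta> by simp
    finally show ?thesis .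
  qed
  \<comment> \<open>The additional \<open>N\<close> letters make the block of length
    \<open>N\<close> at every position \<open>i < n\<close> readable from the prefix.\<close>
  let ?m = "j + (n + N)"
  define J where "J x = (itinerary F n x, prefix ?m x)" for x
  have J: "finite_rv J"
    unfolding J_def by (intro finite_rv_Pair finite_rv_itinerary[OF p F] finite_rv_prefix)
  define q where "q = (\<lambda>(\<phi>, u). markov_weight \<nu> j u * (\<Prod>i<n. \<kappa> (\<phi> i) (take N (drop i u))))"
  have kernel_integral: "(\<integral>x. ln (\<kappa> (F ((shift_map ^^ i) x)) (prefix N ((shift_map ^^ i) x))) \<partial>\<nu>) =
      ln (1 - \<theta>) - \<eta> * (ln (1 - \<theta>) - ln (\<theta> / c))" for i
  proof -
    let ?D = "{x \<in> X. F x \<noteq> g (prefix N x)}"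
    have "finite_rv (\<lambda>x. F x \<noteq> g (prefix N x))"
      using finite_rv_comp[OF finite_rv_Pair[OF F finite_rv_prefix[of N]], of "\<lambda>(v, w). v \<noteq> g w"] by simp
    then have "{x \<in> X. (F x \<noteq> g (prefix N x)) = True} \<in> sets BX"
      unfolding finite_rv_def by blast
    then have D: "?D \<in> sets \<nu>"
      using p by (simp add: prob_on_sets)
    have "(\<lambda>x. ln (\<kappa> (F x) (prefix N x))) \<in> borel_measurable \<nu>"
      using integral_finite_rv(2)[OF p finite_rv_Pair[OF F finite_rv_prefix[of N]], of "\<lambda>(v, w). ln (\<kappa> v w)"]
      by (simp add: borel_measurable_integrable)
    then have "(\<integral>x. ln (\<kappa> (F ((shift_map ^^ i) x)) (prefix N ((shift_map ^^ i) x))) \<partial>\<nu>) =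
        (\<integral>x. ln (\<kappa> (F x) (prefix N x)) \<partial>\<nu>)"
      by (rule integral_shift_pow[OF \<nu>])
    also have "\<dots> = (\<integral>x. ln (1 - \<theta>) - indicator ?D x * (ln (1 - \<theta>) - ln (\<theta> / c)) \<partial>\<nu>)"
      using p by (intro Bochner_Integration.integral_cong) (auto simp: \<kappa>_def indicator_def prob_on_space)
    also have "\<dots> = ln (1 - \<theta>) - \<eta> * (ln (1 - \<theta>) - ln (\<theta> / c))"
    proof -
      have "integrable \<nu> (indicator ?D :: seq \<Rightarrow> real)"
        using D by (intro integrable_real_indicator) (auto simp: \<nu>.emeasure_eq_measure)
      moreover have "?D \<inter> space \<nu> = ?D"
        using p by (auto simp: prob_on_space)
      ultimately show ?thesis
        using D by (simp add: \<nu>.prob_space \<eta>_def)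
    qed
    finally show ?thesis .
  qed
  have "rv_entropy \<nu> (itinerary F n) \<le> rv_entropy \<nu> J"
    using rv_entropy_comp_le[OF p J, of fst] by (simp add: J_def)
  also have "\<dots> \<le> - (\<integral>x. ln (q (J x)) \<partial>\<nu>)"
  proof (rule rv_entropy_le[OF p J])
    show "q v \<ge> 0" for v
      using \<kappa>_pos by (auto simp: q_def markov_weight_nonneg less_imp_le intro!: mult_nonneg_nonneg prod_nonneg split: prod.split)
    let ?P = "(\<Pi>\<^sub>E i\<in>{..<n}. V)"
    have "(\<Sum>v\<in>J ` X. q v) \<le> (\<Sum>v\<in>?P \<times> words d ?m. q v)"
    proof (rule sum_mono2)
      show "finite (?P \<times> words d ?m)"
        using V finite_words by (simp add: finite_PiE)
      show "J ` X \<subseteq> ?P \<times> words d ?m"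
        unfolding J_def itinerary_def V_def
        by (intro image_subsetI SigmaI prefix_words) (auto simp: PiE_iff intro!: imageI shift_pow_closed)
    qed (use \<open>\<And>v. q v \<ge> 0\<close> in auto)
    also have "\<dots> = (\<Sum>u\<in>words d ?m. \<Sum>\<phi>\<in>?P. q (\<phi>, u))"
      by (subst sum.swap) (simp add: sum.cartesian_product)
    also have "\<dots> = (\<Sum>u\<in>words d ?m. markov_weight \<nu> j u * (\<Sum>\<phi>\<in>?P. \<Prod>i<n. \<kappa> (\<phi> i) (take N (drop i u))))"
      by (simp add: q_def sum_distrib_left)
    also have "\<dots> = (\<Sum>u\<in>words d ?m. markov_weight \<nu> j u * (\<Prod>i<n. \<Sum>v\<in>V. \<kappa> v (take N (drop i u))))"
      using V by (subst prod_sum_PiE) auto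
    also have "\<dots> \<le> (\<Sum>u\<in>words d ?m. markov_weight \<nu> j u * 1)"
      using \<kappa>_sum \<kappa>_pos
      by (intro sum_mono mult_left_mono prod_le_1 conjI sum_nonneg markov_weight_nonneg) (auto intro: less_imp_le)
    also have "\<dots> \<le> 1"
      using markov_weight_sum_le[OF p] by simp
    finally show "(\<Sum>v\<in>J ` X. q v) \<le> 1" .
  next
    fix v assume v: "v \<in> J ` X" "pr \<nu> J v > 0"
    have "pr \<nu> J v \<le> pr \<nu> (prefix ?m) (snd v)"
      by (intro pr_mono[OF p finite_rv_prefix]) (auto simp: J_def)
    also have "\<dots> = cp \<nu> (snd v)"
      using v(1) by (auto simp: pr_def prefix_fibre cp_def J_def)
    finally have "cp \<nu> (snd v) > 0"
      using v by simp
    then show "q v > 0"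
      using markov_weight_pos[OF \<nu>] \<kappa>_pos by (auto simp: q_def intro!: mult_pos_pos prod_pos split: prod.split)
  qed
  also have "(\<integral>x. ln (q (J x)) \<partial>\<nu>) = (\<integral>x. ln (markov_weight \<nu> j (prefix ?m x)) +
      (\<Sum>i<n. ln (\<kappa> (F ((shift_map ^^ i) x)) (prefix N ((shift_map ^^ i) x)))) \<partial>\<nu>)"
  proof (rule integral_cong_AE)
    let ?Z = "\<lambda>x. (F x, prefix N x)"
    have Z: "finite_rv ?Z"
      by (intro finite_rv_Pair F finite_rv_prefix)
    show "(\<lambda>x. ln (q (J x))) \<in> borel_measurable \<nu>"
      using integral_finite_rv(2)[OF p J, of "\<lambda>v. ln (q v)"] by (rule borel_measurable_integrable)
    have "(\<lambda>x. ln (\<kappa> (F ((shift_map ^^ i) x)) (prefix N ((shift_map ^^ i) x)))) \<in> borel_measurable \<nu>" for i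
      using integral_finite_rv(2)[OF p finite_rv_shift[OF p Z, of i], of "\<lambda>(v, w). ln (\<kappa> v w)"]
      by (simp add: borel_measurable_integrable)
    moreover have "(\<lambda>x. ln (markov_weight \<nu> j (prefix ?m x))) \<in> borel_measurable \<nu>"
      using integral_prefix(2)[OF p, of "\<lambda>u. ln (markov_weight \<nu> j u)"] by (rule borel_measurable_integrable)
    ultimately show "(\<lambda>x. ln (markov_weight \<nu> j (prefix ?m x)) +
        (\<Sum>i<n. ln (\<kappa> (F ((shift_map ^^ i) x)) (prefix N ((shift_map ^^ i) x))))) \<in> borel_measurable \<nu>"
      by (intro borel_measurable_add borel_measurable_sum)
    show "AE x in \<nu>. ln (q (J x)) = ln (markov_weight \<nu> j (prefix ?m x)) +
        (\<Sum>i<n. ln (\<kappa> (F ((shift_map ^^ i) x)) (prefix N ((shift_map ^^ i) x))))"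
      using AE_cp_pos[OF p, of ?m]
    proof eventually_elim
      case (elim x)
      have "q (J x) = markov_weight \<nu> j (prefix ?m x) *
          (\<Prod>i<n. \<kappa> (F ((shift_map ^^ i) x)) (prefix N ((shift_map ^^ i) x)))"
        by (simp add: q_def J_def itinerary_def prefix_shift_pow)
      moreover have "(\<Prod>i<n. \<kappa> (F ((shift_map ^^ i) x)) (prefix N ((shift_map ^^ i) x))) > 0"
        using \<kappa>_pos by (intro prod_pos) auto
      moreover have "ln (\<Prod>i<n. \<kappa> (F ((shift_map ^^ i) x)) (prefix N ((shift_map ^^ i) x))) =
          (\<Sum>i<n. ln (\<kappa> (F ((shift_map ^^ i) x)) (prefix N ((shift_map ^^ i) x))))"
        by (rule ln_prod_pos) (rule \<kappa>_pos)
      ultimately show ?case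
        using markov_weight_pos[OF \<nu> elim, of j] by (simp add: ln_mult_pos)
    qed
  qed
  also have "\<dots> = (\<integral>x. ln (markov_weight \<nu> j (prefix ?m x)) \<partial>\<nu>) +
      (\<Sum>i<n. \<integral>x. ln (\<kappa> (F ((shift_map ^^ i) x)) (prefix N ((shift_map ^^ i) x))) \<partial>\<nu>)"
  proof -
    have "integrable \<nu> (\<lambda>x. ln (\<kappa> (F ((shift_map ^^ i) x)) (prefix N ((shift_map ^^ i) x))))" for i
      using integral_finite_rv(2)[OF p finite_rv_shift[OF p finite_rv_Pair[OF F finite_rv_prefix[of N]], of i],
          of "\<lambda>(v, w). ln (\<kappa> v w)"]
      by simp
    then show ?thesis
      using integral_prefix(2)[OF p, of "\<lambda>u. ln (markov_weight \<nu> j u)"]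
      by (subst Bochner_Integration.integral_add) (auto intro: Bochner_Integration.integrable_sum)
  qed
  also have "(\<Sum>i<n. \<integral>x. ln (\<kappa> (F ((shift_map ^^ i) x)) (prefix N ((shift_map ^^ i) x))) \<partial>\<nu>) =
      (\<Sum>i<n. ln (1 - \<theta>) - \<eta> * (ln (1 - \<theta>) - ln (\<theta> / c)))"
    by (intro sum.cong refl kernel_integral)
  finally show ?thesis
    unfolding integral_markov_weight[OF \<nu>] by (simp add: algebra_simps)
qed

text \<open>As \<open>n\<close> grows, the dependence on the length \<open>N\<close> of the
  approximation disappears; the error of the approximation and then \<open>\<theta>\<close> can be
  made small afterwards.\<close>

theorem ks_entropy_le:
  assumes \<nu>: "\<nu> \<in> Inv"
  shows "ks_entropy \<nu> shift_map \<le> ereal (block_entropy \<nu> (Suc j) - block_entropy \<nu> j)"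
proof -
  have p: "prob_on \<nu>"
    by (rule inv_prob_on[OF \<nu>])
  define h where "h = block_entropy \<nu> (Suc j) - block_entropy \<nu> j"
  have main: "entropy_of_partition \<nu> shift_map (fibres F) \<le> h" if F: "finite_rv F" for F :: "seq \<Rightarrow> seq set"
  proof -
    define L where "L = entropy_of_partition \<nu> shift_map (fibres F)"
    have L: "(\<lambda>n. rv_entropy \<nu> (itinerary F n) / real n) \<longlonglongrightarrow> L"
      unfolding L_def by (rule entropy_of_partition_lim[OF \<nu> F])
    have step: "L \<le> h - ln (1 - \<theta>) + e" if \<theta>: "0 < \<theta>" "\<theta> < 1" and "e > 0" for \<theta> e
    proof -
      \<comment> \<open>The factor \<open>b\<close> of the error depends on \<open>\<theta>\<close>
        and is unbounded as \<open>\<theta>\<close> tends to 0, so \<open>\<theta>\<close> is fixed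
        before the approximation is chosen.\<close>
      define b where "b = ln (1 - \<theta>) - ln (\<theta> / real (card (F ` X)))"
      obtain N g where Ng: "measure \<nu> {x \<in> X. F x \<noteq> g (prefix N x)} < e / (\<bar>b\<bar> + 1)"
        using finite_rv_approximation[OF p F, of "e / (\<bar>b\<bar> + 1)"] \<open>e > 0\<close> by auto
      define \<eta> where "\<eta> = measure \<nu> {x \<in> X. F x \<noteq> g (prefix N x)}"
      have "\<eta> * b \<le> \<eta> * (\<bar>b\<bar> + 1)"
        by (intro mult_left_mono) (auto simp: \<eta>_def)
      also have "\<dots> \<le> e"
        using Ng by (simp add: \<eta>_def pos_less_divide_eq less_imp_le)
      finally have \<eta>b: "\<eta> * b \<le> e" .
      have "L \<le> 0 + (h + (- ln (1 - \<theta>) + \<eta> * b))"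
      proof (rule LIMSEQ_le[OF L])
        show "(\<lambda>n. (block_entropy \<nu> j + real N * h) / real n + (h + (- ln (1 - \<theta>) + \<eta> * b)))
            \<longlonglongrightarrow> 0 + (h + (- ln (1 - \<theta>) + \<eta> * b))"
          by (intro tendsto_add lim_const_over_n tendsto_const)
        have "rv_entropy \<nu> (itinerary F n) / real n \<le>
            (block_entropy \<nu> j + real N * h) / real n + (h + (- ln (1 - \<theta>) + \<eta> * b))" if "n \<ge> 1" for n
        proof -
          have "rv_entropy \<nu> (itinerary F n) \<le> block_entropy \<nu> j + real (n + N) * h + real n * (- ln (1 - \<theta>) + \<eta> * b)"
            using itinerary_entropy_le[OF \<nu> F \<theta>, of n j N g] by (simp add: h_def \<eta>_def b_def)
          then show ?thesis
            using that by (simp add: field_simps)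
        qed
        then show "\<exists>M. \<forall>n\<ge>M. rv_entropy \<nu> (itinerary F n) / real n \<le>
            (block_entropy \<nu> j + real N * h) / real n + (h + (- ln (1 - \<theta>) + \<eta> * b))"
          by blast
      qed
      then show ?thesis
        using \<eta>b by simp
    qed
    have "L \<le> h"
    proof (rule ccontr)
      assume "\<not> L \<le> h"
      then have "L - h > 0"
        by simp
      \<comment> \<open>For this \<open>\<theta>\<close> the term \<open>- ln (1 - \<theta>)\<close>
        is exactly \<open>(L - h) / 3\<close>.\<close>
      then have "L \<le> h + (L - h) / 3 + (L - h) / 3"
        using step[of "1 - exp (- ((L - h) / 3))" "(L - h) / 3"] by simp
      then show False
        using \<open>L - h > 0\<close> by argo
    qed
    then show ?thesis
      by (simp add: L_def)
  qed
  have "entropy_of_partition \<nu> shift_map P \<le> h" if P: "finite P" "partition_on X P" "P \<subseteq> sets \<nu>" for P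
  proof -
    let ?F = "\<lambda>x. THE p. p \<in> P \<and> x \<in> p"
    have im: "?F ` X = P"
    proof -
      have the: "?F x = p" if "p \<in> P" "x \<in> p" for x p
        using that P(2) by (intro the_equality) (auto simp: partition_on_def disjoint_def)
      have "\<exists>x\<in>X. x \<in> p" if "p \<in> P" for p
        using that P(2) by (metis UnionI ex_in_conv partition_onD1 partition_onD3)
      then show ?thesis
        using the P(2) by (force simp: partition_on_def image_iff)
    qed
    have "finite_rv ?F"
      unfolding finite_rv_def im
    proof (intro conjI allI P(1))
      fix p
      show "{x \<in> X. ?F x = p} \<in> sets BX"
      proof (cases "p \<in> P")
        case True
        then show ?thesis
          using partition_fibres(2)[OF P(2) True] P(3) p by (auto simp: prob_on_sets)
      next
        case False
        then have "{x \<in> X. ?F x = p} = {}"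
          using im by blast
        then show ?thesis
          by (metis sets.empty_sets)
      qed
    qed
    then show ?thesis
      using main[of ?F] partition_fibres(1)[OF P(2)] by simp
  qed
  then show ?thesis
    unfolding ks_entropy_def h_def[symmetric] prob_on_space[OF p] by (intro SUP_least) auto
qed

text \<open>The partition by the first letter suffices: its itineraries are the prefixes up to
  relabelling, and block entropies that are affine from \<open>k\<close> on grow at the rate
  \<open>h\<close>.\<close>

theorem ks_entropy_ge:
  assumes \<nu>: "\<nu> \<in> Inv" and h: "\<And>n. n \<ge> k \<Longrightarrow> block_entropy \<nu> (Suc n) - block_entropy \<nu> n = h"
  shows "ereal h \<le> ks_entropy \<nu> shift_map"
proof -
  have p: "prob_on \<nu>"
    by (rule inv_prob_on[OF \<nu>])
  let ?F = "\<lambda>x :: seq. prefix 1 x"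
  have F: "finite_rv ?F"
    by (rule finite_rv_prefix)
  have "rv_entropy \<nu> (itinerary ?F n) = block_entropy \<nu> n" for n
  proof (rule antisym)
    have "itinerary ?F n = (\<lambda>x. (\<lambda>u. \<lambda>i\<in>{..<n}. [u ! i]) (prefix n x))"
      by (auto simp: itinerary_def fun_eq_iff shift_pow prefix_def restrict_def)
    then show "rv_entropy \<nu> (itinerary ?F n) \<le> block_entropy \<nu> n"
      using rv_entropy_comp_le[OF p finite_rv_prefix[of n], of "\<lambda>u. \<lambda>i\<in>{..<n}. [u ! i]"]
      by (simp add: rv_entropy_prefix)
    have "prefix n = (\<lambda>x. (\<lambda>\<phi>. map (\<lambda>i. hd (\<phi> i)) [0..<n]) (itinerary ?F n x))"
      by (auto simp: itinerary_def fun_eq_iff shift_pow prefix_def)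
    then show "block_entropy \<nu> n \<le> rv_entropy \<nu> (itinerary ?F n)"
      using rv_entropy_comp_le[OF p finite_rv_itinerary[OF p F, of n], of "\<lambda>\<phi>. map (\<lambda>i. hd (\<phi> i)) [0..<n]"]
      by (simp flip: rv_entropy_prefix)
  qed
  then have lim: "(\<lambda>n. block_entropy \<nu> n / real n) \<longlonglongrightarrow> entropy_of_partition \<nu> shift_map (fibres ?F)"
    using entropy_of_partition_lim[OF \<nu> F] by simp
  have lin: "block_entropy \<nu> (k + n) = block_entropy \<nu> k + real n * h" for n
  proof (induction n)
    case (Suc n)
    then show ?case
      using h[of "k + n"] by (simp add: algebra_simps)
  qed simp
  have "(\<lambda>n. (block_entropy \<nu> k - real k * h) / real n + h) \<longlonglongrightarrow> 0 + h"
    by (intro tendsto_add lim_const_over_n tendsto_const)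
  moreover have "\<forall>\<^sub>F n in sequentially. (block_entropy \<nu> k - real k * h) / real n + h = block_entropy \<nu> n / real n"
  proof (rule eventually_sequentiallyI[of "k + 1"])
    fix n assume "k + 1 \<le> n"
    then show "(block_entropy \<nu> k - real k * h) / real n + h = block_entropy \<nu> n / real n"
      using lin[of "n - k"] by (simp add: field_simps of_nat_diff)
  qed
  ultimately have "(\<lambda>n. block_entropy \<nu> n / real n) \<longlonglongrightarrow> h"
    by (auto dest: Lim_transform_eventually)
  then have eq: "entropy_of_partition \<nu> shift_map (fibres ?F) = h"
    using lim by (rule LIMSEQ_unique[symmetric])
  have "finite (fibres ?F)" "partition_on X (fibres ?F)" "fibres ?F \<subseteq> sets \<nu>"
    using F p by (auto simp: fibres_def finite_rv_def prob_on_sets partition_on_def disjoint_def)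
  then show ?thesis
    unfolding ks_entropy_def eq[symmetric] prob_on_space[OF p] by (intro SUP_upper) auto
qed

end

section \<open>Markov measures\<close>

text \<open>The finite type condition at order \<open>k\<close>: membership is decided by the
  windows of length \<open>k + 1\<close>. With \<open>k \<ge> 1\<close> a window overlaps the next
  one in a nonempty word, from which the appended letter can be read.\<close>

locale sft_space = shift_space +
  fixes k :: nat
  assumes k_pos: "k \<ge> 1"
    and sft: "(\<And>i. \<exists>y\<in>X. prefix (Suc k) y = prefix (Suc k) ((shift_map ^^ i) x)) \<Longrightarrow> x \<in> X"
begin

section \<open>The language and its block matrices\<close>

definition lang :: "nat \<Rightarrow> nat list set" where
  "lang n = {u \<in> words d n. cyl u \<noteq> {}}"

definition lastk :: "nat list \<Rightarrow> nat list" where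
  "lastk u = drop (length u - k) u"

text \<open>
  A weight \<open>q\<close> on words of length \<open>k + 1\<close> as a matrix indexed by words of length \<open>k\<close>.
\<close>

definition wmat :: "(nat list \<Rightarrow> real) \<Rightarrow> nat list \<Rightarrow> nat list \<Rightarrow> real" where
  "wmat q w w' = (if tl (w @ [last w']) = w' then q (w @ [last w']) else 0)"

lemma finite_lang: "finite (lang n)"
  using finite_words by (simp add: lang_def)

lemma lang_length: "u \<in> lang n \<Longrightarrow> length u = n"
  by (auto simp: lang_def words_def)

lemma lang_words: "u \<in> lang n \<Longrightarrow> u \<in> words d n"
  by (simp add: lang_def)

lemma prefix_lang: "x \<in> X \<Longrightarrow> prefix n x \<in> lang n"
  using prefix_words by (auto simp: lang_def cyl_def)

lemma lang_iff: "u \<in> lang n \<longleftrightarrow> (\<exists>x\<in>X. u = prefix n x)"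
proof
  assume u: "u \<in> lang n"
  then obtain x where "x \<in> cyl u"
    by (auto simp: lang_def)
  then show "\<exists>x\<in>X. u = prefix n x"
    using lang_length[OF u] by (metis mem_cyl_iff)
qed (auto intro: prefix_lang)

lemma lang_nonempty: "lang n \<noteq> {}"
  using nonempty prefix_lang by blast

lemma cp_pos_lang: "cp \<nu> u > 0 \<Longrightarrow> u \<in> lang (length u)"
  using cp_empty[of u \<nu>] cp_outside[of u \<nu>] by (force simp: lang_def)

lemma lang_snocD:
  assumes "u @ [b] \<in> lang (Suc n)"
  shows "u \<in> lang n" "b < d" "tl (u @ [b]) \<in> lang n"
proof -
  obtain x where x: "x \<in> X" "u @ [b] = prefix (Suc n) x"
    using assms by (auto simp: lang_iff)
  then show "u \<in> lang n" "b < d"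
    using prefix_lang letters by (auto simp: prefix_Suc)
  have "tl (prefix (Suc n) x) = prefix n (shift_map x)"
    by (simp add: prefix_shift)
  then show "tl (u @ [b]) \<in> lang n"
    unfolding x(2) using prefix_lang shift_closed x(1) by simp
qed

lemma lang_CopsD:
  assumes "a # u \<in> lang (Suc n)"
  shows "u \<in> lang n" "a < d" "butlast (a # u) \<in> lang n"
proof -
  obtain x where x: "x \<in> X" "a # u = prefix (Suc n) x"
    using assms by (auto simp: lang_iff)
  then show "u \<in> lang n" "a < d"
    using prefix_lang shift_closed letters by (auto simp: prefix_shift)
  have "butlast (prefix (Suc n) x) = prefix n x"
    by (simp add: prefix_Suc)
  then show "butlast (a # u) \<in> lang n"
    unfolding x(2) using prefix_lang x(1) by simp
qed

lemma length_lastk: "length u \<ge> k \<Longrightarrow> length (lastk u) = k"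
  by (simp add: lastk_def)

lemma lastk_id: "length u = k \<Longrightarrow> lastk u = u"
  by (simp add: lastk_def)

lemma lastk_Cons: "length u \<ge> k \<Longrightarrow> lastk (a # u) = lastk u"
  by (simp add: lastk_def Suc_diff_le)

lemma lastk_append: "length u \<ge> k \<Longrightarrow> lastk (v @ u) = lastk u"
  by (simp add: lastk_def)

lemma lastk_snoc: "length u \<ge> k \<Longrightarrow> lastk (u @ [b]) = tl (lastk u @ [b])"
proof -
  assume u: "length u \<ge> k"
  have "take (length u - k) u @ lastk u @ [b] = u @ [b]"
    by (simp add: lastk_def)
  then have "lastk (u @ [b]) = lastk (take (length u - k) u @ lastk u @ [b])"
    by (rule arg_cong[OF sym])
  also have "\<dots> = lastk (lastk u @ [b])"
    using u by (intro lastk_append) (simp add: length_lastk)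
  also have "\<dots> = tl (lastk u @ [b])"
    unfolding lastk_def[of "lastk u @ [b]"] using length_lastk[OF u] by (simp add: drop_Suc del: drop_append)
  finally show ?thesis .
qed

lemma lastk_prefix: "n \<ge> k \<Longrightarrow> lastk (prefix n x) = prefix k ((shift_map ^^ (n - k)) x)"
  using prefix_shift_pow[of "n - k" k n x] by (simp add: lastk_def)

text \<open>A word with admissible windows is continued by a point of \<open>X\<close> that realises
  its last window; all windows of the glued sequence are then admissible.\<close>

lemma lang_extend:
  assumes u: "length u \<ge> Suc k"
    and blocks: "\<And>i. i + Suc k \<le> length u \<Longrightarrow> take (Suc k) (drop i u) \<in> lang (Suc k)"
  shows "cyl u \<noteq> {}"
proof -
  define m where "m = length u - Suc k"
  have "take (Suc k) (drop m u) \<in> lang (Suc k)"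
    using blocks[of m] u by (simp add: m_def)
  then obtain y where y: "y \<in> X" "drop m u = prefix (Suc k) y"
    using u by (auto simp: lang_iff m_def)
  define x where "x i = (if i < m then u ! i else y (i - m))" for i
  have xu: "x i = u ! i" if "i < length u" for i
  proof (cases "i < m")
    case False
    then have "u ! i = drop m u ! (i - m)"
      using that u by (simp add: m_def)
    moreover have "i - m < Suc k"
      using that u by (simp add: m_def)
    ultimately have "u ! i = y (i - m)"
      by (simp only: y(2) nth_prefix)
    then show ?thesis
      using False by (simp add: x_def)
  qed (simp add: x_def)
  have "x \<in> X"
  proof (rule sft)
    fix i
    show "\<exists>y\<in>X. prefix (Suc k) y = prefix (Suc k) ((shift_map ^^ i) x)"
    proof (cases "i \<le> m")
      case True
      then have "prefix (Suc k) ((shift_map ^^ i) x) = take (Suc k) (drop i u)"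
        using u by (intro nth_equalityI) (auto simp: shift_pow m_def xu)
      moreover have "i + Suc k \<le> length u"
        using True u by (simp add: m_def)
      ultimately show ?thesis
        using blocks[of i] by (metis lang_iff)
    next
      case False
      then have "prefix (Suc k) ((shift_map ^^ i) x) = prefix (Suc k) ((shift_map ^^ (i - m)) y)"
        by (auto simp: prefix_eq_iff shift_pow x_def)
      then show ?thesis
        using shift_pow_closed[OF y(1)] by metis
    qed
  qed
  moreover have "prefix (length u) x = u"
    using xu by (intro nth_equalityI) auto
  ultimately show ?thesis
    by (auto simp: cyl_def)
qed

text \<open>The only successors of \<open>w\<close> are the words \<open>tl (w @ [b])\<close>, and
  \<open>b\<close> is recovered as their last letter because \<open>k \<ge> 1\<close>; a row sum is
  therefore a sum over letters.\<close>

lemma wmat_row: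
  assumes V: "finite V" "\<And>w. w \<in> V \<Longrightarrow> length w = k"
    and q: "\<And>e. q e \<noteq> 0 \<Longrightarrow> e \<in> words d (Suc k) \<and> butlast e \<in> V \<and> tl e \<in> V" and w: "w \<in> V"
  shows "(\<Sum>w'\<in>V. wmat q w w' * f w') = (\<Sum>b<d. q (w @ [b]) * f (tl (w @ [b])))"
proof -
  have len: "length w = k" "w \<noteq> []"
    using V(2)[OF w] k_pos by auto
  define B where "B = {b\<in>{..<d}. q (w @ [b]) \<noteq> 0}"
  have last_tl: "last (tl (w @ [b])) = b" for b
    using len by (simp add: last_tl)
  have inj: "inj_on (\<lambda>b. tl (w @ [b])) B"
    using last_tl by (intro inj_onI) metis
  have "(\<Sum>b<d. q (w @ [b]) * f (tl (w @ [b]))) = (\<Sum>b\<in>B. q (w @ [b]) * f (tl (w @ [b])))"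
    by (intro sum.mono_neutral_right) (auto simp: B_def)
  also have "\<dots> = (\<Sum>b\<in>B. wmat q w (tl (w @ [b])) * f (tl (w @ [b])))"
    by (intro sum.cong) (simp_all add: wmat_def last_tl)
  also have "\<dots> = (\<Sum>w'\<in>(\<lambda>b. tl (w @ [b])) ` B. wmat q w w' * f w')"
    by (simp add: sum.reindex[OF inj])
  also have "\<dots> = (\<Sum>w'\<in>V. wmat q w w' * f w')"
  proof (intro sum.mono_neutral_left V(1) ballI)
    show "(\<lambda>b. tl (w @ [b])) ` B \<subseteq> V"
      using q by (auto simp: B_def)
    fix w' assume w': "w' \<in> V - (\<lambda>b. tl (w @ [b])) ` B"
    show "wmat q w w' * f w' = 0"
    proof (rule ccontr)
      assume "wmat q w w' * f w' \<noteq> 0"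
      then have *: "tl (w @ [last w']) = w'" "q (w @ [last w']) \<noteq> 0"
        by (auto simp: wmat_def split: if_splits)
      then have "last w' \<in> B"
        using q[of "w @ [last w']"] words_snoc_iff by (auto simp: B_def)
      then show False
        using w' *(1) by force
    qed
  qed
  finally show ?thesis
    by simp
qed

lemma wmat_col:
  assumes V: "finite V" "\<And>w. w \<in> V \<Longrightarrow> length w = k"
    and q: "\<And>e. q e \<noteq> 0 \<Longrightarrow> e \<in> words d (Suc k) \<and> butlast e \<in> V \<and> tl e \<in> V" and w': "w' \<in> V"
  shows "(\<Sum>w\<in>V. f w * wmat q w w') = (\<Sum>a<d. f (butlast (a # w')) * q (a # w'))"
proof -
  have len: "length w' = k" "w' \<noteq> []"
    using V(2)[OF w'] k_pos by auto
  have snoc: "butlast (a # w') @ [last w'] = a # w'" for a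
    using len by (metis append_butlast_last_id last_ConsR list.distinct(1))
  define A where "A = {a\<in>{..<d}. q (a # w') \<noteq> 0}"
  have inj: "inj_on (\<lambda>a. butlast (a # w')) A"
    using snoc by (intro inj_onI) (metis list.inject)
  have "(\<Sum>a<d. f (butlast (a # w')) * q (a # w')) = (\<Sum>a\<in>A. f (butlast (a # w')) * q (a # w'))"
    by (intro sum.mono_neutral_right) (auto simp: A_def)
  also have "\<dots> = (\<Sum>a\<in>A. f (butlast (a # w')) * wmat q (butlast (a # w')) w')"
    by (intro sum.cong) (simp_all only: wmat_def snoc list.sel refl if_True)
  also have "\<dots> = (\<Sum>w\<in>(\<lambda>a. butlast (a # w')) ` A. f w * wmat q w w')"
    by (rule sum.reindex[OF inj, unfolded o_def, symmetric])
  also have "\<dots> = (\<Sum>w\<in>V. f w * wmat q w w')"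
  proof (intro sum.mono_neutral_left V(1) ballI)
    show "(\<lambda>a. butlast (a # w')) ` A \<subseteq> V"
    proof (rule image_subsetI)
      fix a assume "a \<in> A"
      then show "butlast (a # w') \<in> V"
        using q[of "a # w'"] unfolding A_def by blast
    qed
    fix w assume w: "w \<in> V - (\<lambda>a. butlast (a # w')) ` A"
    show "f w * wmat q w w' = 0"
    proof (rule ccontr)
      assume "f w * wmat q w w' \<noteq> 0"
      then have *: "tl (w @ [last w']) = w'" "q (w @ [last w']) \<noteq> 0"
        by (auto simp: wmat_def split: if_splits)
      have "w @ [last w'] = hd w # w'"
        using *(1) V(2)[of w] w k_pos by (cases w) auto
      then have "q (hd w # w') \<noteq> 0" "w = butlast (hd w # w')"
        using *(2) by (auto dest: arg_cong[of _ _ butlast])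
      moreover from this have "hd w < d"
        using q[of "hd w # w'"] words_Cons_iff by auto
      ultimately have "hd w \<in> A"
        by (simp add: A_def)
      with \<open>w = butlast (hd w # w')\<close> have "w \<in> (\<lambda>a. butlast (a # w')) ` A"
        by (rule image_eqI)
      then show False
        using w by blast
    qed
  qed
  finally show ?thesis
    by simp
qed

section \<open>Stationary flows and Markov measures\<close>

definition kernel_markov :: "(nat list \<Rightarrow> real) \<Rightarrow> seq measure \<Rightarrow> bool" where
  "kernel_markov K \<nu> \<longleftrightarrow> (\<forall>u b. length u \<ge> k \<longrightarrow> cp \<nu> (u @ [b]) = cp \<nu> u * K (lastk u @ [b]))"

text \<open>A stationary law on words of length \<open>k + 1\<close>: equality of inflow and outflow
  at each word of length \<open>k\<close> is what invariance of the associated Markov measure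
  amounts to.\<close>

definition flow :: "(nat list \<Rightarrow> real) \<Rightarrow> bool" where
  "flow p \<longleftrightarrow> (\<forall>e. p e \<ge> 0) \<and> (\<forall>e. e \<notin> lang (Suc k) \<longrightarrow> p e = 0) \<and>
     (\<forall>w\<in>words d k. (\<Sum>a<d. p (a # w)) = (\<Sum>b<d. p (w @ [b]))) \<and> (\<Sum>e\<in>words d (Suc k). p e) = 1"

definition outflow :: "(nat list \<Rightarrow> real) \<Rightarrow> nat list \<Rightarrow> real" where
  "outflow p w = (\<Sum>b<d. p (w @ [b]))"

lemma flow_le_outflow:
  assumes "flow p"
  shows "p (w @ [b]) \<le> outflow p w"
proof (cases "b < d")
  case True
  then show ?thesis
    unfolding outflow_def using assms by (intro member_le_sum) (auto simp: flow_def)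
next
  case False
  then have "w @ [b] \<notin> lang (Suc k)"
    using lang_snocD(2) by blast
  then show ?thesis
    using assms by (auto simp: flow_def outflow_def intro!: sum_nonneg)
qed

text \<open>The weights are products of transition probabilities started from the outflow. Balance
  makes them stationary, and the window condition confines them to the language of
  \<open>X\<close>.\<close>

theorem markov_measure_exists:
  assumes p: "flow p"
  shows "\<exists>\<nu>\<in>Inv. (\<forall>e\<in>words d (Suc k). cp \<nu> e = p e) \<and> kernel_markov (\<lambda>e. p e / outflow p (butlast e)) \<nu>"
proof -
  have nn: "p e \<ge> 0" and supp: "e \<notin> lang (Suc k) \<Longrightarrow> p e = 0"
    and bal: "w \<in> words d k \<Longrightarrow> (\<Sum>a<d. p (a # w)) = outflow p w" and tot: "(\<Sum>e\<in>words d (Suc k). p e) = 1" for e w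
    using p by (auto simp: flow_def outflow_def)
  have onn: "outflow p w \<ge> 0" for w
    by (simp add: outflow_def sum_nonneg nn)
  have o0: "outflow p w = 0 \<Longrightarrow> p (w @ [b]) = 0" for w b
    using flow_le_outflow[OF p, of w b] nn[of "w @ [b]"] by simp
  define K where "K e = p e / outflow p (butlast e)" for e
  define G where "G u = outflow p (take k u) * (\<Prod>i<length u - k. K (take (Suc k) (drop i u)))" for u
  \<comment> \<open>\<open>G\<close> is the intended weight only from length \<open>k\<close> on;
    shorter words get the total weight of their continuations to length \<open>k\<close>.\<close>
  define W where "W u = (\<Sum>v\<in>words d (k - length u). G (u @ v))" for u
  have G_nonneg: "G u \<ge> 0" for u
    by (auto simp: G_def K_def onn nn intro!: mult_nonneg_nonneg prod_nonneg divide_nonneg_nonneg)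
  have WG: "W u = G u" if "length u \<ge> k" for u
    using that by (simp add: W_def)
  have G_snoc: "G (u @ [b]) = G u * K (lastk u @ [b])" if "length u \<ge> k" for u b
  proof -
    have "(\<Prod>i<length u - k. K (take (Suc k) (drop i (u @ [b])))) = (\<Prod>i<length u - k. K (take (Suc k) (drop i u)))"
      using that by (intro prod.cong) auto
    then show ?thesis
      using that by (simp add: G_def lastk_def Suc_diff_le)
  qed
  have K_sum: "(\<Sum>b<d. K (w @ [b])) = (if outflow p w = 0 then 0 else 1)" for w
    by (simp add: K_def outflow_def flip: sum_divide_distrib)
  \<comment> \<open>The kernel is 0 at a block without outflow, so mass must never arrive there. By
    balance such a block has no inflow, so the last edge of \<open>u\<close> has weight 0.\<close>
  have G0: "G u = 0" if len_u: "length u \<ge> k" and out: "outflow p (lastk u) = 0" for u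
  proof (cases "length u = k")
    case True
    then show ?thesis
      using out by (simp add: G_def lastk_id)
  next
    case False
    then obtain v b where u: "u = v @ [b]" "length v \<ge> k"
      using len_u by (cases u rule: rev_cases) auto
    have len: "length (lastk v) = k"
      using u(2) by (rule length_lastk)
    have "p (lastk v @ [b]) = 0"
    proof (cases "lastk v @ [b] \<in> lang (Suc k)")
      case True
      obtain a s where as: "lastk v = a # s"
        using len k_pos by (cases "lastk v") auto
      have w: "s @ [b] \<in> words d k" "a < d"
        using lang_CopsD[of a "s @ [b]" k] True as by (auto intro: lang_words)
      have "(\<Sum>a<d. p (a # s @ [b])) = 0"
        using bal[OF w(1)] out lastk_snoc[OF u(2), of b] u(1) as by simp
      then have "p (a # s @ [b]) = 0"
        using nn w(2) by (subst (asm) sum_nonneg_eq_0_iff) auto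
      then show ?thesis
        using as by simp
    qed (rule supp)
    then show ?thesis
      using G_snoc[OF u(2), of b] u(1) by (simp add: K_def)
  qed
  have G_sum: "G u = (\<Sum>b<d. G (u @ [b]))" if "length u \<ge> k" for u
    using G_snoc[OF that] K_sum[of "lastk u"] G0[OF that] by (simp flip: sum_distrib_left split: if_splits)
  have "W u = (\<Sum>b<d. W (u @ [b]))" for u
  proof (cases "length u \<ge> k")
    case True
    then show ?thesis
      using G_sum[OF True] by (simp add: WG)
  next
    case False
    then obtain m where m: "k - length u = Suc m" "k - Suc (length u) = m"
      by (metis Suc_diff_Suc not_le_imp_less)
    then show ?thesis
      by (simp add: W_def sum_words_Cons)
  qed
  moreover have "W [] = 1"
  proof -
    have "W [] = (\<Sum>w\<in>words d k. outflow p w)"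
      by (auto simp: W_def G_def words_def intro!: sum.cong)
    then show ?thesis
      using tot by (simp add: outflow_def sum_words_snoc)
  qed
  moreover have G_lang: "G u = 0" if len_u: "length u \<ge> Suc k" and empty: "cyl u = {}" for u
  proof -
    obtain i where i: "i + Suc k \<le> length u" "take (Suc k) (drop i u) \<notin> lang (Suc k)"
      using lang_extend[OF len_u] empty by blast
    then have "K (take (Suc k) (drop i u)) = 0"
      by (simp add: K_def supp)
    then have "(\<Prod>i<length u - k. K (take (Suc k) (drop i u))) = 0"
      using i(1) by (intro prod_zero) (auto intro!: bexI[of _ i])
    then show ?thesis
      by (simp add: G_def)
  qed
  moreover have "W u = 0" if "cyl u = {}" for u
  proof -
    have cyl_ext: "cyl (u @ v) = {}" for v
      using that cyl_append by blast
    show ?thesis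
    proof (cases "length u \<ge> Suc k")
      case True
      then show ?thesis
        using G_lang that WG by simp
    next
      case False
      have "G (u @ v) = 0" if "v \<in> words d (k - length u)" for v
      proof -
        have "length (u @ v) \<ge> k"
          using that words_length by fastforce
        moreover have "G ((u @ v) @ [b]) = 0" for b
          using G_lang[of "(u @ v) @ [b]"] cyl_ext[of "v @ [b]"] calculation by simp
        ultimately show ?thesis
          using G_sum[of "u @ v"] by simp
      qed
      then show ?thesis
        by (simp add: W_def)
    qed
  qed
  moreover have "W u \<ge> 0" for u
    by (simp add: W_def sum_nonneg G_nonneg)
  ultimately obtain \<nu> where \<nu>: "prob_on \<nu>" "\<And>u. cp \<nu> u = W u"
    using measure_extension[of W] by blast
  have G_e: "G e = p e" if "length e = Suc k" for e
  proof -
    obtain w b where "e = w @ [b]" "length w = k"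
      using \<open>length e = Suc k\<close> by (metis length_Suc_conv_rev)
    then show ?thesis
      using G_snoc[of w b] o0[of w b] by (auto simp: G_def K_def lastk_id)
  qed
  have "\<nu> \<in> Inv"
  proof (rule invI[OF \<nu>(1), of k])
    fix u :: "nat list" assume u: "length u \<ge> k"
    \<comment> \<open>Prepending a letter commutes with appending one, which reduces the claim to
      words of length \<open>k\<close>, where it is the balance equation.\<close>
    have eq: "(\<Sum>a<d. G (a # u)) = G u" if "length u \<ge> k" "u \<in> words d (length u)" for u
      using that
    proof (induction u rule: rev_induct)
      case Nil
      then show ?case
        using k_pos by simp
    next
      case (snoc b u)
      show ?case
      proof (cases "length u \<ge> k")
        case True
        have "(\<Sum>a<d. G (a # u @ [b])) = (\<Sum>a<d. G (a # u) * K (lastk u @ [b]))"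
          using G_snoc[of "_ # u" b] True by (intro sum.cong) (auto simp: lastk_Cons)
        also have "\<dots> = G u * K (lastk u @ [b])"
          using snoc.IH[OF True] snoc.prems(2) by (auto simp: words_def simp flip: sum_distrib_right)
        finally show ?thesis
          using G_snoc[OF True, of b] by simp
      next
        case False
        then have len: "length (u @ [b]) = k"
          using snoc.prems by simp
        then have "(\<Sum>a<d. G (a # u @ [b])) = (\<Sum>a<d. p (a # u @ [b]))"
          by (intro sum.cong refl G_e) simp
        also have "\<dots> = outflow p (u @ [b])"
          using snoc.prems(2) len by (intro bal) simp
        finally show ?thesis
          using len by (simp add: G_def)
      qed
    qed
    show "(\<Sum>a<d. cp \<nu> (a # u)) = cp \<nu> u"
    proof (cases "u \<in> words d (length u)")
      case True
      then show ?thesis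
        using eq[OF u] u by (simp add: \<nu>(2) WG)
    next
      case False
      then have "a # u \<notin> words d (length (a # u))" for a
        by (auto simp: words_def)
      then show ?thesis
        using False cp_outside[of _ \<nu>] by simp
    qed
  qed
  moreover have "kernel_markov K \<nu>"
    by (simp add: kernel_markov_def \<nu>(2) WG G_snoc)
  ultimately show ?thesis
    using G_e by (intro bexI[of _ \<nu>]) (auto simp: \<nu>(2) WG K_def[abs_def] words_length)
qed

lemma kernel_markov_eqI:
  assumes \<mu>: "\<mu> \<in> Inv" and \<nu>: "\<nu> \<in> Inv" and K: "kernel_markov K \<mu>" "kernel_markov K \<nu>"
    and eq: "\<And>w. w \<in> words d k \<Longrightarrow> cp \<mu> w = cp \<nu> w"
  shows "\<mu> = \<nu>"
proof (rule measure_eqI_cyl[OF inv_prob_on[OF \<mu>] inv_prob_on[OF \<nu>], of k])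
  fix u :: "nat list" assume "length u \<ge> k"
  then show "cp \<mu> u = cp \<nu> u"
  proof (induction u rule: rev_induct)
    case Nil
    then show ?case
      using k_pos by simp
  next
    case (snoc b u)
    show ?case
    proof (cases "length u \<ge> k")
      case True
      then show ?thesis
        using K snoc.IH by (simp add: kernel_markov_def)
    next
      case False
      then show ?thesis
        using snoc.prems eq[of "u @ [b]"] cp_outside[of "u @ [b]" \<mu>] cp_outside[of "u @ [b]" \<nu>]
        by (cases "u @ [b] \<in> words d k") (auto simp: le_Suc_eq)
    qed
  qed
qed

section \<open>Uniqueness and ergodicity of irreducible Markov measures\<close>

definition transition :: "seq measure \<Rightarrow> nat list \<Rightarrow> real" where
  "transition \<mu> e = cp \<mu> e / cp \<mu> (butlast e)"

definition vertices :: "seq measure \<Rightarrow> nat list set" where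
  "vertices \<mu> = {w \<in> words d k. cp \<mu> w > 0}"

context
  fixes \<mu> K
  assumes \<mu>: "\<mu> \<in> Inv" and K: "kernel_markov K \<mu>"
    and irr: "irreducible_on (vertices \<mu>) (wmat (transition \<mu>))"
begin

lemma vertices_finite: "finite (vertices \<mu>)"
  using finite_words by (simp add: vertices_def)

lemma vertices_length: "w \<in> vertices \<mu> \<Longrightarrow> length w = k"
  by (auto simp: vertices_def words_def)

lemma vertices_nonempty: "vertices \<mu> \<noteq> {}"
proof
  assume "vertices \<mu> = {}"
  then have "cp \<mu> w = 0" if "w \<in> words d k" for w
    using that cp_nonneg[of \<mu> w] by (force simp: vertices_def)
  then show False
    using cp_sum_words[OF inv_prob_on[OF \<mu>], of k] by simp
qed

lemma transition_kernel: "w \<in> vertices \<mu> \<Longrightarrow> transition \<mu> (w @ [b]) = K (w @ [b])"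
  using K by (simp add: transition_def kernel_markov_def vertices_length vertices_def lastk_id words_length)

lemma transition_support:
  assumes "transition \<mu> e \<noteq> 0" "length e = Suc k"
  shows "e \<in> words d (Suc k) \<and> butlast e \<in> vertices \<mu> \<and> tl e \<in> vertices \<mu>"
proof -
  have pos: "cp \<mu> e > 0" "cp \<mu> (butlast e) > 0"
    using assms cp_nonneg[of \<mu>] by (auto simp: transition_def less_le)
  have e: "e \<in> lang (Suc k)"
    using cp_pos_lang[OF pos(1)] assms(2) by simp
  obtain a u where au: "e = a # u"
    using assms(2) by (cases e) auto
  have "cp \<mu> (tl e) > 0"
    using cp_Cons_le[OF \<mu>, of a u] pos(1) au by simp
  then show ?thesis
    using pos(2) e lang_CopsD[of a u k] au by (auto simp: vertices_def lang_words)
qed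

text \<open>Truncation to words of length \<open>k + 1\<close> makes the support condition of
  \<open>wmat_row\<close> and \<open>wmat_col\<close> hold for all words, without changing the
  matrix on the vertices.\<close>

definition tq :: "nat list \<Rightarrow> real" where
  "tq e = (if length e = Suc k then transition \<mu> e else 0)"

lemma tq_support: "tq e \<noteq> 0 \<Longrightarrow> e \<in> words d (Suc k) \<and> butlast e \<in> vertices \<mu> \<and> tl e \<in> vertices \<mu>"
  using transition_support by (auto simp: tq_def split: if_splits)

lemma tq_nonneg: "tq e \<ge> 0"
  by (simp add: tq_def transition_def cp_nonneg)

lemma wmat_tq: "w \<in> vertices \<mu> \<Longrightarrow> wmat tq w w' = wmat (transition \<mu>) w w'"
  by (simp add: wmat_def tq_def vertices_length)

lemma irr_tq: "irreducible_on (vertices \<mu>) (wmat tq)"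
proof -
  have "support_graph (vertices \<mu>) (wmat tq) = support_graph (vertices \<mu>) (wmat (transition \<mu>))"
    by (auto simp: support_graph_def wmat_tq)
  then show ?thesis
    using irr by (simp add: irreducible_on_def)
qed

lemma wmat_tq_nonneg: "wmat tq v w \<ge> 0"
  by (simp add: wmat_def tq_nonneg)

lemma stationary_vector:
  assumes \<nu>: "\<nu> \<in> Inv" "kernel_markov K \<nu>" and sub: "\<And>w. w \<in> words d k \<Longrightarrow> w \<notin> vertices \<mu> \<Longrightarrow> cp \<nu> w = 0"
    and w: "w \<in> vertices \<mu>"
  shows "(\<Sum>v\<in>vertices \<mu>. wmat tq v w * cp \<nu> v) = 1 * cp \<nu> w"
proof -
  have len: "length w = k" "w \<noteq> []"
    using vertices_length[OF w] k_pos by auto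
  have "(\<Sum>v\<in>vertices \<mu>. wmat tq v w * cp \<nu> v) = (\<Sum>v\<in>vertices \<mu>. cp \<nu> v * wmat tq v w)"
    by (simp add: mult.commute)
  also have "\<dots> = (\<Sum>a<d. cp \<nu> (butlast (a # w)) * tq (a # w))"
    by (rule wmat_col[OF vertices_finite vertices_length tq_support w])
  also have "\<dots> = (\<Sum>a<d. cp \<nu> (a # w))"
  proof (intro sum.cong refl)
    fix a assume "a \<in> {..<d}"
    let ?v = "butlast (a # w)"
    have snoc: "?v @ [last w] = a # w" "length ?v = k"
      using len by (auto simp: append_butlast_last_id)
    have wd: "a # w \<in> words d (Suc k)"
      using w \<open>a \<in> {..<d}\<close> by (simp add: words_Cons_iff vertices_def)
    then have vw: "?v \<in> words d k"
      using words_snoc_iff[of ?v "last w" d k] snoc by metis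
    have eq: "cp \<nu> (a # w) = cp \<nu> ?v * K (a # w)"
    proof -
      have "cp \<nu> (?v @ [last w]) = cp \<nu> ?v * K (lastk ?v @ [last w])"
        using \<nu>(2) snoc(2) unfolding kernel_markov_def by (metis order_refl)
      then show ?thesis
        using snoc by (simp add: lastk_id)
    qed
    show "cp \<nu> ?v * tq (a # w) = cp \<nu> (a # w)"
    proof (cases "?v \<in> vertices \<mu>")
      case True
      then have "tq (a # w) = K (a # w)"
        using transition_kernel[OF True, of "last w"] snoc len by (simp add: tq_def)
      then show ?thesis
        using eq by simp
    next
      case False
      then show ?thesis
        using sub[OF vw] eq by simp
    qed
  qed
  also have "\<dots> = cp \<nu> w"
    using cp_Cons[OF \<nu>(1), of w] by simp
  finally show ?thesis
    by simp
qed

text \<open>The block probabilities form a left eigenvector for the eigenvalue 1, unique up to scale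
  by irreducibility; total mass 1 fixes the scale.\<close>

theorem kernel_markov_unique:
  assumes \<nu>: "\<nu> \<in> Inv" "kernel_markov K \<nu>" and sub: "\<And>w. w \<in> words d k \<Longrightarrow> w \<notin> vertices \<mu> \<Longrightarrow> cp \<nu> w = 0"
  shows "\<nu> = \<mu>"
proof -
  have sub\<mu>: "cp \<mu> w = 0" if "w \<in> words d k" "w \<notin> vertices \<mu>" for w
    using that cp_nonneg[of \<mu> w] by (force simp: vertices_def)
  have "\<exists>b. \<forall>w\<in>vertices \<mu>. cp \<nu> w = b * cp \<mu> w"
  proof (rule eigenvector_unique[of "vertices \<mu>" "\<lambda>w v. wmat tq v w" "cp \<mu>" 1])
    show "irreducible_on (vertices \<mu>) (\<lambda>w v. wmat tq v w)"
      by (rule irreducible_on_transpose[OF irr_tq])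
  qed (use vertices_finite vertices_nonempty wmat_tq_nonneg stationary_vector[OF \<nu> sub]
      stationary_vector[OF \<mu> K sub\<mu>] in \<open>auto simp: vertices_def\<close>)
  then obtain b where b: "\<And>w. w \<in> vertices \<mu> \<Longrightarrow> cp \<nu> w = b * cp \<mu> w"
    by blast
  have all: "cp \<nu> w = b * cp \<mu> w" if "w \<in> words d k" for w
    using b sub[OF that] sub\<mu>[OF that] by (cases "w \<in> vertices \<mu>") auto
  have "1 = (\<Sum>w\<in>words d k. b * cp \<mu> w)"
    using cp_sum_words[OF inv_prob_on[OF \<nu>(1)], of k] all by simp
  then have "b = 1"
    using cp_sum_words[OF inv_prob_on[OF \<mu>], of k] by (simp flip: sum_distrib_left)
  then show ?thesis
    using kernel_markov_eqI[OF \<nu>(1) \<mu> \<nu>(2) K] all by simp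
qed

lemma cyl_Cons_Int: "cyl (a # w) = {x \<in> X. x 0 = a} \<inter> (shift_map -` cyl w \<inter> X)"
  by (auto simp: cyl_def prefix_shift shift_closed)

lemma markov_Cons:
  assumes "length w \<ge> k"
  shows "cp \<mu> (a # w @ s) * cp \<mu> w = cp \<mu> (a # w) * cp \<mu> (w @ s)"
proof (induction s rule: rev_induct)
  case (snoc b s)
  have "cp \<mu> ((a # w @ s) @ [b]) = cp \<mu> (a # w @ s) * K (lastk (w @ s) @ [b])"
    "cp \<mu> ((w @ s) @ [b]) = cp \<mu> (w @ s) * K (lastk (w @ s) @ [b])"
    using K assms lastk_Cons[of "w @ s" a] unfolding kernel_markov_def by (metis le_SucI length_Cons length_append le_add1 order_trans)+
  then show ?case
    using snoc by simp
qed simp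

text \<open>Given the block \<open>w\<close>, the letter before it is independent of the future.
  Both sides are finite measures in \<open>B\<close>, so the identity on cylinders extends.\<close>

lemma markov_Cons_set:
  assumes w: "length w \<ge> k" and B: "B \<in> sets BX"
  shows "measure \<mu> (cyl (a # w) \<inter> (shift_map -` B \<inter> X)) * cp \<mu> w = cp \<mu> (a # w) * measure \<mu> (cyl w \<inter> B)"
proof -
  interpret \<mu>: prob_space \<mu>
    by (rule prob_on_prob[OF inv_prob_on[OF \<mu>]])
  have p: "prob_on \<mu>"
    by (rule inv_prob_on[OF \<mu>])
  have S: "sets \<mu> = sets BX" "space \<mu> = X"
    using p by (auto simp: prob_on_sets prob_on_space)
  have pre: "shift_map -` C \<inter> X \<in> sets \<mu>" if "C \<in> sets BX" for C
    using measurable_sets[OF shift_measurable[OF p], of C] that S by simp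
  have cS: "cyl u \<in> sets \<mu>" for u
    using cyl_sets_BX S by simp
  define F where "F C = measure \<mu> (cyl (a # w) \<inter> (shift_map -` C \<inter> X)) * cp \<mu> w - cp \<mu> (a # w) * measure \<mu> (cyl w \<inter> C)" for C
  have "F B = 0"
  proof (rule set_function_zero[OF _ _ _ B])
    fix u
    have eq: "cyl (a # w) \<inter> (shift_map -` cyl u \<inter> X) = {x \<in> X. x 0 = a} \<inter> (shift_map -` (cyl w \<inter> cyl u) \<inter> X)"
      unfolding cyl_Cons_Int by blast
    \<comment> \<open>Two cylinders are disjoint or nested; only a refinement of
      \<open>cyl w\<close> calls for the Markov property.\<close>
    consider "cyl w \<inter> cyl u = {}" | "cyl w \<inter> cyl u = cyl w" | s where "u = w @ s"
      using cyl_Int[of w u] cyl_Int[of u w] append_take_drop_id[of "length w" u]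
      by (metis Int_commute nat_le_linear)
    then show "F (cyl u) = 0"
    proof cases
      case 1
      then show ?thesis
        using eq by (simp add: F_def)
    next
      case 2
      then have "cyl (a # w) \<inter> (shift_map -` cyl u \<inter> X) = cyl (a # w)"
        unfolding eq by (simp add: cyl_Cons_Int)
      then show ?thesis
        using 2 by (simp add: F_def cp_def)
    next
      case 3
      then have wu: "cyl w \<inter> cyl u = cyl u"
        using cyl_append by blast
      then have "cyl (a # w) \<inter> (shift_map -` cyl u \<inter> X) = cyl (a # u)"
        unfolding eq by (simp add: cyl_Cons_Int)
      then show ?thesis
        using wu markov_Cons[OF w, of a s] 3 by (simp add: F_def cp_def)
    qed
  next
    fix C assume C: "C \<in> sets BX"
    have "C \<subseteq> X"
      using sets.sets_into_space[OF C] by simp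
    have 1: "cyl (a # w) \<inter> (shift_map -` (X - C) \<inter> X) = cyl (a # w) \<inter> (shift_map -` X \<inter> X) - cyl (a # w) \<inter> (shift_map -` C \<inter> X)"
      and 2: "cyl w \<inter> (X - C) = cyl w \<inter> X - cyl w \<inter> C"
      by auto
    have X: "X \<in> sets BX"
      using sets.top[of BX] by simp
    have e1: "measure \<mu> (cyl (a # w) \<inter> (shift_map -` (X - C) \<inter> X)) =
        measure \<mu> (cyl (a # w) \<inter> (shift_map -` X \<inter> X)) - measure \<mu> (cyl (a # w) \<inter> (shift_map -` C \<inter> X))"
      unfolding 1 using cS pre[OF C] pre[OF X] \<open>C \<subseteq> X\<close> by (intro \<mu>.finite_measure_Diff) auto
    have e2: "measure \<mu> (cyl w \<inter> (X - C)) = measure \<mu> (cyl w \<inter> X) - measure \<mu> (cyl w \<inter> C)"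
      unfolding 2 using cS C X S \<open>C \<subseteq> X\<close> by (intro \<mu>.finite_measure_Diff) auto
    show "F (X - C) = F X - F C"
      unfolding F_def e1 e2 by (simp add: algebra_simps)
  next
    fix A :: "nat \<Rightarrow> seq set" assume A: "range A \<subseteq> sets BX" "disjoint_family A"
    have "(\<lambda>i. measure \<mu> (cyl (a # w) \<inter> (shift_map -` A i \<inter> X))) sums measure \<mu> (\<Union>i. cyl (a # w) \<inter> (shift_map -` A i \<inter> X))"
      using A cS pre by (intro \<mu>.finite_measure_UNION) (auto simp: disjoint_family_on_def)
    moreover have "(\<lambda>i. measure \<mu> (cyl w \<inter> A i)) sums measure \<mu> (\<Union>i. cyl w \<inter> A i)"
      using A cS S by (intro \<mu>.finite_measure_UNION) (auto simp: disjoint_family_on_def)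
    moreover have "(\<Union>i. cyl (a # w) \<inter> (shift_map -` A i \<inter> X)) = cyl (a # w) \<inter> (shift_map -` (\<Union>i. A i) \<inter> X)"
      "(\<Union>i. cyl w \<inter> A i) = cyl w \<inter> (\<Union>i. A i)"
      by auto
    ultimately show "(\<lambda>i. F (A i)) sums F (\<Union>i. A i)"
      unfolding F_def by (intro sums_diff sums_mult sums_mult2) simp_all
  qed
  then show ?thesis
    by (simp add: F_def)
qed

text \<open>An invariant set is independent of every cylinder, hence of every Borel set and in
  particular of itself.\<close>

theorem kernel_markov_ergodic: "\<mu> \<in> ergodic_measures X shift_map"
proof -
  interpret \<mu>: prob_space \<mu>
    by (rule prob_on_prob[OF inv_prob_on[OF \<mu>]])
  have p: "prob_on \<mu>"
    by (rule inv_prob_on[OF \<mu>])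
  have S: "sets \<mu> = sets BX" "space \<mu> = X"
    using p by (auto simp: prob_on_sets prob_on_space)
  have cS: "cyl u \<in> sets \<mu>" for u
    using cyl_sets_BX S by simp
  have "measure \<mu> B = 0 \<or> measure \<mu> B = 1" if B: "B \<in> sets \<mu>" and inv: "shift_map -` B \<inter> X = B" for B
  proof -
    define m where "m u = measure \<mu> (cyl u \<inter> B)" for u
    have BB: "B \<in> sets BX"
      using B S by simp
    have m_le: "m u \<le> cp \<mu> u" for u
      unfolding m_def cp_def using cS B by (intro \<mu>.finite_measure_mono) auto
    have m0: "m u = 0" if "cp \<mu> u = 0" for u
      using m_le[of u] that by (simp add: m_def measure_le_0_iff)
    have step: "m (a # w) * cp \<mu> w = cp \<mu> (a # w) * m w" if "length w \<ge> k" for a w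
      using markov_Cons_set[OF that BB, of a] by (simp add: inv m_def)
    have m_snoc: "m u = (\<Sum>b<d. m (u @ [b]))" for u
    proof -
      have "cyl u \<inter> B = (\<Union>b\<in>{..<d}. cyl (u @ [b]) \<inter> B)"
        by (subst cyl_snoc) blast
      then have "m u = measure \<mu> (\<Union>b\<in>{..<d}. cyl (u @ [b]) \<inter> B)"
        by (simp add: m_def)
      also have "\<dots> = (\<Sum>b<d. m (u @ [b]))"
        unfolding m_def
      proof (rule \<mu>.finite_measure_finite_Union)
        show "disjoint_family_on (\<lambda>b. cyl (u @ [b]) \<inter> B) {..<d}"
        proof (unfold disjoint_family_on_def, intro ballI impI)
          fix b b' :: nat assume "b \<noteq> b'"
          then have "cyl (u @ [b]) \<inter> cyl (u @ [b']) = {}"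
            by (intro cyl_disjoint) auto
          then show "cyl (u @ [b]) \<inter> B \<inter> (cyl (u @ [b']) \<inter> B) = {}"
            by blast
        qed
      qed (use cS B in auto)
      finally show ?thesis .
    qed
    \<comment> \<open>By the Markov property and invariance of \<open>B\<close>, the conditional
      probability of \<open>B\<close> given a block is harmonic for the transition matrix.
      Irreducibility leaves only constants.\<close>
    have "\<exists>c. \<forall>w\<in>vertices \<mu>. m w / cp \<mu> w = c * 1"
    proof (rule eigenvector_unique[of "vertices \<mu>" "wmat tq" "\<lambda>_. 1" 1])
      fix w assume w: "w \<in> vertices \<mu>"
      have len: "length w = k" and pos: "cp \<mu> w > 0" and ne: "w \<noteq> []"
        using w vertices_length[OF w] k_pos by (auto simp: vertices_def)
      have tqw: "tq (w @ [b]) = cp \<mu> (w @ [b]) / cp \<mu> w" for b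
        by (simp add: tq_def transition_def len)
      have row: "(\<Sum>x\<in>vertices \<mu>. wmat tq w x * f x) = (\<Sum>b<d. tq (w @ [b]) * f (tl (w @ [b])))" for f
        by (rule wmat_row[OF vertices_finite vertices_length tq_support w])
      show "(\<Sum>x\<in>vertices \<mu>. wmat tq w x * 1) = 1 * 1"
        unfolding row tqw using cp_snoc[OF p, of w] pos by (simp flip: sum_divide_distrib)
      have "(\<Sum>x\<in>vertices \<mu>. wmat tq w x * (m x / cp \<mu> x)) = (\<Sum>b<d. m (w @ [b]) / cp \<mu> w)"
        unfolding row tqw
      proof (intro sum.cong refl)
        fix b
        obtain a v where av: "w @ [b] = a # v" "length v = k"
          using len ne by (cases w) auto
        show "cp \<mu> (w @ [b]) / cp \<mu> w * (m (tl (w @ [b])) / cp \<mu> (tl (w @ [b]))) = m (w @ [b]) / cp \<mu> w"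
        proof (cases "cp \<mu> v = 0")
          case True
          then have "cp \<mu> (a # v) = 0"
            using cp_Cons_le[OF \<mu>, of a v] cp_nonneg[of \<mu> "a # v"] by simp
          then show ?thesis
            using m0 av by simp
        next
          case False
          then have "m (a # v) = cp \<mu> (a # v) * (m v / cp \<mu> v)"
            using step[of v a] av by (simp add: eq_divide_eq)
          then show ?thesis
            using av by simp
        qed
      qed
      then show "(\<Sum>x\<in>vertices \<mu>. wmat tq w x * (m x / cp \<mu> x)) = 1 * (m w / cp \<mu> w)"
        by (simp add: m_snoc[of w] sum_divide_distrib)
    qed (use vertices_finite vertices_nonempty wmat_tq_nonneg irr_tq in auto)
    then obtain c where c: "\<And>w. w \<in> vertices \<mu> \<Longrightarrow> m w = c * cp \<mu> w"
      by (auto simp: vertices_def divide_eq_eq)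
    have ck: "m w = c * cp \<mu> w" if "length w = k" for w
    proof (cases "cp \<mu> w = 0")
      case False
      then have "w \<in> vertices \<mu>"
        using cp_nonneg[of \<mu> w] cp_pos_lang[of \<mu> w] that by (auto simp: vertices_def lang_def less_le)
      then show ?thesis
        by (rule c)
    qed (simp add: m0)
    have long: "m u = c * cp \<mu> u" if "length u \<ge> k" for u
      using that
    proof (induction u)
      case Nil
      then show ?case
        using k_pos by simp
    next
      case (Cons a u)
      show ?case
      proof (cases "length u \<ge> k")
        case True
        show ?thesis
        proof (cases "cp \<mu> u = 0")
          case zero: True
          then have "cp \<mu> (a # u) = 0"
            using cp_Cons_le[OF \<mu>, of a u] cp_nonneg[of \<mu> "a # u"] by simp
          then show ?thesis
            by (simp add: m0)
        next
          case False
          then show ?thesis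
            using step[OF True, of a] Cons.IH[OF True] by simp
        qed
      next
        case False
        then show ?thesis
          using Cons.prems ck[of "a # u"] by simp
      qed
    qed
    have cyl: "m u = c * cp \<mu> u" for u
    proof (induction "k - length u" arbitrary: u)
      case 0
      then show ?case
        by (intro long) simp
    next
      case (Suc n)
      have "m (u @ [b]) = c * cp \<mu> (u @ [b])" for b
        using Suc(2) by (intro Suc(1)) simp
      then show ?case
        by (simp add: m_snoc[of u] cp_snoc[OF p, of u] sum_distrib_left)
    qed
    \<comment> \<open>Independence of \<open>B\<close> from cylinders is carried over to Borel sets
      \<open>C\<close>. The constant \<open>c\<close> is the measure of \<open>B\<close>, so
      \<open>C = B\<close> gives the zero-one law.\<close>
    define F where "F C = measure \<mu> (C \<inter> B) - c * measure \<mu> C" for C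
    have F0: "F C = 0" if C: "C \<in> sets BX" for C
    proof (rule set_function_zero[OF _ _ _ C])
      show "F (cyl u) = 0" for u
        using cyl[of u] by (simp add: F_def m_def cp_def)
    next
      fix C assume C: "C \<in> sets BX"
      have "C \<subseteq> X"
        using sets.sets_into_space[OF C] by simp
      have X: "X \<in> sets \<mu>"
        using S sets.top[of \<mu>] by simp
      have "(X - C) \<inter> B = X \<inter> B - C \<inter> B"
        by blast
      then have e1: "measure \<mu> ((X - C) \<inter> B) = measure \<mu> (X \<inter> B) - measure \<mu> (C \<inter> B)"
        using X B C S \<open>C \<subseteq> X\<close> by (metis \<mu>.finite_measure_Diff Int_mono sets.Int subset_refl)
      have e2: "measure \<mu> (X - C) = measure \<mu> X - measure \<mu> C"
        using X C S \<open>C \<subseteq> X\<close> by (intro \<mu>.finite_measure_Diff) auto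
      show "F (X - C) = F X - F C"
        unfolding F_def e1 e2 by (simp add: algebra_simps)
    next
      fix A :: "nat \<Rightarrow> seq set" assume A: "range A \<subseteq> sets BX" "disjoint_family A"
      have "(\<lambda>i. measure \<mu> (A i \<inter> B)) sums measure \<mu> (\<Union>i. A i \<inter> B)"
        using A B S by (intro \<mu>.finite_measure_UNION) (auto simp: disjoint_family_on_def)
      moreover have "(\<lambda>i. measure \<mu> (A i)) sums measure \<mu> (\<Union>i. A i)"
        using A S by (intro \<mu>.finite_measure_UNION) auto
      moreover have "(\<Union>i. A i \<inter> B) = (\<Union>i. A i) \<inter> B"
        by auto
      ultimately show "(\<lambda>i. F (A i)) sums F (\<Union>i. A i)"
        unfolding F_def by (intro sums_diff sums_mult) simp_all
    qed
    have "B \<subseteq> X"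
      using sets.sets_into_space[OF BB] by simp
    then have "measure \<mu> B = c"
      using cyl[of "[]"] by (simp add: m_def cp_Nil[OF p] Int_absorb1)
    then show ?thesis
      using F0[OF BB] by (auto simp: F_def)
  qed
  then show ?thesis
    using \<mu> S by (simp add: ergodic_measures_def)
qed

end

end

section \<open>Gibbs measures\<close>

locale irreducible_sft = sft_space +
  assumes lang_irreducible: "u \<in> lang k \<Longrightarrow> v \<in> lang k \<Longrightarrow>
    (u, v) \<in> {(w, w'). \<exists>b. w @ [b] \<in> lang (Suc k) \<and> w' = tl (w @ [b])}\<^sup>*"
begin

lemma lang_irreducible_on:
  assumes q: "\<And>e. e \<in> lang (Suc k) \<Longrightarrow> q e > 0"
  shows "irreducible_on (lang k) (wmat q)"
  unfolding irreducible_on_def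
proof (intro ballI)
  fix u v assume uv: "u \<in> lang k" "v \<in> lang k"
  have "{(w, w'). \<exists>b. w @ [b] \<in> lang (Suc k) \<and> w' = tl (w @ [b])} \<subseteq> support_graph (lang k) (wmat q)"
  proof clarify
    fix w b assume e: "w @ [b] \<in> lang (Suc k)"
    then have "length w = k"
      using lang_length by fastforce
    then have "w \<noteq> []"
      using k_pos by auto
    then have "last (tl (w @ [b])) = b"
      by (simp add: last_tl)
    then show "(w, tl (w @ [b])) \<in> support_graph (lang k) (wmat q)"
      using lang_snocD[OF e] q[OF e] by (simp add: support_graph_def wmat_def)
  qed
  then show "(u, v) \<in> (support_graph (lang k) (wmat q))\<^sup>*"
    using lang_irreducible[OF uv] rtrancl_mono by blast
qed

lemma lang_butlast_tl:
  assumes "e \<in> lang (Suc k)"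
  shows "butlast e \<in> lang k" "tl e \<in> lang k" "e \<in> words d (Suc k)" "e = butlast e @ [last e]" "length e = Suc k"
proof -
  have len: "length e = Suc k"
    using assms by (rule lang_length)
  then have e: "e = butlast e @ [last e]"
    by (cases e rule: rev_cases) auto
  then show "butlast e \<in> lang k" "tl e \<in> lang k"
    using lang_snocD[of "butlast e" "last e" k] assms by simp_all
  show "e \<in> words d (Suc k)" "e = butlast e @ [last e]" "length e = Suc k"
    using assms lang_words e len by auto
qed

end

text \<open>\<open>G\<close> is \<open>t\<close> times the potential at a fixed \<open>t\<close>;
  freezing the Perron data of one matrix removes \<open>t\<close> from the variational
  argument.\<close>

locale gibbs_data = irreducible_sft +
  fixes G :: "nat list \<Rightarrow> real" and c :: real and l r :: "nat list \<Rightarrow> real"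
  assumes c_pos: "c > 0"
    and l_pos: "v \<in> lang k \<Longrightarrow> l v > 0"
    and r_pos: "v \<in> lang k \<Longrightarrow> r v > 0"
    and r_eig: "v \<in> lang k \<Longrightarrow>
      (\<Sum>w\<in>lang k. wmat (\<lambda>e. if e \<in> lang (Suc k) then exp (G (butlast e)) else 0) v w * r w) = c * r v"
    and l_eig: "v \<in> lang k \<Longrightarrow>
      (\<Sum>w\<in>lang k. l w * wmat (\<lambda>e. if e \<in> lang (Suc k) then exp (G (butlast e)) else 0) w v) = c * l v"
    and lr_sum: "(\<Sum>v\<in>lang k. l v * r v) = 1"
begin

definition q :: "nat list \<Rightarrow> real" where
  "q e = (if e \<in> lang (Suc k) then exp (G (butlast e)) else 0)"

definition p :: "nat list \<Rightarrow> real" where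
  "p e = (if e \<in> lang (Suc k) then l (butlast e) * exp (G (butlast e)) * r (tl e) / c else 0)"

text \<open>The Doob transform of the matrix by its right eigenvector, with rows summing to 1;
  \<open>p\<close> is the stationary edge law of this chain.\<close>

definition kern :: "nat list \<Rightarrow> real" where
  "kern e = (if e \<in> lang (Suc k) then exp (G (butlast e)) * r (tl e) / (c * r (butlast e)) else 0)"

lemma p_q: "p e = l (butlast e) * q e * r (tl e) / c"
  by (simp add: p_def q_def)

lemma q_support: "q e \<noteq> 0 \<Longrightarrow> e \<in> words d (Suc k) \<and> butlast e \<in> lang k \<and> tl e \<in> lang k"
  using lang_butlast_tl by (auto simp: q_def split: if_splits)

lemma q_row: "w \<in> lang k \<Longrightarrow> (\<Sum>b<d. q (w @ [b]) * r (tl (w @ [b]))) = c * r w"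
  using wmat_row[of "lang k" q w r] finite_lang lang_length q_support r_eig[of w]
  unfolding q_def[abs_def] by simp

lemma q_col: "w \<in> lang k \<Longrightarrow> (\<Sum>a<d. l (butlast (a # w)) * q (a # w)) = c * l w"
  using wmat_col[of "lang k" q w l] finite_lang lang_length q_support l_eig[of w]
  unfolding q_def[abs_def] by simp

lemma p_snoc_sum: "(\<Sum>b<d. p (w @ [b])) = (if w \<in> lang k then l w * r w else 0)"
proof (cases "w \<in> lang k")
  case True
  have "(\<Sum>b<d. p (w @ [b])) = l w / c * (\<Sum>b<d. q (w @ [b]) * r (tl (w @ [b])))"
    by (simp add: p_q sum_distrib_left mult_ac)
  then show ?thesis
    using q_row[OF True] c_pos True by simp
next
  case False
  then have "p (w @ [b]) = 0" for b
    using lang_snocD(1)[of w b k] by (auto simp: p_def)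
  then show ?thesis
    using False by simp
qed

lemma p_Cons_sum: "(\<Sum>a<d. p (a # w)) = (if w \<in> lang k then l w * r w else 0)"
proof (cases "w \<in> lang k")
  case True
  have "(\<Sum>a<d. p (a # w)) = (\<Sum>a<d. l (butlast (a # w)) * q (a # w)) * r w / c"
    unfolding p_q by (simp only: list.sel sum_distrib_right sum_divide_distrib)
  then show ?thesis
    using q_col[OF True] c_pos True by simp
next
  case False
  then have "p (a # w) = 0" for a
    using lang_CopsD(1)[of a w k] by (auto simp: p_def)
  then show ?thesis
    using False by simp
qed

lemma flow_p: "flow p"
proof -
  have "p e \<ge> 0" for e
    using lang_butlast_tl(1,2)[of e] l_pos[of "butlast e"] r_pos[of "tl e"] c_pos
    by (auto simp: p_def intro!: divide_nonneg_nonneg mult_nonneg_nonneg less_imp_le)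
  moreover have "(\<Sum>e\<in>words d (Suc k). p e) = 1"
  proof -
    have "(\<Sum>e\<in>words d (Suc k). p e) = (\<Sum>w\<in>words d k. if w \<in> lang k then l w * r w else 0)"
      by (simp add: sum_words_snoc p_snoc_sum)
    also have "\<dots> = (\<Sum>w\<in>lang k. l w * r w)"
      using lang_words by (intro sum.mono_neutral_cong_right finite_words) auto
    finally show ?thesis
      by (simp add: lr_sum)
  qed
  moreover have "p e = 0" if "e \<notin> lang (Suc k)" for e
    using that by (simp add: p_def)
  ultimately show ?thesis
    by (simp add: flow_def p_snoc_sum p_Cons_sum)
qed

lemma kern_eq: "p e / outflow p (butlast e) = kern e"
proof -
  have "outflow p (butlast e) = (if butlast e \<in> lang k then l (butlast e) * r (butlast e) else 0)"
    by (simp only: outflow_def p_snoc_sum)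
  then show ?thesis
    using l_pos[of "butlast e"] lang_butlast_tl(1)[of e] by (auto simp: kern_def p_def)
qed

lemma kern_sum: "w \<in> lang k \<Longrightarrow> (\<Sum>b<d. kern (w @ [b])) = 1"
proof -
  assume w: "w \<in> lang k"
  have "(\<Sum>b<d. kern (w @ [b])) = (\<Sum>b<d. q (w @ [b]) * r (tl (w @ [b]))) / (c * r w)"
    unfolding sum_divide_distrib by (intro sum.cong) (auto simp: kern_def q_def)
  then show ?thesis
    using q_row[OF w] r_pos[OF w] c_pos by simp
qed

lemma kern_pos: "e \<in> lang (Suc k) \<Longrightarrow> kern e > 0"
  using lang_butlast_tl(1,2)[of e] r_pos[of "butlast e"] r_pos[of "tl e"] c_pos by (simp add: kern_def)

definition gibbs :: "seq measure" where
  "gibbs = (SOME \<mu>. \<mu> \<in> Inv \<and> (\<forall>e\<in>words d (Suc k). cp \<mu> e = p e) \<and> kernel_markov kern \<mu>)"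

lemma gibbs: "gibbs \<in> Inv" "e \<in> words d (Suc k) \<Longrightarrow> cp gibbs e = p e" "kernel_markov kern gibbs"
proof -
  have "\<exists>\<mu>. \<mu> \<in> Inv \<and> (\<forall>e\<in>words d (Suc k). cp \<mu> e = p e) \<and> kernel_markov kern \<mu>"
    using markov_measure_exists[OF flow_p] by (auto simp: kern_eq)
  then have "gibbs \<in> Inv \<and> (\<forall>e\<in>words d (Suc k). cp gibbs e = p e) \<and> kernel_markov kern gibbs"
    unfolding gibbs_def by (rule someI_ex)
  then show "gibbs \<in> Inv" "e \<in> words d (Suc k) \<Longrightarrow> cp gibbs e = p e" "kernel_markov kern gibbs"
    by auto
qed

lemma cp_gibbs_k: "w \<in> words d k \<Longrightarrow> cp gibbs w = (if w \<in> lang k then l w * r w else 0)"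
proof -
  assume w: "w \<in> words d k"
  have "cp gibbs w = (\<Sum>b<d. cp gibbs (w @ [b]))"
    by (rule cp_snoc[OF inv_prob_on[OF gibbs(1)]])
  also have "\<dots> = (\<Sum>b<d. p (w @ [b]))"
    using w by (intro sum.cong refl gibbs(2)) (simp add: words_snoc_iff)
  finally show ?thesis
    by (simp add: p_snoc_sum)
qed

lemma vertices_gibbs: "vertices gibbs = lang k"
  using cp_gibbs_k l_pos r_pos lang_words by (auto simp: vertices_def split: if_splits)

lemma irreducible_gibbs: "irreducible_on (vertices gibbs) (wmat (transition gibbs))"
  unfolding vertices_gibbs
proof (rule lang_irreducible_on)
  fix e assume e: "e \<in> lang (Suc k)"
  note * = lang_butlast_tl[OF e]
  have "cp gibbs e > 0"
    using gibbs(2)[OF *(3)] e l_pos[OF *(1)] r_pos[OF *(2)] c_pos by (simp add: p_def)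
  moreover have "cp gibbs (butlast e) > 0"
    using cp_gibbs_k[OF lang_words[OF *(1)]] *(1) l_pos r_pos by simp
  ultimately show "transition gibbs e > 0"
    by (simp add: transition_def)
qed

text \<open>Gibbs' inequality compares the words of length \<open>j + 1\<close> under
  \<open>\<nu>\<close> with a law whose last letter follows \<open>kern\<close>. Equality forces the
  transitions of \<open>\<nu>\<close> at order \<open>j\<close> to be those of
  \<open>kern\<close>.\<close>

lemma pressure:
  assumes \<nu>: "\<nu> \<in> Inv" and j: "j \<ge> k"
  shows "block_entropy \<nu> (Suc j) - block_entropy \<nu> j + (\<integral>x. G (prefix k x) \<partial>\<nu>) \<le> ln c"
    and "block_entropy \<nu> (Suc j) - block_entropy \<nu> j + (\<integral>x. G (prefix k x) \<partial>\<nu>) = ln c \<Longrightarrow>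
      u \<in> words d j \<Longrightarrow> b < d \<Longrightarrow> cp \<nu> (u @ [b]) = cp \<nu> u * kern (lastk u @ [b])"
proof -
  have P: "prob_on \<nu>"
    by (rule inv_prob_on[OF \<nu>])
  \<comment> \<open>The first \<open>j\<close> letters keep their law under \<open>\<nu>\<close>,
    the last one is drawn from \<open>kern\<close>.\<close>
  define B where "B e = cp \<nu> (butlast e) * kern (lastk (butlast e) @ [last e])" for e
  have kern_nonneg: "kern e \<ge> 0" for e
    using kern_pos[of e] by (cases "e \<in> lang (Suc k)") (auto simp: kern_def)
  have blk: "lastk (prefix j x) @ [x j] = prefix (Suc k) ((shift_map ^^ (j - k)) x)" for x
    using j by (simp add: lastk_prefix prefix_Suc shift_pow)
  have B_prefix: "B (prefix (Suc j) x) = cp \<nu> (prefix j x) * kern (prefix (Suc k) ((shift_map ^^ (j - k)) x))" for x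
    by (simp add: B_def prefix_Suc[of j] blk)
  have B_sum: "(\<Sum>e\<in>words d (Suc j). B e) = 1"
  proof -
    have "(\<Sum>b<d. B (u @ [b])) = cp \<nu> u" if "u \<in> words d j" for u
    proof (cases "cp \<nu> u = 0")
      case True
      then show ?thesis
        by (simp add: B_def)
    next
      case False
      then have "u \<in> lang j"
        using cp_pos_lang[of \<nu> u] cp_nonneg[of \<nu> u] words_length[OF that] by (simp add: less_le)
      then obtain x where "x \<in> X" "u = prefix j x"
        by (auto simp: lang_iff)
      then have "lastk u \<in> lang k"
        using j prefix_lang shift_pow_closed by (simp add: lastk_prefix)
      then show ?thesis
        using kern_sum[of "lastk u"] by (simp add: B_def flip: sum_distrib_left)
    qed
    then show ?thesis
      using cp_sum_words[OF P, of j] by (simp add: sum_words_snoc)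
  qed
  have pos: "B e > 0" if "e \<in> words d (Suc j)" "cp \<nu> e > 0" for e
  proof -
    have "e \<in> lang (Suc j)"
      using cp_pos_lang[OF that(2)] words_length[OF that(1)] by simp
    then obtain x where x: "x \<in> X" "e = prefix (Suc j) x"
      by (auto simp: lang_iff)
    have "cp \<nu> (prefix j x) > 0"
      using cp_append_le[OF P, of "prefix j x" "[x j]"] that(2) x(2) by (simp add: prefix_Suc)
    moreover have "kern (prefix (Suc k) ((shift_map ^^ (j - k)) x)) > 0"
      using x(1) by (intro kern_pos prefix_lang shift_pow_closed)
    ultimately show ?thesis
      unfolding x(2) B_prefix by simp
  qed
  have nonneg: "B e \<ge> 0" for e
    by (simp add: B_def cp_nonneg kern_nonneg)
  let ?i = "j - k"
  \<comment> \<open>The logarithm of \<open>kern\<close> is \<open>G - ln c\<close> plus a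
    coboundary of \<open>ln r\<close>, and coboundaries integrate to zero by invariance.\<close>
  let ?L = "\<lambda>x. ln (cp \<nu> (prefix j x)) + (G (prefix k ((shift_map ^^ ?i) x)) +
      (ln (r (prefix k ((shift_map ^^ Suc ?i) x))) - ln (r (prefix k ((shift_map ^^ ?i) x))) - ln c))"
  have int: "integrable \<nu> (\<lambda>x. f (prefix m ((shift_map ^^ i) x)))" for f :: "nat list \<Rightarrow> real" and m i
    by (rule integrable_prefix_shift[OF P])
  have int0: "integrable \<nu> (\<lambda>x. f (prefix m x))" for f :: "nat list \<Rightarrow> real" and m
    by (rule integral_prefix(2)[OF P])
  have shift: "(\<integral>x. f (prefix m ((shift_map ^^ i) x)) \<partial>\<nu>) = (\<integral>x. f (prefix m x) \<partial>\<nu>)" for f :: "nat list \<Rightarrow> real" and m i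
    by (rule integral_shift_pow[OF \<nu> borel_measurable_integrable[OF int0]])
  have "(\<Sum>e\<in>words d (Suc j). cp \<nu> e * ln (B e)) = (\<integral>x. ln (B (prefix (Suc j) x)) \<partial>\<nu>)"
    using integral_prefix(1)[OF P, of "\<lambda>e. ln (B e)" "Suc j"] by (simp add: mult.commute)
  also have "\<dots> = (\<integral>x. ?L x \<partial>\<nu>)"
  proof (rule integral_cong_AE)
    show "(\<lambda>x. ln (B (prefix (Suc j) x))) \<in> borel_measurable \<nu>"
      by (rule borel_measurable_integrable[OF int0[of "\<lambda>e. ln (B e)"]])
    show "?L \<in> borel_measurable \<nu>"
      by (intro borel_measurable_integrable Bochner_Integration.integrable_add Bochner_Integration.integrable_diff
          int[of G] int[of "\<lambda>w. ln (r w)"] int0[of "\<lambda>w. ln (cp \<nu> w)"])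
         (simp add: prob_space.finite_measure[OF prob_on_prob[OF P], THEN finite_measure.integrable_const])
    have "AE x in \<nu>. x \<in> X"
      using P by (auto simp: prob_on_space[symmetric])
    with AE_cp_pos[OF P, of j] show "AE x in \<nu>. ln (B (prefix (Suc j) x)) = ?L x"
    proof eventually_elim
      case (elim x)
      let ?y = "(shift_map ^^ ?i) x"
      have y: "?y \<in> X"
        using elim(2) by (rule shift_pow_closed)
      have tl: "tl (prefix (Suc k) ?y) = prefix k (shift_map ?y)" "butlast (prefix (Suc k) ?y) = prefix k ?y"
        by (simp add: prefix_shift) (simp add: prefix_Suc)
      have rp: "r (prefix k (shift_map ?y)) > 0" "r (prefix k ?y) > 0"
        using y by (auto intro!: r_pos prefix_lang shift_closed)
      have "kern (prefix (Suc k) ?y) = exp (G (prefix k ?y)) * r (prefix k (shift_map ?y)) / (c * r (prefix k ?y))"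
        using prefix_lang[OF y, of "Suc k"] by (simp add: kern_def tl)
      then have "ln (kern (prefix (Suc k) ?y)) = G (prefix k ?y) + (ln (r (prefix k (shift_map ?y))) - ln (r (prefix k ?y)) - ln c)"
        using rp c_pos by (simp add: ln_div ln_mult_pos)
      moreover have "kern (prefix (Suc k) ?y) > 0"
        by (intro kern_pos prefix_lang y)
      ultimately show ?case
        using elim(1) by (simp add: B_prefix ln_mult_pos)
    qed
  qed
  also have "\<dots> = (\<integral>x. ln (cp \<nu> (prefix j x)) \<partial>\<nu>) + ((\<integral>x. G (prefix k ((shift_map ^^ ?i) x)) \<partial>\<nu>) +
      ((\<integral>x. ln (r (prefix k ((shift_map ^^ Suc ?i) x))) \<partial>\<nu>) - (\<integral>x. ln (r (prefix k ((shift_map ^^ ?i) x))) \<partial>\<nu>) - (\<integral>x. ln c \<partial>\<nu>)))"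
  proof -
    have intc: "integrable \<nu> (\<lambda>x. ln c)"
      by (simp add: prob_space.finite_measure[OF prob_on_prob[OF P], THEN finite_measure.integrable_const])
    note i = int0[of "\<lambda>w. ln (cp \<nu> w)" j] int[of G k ?i] int[of "\<lambda>w. ln (r w)" k] intc
    have 1: "integrable \<nu> (\<lambda>x. ln (r (prefix k ((shift_map ^^ Suc ?i) x))) - ln (r (prefix k ((shift_map ^^ ?i) x))))"
      by (intro Bochner_Integration.integrable_diff i)
    have 2: "integrable \<nu> (\<lambda>x. ln (r (prefix k ((shift_map ^^ Suc ?i) x))) - ln (r (prefix k ((shift_map ^^ ?i) x))) - ln c)"
      by (intro Bochner_Integration.integrable_diff 1 i)
    show ?thesis
      by (subst Bochner_Integration.integral_add[OF i(1) Bochner_Integration.integrable_add[OF i(2) 2]],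
          subst Bochner_Integration.integral_add[OF i(2) 2],
          subst Bochner_Integration.integral_diff[OF 1 intc],
          subst Bochner_Integration.integral_diff[OF i(3) i(3)]) (rule refl)
  qed
  also have "\<dots> = - block_entropy \<nu> j + (\<integral>x. G (prefix k x) \<partial>\<nu>) - ln c"
    unfolding shift[of G] shift[of "\<lambda>w. ln (r w)"] integral_ln_cp[OF P]
    using prob_space.prob_space[OF prob_on_prob[OF P]] by simp
  finally have cross: "(\<Sum>e\<in>words d (Suc j). cp \<nu> e * ln (B e)) = - block_entropy \<nu> j + (\<integral>x. G (prefix k x) \<partial>\<nu>) - ln c" .
  have self: "(\<Sum>e\<in>words d (Suc j). cp \<nu> e * ln (cp \<nu> e)) = - block_entropy \<nu> (Suc j)"
    by (simp add: block_entropy_def)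
  have le: "(\<Sum>e\<in>words d (Suc j). B e) \<le> (\<Sum>e\<in>words d (Suc j). cp \<nu> e)"
    using B_sum cp_sum_words[OF P, of "Suc j"] by simp
  note gi = gibbs_inequality[of "words d (Suc j)" "cp \<nu>" B, OF finite_words cp_nonneg nonneg pos le]
  show "block_entropy \<nu> (Suc j) - block_entropy \<nu> j + (\<integral>x. G (prefix k x) \<partial>\<nu>) \<le> ln c"
    using gi(1) unfolding cross self by simp
  assume eq: "block_entropy \<nu> (Suc j) - block_entropy \<nu> j + (\<integral>x. G (prefix k x) \<partial>\<nu>) = ln c"
    and ub: "u \<in> words d j" "b < d"
  have "cp \<nu> (u @ [b]) = B (u @ [b])"
  proof (rule gi(2))
    show "(\<Sum>e\<in>words d (Suc j). cp \<nu> e * ln (B e)) = (\<Sum>e\<in>words d (Suc j). cp \<nu> e * ln (cp \<nu> e))"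
      unfolding cross self using eq by simp
  qed (use ub words_snoc_iff in auto)
  then show "cp \<nu> (u @ [b]) = cp \<nu> u * kern (lastk u @ [b])"
    by (simp add: B_def)
qed

text \<open>By the Markov property each increment is minus the integral of \<open>ln kern\<close>
  over one window. This is the affine growth required by \<open>ks_entropy_ge\<close>.\<close>

lemma kernel_markov_block_entropy:
  assumes \<nu>: "\<nu> \<in> Inv" and K: "kernel_markov kern \<nu>" and j: "j \<ge> k"
  shows "block_entropy \<nu> (Suc j) - block_entropy \<nu> j = block_entropy \<nu> (Suc k) - block_entropy \<nu> k"
proof -
  have P: "prob_on \<nu>"
    by (rule inv_prob_on[OF \<nu>])
  have "block_entropy \<nu> (Suc j) - block_entropy \<nu> j = - (\<integral>x. ln (kern (prefix (Suc k) x)) \<partial>\<nu>)" if "j \<ge> k" for j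
  proof -
    have "- block_entropy \<nu> (Suc j) = (\<integral>x. ln (cp \<nu> (prefix (Suc j) x)) \<partial>\<nu>)"
      by (simp add: integral_ln_cp[OF P])
    also have "\<dots> = (\<integral>x. ln (cp \<nu> (prefix j x)) + ln (kern (prefix (Suc k) ((shift_map ^^ (j - k)) x))) \<partial>\<nu>)"
    proof (rule integral_cong_AE)
      show "(\<lambda>x. ln (cp \<nu> (prefix (Suc j) x))) \<in> borel_measurable \<nu>"
        by (rule borel_measurable_integrable[OF integral_prefix(2)[OF P, of "\<lambda>u. ln (cp \<nu> u)"]])
      show "(\<lambda>x. ln (cp \<nu> (prefix j x)) + ln (kern (prefix (Suc k) ((shift_map ^^ (j - k)) x)))) \<in> borel_measurable \<nu>"
        by (intro borel_measurable_integrable Bochner_Integration.integrable_add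
            integral_prefix(2)[OF P, of "\<lambda>u. ln (cp \<nu> u)"] integrable_prefix_shift[OF P, of "\<lambda>u. ln (kern u)"])
      have "AE x in \<nu>. x \<in> X"
        using P by (auto simp: prob_on_space[symmetric])
      with AE_cp_pos[OF P, of j] show "AE x in \<nu>. ln (cp \<nu> (prefix (Suc j) x)) =
          ln (cp \<nu> (prefix j x)) + ln (kern (prefix (Suc k) ((shift_map ^^ (j - k)) x)))"
      proof eventually_elim
        case (elim x)
        have "cp \<nu> (prefix (Suc j) x) = cp \<nu> (prefix j x) * kern (prefix (Suc k) ((shift_map ^^ (j - k)) x))"
          using K that by (simp add: kernel_markov_def prefix_Suc lastk_prefix shift_pow)
        moreover have "kern (prefix (Suc k) ((shift_map ^^ (j - k)) x)) > 0"
          using elim(2) by (intro kern_pos prefix_lang shift_pow_closed)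
        ultimately show ?case
          using elim(1) by (simp add: ln_mult_pos)
      qed
    qed
    also have "\<dots> = (\<integral>x. ln (cp \<nu> (prefix j x)) \<partial>\<nu>) + (\<integral>x. ln (kern (prefix (Suc k) ((shift_map ^^ (j - k)) x))) \<partial>\<nu>)"
      by (rule Bochner_Integration.integral_add[OF integral_prefix(2)[OF P, of "\<lambda>u. ln (cp \<nu> u)"]
            integrable_prefix_shift[OF P, of "\<lambda>u. ln (kern u)"]])
    also have "(\<integral>x. ln (kern (prefix (Suc k) ((shift_map ^^ (j - k)) x))) \<partial>\<nu>) = (\<integral>x. ln (kern (prefix (Suc k) x)) \<partial>\<nu>)"
      by (rule integral_shift_pow[OF \<nu> borel_measurable_integrable[OF integral_prefix(2)[OF P, of "\<lambda>u. ln (kern u)"]]])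
    finally show ?thesis
      by (simp add: integral_ln_cp[OF P])
  qed
  from this[OF j] this[OF order_refl] show ?thesis
    by simp
qed

text \<open>For the candidate itself the comparison law coincides with its own law, so the bound in
  \<open>pressure\<close> is attained.\<close>

lemma gibbs_pressure: "block_entropy gibbs (Suc k) - block_entropy gibbs k + (\<integral>x. G (prefix k x) \<partial>gibbs) = ln c"
proof -
  have P: "prob_on gibbs"
    by (rule inv_prob_on[OF gibbs(1)])
  note i = integral_prefix[OF P]
  let ?L = "\<lambda>x. G (prefix k x) + (ln (r (prefix k (shift_map x))) - ln (r (prefix k x)) - ln c)"
  have r1: "integrable gibbs (\<lambda>x. ln (r (prefix k (shift_map x))))"
    using integrable_prefix_shift[OF P, of "\<lambda>w. ln (r w)" k 1] by simp
  have r2: "(\<integral>x. ln (r (prefix k (shift_map x))) \<partial>gibbs) = (\<integral>x. ln (r (prefix k x)) \<partial>gibbs)"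
    using integral_shift_pow[OF gibbs(1) borel_measurable_integrable[OF i(2)[of "\<lambda>w. ln (r w)" k]], of 1] by simp
  have intc: "integrable gibbs (\<lambda>x. ln c)"
    by (simp add: prob_space.finite_measure[OF prob_on_prob[OF P], THEN finite_measure.integrable_const])
  have "- block_entropy gibbs (Suc k) = (\<integral>x. ln (cp gibbs (prefix (Suc k) x)) \<partial>gibbs)"
    by (simp add: integral_ln_cp[OF P])
  also have "\<dots> = (\<integral>x. ln (cp gibbs (prefix k x)) + ?L x \<partial>gibbs)"
  proof (rule integral_cong_AE)
    show "(\<lambda>x. ln (cp gibbs (prefix (Suc k) x))) \<in> borel_measurable gibbs"
      by (rule borel_measurable_integrable[OF i(2)[of "\<lambda>w. ln (cp gibbs w)"]])
    show "(\<lambda>x. ln (cp gibbs (prefix k x)) + ?L x) \<in> borel_measurable gibbs"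
      by (intro borel_measurable_integrable Bochner_Integration.integrable_add Bochner_Integration.integrable_diff
          i(2)[of G] i(2)[of "\<lambda>w. ln (cp gibbs w)"] i(2)[of "\<lambda>w. ln (r w)"] r1 intc)
    have "AE x in gibbs. x \<in> X"
      using AE_space[of gibbs] unfolding prob_on_space[OF P] .
    with AE_cp_pos[OF P, of k] show "AE x in gibbs. ln (cp gibbs (prefix (Suc k) x)) = ln (cp gibbs (prefix k x)) + ?L x"
    proof eventually_elim
      case (elim x)
      have K1: "cp gibbs (prefix (Suc k) x) = cp gibbs (prefix k x) * kern (prefix (Suc k) x)"
        using gibbs(3) by (simp add: kernel_markov_def prefix_Suc lastk_id)
      have kp: "kern (prefix (Suc k) x) > 0"
        by (intro kern_pos prefix_lang elim(2))
      have tl: "tl (prefix (Suc k) x) = prefix k (shift_map x)" "butlast (prefix (Suc k) x) = prefix k x"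
        by (simp add: prefix_shift) (simp add: prefix_Suc)
      have ke: "kern (prefix (Suc k) x) = exp (G (prefix k x)) * r (prefix k (shift_map x)) / (c * r (prefix k x))"
        using prefix_lang[OF elim(2), of "Suc k"] by (simp add: kern_def tl)
      have rp: "r (prefix k (shift_map x)) > 0" "r (prefix k x) > 0"
        using elim(2) by (auto intro!: r_pos prefix_lang shift_closed)
      have "ln (kern (prefix (Suc k) x)) = ?L x"
        unfolding ke using rp c_pos by (simp add: ln_div ln_mult_pos)
      then show ?case
        unfolding K1 using elim(1) kp by (simp add: ln_mult_pos)
    qed
  qed
  also have "\<dots> = - block_entropy gibbs k + ((\<integral>x. G (prefix k x) \<partial>gibbs) - ln c)"
  proof -
    have 1: "integrable gibbs (\<lambda>x. ln (r (prefix k (shift_map x))) - ln (r (prefix k x)))"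
      by (intro Bochner_Integration.integrable_diff r1 i(2))
    have 2: "integrable gibbs (\<lambda>x. ln (r (prefix k (shift_map x))) - ln (r (prefix k x)) - ln c)"
      by (intro Bochner_Integration.integrable_diff 1 intc)
    have 3: "integrable gibbs ?L"
      by (intro Bochner_Integration.integrable_add i(2) 2)
    have "(\<integral>x. ln (cp gibbs (prefix k x)) + ?L x \<partial>gibbs) = (\<integral>x. ln (cp gibbs (prefix k x)) \<partial>gibbs) +
      ((\<integral>x. G (prefix k x) \<partial>gibbs) + ((\<integral>x. ln (r (prefix k (shift_map x))) \<partial>gibbs) - (\<integral>x. ln (r (prefix k x)) \<partial>gibbs) - (\<integral>x. ln c \<partial>gibbs)))"
      by (subst Bochner_Integration.integral_add[OF i(2)[of "\<lambda>w. ln (cp gibbs w)"] 3],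
          subst Bochner_Integration.integral_add[OF i(2)[of G] 2],
          subst Bochner_Integration.integral_diff[OF 1 intc],
          subst Bochner_Integration.integral_diff[OF r1 i(2)[of "\<lambda>w. ln (r w)"]]) (rule refl)
    then show ?thesis
      unfolding r2 integral_ln_cp[OF P] using prob_space.prob_space[OF prob_on_prob[OF P]] by simp
  qed
  finally show ?thesis
    by simp
qed

text \<open>The entropy is bounded by conditional block entropies of every order, so a competitor
  reaching \<open>ln c\<close> attains equality in \<open>pressure\<close> for all
  \<open>j \<ge> k\<close>. It is then Markov with kernel \<open>kern\<close>, and irreducibility
  leaves only \<open>gibbs\<close>.\<close>

lemma equilibrium_state_gibbs:
  assumes \<psi>: "\<And>x. x \<in> X \<Longrightarrow> \<psi> x = G (prefix k x)"
  shows "equilibrium_state X shift_map \<psi> = gibbs"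
proof -
  have int: "(\<integral>x. \<psi> x \<partial>\<nu>) = (\<integral>x. G (prefix k x) \<partial>\<nu>)" if "\<nu> \<in> Inv" for \<nu>
    using prob_on_space[OF inv_prob_on[OF that]] by (intro Bochner_Integration.integral_cong) (auto simp: \<psi>)
  have ks: "ks_entropy gibbs shift_map = ereal (block_entropy gibbs (Suc k) - block_entropy gibbs k)"
    using ks_entropy_le[OF gibbs(1), of k]
      ks_entropy_ge[OF gibbs(1) kernel_markov_block_entropy[OF gibbs(1) gibbs(3)]] by (rule antisym)
  have val: "ks_entropy gibbs shift_map + ereal (\<integral>x. \<psi> x \<partial>gibbs) = ereal (ln c)"
    unfolding ks int[OF gibbs(1)] using gibbs_pressure by simp
  have ub: "ks_entropy \<nu> shift_map + ereal (\<integral>x. \<psi> x \<partial>\<nu>) \<le>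
      ereal (block_entropy \<nu> (Suc j) - block_entropy \<nu> j + (\<integral>x. G (prefix k x) \<partial>\<nu>))" if "\<nu> \<in> Inv" for \<nu> j
    using add_right_mono[OF ks_entropy_le[OF that, of j], of "ereal (\<integral>x. G (prefix k x) \<partial>\<nu>)"] int[OF that] by simp
  have eq: "is_equilibrium_state X shift_map \<psi> gibbs"
    unfolding is_equilibrium_state_def val
  proof (intro conjI ballI gibbs(1))
    fix \<nu> assume \<nu>: "\<nu> \<in> Inv"
    have "ks_entropy \<nu> shift_map + ereal (\<integral>x. \<psi> x \<partial>\<nu>) \<le>
        ereal (block_entropy \<nu> (Suc k) - block_entropy \<nu> k + (\<integral>x. G (prefix k x) \<partial>\<nu>))"
      by (rule ub[OF \<nu>])
    also have "\<dots> \<le> ereal (ln c)"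
      using pressure(1)[OF \<nu> order_refl] by simp
    finally show "ks_entropy \<nu> shift_map + ereal (\<integral>x. \<psi> x \<partial>\<nu>) \<le> ereal (ln c)" .
  qed
  have "\<nu> = gibbs" if "is_equilibrium_state X shift_map \<psi> \<nu>" for \<nu>
  proof -
    have \<nu>: "\<nu> \<in> Inv"
      using that by (simp add: is_equilibrium_state_def)
    have ge: "ereal (ln c) \<le> ks_entropy \<nu> shift_map + ereal (\<integral>x. \<psi> x \<partial>\<nu>)"
      using that gibbs(1) val by (auto simp: is_equilibrium_state_def)
    have eq: "block_entropy \<nu> (Suc j) - block_entropy \<nu> j + (\<integral>x. G (prefix k x) \<partial>\<nu>) = ln c" if "j \<ge> k" for j
      using order_trans[OF ge ub[OF \<nu>, of j]] pressure(1)[OF \<nu> that] by simp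
    have "kernel_markov kern \<nu>"
      unfolding kernel_markov_def
    proof (intro allI impI)
      fix u :: "nat list" and b assume u: "length u \<ge> k"
      show "cp \<nu> (u @ [b]) = cp \<nu> u * kern (lastk u @ [b])"
      proof (cases "u \<in> words d (length u) \<and> b < d")
        case True
        then show ?thesis
          using pressure(2)[OF \<nu> u eq[OF u]] by blast
      next
        case False
        then have "cp \<nu> (u @ [b]) = 0"
          by (intro cp_outside) (simp add: words_snoc_iff)
        moreover have "cp \<nu> u = 0 \<or> kern (lastk u @ [b]) = 0"
        proof (cases "b < d")
          case True
          then show ?thesis
            using False cp_outside by blast
        next
          case b: False
          then have "lastk u @ [b] \<notin> lang (Suc k)"
            using lang_snocD(2) by blast
          then show ?thesis
            by (simp add: kern_def)
        qed
        ultimately show ?thesis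
          by auto
      qed
    qed
    moreover have "cp \<nu> w = 0" if "w \<in> words d k" "w \<notin> vertices gibbs" for w
      using that cp_pos_lang[of \<nu> w] cp_nonneg[of \<nu> w] words_length[OF that(1)] by (auto simp: vertices_gibbs less_le)
    ultimately show ?thesis
      using kernel_markov_unique[OF gibbs(1) gibbs(3) irreducible_gibbs \<nu>] by blast
  qed
  with eq show ?thesis
    unfolding equilibrium_state_def by (intro the_equality)
qed

end

section \<open>Limits of cocycles and weak convergence\<close>

text \<open>Comparing the values at \<open>t + 1\<close> and at \<open>t\<close> isolates the
  slope.\<close>

lemma linear_convergent_zero:
  fixes A c :: real
  assumes "((\<lambda>t. t * A) \<longlongrightarrow> c) at_top"
  shows "A = 0" "c = 0"
proof -
  have "filterlim (\<lambda>t :: real. t + 1) at_top at_top"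
    using filterlim_tendsto_add_at_top[OF tendsto_const filterlim_ident, of "1 :: real"] by (simp add: add.commute)
  then have "((\<lambda>t. (t + 1) * A) \<longlongrightarrow> c) at_top"
    by (rule filterlim_compose[OF assms])
  then have "((\<lambda>t. (t + 1) * A - t * A) \<longlongrightarrow> c - c) at_top"
    by (intro tendsto_diff assms)
  then have "((\<lambda>t :: real. A) \<longlongrightarrow> 0) at_top"
    by (simp add: algebra_simps)
  then show A: "A = 0"
    using tendsto_const_iff[of "at_top :: real filter" A 0] by simp
  then show "c = 0"
    using assms tendsto_const_iff[of "at_top :: real filter" 0 c] by simp
qed

text \<open>
  Summing the hypothesis along paths expresses \<open>g\<close> at every vertex through \<open>t\<close> and \<open>a t\<close>.  Each
  edge then yields a convergent expression \<open>t A + N a t\<close>; eliminating \<open>a\<close> by one edge with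
  \<open>N \<noteq> 0\<close>, if there is any, leaves convergent multiples of \<open>t\<close>, which vanish.
\<close>

lemma cocycle_limit:
  fixes E :: "('v \<times> 'v) set" and g :: "'v \<Rightarrow> real \<Rightarrow> real" and a :: "real \<Rightarrow> real"
  assumes lim: "\<And>v w. (v, w) \<in> E \<Longrightarrow> ((\<lambda>t. t * \<phi> v - a t + g w t - g v t) \<longlongrightarrow> \<theta> v w) at_top"
  shows "\<exists>\<kappa> h. \<forall>v w. (w0, v) \<in> E\<^sup>* \<longrightarrow> (v, w) \<in> E \<longrightarrow> \<theta> v w = \<kappa> + h w - h v"
proof -
  \<comment> \<open>\<open>s\<close> is the sum of \<open>\<phi>\<close> along a path from
    \<open>w0\<close> and \<open>n\<close> the length of the path; one path to each vertex is fixed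
    afterwards.\<close>
  have "\<exists>s n Q. ((\<lambda>t. g v t - g w0 t + t * s - n * a t) \<longlongrightarrow> Q) at_top" if "(w0, v) \<in> E\<^sup>*" for v
    using that
  proof (induction rule: rtrancl_induct)
    case base
    show ?case
      by (intro exI[of _ 0]) simp
  next
    case (step v w)
    then obtain s n Q where "((\<lambda>t. g v t - g w0 t + t * s - n * a t) \<longlongrightarrow> Q) at_top"
      by blast
    from tendsto_add[OF this lim[OF step.hyps(2)]]
    have "((\<lambda>t. g w t - g w0 t + t * (s + \<phi> v) - (n + 1) * a t) \<longlongrightarrow> Q + \<theta> v w) at_top"
      by (rule Lim_transform_eventually) (simp add: algebra_simps)
    then show ?case
      by blast
  qed
  then obtain s n Q where snQ: "\<And>v. (w0, v) \<in> E\<^sup>* \<Longrightarrow> ((\<lambda>t. g v t - g w0 t + t * s v - n v * a t) \<longlongrightarrow> Q v) at_top"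
    by metis
  define A where "A v w = \<phi> v - s w + s v" for v w
  define N where "N v w = n w - n v - 1" for v w
  define \<delta> where "\<delta> v w = \<theta> v w - Q w + Q v" for v w
  have edge: "((\<lambda>t. t * A v w + N v w * a t) \<longlongrightarrow> \<delta> v w) at_top" if "(w0, v) \<in> E\<^sup>*" "(v, w) \<in> E" for v w
  proof -
    have "(w0, w) \<in> E\<^sup>*"
      using that by simp
    from tendsto_add[OF tendsto_diff[OF lim[OF that(2)] snQ[OF this]] snQ[OF that(1)]]
    show ?thesis
      unfolding \<delta>_def by (rule Lim_transform_eventually) (simp add: A_def N_def algebra_simps)
  qed
  have "\<exists>k0. \<forall>v w. (w0, v) \<in> E\<^sup>* \<longrightarrow> (v, w) \<in> E \<longrightarrow> \<delta> v w = N v w * k0"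
  proof (cases "\<exists>v w. (w0, v) \<in> E\<^sup>* \<and> (v, w) \<in> E \<and> N v w \<noteq> 0")
    case True
    then obtain v0 w1 where e0: "(w0, v0) \<in> E\<^sup>*" "(v0, w1) \<in> E" "N v0 w1 \<noteq> 0"
      by blast
    have "\<delta> v w = N v w * (\<delta> v0 w1 / N v0 w1)" if "(w0, v) \<in> E\<^sup>*" "(v, w) \<in> E" for v w
    proof -
      have "((\<lambda>t. (t * A v w + N v w * a t) - N v w / N v0 w1 * (t * A v0 w1 + N v0 w1 * a t))
          \<longlongrightarrow> \<delta> v w - N v w / N v0 w1 * \<delta> v0 w1) at_top"
        by (intro tendsto_diff tendsto_mult_left edge that e0)
      then have "((\<lambda>t. t * (A v w - N v w / N v0 w1 * A v0 w1)) \<longlongrightarrow> \<delta> v w - N v w / N v0 w1 * \<delta> v0 w1) at_top"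
        by (rule Lim_transform_eventually) (use e0(3) in \<open>simp add: algebra_simps\<close>)
      then show ?thesis
        using linear_convergent_zero(2) by fastforce
    qed
    then show ?thesis
      by blast
  next
    case False
    have "\<delta> v w = N v w * 0" if "(w0, v) \<in> E\<^sup>*" "(v, w) \<in> E" for v w
      using edge[OF that] False that linear_convergent_zero(2)[of "A v w" "\<delta> v w"] by auto
    then show ?thesis
      by blast
  qed
  then obtain k0 where k0: "\<And>v w. (w0, v) \<in> E\<^sup>* \<Longrightarrow> (v, w) \<in> E \<Longrightarrow> \<delta> v w = N v w * k0"
    by blast
  have "\<theta> v w = - k0 + (Q w + n w * k0) - (Q v + n v * k0)" if "(w0, v) \<in> E\<^sup>*" "(v, w) \<in> E" for v w
    using k0[OF that] by (simp add: \<delta>_def N_def algebra_simps)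
  then show ?thesis
    by (intro exI[of _ "- k0"] exI[of _ "\<lambda>w. Q w + n w * k0"]) blast
qed

text \<open>No flow leaves the set \<open>S\<close> reachable from \<open>w0\<close>, so by balance
  none enters it. If \<open>v0\<close> were outside \<open>S\<close>, the edge from
  \<open>v0\<close> to \<open>w0\<close> would enter.\<close>

lemma balanced_recurrent:
  fixes Q :: "'v \<Rightarrow> 'v \<Rightarrow> real"
  assumes V: "finite V" and Q: "\<And>v w. v \<in> V \<Longrightarrow> w \<in> V \<Longrightarrow> Q v w \<ge> 0"
    and row: "\<And>v. v \<in> V \<Longrightarrow> (\<Sum>w\<in>V. Q v w) = \<pi> v" and col: "\<And>w. w \<in> V \<Longrightarrow> (\<Sum>v\<in>V. Q v w) = \<pi> w"
    and edge: "(v0, w0) \<in> support_graph V Q"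
  shows "(w0, v0) \<in> (support_graph V Q)\<^sup>*"
proof (rule ccontr)
  let ?E = "support_graph V Q"
  assume no: "(w0, v0) \<notin> ?E\<^sup>*"
  define S where "S = {v\<in>V. (w0, v) \<in> ?E\<^sup>*}"
  have S: "S \<subseteq> V" "finite S" "w0 \<in> S" "v0 \<in> V - S"
    using V edge no by (auto simp: S_def support_graph_def)
  have closed: "Q v w = 0" if "v \<in> S" "w \<in> V - S" for v w
  proof (rule ccontr)
    assume "Q v w \<noteq> 0"
    then have "(v, w) \<in> ?E"
      using that S(1) Q[of v w] by (auto simp: support_graph_def)
    then have "(w0, w) \<in> ?E\<^sup>*"
      using that(1) by (auto simp: S_def)
    then show False
      using that(2) by (auto simp: S_def)
  qed
  have "(\<Sum>v\<in>S. \<pi> v) = (\<Sum>v\<in>S. \<Sum>w\<in>S. Q v w)"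
  proof (rule sum.cong)
    fix v assume v: "v \<in> S"
    have "(\<Sum>w\<in>V. Q v w) = (\<Sum>w\<in>S. Q v w)"
      using V S(1) closed[OF v] by (intro sum.mono_neutral_right) auto
    then show "\<pi> v = (\<Sum>w\<in>S. Q v w)"
      using row v S(1) by auto
  qed simp
  moreover have "(\<Sum>w\<in>S. \<pi> w) = (\<Sum>w\<in>S. \<Sum>v\<in>S. Q v w) + (\<Sum>w\<in>S. \<Sum>v\<in>V - S. Q v w)"
  proof -
    have "\<pi> w = (\<Sum>v\<in>S. Q v w) + (\<Sum>v\<in>V - S. Q v w)" if "w \<in> S" for w
      using col[of w] that S V sum.subset_diff[of S V "\<lambda>v. Q v w"] by auto
    then show ?thesis
      by (simp add: sum.distrib)
  qed
  ultimately have "(\<Sum>w\<in>S. \<Sum>v\<in>V - S. Q v w) = 0"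
    by (subst (asm) sum.swap) simp
  moreover have "(\<Sum>w\<in>S. \<Sum>v\<in>V - S. Q v w) \<ge> Q v0 w0"
  proof -
    have "Q v0 w0 \<le> (\<Sum>v\<in>V - S. Q v w0)"
      using S V Q by (intro member_le_sum) auto
    also have "\<dots> \<le> (\<Sum>w\<in>S. \<Sum>v\<in>V - S. Q v w)"
      using S V Q by (intro member_le_sum[of w0 S "\<lambda>w. \<Sum>v\<in>V - S. Q v w"] sum_nonneg) auto
    finally show ?thesis .
  qed
  ultimately show False
    using edge by (simp add: support_graph_def)
qed

section \<open>Weak convergence through cylinder probabilities\<close>

context shift_space
begin

lemma continuous_on_prefix:
  fixes f :: "nat list \<Rightarrow> real"
  shows "continuous_on X (\<lambda>x. f (prefix n x))"
  unfolding continuous_on_topological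
proof (intro ballI allI impI)
  fix x B assume "open B" "f (prefix n x) \<in> B"
  then show "\<exists>A. open A \<and> x \<in> A \<and> (\<forall>y\<in>X. y \<in> A \<longrightarrow> f (prefix n y) \<in> B)"
    by (intro exI[of _ "{y. prefix n y = prefix n x}"]) (auto intro: open_prefix)
qed

text \<open>
  If \<open>g\<close> oscillated by more than \<open>e\<close> on cylinders of every length, these cylinders would contain a
  nested sequence (Koenig's lemma), contradicting continuity at its intersection point.
\<close>

lemma continuous_uniform_prefix:
  fixes g :: "seq \<Rightarrow> real"
  assumes g: "continuous_on X g" and "e > 0"
  shows "\<exists>n. \<forall>x\<in>X. \<forall>y\<in>X. prefix n x = prefix n y \<longrightarrow> \<bar>g x - g y\<bar> \<le> e"
proof (rule ccontr)
  assume neg: "\<not> ?thesis"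
  \<comment> \<open>The cylinder contains pairs of points that agree to any prescribed length and
    are still separated by \<open>g\<close>. This passes to one of its finitely many
    subcylinders.\<close>
  define bad where "bad u \<longleftrightarrow> (\<forall>n. \<exists>x\<in>cyl u. \<exists>y\<in>cyl u. prefix n x = prefix n y \<and> \<bar>g x - g y\<bar> > e)" for u
  have bad_Nil: "bad []"
    using neg by (auto simp: bad_def not_le)
  have bad_snoc: "\<exists>b. bad (u @ [b])" if bad_u: "bad u" for u
  proof (rule ccontr)
    assume "\<not> ?thesis"
    then obtain N where N: "\<And>b x y. x \<in> cyl (u @ [b]) \<Longrightarrow> y \<in> cyl (u @ [b]) \<Longrightarrow>
        prefix (N b) x = prefix (N b) y \<Longrightarrow> \<bar>g x - g y\<bar> \<le> e"
      unfolding bad_def not_ex not_all not_less[symmetric] by metis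
    \<comment> \<open>Agreement to length \<open>M\<close> fixes the letter after \<open>u\<close>
      and exceeds every bound \<open>N b\<close>.\<close>
    define M where "M = Suc (length u) + (\<Sum>b<d. N b)"
    obtain x y where xy: "x \<in> cyl u" "y \<in> cyl u" "prefix M x = prefix M y" "\<bar>g x - g y\<bar> > e"
      using bad_u unfolding bad_def by blast
    let ?b = "x (length u)"
    have "?b < d"
      using xy(1) letters by (simp add: cyl_def)
    then have "N ?b \<le> M"
      using member_le_sum[of ?b "{..<d}" N] by (simp add: M_def)
    then have "prefix (N ?b) x = prefix (N ?b) y"
      using xy(3) by (auto simp: prefix_eq_iff)
    moreover have "y (length u) = ?b"
      using xy(3) by (auto simp: prefix_eq_iff M_def)
    then have "x \<in> cyl (u @ [?b])" "y \<in> cyl (u @ [?b])"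
      using xy(1,2) by (auto simp: cyl_def prefix_Suc)
    ultimately show False
      using N xy(4) by fastforce
  qed
  define nxt where "nxt u = (SOME b. bad (u @ [b]))" for u
  define z where "z n = nxt (rec_nat [] (\<lambda>_ u. u @ [nxt u]) n)" for n
  have pz: "prefix n z = rec_nat [] (\<lambda>_ u. u @ [nxt u]) n" for n
    by (induction n) (auto simp: prefix_Suc z_def, simp add: prefix_def)
  have bad_z: "bad (prefix n z)" for n
  proof (induction n)
    case (Suc n)
    have "bad (prefix n z @ [nxt (prefix n z)])"
      unfolding nxt_def by (rule someI_ex[OF bad_snoc[OF Suc]])
    moreover have "prefix (Suc n) z = prefix n z @ [nxt (prefix n z)]"
      unfolding prefix_Suc pz by (simp add: z_def)
    ultimately show ?case
      by simp
  qed (use bad_Nil in \<open>simp add: prefix_def\<close>)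
  have zX: "z \<in> X"
  proof (rule prefix_closed)
    fix n
    show "\<exists>y\<in>X. prefix n y = prefix n z"
      using bad_z[of n] unfolding bad_def cyl_def by auto
  qed
  have "open (ball (g z) (e / 2))" "g z \<in> ball (g z) (e / 2)"
    using \<open>e > 0\<close> by auto
  then obtain S where S: "open S" "z \<in> S" "\<And>y. y \<in> X \<Longrightarrow> y \<in> S \<Longrightarrow> g y \<in> ball (g z) (e / 2)"
    using g zX unfolding continuous_on_topological by metis
  obtain n where n: "{y. prefix n y = prefix n z} \<subseteq> S"
    using open_contains_cyl[OF S(1,2)] by blast
  obtain x y where xy: "x \<in> cyl (prefix n z)" "y \<in> cyl (prefix n z)" "\<bar>g x - g y\<bar> > e"
    using bad_z[of n] unfolding bad_def by blast
  then have "dist (g z) (g x) < e / 2" "dist (g z) (g y) < e / 2"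
    using S(3)[of x] S(3)[of y] n by (auto simp: cyl_def)
  then show False
    using xy(3) unfolding dist_real_def by linarith
qed

lemma integrable_continuous:
  fixes g :: "seq \<Rightarrow> real"
  assumes \<nu>: "prob_on \<nu>" and g: "continuous_on X g"
  shows "integrable \<nu> g"
proof -
  obtain n where n: "\<And>x y. x \<in> X \<Longrightarrow> y \<in> X \<Longrightarrow> prefix n x = prefix n y \<Longrightarrow> \<bar>g x - g y\<bar> \<le> 1"
    using continuous_uniform_prefix[OF g, of 1] by auto
  define f where "f u = g (SOME y. y \<in> cyl u)" for u
  define B where "B = (\<Sum>u\<in>words d n. \<bar>f u\<bar>) + 1"
  have "\<bar>g x\<bar> \<le> B" if x: "x \<in> X" for x
  proof -
    have "x \<in> cyl (prefix n x)"
      using x by (simp add: cyl_def)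
    then have "(SOME y. y \<in> cyl (prefix n x)) \<in> cyl (prefix n x)"
      by (rule someI[where P = "\<lambda>y. y \<in> cyl (prefix n x)"])
    then have "\<bar>g x - f (prefix n x)\<bar> \<le> 1"
      using n[of x "SOME y. y \<in> cyl (prefix n x)"] x by (simp add: f_def cyl_def)
    moreover have "\<bar>f (prefix n x)\<bar> \<le> (\<Sum>u\<in>words d n. \<bar>f u\<bar>)"
      using prefix_words[OF x] finite_words by (intro member_le_sum) auto
    ultimately show ?thesis
      by (simp add: B_def)
  qed
  moreover have "g \<in> borel_measurable \<nu>"
    using borel_measurable_continuous_on_restrict[OF g] \<nu>
    by (subst measurable_cong_sets[OF prob_on_sets[OF \<nu>] refl])
  ultimately show ?thesis
    using \<nu> by (intro finite_measure.integrable_const_bound[of _ _ B])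
      (auto simp: prob_on_finite prob_on_space)
qed

text \<open>A continuous function is uniformly close to a function of a prefix, with the same error
  for all measures; for the latter only finitely many cylinder probabilities matter.\<close>

lemma weak_star_of_cp:
  assumes \<mu>: "\<And>t. prob_on (\<mu> t)" and \<nu>: "prob_on \<nu>"
    and lim: "\<And>u. ((\<lambda>t. cp (\<mu> t) u) \<longlongrightarrow> cp \<nu> u) F"
  shows "weak_star_tendsto X \<mu> \<nu> F"
  unfolding weak_star_tendsto_def
proof (intro allI impI)
  fix g :: "seq \<Rightarrow> real" assume g: "continuous_on X g"
  show "((\<lambda>t. \<integral>x. g x \<partial>\<mu> t) \<longlongrightarrow> (\<integral>x. g x \<partial>\<nu>)) F"
  proof (rule tendstoI)
    fix e :: real assume "e > 0"
    then obtain n where n: "\<And>x y. x \<in> X \<Longrightarrow> y \<in> X \<Longrightarrow> prefix n x = prefix n y \<Longrightarrow> \<bar>g x - g y\<bar> \<le> e / 3"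
      using continuous_uniform_prefix[OF g, of "e / 3"] by auto
    define f where "f u = g (SOME y. y \<in> cyl u)" for u
    have gf: "\<bar>g x - f (prefix n x)\<bar> \<le> e / 3" if x: "x \<in> X" for x
    proof -
      have "x \<in> cyl (prefix n x)"
        using x by (simp add: cyl_def)
      then have "(SOME y. y \<in> cyl (prefix n x)) \<in> cyl (prefix n x)"
        by (rule someI[where P = "\<lambda>y. y \<in> cyl (prefix n x)"])
      then show ?thesis
        using n[of x "SOME y. y \<in> cyl (prefix n x)"] x by (simp add: f_def cyl_def)
    qed
    have close: "\<bar>(\<integral>x. g x \<partial>\<rho>) - (\<integral>x. f (prefix n x) \<partial>\<rho>)\<bar> \<le> e / 3" if \<rho>: "prob_on \<rho>" for \<rho>
    proof -
      interpret \<rho>: prob_space \<rho>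
        by (rule prob_on_prob[OF \<rho>])
      have i: "integrable \<rho> g" "integrable \<rho> (\<lambda>x. f (prefix n x))"
        by (rule integrable_continuous[OF \<rho> g], rule integral_prefix(2)[OF \<rho>])
      have "\<bar>(\<integral>x. g x \<partial>\<rho>) - (\<integral>x. f (prefix n x) \<partial>\<rho>)\<bar> = \<bar>\<integral>x. g x - f (prefix n x) \<partial>\<rho>\<bar>"
        using i by simp
      also have "\<dots> \<le> (\<integral>x. \<bar>g x - f (prefix n x)\<bar> \<partial>\<rho>)"
        by (rule integral_abs_bound)
      also have "\<dots> \<le> (\<integral>x. e / 3 \<partial>\<rho>)"
        using i gf \<rho> by (intro integral_mono) (auto simp: prob_on_space)
      finally show ?thesis
        by (simp add: \<rho>.prob_space)
    qed
    have "((\<lambda>t. \<integral>x. f (prefix n x) \<partial>\<mu> t) \<longlongrightarrow> (\<integral>x. f (prefix n x) \<partial>\<nu>)) F"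
      unfolding integral_prefix(1)[OF \<mu>] integral_prefix(1)[OF \<nu>]
      by (intro tendsto_sum tendsto_mult tendsto_const lim)
    then have "\<forall>\<^sub>F t in F. dist (\<integral>x. f (prefix n x) \<partial>\<mu> t) (\<integral>x. f (prefix n x) \<partial>\<nu>) < e / 3"
      using \<open>e > 0\<close> by (intro tendstoD) auto
    then show "\<forall>\<^sub>F t in F. dist (\<integral>x. g x \<partial>\<mu> t) (\<integral>x. g x \<partial>\<nu>) < e"
    proof eventually_elim
      case (elim t)
      then show ?case
        using close[OF \<mu>[of t]] close[OF \<nu>] unfolding dist_real_def by linarith
    qed
  qed
qed

text \<open>The definite description needs uniqueness: indicators of cylinders are continuous, so
  weak limits agree on cylinders.\<close>

lemma zero_temperature_measure_eqI:
  assumes \<nu>: "prob_on \<nu>"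
    and lim: "weak_star_tendsto X (\<lambda>t. equilibrium_state X shift_map (\<lambda>x. t * \<phi> x)) \<nu> at_top"
  shows "zero_temperature_measure X shift_map \<phi> = \<nu>"
  unfolding zero_temperature_measure_def
proof (rule the_equality)
  show "sets \<nu> = sets BX \<and> prob_space \<nu> \<and>
      weak_star_tendsto X (\<lambda>t. equilibrium_state X shift_map (\<lambda>x. t * \<phi> x)) \<nu> at_top"
    using \<nu> lim by (simp add: prob_on_def)
  fix \<rho> assume \<rho>: "sets \<rho> = sets BX \<and> prob_space \<rho> \<and>
      weak_star_tendsto X (\<lambda>t. equilibrium_state X shift_map (\<lambda>x. t * \<phi> x)) \<rho> at_top"
  then have p: "prob_on \<rho>"
    by (simp add: prob_on_def)
  have int: "(\<integral>x. (if prefix (length u) x = u then 1 else 0) \<partial>\<sigma>) = cp \<sigma> u" if "prob_on \<sigma>" for \<sigma> u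
  proof -
    have "(\<integral>x. (if prefix (length u) x = u then 1 else 0) \<partial>\<sigma>) = (\<Sum>v\<in>words d (length u). if v = u then cp \<sigma> u else 0)"
      using integral_prefix(1)[OF that, of "\<lambda>v. if v = u then 1 else 0" "length u"]
      by (auto intro!: sum.cong)
    then show ?thesis
      using cp_outside[of u \<sigma>] finite_words by auto
  qed
  show "\<rho> = \<nu>"
  proof (rule measure_eqI_cyl[OF p \<nu>])
    fix u :: "nat list"
    let ?f = "\<lambda>x. if prefix (length u) x = u then 1 else 0 :: real"
    have c: "continuous_on X ?f"
      using continuous_on_prefix[of "\<lambda>v. if v = u then 1 else 0" "length u"] by simp
    have "(\<integral>x. ?f x \<partial>\<rho>) = (\<integral>x. ?f x \<partial>\<nu>)"
      using \<rho> lim c unfolding weak_star_tendsto_def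
      by (intro tendsto_unique[OF trivial_limit_at_top_linorder, of "\<lambda>t. \<integral>x. ?f x \<partial>(equilibrium_state X shift_map (\<lambda>x. t * \<phi> x))"]) auto
    then show "cp \<rho> u = cp \<nu> u"
      by (simp add: int[OF p] int[OF \<nu>])
  qed
qed

end

section \<open>Parry measures\<close>

context irreducible_sft
begin

text \<open>Replaces an arbitrary kernel by the conditional probabilities. If the last block is
  null, so is the whole word, and both sides vanish.\<close>

lemma kernel_transition:
  assumes \<mu>: "\<mu> \<in> Inv" and K: "kernel_markov K \<mu>"
  shows "kernel_markov (transition \<mu>) \<mu>"
  unfolding kernel_markov_def
proof (intro allI impI)
  fix u :: "nat list" and b assume u: "length u \<ge> k"
  have cpK: "cp \<mu> (u @ [b]) = cp \<mu> u * K (lastk u @ [b])"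
    using K u by (simp add: kernel_markov_def)
  show "cp \<mu> (u @ [b]) = cp \<mu> u * transition \<mu> (lastk u @ [b])"
  proof (cases "cp \<mu> (lastk u) = 0")
    case True
    then have "cp \<mu> u = 0"
      using cp_drop_le[OF \<mu>, of u "length u - k"] cp_nonneg[of \<mu> u] by (simp add: lastk_def)
    then show ?thesis
      using cpK by simp
  next
    case False
    have len: "length (lastk u) = k"
      by (rule length_lastk[OF u])
    then have "cp \<mu> (lastk u @ [b]) = cp \<mu> (lastk u) * K (lastk u @ [b])"
      using K by (simp add: kernel_markov_def lastk_id)
    then show ?thesis
      using cpK False by (simp add: transition_def)
  qed
qed

text \<open>
  Up to the normalisation by \<open>\<rho>\<close>, the transition probabilities are a coboundary, as for the measure
  of maximal entropy of a transitive subshift of finite type.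
\<close>

definition parry :: "seq measure \<Rightarrow> bool" where
  "parry \<mu> \<longleftrightarrow> \<mu> \<in> Inv \<and> kernel_markov (transition \<mu>) \<mu> \<and>
     irreducible_on (vertices \<mu>) (wmat (transition \<mu>)) \<and>
     (\<exists>\<rho>>0. \<exists>h. (\<forall>w. h w > 0) \<and> (\<forall>e. length e = Suc k \<longrightarrow> cp \<mu> e > 0 \<longrightarrow>
        transition \<mu> e = h (tl e) / (\<rho> * h (butlast e))))"

definition edges :: "seq measure \<Rightarrow> nat list set" where
  "edges \<mu> = {e \<in> words d (Suc k). cp \<mu> e > 0}"

lemma edges_vertices:
  assumes \<mu>: "\<mu> \<in> Inv" and e: "e \<in> edges \<mu>"
  shows "butlast e \<in> vertices \<mu>" "tl e \<in> vertices \<mu>" "e = butlast e @ [last e]" "length e = Suc k"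
    "tl (butlast e @ [last (tl e)]) = tl e" "butlast e @ [last (tl e)] = e"
proof -
  have e': "e \<in> words d (Suc k)" "cp \<mu> e > 0"
    using e by (auto simp: edges_def)
  then show len: "length e = Suc k"
    by (simp add: words_def)
  then show snoc: "e = butlast e @ [last e]"
    by (cases e rule: rev_cases) auto
  have cons: "e = hd e # tl e"
    using len by (cases e) auto
  have "butlast e \<in> words d k" "tl e \<in> words d k"
    using e'(1) snoc cons words_snoc_iff[of "butlast e" "last e" d k] words_Cons_iff[of "hd e" "tl e" d k] by simp_all
  moreover have "cp \<mu> (butlast e) > 0"
    using e'(2) snoc cp_append_le[OF inv_prob_on[OF \<mu>], of "butlast e" "[last e]"] by simp
  moreover have "cp \<mu> (tl e) > 0"
    using e'(2) cons cp_Cons_le[OF \<mu>, of "hd e" "tl e"] by simp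
  ultimately show "butlast e \<in> vertices \<mu>" "tl e \<in> vertices \<mu>"
    by (auto simp: vertices_def)
  have "tl e \<noteq> []"
    using len k_pos by (cases e) auto
  then have "last (tl e) = last e"
    by (simp add: last_tl)
  then show "butlast e @ [last (tl e)] = e" "tl (butlast e @ [last (tl e)]) = tl e"
    using snoc by simp_all
qed

lemma vertices_edges: "\<mu> \<in> Inv \<Longrightarrow> vertices \<mu> = {w \<in> words d k. \<exists>b. w @ [b] \<in> edges \<mu>}"
proof (intro equalityI subsetI)
  fix w assume \<mu>: "\<mu> \<in> Inv" and w: "w \<in> vertices \<mu>"
  then have "(\<Sum>b<d. cp \<mu> (w @ [b])) > 0"
    using cp_snoc[OF inv_prob_on[OF \<mu>], of w] by (simp add: vertices_def)
  then obtain b where "b < d" "cp \<mu> (w @ [b]) > 0"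
    by (metis lessThan_iff not_le sum_nonpos)
  then show "w \<in> {w \<in> words d k. \<exists>b. w @ [b] \<in> edges \<mu>}"
    using w by (auto simp: edges_def vertices_def words_snoc_iff)
qed (use edges_vertices(1) in fastforce)

lemma edges_iff: "length e = Suc k \<Longrightarrow> e \<in> edges \<mu> \<longleftrightarrow> cp \<mu> e > 0"
  using cp_outside[of e \<mu>] by (cases "e \<in> words d (Suc k)") (auto simp: edges_def)

lemma transition_not_edge: "length e = Suc k \<Longrightarrow> e \<notin> edges \<mu> \<Longrightarrow> transition \<mu> e = 0"
  using cp_nonneg[of \<mu> e] by (simp add: edges_iff transition_def)

lemma transition_edge: "\<mu> \<in> Inv \<Longrightarrow> e \<in> edges \<mu> \<Longrightarrow> transition \<mu> e > 0"
  using edges_vertices(1)[of \<mu> e] by (auto simp: transition_def edges_def vertices_def)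

lemma support_graph_transition:
  assumes \<mu>: "\<mu> \<in> Inv"
  shows "support_graph (vertices \<mu>) (wmat (transition \<mu>)) = (\<lambda>e. (butlast e, tl e)) ` edges \<mu>"
proof (intro equalityI subsetI)
  fix vw assume vw: "vw \<in> support_graph (vertices \<mu>) (wmat (transition \<mu>))"
  obtain v w where eq: "vw = (v, w)"
    by (cases vw)
  have *: "v \<in> vertices \<mu>" "tl (v @ [last w]) = w" "transition \<mu> (v @ [last w]) > 0"
    using vw eq by (auto simp: support_graph_def wmat_def split: if_splits)
  then have "v @ [last w] \<in> edges \<mu>"
    using transition_not_edge[of "v @ [last w]" \<mu>] by (auto simp: vertices_def words_def)
  then show "vw \<in> (\<lambda>e. (butlast e, tl e)) ` edges \<mu>"
    using * eq by force
next
  fix vw assume "vw \<in> (\<lambda>e. (butlast e, tl e)) ` edges \<mu>"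
  then obtain e where e: "e \<in> edges \<mu>" "vw = (butlast e, tl e)"
    by blast
  note * = edges_vertices[OF \<mu> e(1)]
  show "vw \<in> support_graph (vertices \<mu>) (wmat (transition \<mu>))"
    using e(2) *(1,2) transition_edge[OF \<mu> e(1)] by (simp add: support_graph_def wmat_def *(6))
qed

text \<open>Transition probabilities out of \<open>w\<close> sum to 1; cleared of denominators this
  makes \<open>h\<close> an eigenvector of the 0-1 matrix of edges, with eigenvalue
  \<open>\<rho>\<close>.\<close>

lemma parry_eigenvector:
  assumes \<mu>: "\<mu> \<in> Inv" and \<rho>: "\<rho> > 0" and h: "\<And>w. h w > (0 :: real)"
    and tr: "\<And>e. length e = Suc k \<Longrightarrow> cp \<mu> e > 0 \<Longrightarrow> transition \<mu> e = h (tl e) / (\<rho> * h (butlast e))"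
    and w: "w \<in> vertices \<mu>"
  shows "(\<Sum>x\<in>vertices \<mu>. wmat (\<lambda>e. if e \<in> edges \<mu> then 1 else 0) w x * h x) = \<rho> * h w"
proof -
  have len: "length w = k" "cp \<mu> w > 0"
    using w by (auto simp: vertices_def words_def)
  have "(\<Sum>x\<in>vertices \<mu>. wmat (\<lambda>e. if e \<in> edges \<mu> then 1 else 0) w x * h x) =
      (\<Sum>b<d. (if w @ [b] \<in> edges \<mu> then 1 else 0) * h (tl (w @ [b])))"
  proof (rule wmat_row[OF _ _ _ w])
    show "finite (vertices \<mu>)"
      using finite_words by (simp add: vertices_def)
    show "v \<in> vertices \<mu> \<Longrightarrow> length v = k" for v
      by (simp add: vertices_def words_def)
    show "e \<in> words d (Suc k) \<and> butlast e \<in> vertices \<mu> \<and> tl e \<in> vertices \<mu>"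
      if "(if e \<in> edges \<mu> then 1 else 0 :: real) \<noteq> 0" for e
      using that edges_vertices(1,2)[OF \<mu>, of e] by (auto simp: edges_def split: if_splits)
  qed
  also have "\<dots> = (\<Sum>b<d. transition \<mu> (w @ [b]) * (\<rho> * h w))"
  proof (intro sum.cong refl)
    fix b
    show "(if w @ [b] \<in> edges \<mu> then 1 else 0) * h (tl (w @ [b])) = transition \<mu> (w @ [b]) * (\<rho> * h w)"
    proof (cases "w @ [b] \<in> edges \<mu>")
      case True
      then have "cp \<mu> (w @ [b]) > 0"
        by (simp add: edges_def)
      then have "transition \<mu> (w @ [b]) = h (tl (w @ [b])) / (\<rho> * h w)"
        using tr[of "w @ [b]"] len by simp
      then show ?thesis
        using True \<rho> h[of w] by simp
    qed (use transition_not_edge[of "w @ [b]" \<mu>] len in simp)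
  qed
  also have "\<dots> = \<rho> * h w"
  proof -
    have "(\<Sum>b<d. transition \<mu> (w @ [b])) = (\<Sum>b<d. cp \<mu> (w @ [b])) / cp \<mu> w"
      unfolding transition_def sum_divide_distrib by simp
    also have "\<dots> = 1"
      unfolding cp_snoc[OF inv_prob_on[OF \<mu>], of w, symmetric] using len by simp
    finally show ?thesis
      unfolding sum_distrib_right[symmetric] by simp
  qed
  finally show ?thesis .
qed

text \<open>The edges determine the 0-1 matrix, and Perron uniqueness determines
  \<open>\<rho>\<close> and, up to a factor, \<open>h\<close>. The factor cancels in the transition
  probabilities, which determine the measure.\<close>

lemma parry_unique:
  assumes "parry \<mu>" "parry \<mu>'" and eq: "edges \<mu> = edges \<mu>'"
  shows "\<mu>' = \<mu>"
proof -
  obtain \<rho> h where \<mu>: "\<mu> \<in> Inv" "kernel_markov (transition \<mu>) \<mu>"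
      "irreducible_on (vertices \<mu>) (wmat (transition \<mu>))"
    and \<rho>: "\<rho> > 0" and h: "\<And>w. h w > 0"
    and tr: "\<And>e. length e = Suc k \<Longrightarrow> cp \<mu> e > 0 \<Longrightarrow> transition \<mu> e = h (tl e) / (\<rho> * h (butlast e))"
    using assms(1) unfolding parry_def by blast
  obtain \<rho>' h' where \<mu>': "\<mu>' \<in> Inv" "kernel_markov (transition \<mu>') \<mu>'"
    and \<rho>': "\<rho>' > 0" and h': "\<And>w. h' w > 0"
    and tr': "\<And>e. length e = Suc k \<Longrightarrow> cp \<mu>' e > 0 \<Longrightarrow> transition \<mu>' e = h' (tl e) / (\<rho>' * h' (butlast e))"
    using assms(2) unfolding parry_def by blast
  let ?V = "vertices \<mu>" and ?A = "wmat (\<lambda>e. if e \<in> edges \<mu> then 1 else 0)"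
  have V: "vertices \<mu>' = ?V"
    using \<mu>(1) \<mu>'(1) eq by (simp add: vertices_edges)
  have fin: "finite ?V" "?V \<noteq> {}"
    using vertices_finite[OF \<mu>] vertices_nonempty[OF \<mu>] by auto
  have Ann: "?A v w \<ge> 0" for v w
    by (simp add: wmat_def)
  note e1 = parry_eigenvector[OF \<mu>(1) \<rho> h tr]
  note e2 = parry_eigenvector[OF \<mu>'(1) \<rho>' h' tr', folded eq, unfolded V]
  have "\<rho> = \<rho>'"
    by (rule positive_eigenvalue_unique[OF fin Ann h e1 h' e2])
  have irrA: "irreducible_on ?V ?A"
  proof -
    have "support_graph ?V (wmat (transition \<mu>)) \<subseteq> support_graph ?V ?A"
      unfolding support_graph_transition[OF \<mu>(1)]
      using edges_vertices[OF \<mu>(1)] by (auto simp: support_graph_def wmat_def)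
    then show ?thesis
      using \<mu>(3) rtrancl_mono unfolding irreducible_on_def by blast
  qed
  obtain b where b: "\<And>w. w \<in> ?V \<Longrightarrow> h' w = b * h w"
    using eigenvector_unique[OF fin Ann irrA h e1 e2[folded \<open>\<rho> = \<rho>'\<close>]] by blast
  obtain v0 where v0: "v0 \<in> ?V"
    using fin(2) by blast
  have "b \<noteq> 0"
    using b[OF v0] h'[of v0] by auto
  have tr_eq: "transition \<mu> e = transition \<mu>' e" if len: "length e = Suc k" for e
  proof (cases "e \<in> edges \<mu>")
    case True
    note * = edges_vertices[OF \<mu>(1) True]
    have "transition \<mu> e = h (tl e) / (\<rho> * h (butlast e))"
      using True by (intro tr len) (simp add: edges_def)
    moreover have "transition \<mu>' e = h' (tl e) / (\<rho>' * h' (butlast e))"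
      using True unfolding eq by (intro tr' len) (simp add: edges_def)
    ultimately show ?thesis
      using b[OF *(1)] b[OF *(2)] \<open>b \<noteq> 0\<close> \<open>\<rho> = \<rho>'\<close> by simp
  next
    case False
    then show ?thesis
      using transition_not_edge[OF len] eq by simp
  qed
  have K': "kernel_markov (transition \<mu>) \<mu>'"
    using \<mu>'(2) tr_eq length_lastk unfolding kernel_markov_def by simp
  have "cp \<mu>' w = 0" if "w \<in> words d k" "w \<notin> ?V" for w
    using that cp_nonneg[of \<mu>' w] unfolding V[symmetric] by (simp add: vertices_def)
  then show ?thesis
    by (rule kernel_markov_unique[OF \<mu> \<mu>'(1) K'])
qed

lemma finite_parry: "finite {\<mu>. parry \<mu>}"
proof (rule inj_on_finite[of edges])
  show "inj_on edges {\<mu>. parry \<mu>}"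
    by (intro inj_onI parry_unique[symmetric]) auto
  show "edges ` {\<mu>. parry \<mu>} \<subseteq> Pow (words d (Suc k))"
    by (auto simp: edges_def)
qed (simp add: finite_words)

lemma parry_ergodic: "parry \<mu> \<Longrightarrow> \<mu> \<in> ergodic_measures X shift_map"
  using kernel_markov_ergodic[of \<mu> "transition \<mu>"] by (simp add: parry_def)

end

section \<open>Decomposition of a limit measure into Parry measures\<close>

context irreducible_sft
begin

context
  fixes \<nu> :: "seq measure" and \<phi> :: "nat list \<Rightarrow> real" and a :: "real \<Rightarrow> real" and g :: "nat list \<Rightarrow> real \<Rightarrow> real"
  assumes \<nu>: "\<nu> \<in> Inv" and K: "kernel_markov (transition \<nu>) \<nu>"
    and lim: "\<And>e. e \<in> edges \<nu> \<Longrightarrow>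
      ((\<lambda>t. t * \<phi> (butlast e) - a t + g (tl e) t - g (butlast e) t) \<longlongrightarrow> ln (transition \<nu> e)) at_top"
begin

definition graph :: "(nat list \<times> nat list) set" where
  "graph = (\<lambda>e. (butlast e, tl e)) ` edges \<nu>"

lemma graph_cases:
  assumes "(v, w) \<in> graph"
  shows "v @ [last w] \<in> edges \<nu>" "tl (v @ [last w]) = w" "v \<in> vertices \<nu>" "w \<in> vertices \<nu>"
  using assms edges_vertices[OF \<nu>] by (auto simp: graph_def)

text \<open>Edge probabilities of an invariant measure are a balanced flow, in which every edge lies
  on a cycle. Reachability is thus an equivalence relation.\<close>

lemma graph_sym: "sym (graph\<^sup>*)"
proof -
  let ?q = "\<lambda>e. if e \<in> edges \<nu> then cp \<nu> e else 0" and ?V = "vertices \<nu>"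
  have q: "?q e = cp \<nu> e" if "length e = Suc k" for e
    using that edges_iff[of e \<nu>] cp_nonneg[of \<nu> e] by (auto simp: not_less)
  have supp: "e \<in> words d (Suc k) \<and> butlast e \<in> ?V \<and> tl e \<in> ?V" if "?q e \<noteq> 0" for e
    using that edges_vertices[OF \<nu>] by (auto simp: edges_def split: if_splits)
  have fin: "finite ?V"
    using finite_words by (simp add: vertices_def)
  have len: "length w = k" if "w \<in> ?V" for w
    using that by (auto simp: vertices_def words_def)
  have row: "(\<Sum>w\<in>?V. wmat ?q v w) = cp \<nu> v" if "v \<in> ?V" for v
    using wmat_row[of ?V ?q v "\<lambda>_. 1", OF fin len supp that] cp_snoc[OF inv_prob_on[OF \<nu>], of v] len[OF that]
    by (simp add: q)
  have col: "(\<Sum>v\<in>?V. wmat ?q v w) = cp \<nu> w" if "w \<in> ?V" for w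
    using wmat_col[of ?V ?q w "\<lambda>_. 1", OF fin len supp that] cp_Cons[OF \<nu>, of w] len[OF that]
    by (simp add: q)
  have "graph = support_graph ?V (wmat ?q)"
  proof (intro equalityI subrelI)
    fix v w assume "(v, w) \<in> graph"
    note * = graph_cases[OF this]
    then show "(v, w) \<in> support_graph ?V (wmat ?q)"
      using *(1) by (simp add: support_graph_def wmat_def edges_def)
  next
    fix v w assume "(v, w) \<in> support_graph ?V (wmat ?q)"
    then have *: "v @ [last w] \<in> edges \<nu>" "tl (v @ [last w]) = w"
      by (auto simp: support_graph_def wmat_def split: if_splits)
    then show "(v, w) \<in> graph"
      unfolding graph_def by (intro image_eqI[of _ _ "v @ [last w]"]) auto
  qed
  moreover have "wmat ?q v w \<ge> 0" for v w
    by (simp add: wmat_def cp_nonneg)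
  ultimately have rec: "(w, v) \<in> graph\<^sup>*" if "(v, w) \<in> graph" for v w
    using balanced_recurrent[OF fin _ row col, of v w] that by simp
  show ?thesis
  proof (rule symI)
    fix v w assume "(v, w) \<in> graph\<^sup>*"
    then show "(w, v) \<in> graph\<^sup>*"
      by (induction rule: rtrancl_induct) (auto dest: rec)
  qed
qed

text \<open>The measure is \<open>\<nu>\<close> conditioned on an initial block in the class of
  \<open>v0\<close>. Its identity is multiplied by the mass of the class so that it can be summed
  over classes.\<close>

lemma class_measure:
  assumes v0: "v0 \<in> vertices \<nu>"
  shows "\<exists>\<mu>. parry \<mu> \<and> (\<forall>u. length u \<ge> k \<longrightarrow>
    (\<Sum>w\<in>graph\<^sup>* `` {v0}. cp \<nu> w) * cp \<mu> u = (if take k u \<in> graph\<^sup>* `` {v0} then cp \<nu> u else 0))"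
proof -
  define C where "C = graph\<^sup>* `` {v0}"
  define \<pi> where "\<pi> = (\<Sum>w\<in>C. cp \<nu> w)"
  have CV: "C \<subseteq> vertices \<nu>"
  proof
    fix w assume "w \<in> C"
    then have "(v0, w) \<in> graph\<^sup>*"
      by (simp add: C_def)
    then show "w \<in> vertices \<nu>"
      using v0 by (induction rule: rtrancl_induct) (auto dest: graph_cases)
  qed
  have Cw: "w \<in> words d k" "cp \<nu> w > 0" "length w = k" if "w \<in> C" for w
    using that CV by (auto simp: vertices_def words_def)
  have finC: "finite C"
    using CV finite_words finite_subset by (fastforce simp: vertices_def)
  have "v0 \<in> C"
    by (simp add: C_def)
  then have \<pi>: "\<pi> > 0"
    unfolding \<pi>_def using Cw finC by (intro sum_pos) auto
  \<comment> \<open>By symmetry of reachability no edge of positive probability enters or leaves the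
    class, which gives balance of the restricted flow.\<close>
  have C_edge: "butlast e \<in> C \<longleftrightarrow> tl e \<in> C" if "e \<in> edges \<nu>" for e
  proof -
    have "(butlast e, tl e) \<in> graph\<^sup>*"
      using that by (auto simp: graph_def)
    then show ?thesis
      using graph_sym by (auto simp: C_def dest: symD intro: rtrancl_trans)
  qed
  define p where "p e = (if length e = Suc k \<and> butlast e \<in> C then cp \<nu> e / \<pi> else 0)" for e
  have p_snoc: "(\<Sum>b<d. p (w @ [b])) = (if w \<in> C then cp \<nu> w / \<pi> else 0)" if "length w = k" for w
    using that cp_snoc[OF inv_prob_on[OF \<nu>], of w] by (simp add: p_def flip: sum_divide_distrib)
  have p_Cons: "(\<Sum>a<d. p (a # w)) = (if w \<in> C then cp \<nu> w / \<pi> else 0)" if "length w = k" for w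
  proof -
    have "p (a # w) = (if w \<in> C then cp \<nu> (a # w) / \<pi> else 0)" for a
    proof (cases "a # w \<in> edges \<nu>")
      case True
      then show ?thesis
        using C_edge[OF True] that unfolding p_def by simp
    next
      case False
      then have "cp \<nu> (a # w) = 0"
        using that edges_iff[of "a # w" \<nu>] cp_nonneg[of \<nu> "a # w"] by simp
      then show ?thesis
        by (simp add: p_def)
    qed
    then show ?thesis
      using cp_Cons[OF \<nu>, of w] by (simp flip: sum_divide_distrib)
  qed
  have flow: "flow p"
    unfolding flow_def
  proof (intro conjI allI impI ballI)
    show "p e \<ge> 0" for e
      using \<pi> by (simp add: p_def cp_nonneg)
    show "p e = 0" if "e \<notin> lang (Suc k)" for e
    proof (cases "length e = Suc k")
      case True
      then have "cp \<nu> e = 0"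
        using that cp_pos_lang[of \<nu> e] cp_nonneg[of \<nu> e] by (metis less_le)
      then show ?thesis
        by (simp add: p_def)
    qed (simp add: p_def)
    show "(\<Sum>a<d. p (a # w)) = (\<Sum>b<d. p (w @ [b]))" if "w \<in> words d k" for w
      using p_snoc p_Cons words_length[OF that] by simp
    have "(\<Sum>e\<in>words d (Suc k). p e) = (\<Sum>w\<in>words d k. if w \<in> C then cp \<nu> w / \<pi> else 0)"
      unfolding sum_words_snoc using p_snoc by (intro sum.cong refl) (simp add: words_def)
    also have "\<dots> = (\<Sum>w\<in>C. cp \<nu> w / \<pi>)"
      using Cw by (intro sum.mono_neutral_cong_right finite_words) auto
    also have "\<dots> = 1"
      using \<pi> by (simp add: \<pi>_def flip: sum_divide_distrib)
    finally show "(\<Sum>e\<in>words d (Suc k). p e) = 1" .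
  qed
  obtain \<mu> where \<mu>: "\<mu> \<in> Inv" "\<And>e. e \<in> words d (Suc k) \<Longrightarrow> cp \<mu> e = p e"
    and K\<mu>: "kernel_markov (\<lambda>e. p e / outflow p (butlast e)) \<mu>"
    using markov_measure_exists[OF flow] by blast
  have K': "kernel_markov (transition \<mu>) \<mu>"
    by (rule kernel_transition[OF \<mu>(1) K\<mu>])
  have cp_k: "cp \<mu> w = (if w \<in> C then cp \<nu> w / \<pi> else 0)" if "length w = k" for w
  proof (cases "w \<in> words d k")
    case True
    have "cp \<mu> w = (\<Sum>b<d. cp \<mu> (w @ [b]))"
      by (rule cp_snoc[OF inv_prob_on[OF \<mu>(1)]])
    also have "\<dots> = (\<Sum>b<d. p (w @ [b]))"
      using True by (intro sum.cong refl \<mu>(2)) (simp add: words_snoc_iff)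
    finally show ?thesis
      using p_snoc[OF that] by simp
  next
    case False
    then show ?thesis
      using Cw(1)[of w] cp_outside[of w \<mu>] that by auto
  qed
  have vert: "vertices \<mu> = C"
  proof (intro equalityI subsetI)
    fix w assume "w \<in> vertices \<mu>"
    then have "length w = k" "cp \<mu> w > 0"
      by (auto simp: vertices_def words_def)
    then show "w \<in> C"
      using cp_k[of w] by (cases "w \<in> C") simp_all
  next
    fix w assume "w \<in> C"
    then show "w \<in> vertices \<mu>"
      using Cw[of w] cp_k[of w] \<pi> by (simp add: vertices_def)
  qed
  have edges_mu: "edges \<mu> = {e \<in> edges \<nu>. butlast e \<in> C}"
  proof -
    have "e \<in> edges \<mu> \<longleftrightarrow> e \<in> edges \<nu> \<and> butlast e \<in> C" for e
    proof (cases "e \<in> words d (Suc k)")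
      case True
      then show ?thesis
        using \<mu>(2)[OF True] words_length[OF True] \<pi> by (simp add: edges_def p_def zero_less_divide_iff)
    qed (simp add: edges_def)
    then show ?thesis
      by blast
  qed
  have tr: "transition \<mu> e = transition \<nu> e" if "length e = Suc k" "butlast e \<in> C" for e
  proof (cases "e \<in> words d (Suc k)")
    case True
    then show ?thesis
      using that \<mu>(2)[OF True] cp_k[OF Cw(3)[OF that(2)]] \<pi> by (simp add: transition_def p_def)
  next
    case False
    then show ?thesis
      using that cp_outside[of e \<mu>] cp_outside[of e \<nu>] by (simp add: transition_def)
  qed
  have irr: "irreducible_on (vertices \<mu>) (wmat (transition \<mu>))"
    unfolding irreducible_on_def vert
  proof (intro ballI)
    fix v w assume vw: "v \<in> C" "w \<in> C"
    have st: "(x, y) \<in> support_graph C (wmat (transition \<mu>))" if "(x, y) \<in> graph" "x \<in> C" for x y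
    proof -
      obtain e where e: "e \<in> edges \<nu>" "x = butlast e" "y = tl e"
        using \<open>(x, y) \<in> graph\<close> by (auto simp: graph_def)
      then have "e \<in> edges \<mu>"
        using \<open>x \<in> C\<close> edges_mu by simp
      then show ?thesis
        using support_graph_transition[OF \<mu>(1)] e unfolding vert by auto
    qed
    have "(v0, v) \<in> graph\<^sup>*" "(v0, w) \<in> graph\<^sup>*"
      using vw by (auto simp: C_def)
    then have "(v, w) \<in> graph\<^sup>*"
      using graph_sym by (meson symD rtrancl_trans)
    then have "w \<in> C \<and> (v, w) \<in> (support_graph C (wmat (transition \<mu>)))\<^sup>*"
    proof (induction rule: rtrancl_induct)
      case (step x y)
      then have "(x, y) \<in> support_graph C (wmat (transition \<mu>))"
        using st by blast
      moreover from this have "y \<in> C"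
        by (simp add: support_graph_def)
      ultimately show ?case
        using step.IH by (meson rtrancl.rtrancl_into_rtrancl)
    qed (use vw in simp)
    then show "(v, w) \<in> (support_graph C (wmat (transition \<mu>)))\<^sup>*"
      by blast
  qed
  have lim': "((\<lambda>t. t * \<phi> v - a t + g w t - g v t) \<longlongrightarrow> ln (transition \<nu> (v @ [last w]))) at_top"
    if "(v, w) \<in> graph" for v w
    using lim[OF graph_cases(1)[OF that]] graph_cases(2)[OF that] by simp
  \<comment> \<open>Here the limit hypothesis enters: on the class the logarithms of the transition
    probabilities are a constant plus a coboundary, and \<open>exp (- \<kappa>)\<close> becomes the
    eigenvalue \<open>\<rho>\<close>.\<close>
  obtain \<kappa> h where h: "\<And>v w. (v0, v) \<in> graph\<^sup>* \<Longrightarrow> (v, w) \<in> graph \<Longrightarrow>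
      ln (transition \<nu> (v @ [last w])) = \<kappa> + h w - h v"
    using cocycle_limit[of graph \<phi> a g "\<lambda>v w. ln (transition \<nu> (v @ [last w]))" v0, OF lim'] by blast
  have cob: "transition \<mu> e = exp (h (tl e)) / (exp (- \<kappa>) * exp (h (butlast e)))"
    if len: "length e = Suc k" and pos: "cp \<mu> e > 0" for e
  proof -
    have e\<mu>: "e \<in> edges \<mu>"
      using edges_iff[OF len] pos by simp
    then have e: "e \<in> edges \<nu>" "butlast e \<in> C"
      using edges_mu by auto
    then have "(v0, butlast e) \<in> graph\<^sup>*" "(butlast e, tl e) \<in> graph"
      by (auto simp: C_def graph_def)
    from h[OF this] have "ln (transition \<nu> e) = \<kappa> + h (tl e) - h (butlast e)"
      using edges_vertices(6)[OF \<nu> e(1)] by simp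
    then have "transition \<nu> e = exp (\<kappa> + h (tl e) - h (butlast e))"
      using transition_edge[OF \<nu> e(1)] by (metis exp_ln)
    then show ?thesis
      unfolding tr[OF len e(2)] by (simp add: exp_add exp_diff exp_minus field_simps)
  qed
  have "parry \<mu>"
    unfolding parry_def
    by (intro conjI \<mu>(1) K' irr exI[of _ "exp (- \<kappa>)"] exI[of _ "\<lambda>w. exp (h w)"] allI impI cob) auto
  moreover have "\<pi> * cp \<mu> u = (if take k u \<in> C then cp \<nu> u else 0)" if "length u \<ge> k" for u
    using that
  proof (induction u rule: rev_induct)
    case Nil
    then show ?case
      using k_pos by simp
  next
    case (snoc b u)
    show ?case
    proof (cases "length u \<ge> k")
      case False
      then have "length (u @ [b]) = k"
        using snoc.prems by simp
      then show ?thesis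
        using cp_k[of "u @ [b]"] \<pi> by simp
    next
      case True
      have IH: "\<pi> * cp \<mu> u = (if take k u \<in> C then cp \<nu> u else 0)"
        by (rule snoc.IH[OF True])
      have len: "length (lastk u @ [b]) = Suc k"
        using length_lastk[OF True] by simp
      have \<mu>b: "cp \<mu> (u @ [b]) = cp \<mu> u * transition \<mu> (lastk u @ [b])"
        using K' True by (simp add: kernel_markov_def)
      have \<nu>b: "cp \<nu> (u @ [b]) = cp \<nu> u * transition \<nu> (lastk u @ [b])"
        using K True by (simp add: kernel_markov_def)
      have "\<pi> * cp \<mu> (u @ [b]) = (\<pi> * cp \<mu> u) * transition \<nu> (lastk u @ [b])"
      proof (cases "cp \<mu> u = 0")
        case False
        then have "cp \<mu> (lastk u) \<noteq> 0"
          using cp_drop_le[OF \<mu>(1), of u "length u - k"] cp_nonneg[of \<mu> u] by (simp add: lastk_def)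
        then have "lastk u \<in> C"
          using cp_k[OF length_lastk[OF True]] by (cases "lastk u \<in> C") simp_all
        then show ?thesis
          using \<mu>b tr[OF len] by simp
      qed (use \<mu>b in simp)
      then show ?thesis
        unfolding IH using \<nu>b True by simp
    qed
  qed
  ultimately show ?thesis
    unfolding \<pi>_def C_def by blast
qed

text \<open>A word of length at least \<open>k\<close> begins in exactly one class or has a null
  initial block, so the weighted class measures add up to \<open>\<nu>\<close> on long cylinders,
  then on all, then on Borel sets.\<close>

lemma convex_sum_of_parry: "convex_sum_of \<nu> {\<mu>. parry \<mu>}"
proof -
  let ?V = "vertices \<nu>"
  define \<C> where "\<C> = (\<lambda>v. graph\<^sup>* `` {v}) ` ?V"
  define \<pi> where "\<pi> C = (\<Sum>w\<in>C. cp \<nu> w)" for C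
  have fin: "finite \<C>"
    using finite_words by (simp add: \<C>_def vertices_def)
  have "\<forall>C\<in>\<C>. \<exists>\<mu>. parry \<mu> \<and> (\<forall>u. length u \<ge> k \<longrightarrow> \<pi> C * cp \<mu> u = (if take k u \<in> C then cp \<nu> u else 0))"
    unfolding \<C>_def \<pi>_def using class_measure by blast
  then obtain m where m: "\<And>C. C \<in> \<C> \<Longrightarrow> parry (m C)"
    "\<And>C u. C \<in> \<C> \<Longrightarrow> length u \<ge> k \<Longrightarrow> \<pi> C * cp (m C) u = (if take k u \<in> C then cp \<nu> u else 0)"
    by metis
  have P: "prob_on \<nu>" "\<And>C. C \<in> \<C> \<Longrightarrow> prob_on (m C)"
    using \<nu> m(1) by (auto simp: parry_def intro: inv_prob_on)
  have \<pi>_nonneg: "\<pi> C \<ge> 0" for C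
    by (simp add: \<pi>_def sum_nonneg cp_nonneg)
  have long: "(\<Sum>C\<in>\<C>. \<pi> C * cp (m C) u) = cp \<nu> u" if u: "length u \<ge> k" for u
  proof -
    have eq: "(\<Sum>C\<in>\<C>. \<pi> C * cp (m C) u) = (\<Sum>C\<in>\<C>. if take k u \<in> C then cp \<nu> u else 0)"
      using m(2) u by (intro sum.cong) auto
    show ?thesis
    proof (cases "take k u \<in> ?V")
      case True
      let ?C = "graph\<^sup>* `` {take k u}"
      have "take k u \<in> C \<longleftrightarrow> C = ?C" if "C \<in> \<C>" for C
      proof -
        obtain v where v: "C = graph\<^sup>* `` {v}"
          using \<open>C \<in> \<C>\<close> by (auto simp: \<C>_def)
        show ?thesis
        proof
          assume "take k u \<in> C"
          then have "(v, take k u) \<in> graph\<^sup>*" "(take k u, v) \<in> graph\<^sup>*"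
            using v graph_sym by (auto dest: symD)
          then show "C = ?C"
            unfolding v by (auto intro: rtrancl_trans)
        qed simp
      qed
      then have "(\<Sum>C\<in>\<C>. if take k u \<in> C then cp \<nu> u else 0) = (\<Sum>C\<in>\<C>. if C = ?C then cp \<nu> u else 0)"
        by (intro sum.cong) auto
      also have "\<dots> = cp \<nu> u"
        using fin True by (simp add: \<C>_def)
      finally show ?thesis
        using eq by simp
    next
      case False
      have len: "length (take k u) = k"
        using u by simp
      have "cp \<nu> (take k u) = 0"
        using False cp_outside[of "take k u" \<nu>] cp_nonneg[of \<nu> "take k u"] len by (auto simp: vertices_def less_le)
      then have "cp \<nu> u = 0"
        using cp_append_le[OF P(1), of "take k u" "drop k u"] cp_nonneg[of \<nu> u] by simp
      then show ?thesis
        unfolding eq by (simp cong: if_cong)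
    qed
  qed
  have all: "(\<Sum>C\<in>\<C>. \<pi> C * cp (m C) u) = cp \<nu> u" for u
  proof -
    have "(\<Sum>C\<in>\<C>. \<pi> C * cp (m C) u) = (\<Sum>C\<in>\<C>. \<pi> C * (\<Sum>v\<in>words d k. cp (m C) (u @ v)))"
      by (intro sum.cong refl) (simp add: cp_words[OF P(2)])
    also have "\<dots> = (\<Sum>v\<in>words d k. \<Sum>C\<in>\<C>. \<pi> C * cp (m C) (u @ v))"
      unfolding sum_distrib_left by (rule sum.swap)
    also have "\<dots> = (\<Sum>v\<in>words d k. cp \<nu> (u @ v))"
      by (intro sum.cong refl long) (simp add: words_def)
    finally show ?thesis
      by (simp add: cp_words[OF P(1)])
  qed
  have meas: "measure \<nu> B = (\<Sum>C\<in>\<C>. \<pi> C * measure (m C) B)" if B: "B \<in> sets BX" for B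
  proof -
    have "measure \<nu> B - (\<Sum>C\<in>\<C>. \<pi> C * measure (m C) B) = 0"
    proof (rule set_function_zero[where F = "\<lambda>B. measure \<nu> B - (\<Sum>C\<in>\<C>. \<pi> C * measure (m C) B)", OF _ _ _ B])
      show "measure \<nu> (cyl u) - (\<Sum>C\<in>\<C>. \<pi> C * measure (m C) (cyl u)) = 0" for u
        using all[of u] by (simp add: cp_def)
      have compl: "measure \<rho> (X - B) = measure \<rho> X - measure \<rho> B" if "prob_on \<rho>" "B \<in> sets BX" for \<rho> B
        using that finite_measure.finite_measure_compl[OF prob_on_finite[OF that(1)], of B]
        by (simp add: prob_on_sets prob_on_space)
      show "measure \<nu> (X - B) - (\<Sum>C\<in>\<C>. \<pi> C * measure (m C) (X - B)) =
          measure \<nu> X - (\<Sum>C\<in>\<C>. \<pi> C * measure (m C) X) - (measure \<nu> B - (\<Sum>C\<in>\<C>. \<pi> C * measure (m C) B))"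
        if "B \<in> sets BX" for B
        using compl[OF P(1) that] compl[OF P(2) that] by (simp add: right_diff_distrib sum_subtractf)
      show "(\<lambda>i. measure \<nu> (A i) - (\<Sum>C\<in>\<C>. \<pi> C * measure (m C) (A i))) sums
          (measure \<nu> (\<Union>i. A i) - (\<Sum>C\<in>\<C>. \<pi> C * measure (m C) (\<Union>i. A i)))"
        if A: "range A \<subseteq> sets BX" "disjoint_family A" for A :: "nat \<Rightarrow> seq set"
      proof -
        have U: "(\<lambda>i. measure \<rho> (A i)) sums measure \<rho> (\<Union>i. A i)" if "prob_on \<rho>" for \<rho>
          using finite_measure.finite_measure_UNION[OF prob_on_finite[OF that], of A] A
          by (simp add: prob_on_sets[OF that])
        show ?thesis
          by (intro sums_diff sums_sum sums_mult U P)
      qed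
    qed
    then show ?thesis
      by simp
  qed
  \<comment> \<open>Classes with equal measures are collected, and Parry measures of no class get
    coefficient 0, since the combination runs over all Parry measures.\<close>
  define c where "c \<mu> = (\<Sum>C\<in>{C\<in>\<C>. m C = \<mu>}. \<pi> C)" for \<mu>
  have group: "(\<Sum>\<mu>\<in>{\<mu>. parry \<mu>}. c \<mu> * measure \<mu> B) = measure \<nu> B" if "B \<in> sets BX" for B
  proof -
    have "(\<Sum>\<mu>\<in>{\<mu>. parry \<mu>}. c \<mu> * measure \<mu> B) =
        (\<Sum>\<mu>\<in>{\<mu>. parry \<mu>}. \<Sum>C\<in>{C\<in>\<C>. m C = \<mu>}. \<pi> C * measure (m C) B)"
      unfolding c_def sum_distrib_right by (intro sum.cong) auto
    also have "\<dots> = (\<Sum>C\<in>\<C>. \<pi> C * measure (m C) B)"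
      using m(1) by (intro sum.group fin finite_parry) auto
    finally show ?thesis
      using meas[OF that] by simp
  qed
  have one: "measure \<rho> X = 1" if "prob_on \<rho>" for \<rho>
    using prob_space.prob_space[OF prob_on_prob[OF that]] by (simp add: prob_on_space[OF that])
  have PP: "prob_on \<mu>" if "parry \<mu>" for \<mu>
    using that by (auto simp: parry_def intro: inv_prob_on)
  have "X \<in> sets BX"
    using cyl_sets_BX[of "[]"] by simp
  have "(\<Sum>\<mu>\<in>{\<mu>. parry \<mu>}. c \<mu>) = (\<Sum>\<mu>\<in>{\<mu>. parry \<mu>}. c \<mu> * measure \<mu> X)"
    using one PP by (intro sum.cong) auto
  also have "\<dots> = 1"
    unfolding group[OF \<open>X \<in> sets BX\<close>] by (rule one[OF P(1)])
  finally have c_sum: "(\<Sum>\<mu>\<in>{\<mu>. parry \<mu>}. c \<mu>) = 1" .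
  show ?thesis
    unfolding convex_sum_of_def
  proof (intro conjI ballI exI[of _ c] finite_parry c_sum)
    show "sets \<mu> = sets \<nu>" if "\<mu> \<in> {\<mu>. parry \<mu>}" for \<mu>
      using that PP[of \<mu>] P(1) by (simp add: prob_on_sets)
    show "0 \<le> c \<mu>" for \<mu>
      unfolding c_def by (intro sum_nonneg \<pi>_nonneg)
    show "measure \<nu> B = (\<Sum>\<mu>\<in>{\<mu>. parry \<mu>}. c \<mu> * measure \<mu> B)" if "B \<in> sets \<nu>" for B
      using group[of B] that by (simp add: prob_on_sets[OF P(1)])
  qed
qed

end

end

section \<open>The zero-temperature limit\<close>

context irreducible_sft
begin

text \<open>The limit is rebuilt as the Markov measure of the limiting edge law, which inherits
  balance from invariance. Convergence is then carried from words of length \<open>k + 1\<close> to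
  all words.\<close>

theorem zero_temperature_convex_sum:
  assumes \<phi>: "\<And>x. x \<in> X \<Longrightarrow> \<phi> x = g (prefix k x)"
  shows "convex_sum_of (zero_temperature_measure X shift_map \<phi>) {\<mu>. parry \<mu>}"
proof -
  define M where "M t = wmat (\<lambda>e. if e \<in> lang (Suc k) then exp (t * g (butlast e)) else 0)" for t :: real
  have M_eq: "M t v w = (if tl (v @ [last w]) = w \<and> v @ [last w] \<in> lang (Suc k) then exp (t * g v) else 0)" for t v w
    by (simp add: M_def wmat_def)
  \<comment> \<open>The Lipschitz constant has to dominate every \<open>\<bar>g w\<bar>\<close> at
    once; the sum does.\<close>
  interpret F: perron_family "lang k" M "\<Sum>w\<in>lang k. \<bar>g w\<bar>"
  proof
    show "irreducible_on (lang k) (M t)" for t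
      unfolding M_def by (rule lang_irreducible_on) simp
    show "\<exists>w\<in>lang k. M t v w > 0" if "v \<in> lang k" for t v
    proof -
      obtain x where x: "x \<in> X" "v = prefix k x"
        using \<open>v \<in> lang k\<close> by (auto simp: lang_iff)
      have e: "prefix (Suc k) x \<in> lang (Suc k)"
        by (rule prefix_lang[OF x(1)])
      have "tl (prefix (Suc k) x) \<noteq> []"
        using k_pos by (auto simp: prefix_shift prefix_def)
      then have "last (tl (prefix (Suc k) x)) = x k"
        by (simp add: last_tl) (simp add: prefix_Suc)
      then have "M t v (tl (prefix (Suc k) x)) > 0"
        using e x(2) by (simp add: M_eq prefix_Suc[symmetric])
      then show ?thesis
        using lang_butlast_tl(2)[OF e] by blast
    qed
    show "exp_sum (\<lambda>t. M t v w)" for v w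
      using exp_sum_exp[of 1 "g v"] exp_sum_const[of 0] 
      by (cases "tl (v @ [last w]) = w"; cases "v @ [last w] \<in> lang (Suc k)") (simp_all add: M_eq mult.commute)
    show "M s v w \<le> exp ((\<Sum>w\<in>lang k. \<bar>g w\<bar>) * \<bar>s - t\<bar>) * M t v w" if "v \<in> lang k" for s t v w
    proof -
      have "s * g v - t * g v \<le> \<bar>(s - t) * g v\<bar>"
        by (simp add: left_diff_distrib)
      also have "\<dots> = \<bar>g v\<bar> * \<bar>s - t\<bar>"
        by (simp add: abs_mult)
      also have "\<dots> \<le> (\<Sum>w\<in>lang k. \<bar>g w\<bar>) * \<bar>s - t\<bar>"
        using finite_lang that by (intro mult_right_mono member_le_sum) auto
      finally have "s * g v \<le> (\<Sum>w\<in>lang k. \<bar>g w\<bar>) * \<bar>s - t\<bar> + t * g v"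
        by simp
      then show ?thesis
        by (simp add: M_eq flip: exp_add)
    qed
  qed (simp_all add: finite_lang lang_nonempty M_eq)
  obtain c l r where D: "F.perron_data c l r"
    using F.perron_data_exists by blast
  note pos = D[unfolded F.perron_data_def, rule_format]
  define \<mu> where "\<mu> t = equilibrium_state X shift_map (\<lambda>x. t * \<phi> x)" for t
  have gibbs: "\<mu> t \<in> Inv \<and> (\<exists>K. kernel_markov K (\<mu> t)) \<and>
      (\<forall>e\<in>words d (Suc k). cp (\<mu> t) e =
        (if e \<in> lang (Suc k) then l t (butlast e) * exp (t * g (butlast e)) * r t (tl e) / c t else 0)) \<and>
      (\<forall>e\<in>lang (Suc k). transition (\<mu> t) e = exp (t * g (butlast e)) * r t (tl e) / (c t * r t (butlast e)))" for t
  proof -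
    interpret G: gibbs_data d X k "\<lambda>w. t * g w" "c t" "l t" "r t"
      by unfold_locales (use pos[of t] in \<open>auto simp: M_def\<close>)
    have "\<mu> t = G.gibbs"
      unfolding \<mu>_def by (rule G.equilibrium_state_gibbs) (simp add: \<phi>)
    moreover have "transition G.gibbs e = G.kern e" if e: "e \<in> lang (Suc k)" for e
    proof -
      note * = lang_butlast_tl[OF e]
      have "cp G.gibbs (butlast e @ [last e]) = cp G.gibbs (butlast e) * G.kern (butlast e @ [last e])"
        using G.gibbs(3) *(5) by (simp add: kernel_markov_def lastk_id)
      moreover have "cp G.gibbs (butlast e) > 0"
        using *(1) G.vertices_gibbs by (auto simp: vertices_def)
      ultimately show ?thesis
        unfolding *(4)[symmetric] by (simp add: transition_def)
    qed
    ultimately show ?thesis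
      using G.gibbs by (auto simp: G.p_def G.kern_def)
  qed
  have \<mu>: "\<mu> t \<in> Inv" "kernel_markov (transition (\<mu> t)) (\<mu> t)" "prob_on (\<mu> t)" for t
    using gibbs[of t] kernel_transition inv_prob_on by blast+
  have zero: "cp (\<mu> t) e = 0" if "e \<notin> lang (length e)" for t e
    using cp_pos_lang[of "\<mu> t" e] cp_nonneg[of "\<mu> t" e] that by (metis less_le)
  have ex_lim: "\<exists>L. ((\<lambda>t. cp (\<mu> t) e) \<longlongrightarrow> L) at_top" if len: "length e = Suc k" for e
  proof (cases "e \<in> lang (Suc k)")
    case True
    note * = lang_butlast_tl[OF True]
    have "tl e \<noteq> []"
      using len k_pos by (cases e) auto
    then have e': "butlast e @ [last (tl e)] = e"
      using *(4) by (simp add: last_tl)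
    have "cp (\<mu> t) e = l t (butlast e) * M t (butlast e) (tl e) * r t (tl e) / c t" for t
      using gibbs[of t] *(3) True by (simp add: M_eq e')
    then show ?thesis
      using F.edge_weight_converges[OF D *(1,2)] by simp
  next
    case False
    then show ?thesis
      using zero[of e] len by (intro exI[of _ 0]) simp
  qed
  define p where "p e = (if length e = Suc k then Lim at_top (\<lambda>t. cp (\<mu> t) e) else 0)" for e
  have p_lim: "((\<lambda>t. cp (\<mu> t) e) \<longlongrightarrow> p e) at_top" if "length e = Suc k" for e
    using ex_lim[OF that] that tendsto_Lim[OF trivial_limit_at_top_linorder] by (metis p_def)
  have flow: "flow p"
    unfolding flow_def
  proof (intro conjI allI impI ballI)
    show "p e \<ge> 0" for e
    proof (cases "length e = Suc k")
      case True
      show ?thesis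
        by (rule tendsto_lowerbound[OF p_lim[OF True]]) (simp_all add: cp_nonneg)
    qed (simp add: p_def)
    show "p e = 0" if "e \<notin> lang (Suc k)" for e
    proof (cases "length e = Suc k")
      case True
      then have "((\<lambda>t :: real. 0) \<longlongrightarrow> p e) at_top"
        using p_lim[OF True] zero[of e] that by simp
      then show ?thesis
        using tendsto_const_iff[of "at_top :: real filter" 0 "p e"] by simp
    qed (simp add: p_def)
    show "(\<Sum>a<d. p (a # w)) = (\<Sum>b<d. p (w @ [b]))" if "w \<in> words d k" for w
    proof (rule tendsto_unique[OF trivial_limit_at_top_linorder])
      have len: "length w = k"
        using that by (rule words_length)
      have "((\<lambda>t. \<Sum>a<d. cp (\<mu> t) (a # w)) \<longlongrightarrow> (\<Sum>a<d. p (a # w))) at_top"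
        using len by (intro tendsto_sum p_lim) simp
      then show "((\<lambda>t. cp (\<mu> t) w) \<longlongrightarrow> (\<Sum>a<d. p (a # w))) at_top"
        unfolding cp_Cons[OF \<mu>(1), of _ w, symmetric] .
      have "((\<lambda>t. \<Sum>b<d. cp (\<mu> t) (w @ [b])) \<longlongrightarrow> (\<Sum>b<d. p (w @ [b]))) at_top"
        using len by (intro tendsto_sum p_lim) simp
      then show "((\<lambda>t. cp (\<mu> t) w) \<longlongrightarrow> (\<Sum>b<d. p (w @ [b]))) at_top"
        unfolding cp_snoc[OF \<mu>(3), of _ w, symmetric] .
    qed
    have "((\<lambda>t. \<Sum>e\<in>words d (Suc k). cp (\<mu> t) e) \<longlongrightarrow> (\<Sum>e\<in>words d (Suc k). p e)) at_top"
      by (intro tendsto_sum p_lim) (simp add: words_def)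
    then show "(\<Sum>e\<in>words d (Suc k). p e) = 1"
      using tendsto_const_iff[of "at_top :: real filter" 1 "\<Sum>e\<in>words d (Suc k). p e"]
      by (simp add: cp_sum_words[OF \<mu>(3)])
  qed
  obtain \<nu> where \<nu>: "\<nu> \<in> Inv" and \<nu>p: "\<And>e. e \<in> words d (Suc k) \<Longrightarrow> cp \<nu> e = p e"
    and "kernel_markov (\<lambda>e. p e / outflow p (butlast e)) \<nu>"
    using markov_measure_exists[OF flow] by blast
  then have K: "kernel_markov (transition \<nu>) \<nu>"
    by (intro kernel_transition)
  have P: "prob_on \<nu>"
    by (rule inv_prob_on[OF \<nu>])
  have lim_Suc: "((\<lambda>t. cp (\<mu> t) e) \<longlongrightarrow> cp \<nu> e) at_top" if len: "length e = Suc k" for e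
  proof (cases "e \<in> words d (Suc k)")
    case True
    then show ?thesis
      using p_lim[OF len] \<nu>p by simp
  next
    case False
    then show ?thesis
      using len cp_outside[of e] by simp
  qed
  have lim_k: "((\<lambda>t. cp (\<mu> t) w) \<longlongrightarrow> cp \<nu> w) at_top" if "length w = k" for w
    unfolding cp_snoc[OF \<mu>(3), of _ w] cp_snoc[OF P, of w]
    using that by (intro tendsto_sum lim_Suc) simp
  have lim_long: "((\<lambda>t. cp (\<mu> t) u) \<longlongrightarrow> cp \<nu> u) at_top" if "length u \<ge> k" for u
    using that
  proof (induction u rule: rev_induct)
    case Nil
    then show ?case
      using k_pos by simp
  next
    case (snoc b u)
    show ?case
    proof (cases "length u \<ge> k")
      case False
      then show ?thesis
        using snoc.prems by (intro lim_k) simp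
    next
      case True
      note len = length_lastk[OF True]
      show ?thesis
      proof (cases "cp \<nu> (lastk u) = 0")
        case False
        have "((\<lambda>t. cp (\<mu> t) u * transition (\<mu> t) (lastk u @ [b])) \<longlongrightarrow> cp \<nu> u * transition \<nu> (lastk u @ [b])) at_top"
          unfolding transition_def using False len by (intro tendsto_intros snoc.IH[OF True] lim_Suc lim_k) simp_all
        moreover have "cp (\<mu> t) (u @ [b]) = cp (\<mu> t) u * transition (\<mu> t) (lastk u @ [b])" for t
          using \<mu>(2)[of t] True by (simp add: kernel_markov_def)
        moreover have "cp \<nu> (u @ [b]) = cp \<nu> u * transition \<nu> (lastk u @ [b])"
          using K True by (simp add: kernel_markov_def)
        ultimately show ?thesis
          by simp
      next
        \<comment> \<open>At a block that is null in the limit nothing is known about the transition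
          probabilities, but the word is squeezed by the probability of the block.\<close>
        case z: True
        have le: "cp \<rho> (u @ [b]) \<le> cp \<rho> (lastk u)" if "\<rho> \<in> Inv" for \<rho>
          using cp_append_le[OF inv_prob_on[OF that], of u "[b]"] cp_drop_le[OF that, of u "length u - k"]
          by (simp add: lastk_def)
        have "cp \<nu> (u @ [b]) = 0"
          using le[OF \<nu>] z cp_nonneg[of \<nu> "u @ [b]"] by simp
        moreover have "((\<lambda>t. cp (\<mu> t) (u @ [b])) \<longlongrightarrow> 0) at_top"
        proof (rule tendsto_sandwich[of "\<lambda>_. 0" _ _ "\<lambda>t. cp (\<mu> t) (lastk u)"])
          show "((\<lambda>t. cp (\<mu> t) (lastk u)) \<longlongrightarrow> 0) at_top"
            using lim_k[OF len] z by simp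
        qed (use le[OF \<mu>(1)] cp_nonneg in auto)
        ultimately show ?thesis
          by simp
      qed
    qed
  qed
  have lim_cp: "((\<lambda>t. cp (\<mu> t) u) \<longlongrightarrow> cp \<nu> u) at_top" for u
    unfolding cp_words[OF \<mu>(3), of _ u k, symmetric] cp_words[OF P, of u k, symmetric]
    by (intro tendsto_sum lim_long) (simp add: words_def)
  have "weak_star_tendsto X (\<lambda>t. equilibrium_state X shift_map (\<lambda>x. t * \<phi> x)) \<nu> at_top"
    unfolding \<mu>_def[symmetric] by (rule weak_star_of_cp[OF \<mu>(3) P lim_cp])
  then have "zero_temperature_measure X shift_map \<phi> = \<nu>"
    by (rule zero_temperature_measure_eqI[OF P])
  \<comment> \<open>The logarithmic transition probabilities are the cocycle: \<open>a\<close> is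
    \<open>ln (c t)\<close> and the coboundary comes from \<open>ln (r t w)\<close>. Neither is
    asked to converge.\<close>
  moreover have "convex_sum_of \<nu> {\<mu>. parry \<mu>}"
  proof (rule convex_sum_of_parry[OF \<nu> K, of g "\<lambda>t. ln (c t)" "\<lambda>w t. ln (r t w)"])
    fix e assume e: "e \<in> edges \<nu>"
    note * = edges_vertices[OF \<nu> e]
    have "e \<in> lang (Suc k)"
      using e cp_pos_lang[of \<nu> e] by (simp add: edges_def words_def)
    note lb = lang_butlast_tl[OF this]
    have "ln (transition (\<mu> t) e) = t * g (butlast e) - ln (c t) + ln (r t (tl e)) - ln (r t (butlast e))" for t
    proof -
      have "transition (\<mu> t) e = exp (t * g (butlast e)) * r t (tl e) / (c t * r t (butlast e))"
        using gibbs[of t] \<open>e \<in> lang (Suc k)\<close> by blast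
      moreover have "c t > 0" "r t (tl e) > 0" "r t (butlast e) > 0"
        using pos[of t] lb(1,2) by blast+
      ultimately show ?thesis
        by (simp add: ln_div ln_mult_pos)
    qed
    moreover have "((\<lambda>t. ln (transition (\<mu> t) e)) \<longlongrightarrow> ln (transition \<nu> e)) at_top"
    proof (rule tendsto_ln)
      show "((\<lambda>t. transition (\<mu> t) e) \<longlongrightarrow> transition \<nu> e) at_top"
        unfolding transition_def using *(1,4)
        by (intro tendsto_divide lim_Suc lim_k) (auto simp: vertices_def)
      show "transition \<nu> e \<noteq> 0"
        using transition_edge[OF \<nu> e] by simp
    qed
    ultimately show "((\<lambda>t. t * g (butlast e) - ln (c t) + ln (r t (tl e)) - ln (r t (butlast e))) \<longlongrightarrow>
        ln (transition \<nu> e)) at_top"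
      by simp
  qed
  ultimately show ?thesis
    by simp
qed

end

section \<open>Analyticity of the normalisation\<close>

text \<open>Iterated summation over the fibres of \<open>\<nu>\<close>; as they are finite, the
  inner sums are ordinary ones.\<close>

lemma has_sum_regroup:
  fixes f :: "'i \<Rightarrow> real"
  assumes f: "(f has_sum a) \<Omega>" and \<nu>: "\<And>\<omega>. \<omega> \<in> \<Omega> \<Longrightarrow> \<nu> \<omega> \<in> K"
    and fin: "\<And>\<kappa>. \<kappa> \<in> K \<Longrightarrow> finite {\<omega>\<in>\<Omega>. \<nu> \<omega> = \<kappa>}"
  shows "((\<lambda>\<kappa>. \<Sum>\<omega>\<in>{\<omega>\<in>\<Omega>. \<nu> \<omega> = \<kappa>}. f \<omega>) has_sum a) K"
proof -
  let ?B = "\<lambda>\<kappa>. {\<omega>\<in>\<Omega>. \<nu> \<omega> = \<kappa>}"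
  have inj: "inj_on snd (Sigma K ?B)"
    by (auto simp: inj_on_def)
  have "snd ` Sigma K ?B = \<Omega>"
    using \<nu> by force
  then have "((f \<circ> snd) has_sum a) (Sigma K ?B)"
    using f has_sum_reindex[OF inj, of f a] by simp
  then show ?thesis
  proof (rule has_sum_SigmaD)
    fix \<kappa> assume "\<kappa> \<in> K"
    then show "((\<lambda>\<omega>. (f \<circ> snd) (\<kappa>, \<omega>)) has_sum (\<Sum>\<omega>\<in>?B \<kappa>. f \<omega>)) (?B \<kappa>)"
      using fin has_sum_finite[of "?B \<kappa>" f] by simp
  qed
qed

lemma sum_lists_length:
  fixes z :: "'i \<Rightarrow> real"
  assumes "finite I"
  shows "(\<Sum>L\<in>{L. set L \<subseteq> I \<and> length L = n}. prod_list (map z L)) = (\<Sum>i\<in>I. z i) ^ n"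
proof (induction n)
  case 0
  have "{L. set L \<subseteq> I \<and> length L = 0} = {[]}"
    by auto
  then show ?case
    by simp
next
  case (Suc n)
  let ?S = "\<lambda>n. {L. set L \<subseteq> I \<and> length L = n}"
  have "?S (Suc n) = (\<lambda>(i, L). i # L) ` (I \<times> ?S n)"
    by (auto simp: length_Suc_conv image_iff)
  moreover have "inj_on (\<lambda>(i, L). i # L) (I \<times> ?S n)"
    by (auto simp: inj_on_def)
  ultimately have "(\<Sum>L\<in>?S (Suc n). prod_list (map z L)) = (\<Sum>(i, L)\<in>I \<times> ?S n. z i * prod_list (map z L))"
    by (simp add: sum.reindex case_prod_unfold)
  also have "\<dots> = (\<Sum>i\<in>I. z i) * (\<Sum>L\<in>?S n. prod_list (map z L))"
    by (simp add: sum_product sum.cartesian_product)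
  finally show ?case
    using Suc by simp
qed

text \<open>Powers of a sum expand into products over lists. The series with absolute values bounds
  all finite partial sums, which makes the family summable.\<close>

lemma has_sum_power_series_lists:
  fixes z :: "'i \<Rightarrow> real" and g :: "nat \<Rightarrow> real"
  assumes I: "finite I" and summ: "summable (\<lambda>n. \<bar>g n\<bar> * (\<Sum>i\<in>I. \<bar>z i\<bar>) ^ n)"
    and sums: "(\<lambda>n. g n * (\<Sum>i\<in>I. z i) ^ n) sums v"
  shows "((\<lambda>L. g (length L) * prod_list (map z L)) has_sum v) (lists I)"
proof -
  let ?S = "\<lambda>n. {L. set L \<subseteq> I \<and> length L = n}"
  let ?f = "\<lambda>L. g (length L) * prod_list (map z L)"
  define A where "A N = {L \<in> lists I. length L < N}" for N
  have finS: "finite (?S n)" for n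
    using I by (rule finite_lists_length_eq)
  have A: "A N = (\<Union>n<N. ?S n)" for N
    by (auto simp: A_def)
  have sumA: "(\<Sum>L\<in>A N. h (length L) * prod_list (map y L)) = (\<Sum>n<N. h n * (\<Sum>i\<in>I. y i) ^ n)"
    for N and h :: "nat \<Rightarrow> real" and y :: "'i \<Rightarrow> real"
  proof -
    have "(\<Sum>L\<in>A N. h (length L) * prod_list (map y L)) = (\<Sum>n<N. \<Sum>L\<in>?S n. h (length L) * prod_list (map y L))"
      unfolding A using finS by (intro sum.UNION_disjoint) auto
    also have "\<dots> = (\<Sum>n<N. h n * (\<Sum>L\<in>?S n. prod_list (map y L)))"
      by (simp add: sum_distrib_left)
    finally show ?thesis
      by (simp add: sum_lists_length[OF I])
  qed
  have abs_prod: "\<bar>prod_list (map z L)\<bar> = prod_list (map (\<lambda>i. \<bar>z i\<bar>) L)" for L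
    by (induction L) (auto simp: abs_mult)
  have "(\<lambda>L. \<bar>?f L\<bar>) summable_on lists I"
  proof (rule nonneg_bdd_above_summable_on)
    have "(\<Sum>L\<in>F. \<bar>?f L\<bar>) \<le> (\<Sum>n. \<bar>g n\<bar> * (\<Sum>i\<in>I. \<bar>z i\<bar>) ^ n)" if F: "F \<subseteq> lists I" "finite F" for F
    proof -
      define N where "N = Suc (Max (insert 0 (length ` F)))"
      have "F \<subseteq> A N"
        using F by (auto simp: A_def N_def less_Suc_eq_le intro!: Max_ge)
      then have "(\<Sum>L\<in>F. \<bar>?f L\<bar>) \<le> (\<Sum>L\<in>A N. \<bar>?f L\<bar>)"
        using finS by (intro sum_mono2) (auto simp: A)
      also have "\<dots> = (\<Sum>n<N. \<bar>g n\<bar> * (\<Sum>i\<in>I. \<bar>z i\<bar>) ^ n)"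
        using sumA[where h="\<lambda>n. \<bar>g n\<bar>" and y="\<lambda>i. \<bar>z i\<bar>" and N=N] by (simp add: abs_mult abs_prod)
      also have "\<dots> \<le> (\<Sum>n. \<bar>g n\<bar> * (\<Sum>i\<in>I. \<bar>z i\<bar>) ^ n)"
        using summ by (intro sum_le_suminf) (auto simp: sum_nonneg)
      finally show ?thesis .
    qed
    then show "bdd_above (sum (\<lambda>L. \<bar>?f L\<bar>) ` {F. F \<subseteq> lists I \<and> finite F})"
      by (intro bdd_aboveI2) auto
  qed auto
  then have "?f summable_on lists I"
    using abs_summable_summable[of ?f "lists I"] by simp
  then obtain w where w: "(?f has_sum w) (lists I)"
    by (auto simp: summable_on_def)
  \<comment> \<open>The finite sets \<open>A N\<close> exhaust the lists, so the unordered sum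
    equals the limit of the ordered partial sums, whose value is given.\<close>
  have "filterlim A (finite_subsets_at_top (lists I)) sequentially"
    unfolding filterlim_finite_subsets_at_top
  proof (intro allI impI)
    fix F assume F: "finite F \<and> F \<subseteq> lists I"
    show "\<forall>\<^sub>F N in sequentially. finite (A N) \<and> F \<subseteq> A N \<and> A N \<subseteq> lists I"
    proof (rule eventually_sequentiallyI)
      fix N assume "Suc (Max (insert 0 (length ` F))) \<le> N"
      then have "length L < N" if "L \<in> F" for L
      proof -
        have "length L \<le> Max (insert 0 (length ` F))"
          using F that by (intro Max_ge) auto
        then show ?thesis
          using \<open>Suc (Max (insert 0 (length ` F))) \<le> N\<close> by linarith
      qed
      then have "F \<subseteq> A N"
        unfolding A_def using F by blast
      moreover have "finite (A N)"
        unfolding A using finS by auto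
      ultimately show "finite (A N) \<and> F \<subseteq> A N \<and> A N \<subseteq> lists I"
        unfolding A_def by blast
    qed
  qed
  then have "(\<lambda>N. sum ?f (A N)) \<longlonglongrightarrow> w"
    using w unfolding has_sum_def by (rule filterlim_compose[rotated])
  then have "(\<lambda>n. g n * (\<Sum>i\<in>I. z i) ^ n) sums w"
    by (simp add: sums_def sumA)
  then show ?thesis
    using w sums sums_unique2 by blast
qed

lemma inverse_sqrt_series:
  fixes u :: real
  assumes "\<bar>u\<bar> < 1"
  shows "(\<lambda>n. ((-1/2) gchoose n) * u ^ n) sums (1 / sqrt (1 + u))"
proof -
  have "(1 + u) powr (-1/2) = 1 / sqrt (1 + u)"
    using assms powr_minus[of "1 + u" "1/2"] by (simp add: powr_half_sqrt inverse_eq_divide)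
  then show ?thesis
    using gen_binomial_real[OF assms, of "-1/2"] by simp
qed

text \<open>Convergence at the larger point \<open>(1 + \<rho>) / 2\<close> gives absolute
  convergence at \<open>\<rho>\<close>.\<close>

lemma inverse_sqrt_series_abs:
  fixes \<rho> :: real
  assumes "0 \<le> \<rho>" "\<rho> < 1"
  shows "summable (\<lambda>n. \<bar>(-1/2 :: real) gchoose n\<bar> * \<rho> ^ n)"
proof -
  have "summable (\<lambda>n. ((-1/2 :: real) gchoose n) * ((1 + \<rho>) / 2) ^ n)"
    using inverse_sqrt_series[of "(1 + \<rho>) / 2"] assms by (intro sums_summable) auto
  then have "summable (\<lambda>n. norm (((-1/2 :: real) gchoose n) * \<rho> ^ n))"
    by (rule powser_insidea) (use assms in auto)
  then show ?thesis
    using assms by (simp add: abs_mult)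
qed

text \<open>
  With \<open>y = x - a\<close> and \<open>S = \<Sum>\<^sub>j a\<^sub>j\<^sup>2\<close>, the sum of squares is \<open>S (1 + u)\<close> where \<open>u\<close> is a sum of
  monomials \<open>2 a\<^sub>j y\<^sub>j / S\<close> and \<open>y\<^sub>j\<^sup>2 / S\<close>.  The powers of \<open>u\<close> in the binomial series expand into
  products over lists of such monomials, and only finitely many lists yield a given multi-index.
\<close>

lemma real_analytic_normalised_coordinate:
  fixes a :: "'j \<Rightarrow> real"
  assumes J: "finite J" and C: "C \<in> J" and a: "\<exists>j\<in>J. a j \<noteq> 0"
  shows "real_analytic_at J (\<lambda>x. x C / sqrt (\<Sum>j\<in>J. (x j)\<^sup>2)) a"
proof -
  define S where "S = (\<Sum>j\<in>J. (a j)\<^sup>2)"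
  have S: "S > 0"
    using a J unfolding S_def by (metis sum_pos2 zero_le_power2 zero_less_power2)
  \<comment> \<open>\<open>(j, False)\<close> indexes the linear monomial in \<open>y j\<close>, and
    \<open>(j, True)\<close> the quadratic one.\<close>
  define I where "I = J \<times> (UNIV :: bool set)"
  have I: "finite I"
    using J by (simp add: I_def)
  define \<beta> where "\<beta> = (\<lambda>(j, s). if s then 1 / S else 2 * a j / S)"
  define ex where "ex = (\<lambda>(j :: 'j, s). if s then 2 else 1 :: nat)"
  define Kb where "Kb = (\<Sum>i\<in>I. \<bar>\<beta> i\<bar>)"
  \<comment> \<open>\<open>r \<le> 1\<close> lets \<open>r\<close> bound the squares too, and
    \<open>Kb * r < 1\<close> keeps the sum of the absolute monomials inside the disc of the
    binomial series.\<close>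
  define r where "r = 1 / (1 + Kb)"
  have Kb: "Kb \<ge> 0"
    by (simp add: Kb_def sum_nonneg)
  have r: "0 < r" "r \<le> 1" "Kb * r < 1"
    using Kb by (auto simp: r_def divide_simps)
  define g where "g n = ((-1/2 :: real) gchoose n)" for n
  define \<nu>0 where "\<nu>0 L j = sum_list (map (\<lambda>i. if fst i = j then ex i else 0) L)" for L j
  \<comment> \<open>The Boolean records which summand of the numerator
    \<open>x C = a C + y C\<close> is taken; \<open>y C\<close> raises the exponent at
    \<open>C\<close> by one.\<close>
  define \<nu> where "\<nu> = (\<lambda>(b, L). \<lambda>j\<in>J. \<nu>0 L j + (if b \<and> j = C then 1 else 0))"
  define h where "h = (\<lambda>(b, L). (if b then 1 else a C) / sqrt S * (g (length L) * prod_list (map \<beta> L)))"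
  define \<Omega> where "\<Omega> = Pair False ` lists I \<union> Pair True ` lists I"
  define K where "K = (J \<rightarrow>\<^sub>E (UNIV :: nat set))"
  define c where "c \<kappa> = (\<Sum>\<omega>\<in>{\<omega>\<in>\<Omega>. \<nu> \<omega> = \<kappa>}. h \<omega>)" for \<kappa>
  have fibre: "finite {\<omega>\<in>\<Omega>. \<nu> \<omega> = \<kappa>}" for \<kappa>
  proof -
    \<comment> \<open>Every monomial has degree at least 1, so the total degree bounds the length of
      a list.\<close>
    have len: "length L \<le> (\<Sum>j\<in>J. \<nu>0 L j)" if "L \<in> lists I" for L
      using that
    proof (induction L)
      case (Cons i L)
      have "(\<Sum>j\<in>J. \<nu>0 (i # L) j) = (\<Sum>j\<in>J. if fst i = j then ex i else 0) + (\<Sum>j\<in>J. \<nu>0 L j)"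
        by (simp add: \<nu>0_def sum.distrib)
      moreover have "(\<Sum>j\<in>J. if fst i = j then ex i else 0) = ex i"
        using Cons.hyps J by (auto simp: I_def)
      moreover have "ex i \<ge> 1"
        by (simp add: ex_def split: prod.split)
      ultimately show ?case
        using Cons.IH by simp
    qed simp
    have "{\<omega>\<in>\<Omega>. \<nu> \<omega> = \<kappa>} \<subseteq> UNIV \<times> {L. set L \<subseteq> I \<and> length L \<le> (\<Sum>j\<in>J. \<kappa> j)}"
    proof
      fix \<omega> assume "\<omega> \<in> {\<omega>\<in>\<Omega>. \<nu> \<omega> = \<kappa>}"
      then obtain b L where \<omega>: "\<omega> = (b, L)" "L \<in> lists I" "\<nu> (b, L) = \<kappa>"
        by (auto simp: \<Omega>_def)
      have "(\<Sum>j\<in>J. \<nu>0 L j) \<le> (\<Sum>j\<in>J. \<kappa> j)"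
        unfolding \<omega>(3)[symmetric] by (intro sum_mono) (simp add: \<nu>_def)
      then show "\<omega> \<in> UNIV \<times> {L. set L \<subseteq> I \<and> length L \<le> (\<Sum>j\<in>J. \<kappa> j)}"
        using len[OF \<omega>(2)] \<omega> by auto
    qed
    then show ?thesis
      by (rule finite_subset) (simp add: finite_lists_length_le[OF I])
  qed
  have "((\<lambda>\<kappa>. c \<kappa> * (\<Prod>j\<in>J. (x j - a j) ^ \<kappa> j)) has_sum x C / sqrt (\<Sum>j\<in>J. (x j)\<^sup>2)) K"
    if x: "\<forall>j\<in>J. \<bar>x j - a j\<bar> < r" for x
  proof -
    define y where "y j = x j - a j" for j
    have y: "\<bar>y j\<bar> < r" if "j \<in> J" for j
      using x that by (simp add: y_def)
    define z where "z i = \<beta> i * y (fst i) ^ ex i" for i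
    have z_le: "\<bar>z i\<bar> \<le> \<bar>\<beta> i\<bar> * r" if "i \<in> I" for i
    proof -
      have yi: "\<bar>y (fst i)\<bar> \<le> r" "\<bar>y (fst i)\<bar> \<le> 1"
        using y[of "fst i"] that r by (auto simp: I_def)
      have "\<bar>y (fst i)\<bar> ^ ex i \<le> \<bar>y (fst i)\<bar> ^ 1"
        using yi by (intro power_decreasing) (auto simp: ex_def split: prod.split)
      then have "\<bar>y (fst i)\<bar> ^ ex i \<le> r"
        using yi by simp
      then show ?thesis
        by (simp add: z_def abs_mult power_abs mult_left_mono)
    qed
    define \<rho> where "\<rho> = (\<Sum>i\<in>I. \<bar>z i\<bar>)"
    define u where "u = (\<Sum>i\<in>I. z i)"
    have \<rho>: "0 \<le> \<rho>" "\<rho> < 1" "\<bar>u\<bar> < 1"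
    proof -
      show "0 \<le> \<rho>"
        by (simp add: \<rho>_def sum_nonneg)
      have "\<rho> \<le> (\<Sum>i\<in>I. \<bar>\<beta> i\<bar> * r)"
        unfolding \<rho>_def by (intro sum_mono z_le)
      then show "\<rho> < 1"
        using r by (simp add: Kb_def sum_distrib_right)
      moreover have "\<bar>u\<bar> \<le> \<rho>"
        by (simp add: u_def \<rho>_def sum_abs)
      ultimately show "\<bar>u\<bar> < 1"
        by simp
    qed
    have Su: "(\<Sum>j\<in>J. (x j)\<^sup>2) = S * (1 + u)"
    proof -
      have "u = (\<Sum>j\<in>J. \<Sum>s\<in>UNIV. z (j, s))"
        by (simp add: u_def I_def sum.cartesian_product)
      also have "\<dots> = (\<Sum>j\<in>J. (2 * a j * y j + (y j)\<^sup>2) / S)"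
        by (intro sum.cong) (simp_all add: UNIV_bool z_def \<beta>_def ex_def add_divide_distrib)
      finally have "S * u = (\<Sum>j\<in>J. 2 * a j * y j + (y j)\<^sup>2)"
        using S by (simp flip: sum_divide_distrib)
      then have "S * (1 + u) = (\<Sum>j\<in>J. (a j)\<^sup>2 + (2 * a j * y j + (y j)\<^sup>2))"
        by (simp add: distrib_left S_def sum.distrib)
      also have "\<dots> = (\<Sum>j\<in>J. (x j)\<^sup>2)"
        by (intro sum.cong) (simp_all add: y_def power2_eq_square algebra_simps)
      finally show ?thesis
        by simp
    qed
    have hs: "((\<lambda>L. g (length L) * prod_list (map z L)) has_sum (1 / sqrt (1 + u))) (lists I)"
      using inverse_sqrt_series[OF \<rho>(3)] inverse_sqrt_series_abs[OF \<rho>(1,2)]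
      by (intro has_sum_power_series_lists[OF I]) (simp_all add: g_def u_def \<rho>_def)
    define f where "f = (\<lambda>(b, L). (if b then y C else a C) / sqrt S * (g (length L) * prod_list (map z L)))"
    have part: "(f has_sum (if b then y C else a C) / sqrt S * (1 / sqrt (1 + u))) (Pair b ` lists I)" for b
    proof -
      have "inj_on (Pair b) (lists I)"
        by (auto simp: inj_on_def)
      then show ?thesis
        using has_sum_cmult_right[OF hs, of "(if b then y C else a C) / sqrt S"]
        by (subst has_sum_reindex) (simp_all add: o_def f_def)
    qed
    have "(f has_sum (a C / sqrt S * (1 / sqrt (1 + u)) + y C / sqrt S * (1 / sqrt (1 + u)))) \<Omega>"
      unfolding \<Omega>_def using part[of False] part[of True] by (intro has_sum_Un_disjoint) auto
    moreover have "a C / sqrt S * (1 / sqrt (1 + u)) + y C / sqrt S * (1 / sqrt (1 + u)) = x C / sqrt (\<Sum>j\<in>J. (x j)\<^sup>2)"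
      by (simp add: Su real_sqrt_mult y_def flip: add_divide_distrib)
    ultimately have f: "(f has_sum x C / sqrt (\<Sum>j\<in>J. (x j)\<^sup>2)) \<Omega>"
      by simp
    have mono: "prod_list (map z L) = prod_list (map \<beta> L) * (\<Prod>j\<in>J. y j ^ \<nu>0 L j)" if "L \<in> lists I" for L
      using that
    proof (induction L)
      case (Cons i L)
      have "(\<Prod>j\<in>J. y j ^ \<nu>0 (i # L) j) = (\<Prod>j\<in>J. (if fst i = j then y j ^ ex i else 1) * y j ^ \<nu>0 L j)"
        by (intro prod.cong) (auto simp: \<nu>0_def power_add)
      also have "\<dots> = y (fst i) ^ ex i * (\<Prod>j\<in>J. y j ^ \<nu>0 L j)"
        using Cons.hyps J by (auto simp: prod.distrib I_def)
      finally show ?case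
        using Cons.IH by (simp add: z_def)
    qed (simp add: \<nu>0_def)
    have fh: "f \<omega> = h \<omega> * (\<Prod>j\<in>J. y j ^ \<nu> \<omega> j)" if \<omega>\<Omega>: "\<omega> \<in> \<Omega>" for \<omega>
    proof -
      obtain b L where \<omega>: "\<omega> = (b, L)" "L \<in> lists I"
        using \<omega>\<Omega> by (auto simp: \<Omega>_def)
      have "(\<Prod>j\<in>J. y j ^ \<nu> (b, L) j) = (\<Prod>j\<in>J. y j ^ \<nu>0 L j * (if j = C then (if b then y j else 1) else 1))"
        by (intro prod.cong) (auto simp: \<nu>_def)
      also have "\<dots> = (\<Prod>j\<in>J. y j ^ \<nu>0 L j) * (if b then y C else 1)"
        using J C by (simp add: prod.distrib)
      finally show ?thesis
        using mono[OF \<omega>(2)] by (simp add: \<omega>(1) f_def h_def)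
    qed
    have "((\<lambda>\<kappa>. \<Sum>\<omega>\<in>{\<omega>\<in>\<Omega>. \<nu> \<omega> = \<kappa>}. f \<omega>) has_sum x C / sqrt (\<Sum>j\<in>J. (x j)\<^sup>2)) K"
      by (rule has_sum_regroup[OF f _ fibre]) (auto simp: \<nu>_def K_def split: prod.split)
    moreover have "(\<Sum>\<omega>\<in>{\<omega>\<in>\<Omega>. \<nu> \<omega> = \<kappa>}. f \<omega>) = c \<kappa> * (\<Prod>j\<in>J. (x j - a j) ^ \<kappa> j)" for \<kappa>
      unfolding c_def sum_distrib_right by (intro sum.cong) (auto simp: fh y_def)
    ultimately show ?thesis
      by simp
  qed
  then show ?thesis
    unfolding real_analytic_at_def K_def[symmetric] using r(1) by blast
qed

section \<open>Subshifts of finite type\<close>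

text \<open>Membership in \<open>sft d A\<close> is a condition on adjacent letters, visible in any
  window of length \<open>k + 1 \<ge> 2\<close>; \<open>local\<close> isolates this for both closure
  properties.\<close>

lemma sft_space_sft:
  fixes A :: "nat \<Rightarrow> nat \<Rightarrow> nat"
  assumes X: "X = sft d A" and ne: "X \<noteq> {}" and k: "k \<ge> 1"
  shows "sft_space d X k"
proof
  show "x n < d" if "x \<in> X" for x n
    using that by (simp add: X sft_def)
  show "shift_map x \<in> X" if "x \<in> X" for x
    using that by (simp add: X sft_def shift_map_def)
  have local: "x \<in> X" if y: "\<And>i. \<exists>y\<in>X. \<exists>j. y j = x i \<and> y (Suc j) = x (Suc i)" for x
    unfolding X sft_def
  proof (intro CollectI conjI allI)
    fix i
    obtain z j where z: "z \<in> X" "z j = x i" "z (Suc j) = x (Suc i)"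
      using y by blast
    have "z j < d" "A (z j) (z (Suc j)) = 1"
      using z(1) by (simp_all add: X sft_def)
    then show "x i < d" "A (x i) (x (Suc i)) = 1"
      unfolding z(2,3) .
  qed
  show "x \<in> X" if pr: "\<And>n. \<exists>y\<in>X. prefix n y = prefix n x" for x
  proof (rule local)
    fix i
    obtain y where "y \<in> X" "prefix (Suc (Suc i)) y = prefix (Suc (Suc i)) x"
      using pr by blast
    then show "\<exists>y\<in>X. \<exists>j. y j = x i \<and> y (Suc j) = x (Suc i)"
      by (intro bexI[of _ y] exI[of _ i]) (auto simp: prefix_eq_iff)
  qed
  show "x \<in> X" if bl: "\<And>i. \<exists>y\<in>X. prefix (Suc k) y = prefix (Suc k) ((shift_map ^^ i) x)" for x
  proof (rule local)
    fix i
    obtain y where y: "y \<in> X" "prefix (Suc k) y = prefix (Suc k) ((shift_map ^^ i) x)"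
      using bl by blast
    then have "y j = x (i + j)" if "j < Suc k" for j
      using that by (simp add: prefix_eq_iff shift_pow)
    from this[of 0] this[of 1] show "\<exists>y\<in>X. \<exists>j. y j = x i \<and> y (Suc j) = x (Suc i)"
      using k y(1) by (intro bexI[of _ y] exI[of _ 0]) auto
  qed
qed (use ne k in auto)

text \<open>Transitivity for two cylinders gives an orbit segment from one to the other; the window
  of length \<open>k\<close> sliding along it is a path in the block graph.\<close>

lemma irreducible_sft_transitive:
  assumes S: "sft_space d X k" and trans: "topologically_transitive X shift_map"
  shows "irreducible_sft d X k"
proof -
  interpret sft_space d X k
    by (rule S)
  show ?thesis
  proof
    fix u v assume uv: "u \<in> lang k" "v \<in> lang k"
    let ?R = "{(w, w'). \<exists>b. w @ [b] \<in> lang (Suc k) \<and> w' = tl (w @ [b])}"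
    have op: "openin (top_of_set X) (cyl w)" for w
      unfolding openin_open using open_prefix[of "length w" w]
      by (intro exI[of _ "{x. prefix (length w) x = w}"]) (auto simp: cyl_def)
    have "cyl u \<noteq> {}" "cyl v \<noteq> {}"
      using uv by (auto simp: lang_def)
    then obtain n where "(shift_map ^^ n) ` cyl u \<inter> cyl v \<noteq> {}"
      using trans op unfolding topologically_transitive_def by meson
    then obtain x where x: "x \<in> cyl u" "(shift_map ^^ n) x \<in> cyl v"
      by blast
    have "(prefix k x, prefix k ((shift_map ^^ i) x)) \<in> ?R\<^sup>*" for i
    proof (induction i)
      case (Suc i)
      let ?y = "(shift_map ^^ i) x"
      have "?y \<in> X"
        using x(1) by (intro shift_pow_closed) (simp add: cyl_def)
      then have "prefix k ?y @ [?y k] \<in> lang (Suc k)"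
        using prefix_lang[of ?y "Suc k"] by (simp add: prefix_Suc)
      moreover have "prefix k (shift_map ?y) = tl (prefix k ?y @ [?y k])"
        unfolding prefix_Suc[symmetric] by (simp add: prefix_shift)
      ultimately have "(prefix k ?y, prefix k (shift_map ?y)) \<in> ?R"
        by blast
      with Suc.IH show ?case
        by (simp add: rtrancl.rtrancl_into_rtrancl)
    qed simp
    from this[of n] show "(u, v) \<in> ?R\<^sup>*"
      using x uv by (simp add: cyl_def lang_length)
  qed
qed

section \<open>Rescaling of the potential\<close>

lemma equilibrium_state_cong:
  assumes "\<And>x. x \<in> X \<Longrightarrow> \<phi> x = \<psi> x"
  shows "equilibrium_state X T \<phi> = equilibrium_state X T \<psi>"
proof -
  have "(\<integral>x. \<phi> x \<partial>\<mu>) = (\<integral>x. \<psi> x \<partial>\<mu>)" if "\<mu> \<in> invariant_measures X T" for \<mu>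
  proof (rule Bochner_Integration.integral_cong)
    have "space \<mu> = X"
      using that sets_eq_imp_space_eq[of \<mu> "restrict_space borel X"]
      by (simp add: invariant_measures_def space_restrict_space)
    then show "x \<in> space \<mu> \<Longrightarrow> \<phi> x = \<psi> x" for x
      using assms by simp
  qed simp
  then have "is_equilibrium_state X T \<phi> = is_equilibrium_state X T \<psi>"
    by (auto simp: is_equilibrium_state_def fun_eq_iff)
  then show ?thesis
    by (simp add: equilibrium_state_def)
qed

lemma weak_star_tendsto_scale:
  fixes F :: "real \<Rightarrow> 'a :: topological_space measure"
  assumes "weak_star_tendsto X F \<nu> at_top" "c > 0"
  shows "weak_star_tendsto X (\<lambda>t. F (t * c)) \<nu> at_top"
proof -
  have "filterlim (\<lambda>t :: real. t * c) at_top at_top"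
    using filterlim_tendsto_pos_mult_at_top[OF tendsto_const \<open>c > 0\<close> filterlim_ident] by (simp add: mult.commute)
  then show ?thesis
    using assms(1) unfolding weak_star_tendsto_def
    by (intro allI impI) (erule_tac x = g in allE, auto intro: filterlim_compose)
qed

text \<open>A positive factor only reparametrises the temperature. The equivalence holds for every
  candidate \<open>\<nu>\<close>, so the two definite descriptions agree without appeal to
  existence.\<close>

lemma zero_temperature_measure_scale:
  assumes c: "c > 0" and eq: "\<And>x. x \<in> X \<Longrightarrow> \<psi> x = c * \<phi> x"
  shows "zero_temperature_measure X T \<psi> = zero_temperature_measure X T \<phi>"
proof -
  have es: "equilibrium_state X T (\<lambda>x. t * \<psi> x) = equilibrium_state X T (\<lambda>x. (t * c) * \<phi> x)" for t
    by (rule equilibrium_state_cong) (simp add: eq)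
  have "weak_star_tendsto X (\<lambda>t. equilibrium_state X T (\<lambda>x. t * \<psi> x)) \<nu> at_top \<longleftrightarrow>
      weak_star_tendsto X (\<lambda>t. equilibrium_state X T (\<lambda>x. t * \<phi> x)) \<nu> at_top" for \<nu>
    unfolding es
    using weak_star_tendsto_scale[of X "\<lambda>t. equilibrium_state X T (\<lambda>x. t * \<phi> x)" \<nu> c]
      weak_star_tendsto_scale[of X "\<lambda>t. equilibrium_state X T (\<lambda>x. t * c * \<phi> x)" \<nu> "1 / c"] c
    by (auto simp: mult.assoc)
  then show ?thesis
    by (simp add: zero_temperature_measure_def)
qed

section \<open>Locally constant functions in coordinates\<close>

lemma cylinders_eq:
  assumes "C \<in> cylinders X k" "x \<in> C"
  shows "C = cylinder X k x" "x \<in> X"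
  using assms by (auto simp: cylinders_def cylinder_def)

lemma cylinders_Some:
  assumes "C \<in> cylinders X k"
  shows "(SOME x. x \<in> C) \<in> X" "cylinder X k (SOME x. x \<in> C) = C"
proof -
  have "\<exists>x. x \<in> C"
    using assms by (auto simp: cylinders_def cylinder_def)
  then have "(SOME x. x \<in> C) \<in> C"
    by (rule someI_ex)
  then show "(SOME x. x \<in> C) \<in> X" "cylinder X k (SOME x. x \<in> C) = C"
    using cylinders_eq[OF assms] by blast+
qed

lemma LC_cong_cylinder:
  assumes "\<phi> \<in> LC X k E" "x \<in> X" "y \<in> X" "cylinder X k x = cylinder X k y"
  shows "\<phi> x = \<phi> y"
proof -
  have "cylinder X k x \<in> cylinders X k" "x \<in> cylinder X k x" "y \<in> cylinder X k x"
    using assms(2,3) unfolding assms(4) by (auto simp: cylinders_def cylinder_def)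
      (use assms(4) in \<open>auto simp: cylinder_def\<close>)
  then show ?thesis
    using assms(1) unfolding LC_def by blast
qed

lemma LC_I:
  assumes "\<phi> \<in> X \<rightarrow>\<^sub>E E" "\<And>x y. x \<in> X \<Longrightarrow> y \<in> X \<Longrightarrow> cylinder X k x = cylinder X k y \<Longrightarrow> \<phi> x = \<phi> y"
  shows "\<phi> \<in> LC X k E"
  unfolding LC_def
proof (intro CollectI conjI ballI assms(1))
  fix C x y assume "C \<in> cylinders X k" "x \<in> C" "y \<in> C"
  then show "\<phi> x = \<phi> y"
    using cylinders_eq[of C X k x] cylinders_eq[of C X k y] assms(2)[of x y] by simp
qed

lemma dot_fun_LC:
  assumes "\<Phi> \<in> LC X k E"
  shows "dot_fun X m \<alpha> \<Phi> \<in> LC X k UNIV"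
proof (rule LC_I)
  show "dot_fun X m \<alpha> \<Phi> x = dot_fun X m \<alpha> \<Phi> y" if "x \<in> X" "y \<in> X" "cylinder X k x = cylinder X k y" for x y
    using that LC_cong_cylinder[OF assms that] by (simp add: dot_fun_def)
qed (simp add: dot_fun_def)

lemma (in irreducible_sft) zero_temperature_LC:
  assumes "\<phi> \<in> LC X k UNIV"
  shows "convex_sum_of (zero_temperature_measure X shift_map \<phi>) {\<mu>. parry \<mu>}"
proof (rule zero_temperature_convex_sum[where g = "\<lambda>w. \<phi> (SOME x. x \<in> cyl w)"])
  fix x assume x: "x \<in> X"
  then have "cyl (prefix k x) \<in> cylinders X k"
    by (auto simp: cylinders_def cyl_prefix)
  from cylinders_Some[OF this] show "\<phi> x = \<phi> (SOME y. y \<in> cyl (prefix k x))"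
    using x by (intro LC_cong_cylinder[OF assms]) (simp_all add: cyl_prefix)
qed

lemma (in irreducible_sft) finite_cylinders: "finite (cylinders X k)"
proof (rule finite_subset[OF _ finite_imageI[OF finite_words]])
  show "cylinders X k \<subseteq> cyl ` words d k"
    using prefix_words by (auto simp: cylinders_def cyl_prefix)
qed

theorem theorem5:
  fixes d k :: nat and A :: "nat \<Rightarrow> nat \<Rightarrow> nat" and X :: "(nat \<Rightarrow> nat) set"
  assumes "d \<ge> 1"
    and "\<forall>i<d. \<forall>j<d. A i j \<in> {0, 1}"
    and "X = sft d A"
    and "\<forall>a<d. \<exists>x\<in>X. \<exists>n. x n = a"
    and "topologically_transitive X shift_map"
    and "k \<ge> 1"
  shows "\<exists>\<M> :: nat \<Rightarrow> (seq \<Rightarrow> nat \<Rightarrow> real) \<Rightarrow> seq measure set.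
    (\<forall>m\<ge>1. \<forall>\<Phi>\<in>LC X k (rvec m). finite (\<M> m \<Phi>) \<and> \<M> m \<Phi> \<subseteq> ergodic_measures X shift_map) \<and>
    (\<forall>m\<ge>1. \<forall>\<Phi>\<in>LC X k (rvec m). \<forall>\<alpha>\<in>unit_sphere m.
       convex_sum_of (zero_temperature_measure X shift_map (dot_fun X m \<alpha> \<Phi>)) (\<M> m \<Phi>)) \<and>
    (\<exists>\<Phi>\<^sub>u\<in>LC X k (rvec (num_cylinders X k)). \<exists>I.
       analytic_on_LC_nonzero X k (num_cylinders X k) I \<and>
       I ` LC_nonzero X k = unit_sphere (num_cylinders X k) \<and>
       (\<forall>\<phi>\<in>LC_nonzero X k.
          zero_temperature_measure X shift_map \<phi> =
            zero_temperature_measure X shift_map (dot_fun X (num_cylinders X k) (I \<phi>) \<Phi>\<^sub>u) \<and>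
          convex_sum_of (zero_temperature_measure X shift_map \<phi>) (\<M> (num_cylinders X k) \<Phi>\<^sub>u)))"
proof -
  have "X \<noteq> {}"
    using assms(1,4) by fastforce
  then interpret irreducible_sft d X k
    by (rule irreducible_sft_transitive[OF sft_space_sft[OF assms(3) _ assms(6)] assms(5)])
  define n where "n = num_cylinders X k"
  let ?J = "cylinders X k"
  \<comment> \<open>The sphere is indexed by numbers and the coordinates of a locally constant
    function by cylinders; \<open>e\<close> translates.\<close>
  obtain e where e: "bij_betw e {..<n} ?J"
    using ex_bij_betw_nat_finite[OF finite_cylinders] by (auto simp: n_def num_cylinders_def lessThan_atLeast0)
  have eJ: "e i \<in> ?J" if "i < n" for i
    using e that by (auto simp: bij_betw_def)
  define pt where "pt C = (SOME x. x \<in> C)" for C :: "seq set"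
  have pt: "pt C \<in> X" "cylinder X k (pt C) = C" if "C \<in> ?J" for C
    using cylinders_Some[OF that] by (simp_all add: pt_def)
  have cyl_J: "cylinder X k x \<in> ?J" if "x \<in> X" for x
    using that by (simp add: cylinders_def)
  have val: "\<phi> (pt (cylinder X k x)) = \<phi> x" if "\<phi> \<in> LC X k UNIV" "x \<in> X" for x and \<phi> :: "seq \<Rightarrow> real"
    using that pt[OF cyl_J] by (intro LC_cong_cylinder) auto
  define N where "N \<phi> = sqrt (\<Sum>C\<in>?J. (\<phi> (pt C))\<^sup>2)" for \<phi> :: "seq \<Rightarrow> real"
  define I where "I \<phi> = (\<lambda>i\<in>{..<n}. \<phi> (pt (e i)) / N \<phi>)" for \<phi>
  \<comment> \<open>The components are the indicators of the cylinders, so pairing with the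
    coordinate vector of a function restores that function.\<close>
  define \<Phi>u where "\<Phi>u = (\<lambda>x\<in>X. \<lambda>i\<in>{..<n}. if cylinder X k x = e i then 1 else 0 :: real)"
  have sum_e: "(\<Sum>i<n. f (e i)) = (\<Sum>C\<in>?J. f C)" for f :: "seq set \<Rightarrow> real"
    by (rule sum.reindex_bij_betw[OF e])
  have N_pos: "N \<phi> > 0" if \<phi>: "\<phi> \<in> LC_nonzero X k" for \<phi>
  proof -
    have L: "\<phi> \<in> LC X k UNIV"
      using \<phi> by (simp add: LC_nonzero_def)
    then have ext: "\<phi> \<in> extensional X"
      unfolding LC_def PiE_def by blast
    have "\<exists>x\<in>X. \<phi> x \<noteq> 0"
    proof (rule ccontr)
      assume "\<not> ?thesis"
      then have "\<phi> = (\<lambda>x\<in>X. 0)"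
        using ext by (intro extensionalityI[of _ X]) auto
      then show False
        using \<phi> by (simp add: LC_nonzero_def)
    qed
    then obtain x where x: "x \<in> X" "\<phi> x \<noteq> 0"
      by blast
    have "(\<Sum>C\<in>?J. (\<phi> (pt C))\<^sup>2) > 0"
      using x val[OF L x(1)] by (intro sum_pos2[OF finite_cylinders cyl_J[OF x(1)]]) auto
    then show ?thesis
      by (simp add: N_def)
  qed
  have N_sq: "(N \<phi>)\<^sup>2 = (\<Sum>C\<in>?J. (\<phi> (pt C))\<^sup>2)" for \<phi>
    by (simp add: N_def sum_nonneg)
  have coords: "LC_of_coords X k b (pt C) = b C" if "C \<in> ?J" for b C
    using pt[OF that] by (simp add: LC_of_coords_def)
  have coords_LC: "LC_of_coords X k b \<in> LC X k UNIV" for b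
    by (intro LC_I) (auto simp: LC_of_coords_def)
  have F1: "\<Phi>u \<in> LC X k (rvec n)"
    by (intro LC_I) (auto simp: \<Phi>u_def rvec_def)
  have F2: "analytic_on_LC_nonzero X k n I"
    unfolding analytic_on_LC_nonzero_def
  proof (intro ballI impI allI)
    fix a i assume a: "LC_of_coords X k a \<in> LC_nonzero X k" and i: "i < n"
    have "(\<lambda>b. I (LC_of_coords X k b) i) = (\<lambda>b. b (e i) / sqrt (\<Sum>C\<in>?J. (b C)\<^sup>2))"
      using i eJ by (simp add: I_def N_def coords)
    moreover have "\<exists>C\<in>?J. a C \<noteq> 0"
    proof (rule ccontr)
      assume "\<not> ?thesis"
      then have "LC_of_coords X k a = (\<lambda>x\<in>X. 0)"
        using cyl_J by (auto simp: LC_of_coords_def)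
      then show False
        using a by (simp add: LC_nonzero_def)
    qed
    ultimately show "real_analytic_at ?J (\<lambda>b. I (LC_of_coords X k b) i) a"
      using real_analytic_normalised_coordinate[OF finite_cylinders eJ[OF i], of a] by simp
  qed
  have F3: "I ` LC_nonzero X k = unit_sphere n"
  proof (intro equalityI subsetI)
    fix \<alpha> assume "\<alpha> \<in> I ` LC_nonzero X k"
    then obtain \<phi> where \<phi>: "\<phi> \<in> LC_nonzero X k" "\<alpha> = I \<phi>"
      by blast
    have "(\<Sum>i<n. (I \<phi> i)\<^sup>2) = (\<Sum>i<n. (\<phi> (pt (e i)))\<^sup>2) / (N \<phi>)\<^sup>2"
      by (simp add: I_def power_divide sum_divide_distrib)
    also have "\<dots> = 1"
      using sum_e[of "\<lambda>C. (\<phi> (pt C))\<^sup>2"] N_pos[OF \<phi>(1)] by (simp add: N_sq[symmetric])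
    finally show "\<alpha> \<in> unit_sphere n"
      by (simp add: \<phi>(2) unit_sphere_def rvec_def I_def)
  next
    fix \<alpha> assume \<alpha>: "\<alpha> \<in> unit_sphere n"
    \<comment> \<open>The function with coordinates \<open>\<alpha>\<close> has norm 1, so
      normalisation does not change it and it is a preimage of \<open>\<alpha>\<close>.\<close>
    define b where "b C = \<alpha> (inv_into {..<n} e C)" for C
    have b: "b (e i) = \<alpha> i" if "i < n" for i
      using e that by (simp add: b_def bij_betw_def inv_into_f_f)
    let ?\<phi> = "LC_of_coords X k b"
    have "(\<Sum>C\<in>?J. (b C)\<^sup>2) = (\<Sum>i<n. (\<alpha> i)\<^sup>2)"
      using sum_e[of "\<lambda>C. (b C)\<^sup>2"] b by simp
    then have sum1: "(\<Sum>C\<in>?J. (b C)\<^sup>2) = 1"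
      using \<alpha> by (simp add: unit_sphere_def)
    then have N1: "N ?\<phi> = 1"
      by (simp add: N_def coords)
    have "?\<phi> \<noteq> (\<lambda>x\<in>X. 0)"
    proof
      assume "?\<phi> = (\<lambda>x\<in>X. 0)"
      then have "b C = 0" if "C \<in> ?J" for C
        using coords[OF that, of b] pt(1)[OF that] by simp
      then show False
        using sum1 by simp
    qed
    then have "?\<phi> \<in> LC_nonzero X k"
      using coords_LC by (simp add: LC_nonzero_def)
    moreover have "\<alpha> = I ?\<phi>"
    proof (rule extensionalityI[of _ "{..<n}"])
      show "\<alpha> \<in> extensional {..<n}"
        using \<alpha> by (auto simp: unit_sphere_def rvec_def PiE_def)
      show "I ?\<phi> \<in> extensional {..<n}"
        by (simp add: I_def)
      show "\<alpha> i = I ?\<phi> i" if "i \<in> {..<n}" for i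
        using that by (simp add: I_def N1 coords eJ b)
    qed
    ultimately show "\<alpha> \<in> I ` LC_nonzero X k"
      by blast
  qed
  have F4: "zero_temperature_measure X shift_map \<phi> =
      zero_temperature_measure X shift_map (dot_fun X n (I \<phi>) \<Phi>u)" if \<phi>: "\<phi> \<in> LC_nonzero X k" for \<phi>
  proof (rule zero_temperature_measure_scale[symmetric, of "1 / N \<phi>"])
    show "1 / N \<phi> > 0"
      using N_pos[OF \<phi>] by simp
    fix x assume x: "x \<in> X"
    have "dot_fun X n (I \<phi>) \<Phi>u x = (\<Sum>i<n. \<phi> (pt (e i)) / N \<phi> * (if cylinder X k x = e i then 1 else 0))"
      using x by (simp add: dot_fun_def I_def \<Phi>u_def)
    also have "\<dots> = (\<Sum>C\<in>?J. \<phi> (pt C) / N \<phi> * (if cylinder X k x = C then 1 else 0))"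
      by (rule sum_e)
    also have "\<dots> = (\<Sum>C\<in>?J. if C = cylinder X k x then \<phi> x / N \<phi> else 0)"
      using \<phi> x by (intro sum.cong) (auto simp: LC_nonzero_def val)
    also have "\<dots> = 1 / N \<phi> * \<phi> x"
      using finite_cylinders cyl_J[OF x] by simp
    finally show "dot_fun X n (I \<phi>) \<Phi>u x = 1 / N \<phi> * \<phi> x" .
  qed
  have F5: "convex_sum_of (zero_temperature_measure X shift_map \<phi>) {\<mu>. parry \<mu>}"
    if "\<phi> \<in> LC_nonzero X k" for \<phi>
    using that by (intro zero_temperature_LC) (simp add: LC_nonzero_def)
  show ?thesis
    unfolding n_def[symmetric]
  proof (rule exI[of _ "\<lambda>_ _. {\<mu>. parry \<mu>}"], intro conjI)
    show "\<forall>m\<ge>1. \<forall>\<Phi>\<in>LC X k (rvec m). finite {\<mu>. parry \<mu>} \<and> {\<mu>. parry \<mu>} \<subseteq> ergodic_measures X shift_map"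
      using finite_parry parry_ergodic by blast
    show "\<forall>m\<ge>1. \<forall>\<Phi>\<in>LC X k (rvec m). \<forall>\<alpha>\<in>unit_sphere m.
        convex_sum_of (zero_temperature_measure X shift_map (dot_fun X m \<alpha> \<Phi>)) {\<mu>. parry \<mu>}"
      using zero_temperature_LC[OF dot_fun_LC] by blast
    show "\<exists>\<Phi>\<in>LC X k (rvec n). \<exists>I. analytic_on_LC_nonzero X k n I \<and> I ` LC_nonzero X k = unit_sphere n \<and>
        (\<forall>\<phi>\<in>LC_nonzero X k. zero_temperature_measure X shift_map \<phi> =
            zero_temperature_measure X shift_map (dot_fun X n (I \<phi>) \<Phi>) \<and>
          convex_sum_of (zero_temperature_measure X shift_map \<phi>) {\<mu>. parry \<mu>})"
      by (intro bexI[of _ \<Phi>u] exI[of _ I] conjI ballI F1 F2 F3 F4 F5)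
  qed
qed

end
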